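(* For every integer $n$ with $4\le n\le10$ and every complex number $\omega$ with $\omega^n=1$, the category $\mathcal{TT}_{n,\omega}$ does not exist.
   Context: Let $\tau=\frac{1+\sqrt5}{2}$. $T_2$ denotes the unitary Fibonacci category (the even half of the Temperley–Lieb category $A_4$ with loop parameter $\tau$): two simple objects, the nontrivial one being symmetrically self-dual of dimension $\tau$ with square $\cong 1\oplus$ itself. In $T_2*T_2$ the nontrivial simple objects of the two copies are denoted $\rho$ and $\mu$, so $\rho\rho\cong1\oplus\rho$, $\mu\mu\cong1\oplus\mu$. The free product $T_2*T_2$ is the pivotal category whose objects are words in objects of the two copies and whose morphisms are linear combinations of planar disjoint unions of diagrams from the two copies (strands of different types may not cross), modulo the local relations of each. A quotient of a pivotal category $\mathcal C$ is a pivotal category $\mathcal D$ with a faithful, dominant tensor functor $\mathcal C\to\mathcal D$ preserving the pivotal structure (dominant: every simple object of $\mathcal D$ is a summand of the image of an object of $\mathcal C$); it is a unitary quotient if $\mathcal D$ is unitary and the functor preserves $*$. Categories are considered up to direct-sum and idempotent completion; tensor signs are omitted. Let $P_k=\rho\mu\rho\cdots$ and $Q_k=\mu\rho\mu\cdots$ be the alternating words with $k$ letters starting with $\rho$, resp. $\mu$. Let $x$ be the last letter of $P_n$ and $y$ the last letter of $Q_n$; thus $P_n=\rho Q_{n-1}=P_{n-1}x$ and $Q_n=\mu P_{n-1}=Q_{n-1}y$. For $n\ge2$ and $\omega^n=1$, $\mathcal{TT}_{n,\omega}$ denotes the unitary quotient of $T_2*T_2$ (provided it exists) such that $n$ is the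 least integer $\ge2$ with $P_n\cong Q_n$, and which is generated over $T_2*T_2$ by a unitary isomorphism $U:P_n\to Q_n$ satisfying $\mathcal F^{-1}(U)=U^*=\omega^{-1}\mathcal F(U)$, where $\mathcal F(U)=(\mathrm{id}_{P_n}\otimes \mathrm{ev}_y)(\mathrm{id}_\rho\otimes U\otimes \mathrm{id}_y)(\mathrm{coev}_\rho\otimes \mathrm{id}_{Q_n}):Q_n\to P_n$ and $\mathcal F^{-1}(U)=(\mathrm{ev}_\mu\otimes \mathrm{id}_{P_n})(\mathrm{id}_\mu\otimes U\otimes \mathrm{id}_x)(\mathrm{id}_{Q_n}\otimes \mathrm{coev}_x):Q_n\to P_n$, with $\mathrm{ev}_z:zz\to1$, $\mathrm{coev}_z:1\to zz$ the caps and cups. *)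

theory Defs
  imports Complex_Main
begin

section \<open>Strict pivotal categories\<close>

text \<open>
  Pivotal categories are taken to be strict, as is implicit in a calculus of planar diagrams without
  associators: the tensor product is strictly associative and unital, \<open>a\<^sup>*\<^sup>* = a\<close>, and
  \<open>(a \<otimes> b)\<^sup>* = b\<^sup>* \<otimes> a\<^sup>*\<close>.  Every pivotal category is pivotally equivalent to such a category.
  Composition is written in the order of functions: \<open>g \<cdot> f\<close> is \<open>g\<close> after \<open>f\<close>.
  The operations are only meaningful on \<open>Obj\<close> and \<open>Mor\<close>.
\<close>

record ('o, 'm) pcat =
  Obj :: "'o set"
  Mor :: "'m set"
  Dom :: "'m \<Rightarrow> 'o"
  Cod :: "'m \<Rightarrow> 'o"
  Ident :: "'o \<Rightarrow> 'm"
  Comp :: "'m \<Rightarrow> 'm \<Rightarrow> 'm"  (infixr "\<cdot>\<index>" 70)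
  Zero :: "'o \<Rightarrow> 'o \<Rightarrow> 'm"
  Add :: "'m \<Rightarrow> 'm \<Rightarrow> 'm"  (infixl "\<oplus>\<index>" 65)
  Scale :: "complex \<Rightarrow> 'm \<Rightarrow> 'm"  (infixr "\<odot>\<index>" 75)
  Unit :: "'o"
  TensO :: "'o \<Rightarrow> 'o \<Rightarrow> 'o"  (infixr "\<boxtimes>\<index>" 80)
  TensM :: "'m \<Rightarrow> 'm \<Rightarrow> 'm"  (infixr "\<otimes>\<index>" 80)
  Dual :: "'o \<Rightarrow> 'o"
  Ev :: "'o \<Rightarrow> 'm"
  Coev :: "'o \<Rightarrow> 'm"
  Star :: "'m \<Rightarrow> 'm"

definition Hom :: "('o, 'm) pcat \<Rightarrow> 'o \<Rightarrow> 'o \<Rightarrow> 'm set" where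
  "Hom C a b = {f \<in> Mor C. Dom C f = a \<and> Cod C f = b}"

locale linear_category =
  fixes C :: "('o, 'm) pcat" (structure)
  assumes Dom_Obj: "f \<in> Mor C \<Longrightarrow> Dom C f \<in> Obj C"
    and Cod_Obj: "f \<in> Mor C \<Longrightarrow> Cod C f \<in> Obj C"
    and Ident_Hom: "a \<in> Obj C \<Longrightarrow> Ident C a \<in> Hom C a a"
    and Comp_Hom: "\<lbrakk>f \<in> Hom C a b; g \<in> Hom C b c\<rbrakk> \<Longrightarrow> g \<cdot> f \<in> Hom C a c"
    and Comp_assoc: "\<lbrakk>f \<in> Hom C a b; g \<in> Hom C b c; h \<in> Hom C c d\<rbrakk> \<Longrightarrow> (h \<cdot> g) \<cdot> f = h \<cdot> (g \<cdot> f)"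
    and Comp_Ident_right: "f \<in> Hom C a b \<Longrightarrow> f \<cdot> Ident C a = f"
    and Comp_Ident_left: "f \<in> Hom C a b \<Longrightarrow> Ident C b \<cdot> f = f"
    and Zero_Hom: "\<lbrakk>a \<in> Obj C; b \<in> Obj C\<rbrakk> \<Longrightarrow> Zero C a b \<in> Hom C a b"
    and Add_Hom: "\<lbrakk>f \<in> Hom C a b; g \<in> Hom C a b\<rbrakk> \<Longrightarrow> f \<oplus> g \<in> Hom C a b"
    and Scale_Hom: "f \<in> Hom C a b \<Longrightarrow> z \<odot> f \<in> Hom C a b"
    and Add_assoc: "\<lbrakk>f \<in> Hom C a b; g \<in> Hom C a b; h \<in> Hom C a b\<rbrakk> \<Longrightarrow> (f \<oplus> g) \<oplus> h = f \<oplus> (g \<oplus> h)"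
    and Add_commute: "\<lbrakk>f \<in> Hom C a b; g \<in> Hom C a b\<rbrakk> \<Longrightarrow> f \<oplus> g = g \<oplus> f"
    and Add_Zero: "f \<in> Hom C a b \<Longrightarrow> f \<oplus> Zero C a b = f"
    and Add_inverse: "f \<in> Hom C a b \<Longrightarrow> f \<oplus> (-1) \<odot> f = Zero C a b"
    and Scale_one: "f \<in> Hom C a b \<Longrightarrow> 1 \<odot> f = f"
    and Scale_Scale: "f \<in> Hom C a b \<Longrightarrow> z \<odot> (w \<odot> f) = (z * w) \<odot> f"
    and Scale_add_left: "f \<in> Hom C a b \<Longrightarrow> (z + w) \<odot> f = z \<odot> f \<oplus> w \<odot> f"
    and Scale_add_right: "\<lbrakk>f \<in> Hom C a b; g \<in> Hom C a b\<rbrakk> \<Longrightarrow> z \<odot> (f \<oplus> g) = z \<odot> f \<oplus> z \<odot> g"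
    and Comp_Add_left: "\<lbrakk>f \<in> Hom C a b; g \<in> Hom C b c; h \<in> Hom C b c\<rbrakk> \<Longrightarrow> (g \<oplus> h) \<cdot> f = g \<cdot> f \<oplus> h \<cdot> f"
    and Comp_Add_right: "\<lbrakk>f \<in> Hom C a b; g \<in> Hom C a b; h \<in> Hom C b c\<rbrakk> \<Longrightarrow> h \<cdot> (f \<oplus> g) = h \<cdot> f \<oplus> h \<cdot> g"
    and Comp_Scale_left: "\<lbrakk>f \<in> Hom C a b; g \<in> Hom C b c\<rbrakk> \<Longrightarrow> (z \<odot> g) \<cdot> f = z \<odot> (g \<cdot> f)"
    and Comp_Scale_right: "\<lbrakk>f \<in> Hom C a b; g \<in> Hom C b c\<rbrakk> \<Longrightarrow> g \<cdot> (z \<odot> f) = z \<odot> (g \<cdot> f)"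

locale monoidal_category = linear_category +
  assumes Unit_Obj: "Unit C \<in> Obj C"
    and TensO_Obj: "\<lbrakk>a \<in> Obj C; b \<in> Obj C\<rbrakk> \<Longrightarrow> a \<boxtimes> b \<in> Obj C"
    and TensO_assoc: "\<lbrakk>a \<in> Obj C; b \<in> Obj C; c \<in> Obj C\<rbrakk> \<Longrightarrow> (a \<boxtimes> b) \<boxtimes> c = a \<boxtimes> (b \<boxtimes> c)"
    and TensO_Unit_left: "a \<in> Obj C \<Longrightarrow> Unit C \<boxtimes> a = a"
    and TensO_Unit_right: "a \<in> Obj C \<Longrightarrow> a \<boxtimes> Unit C = a"
    and TensM_Hom: "\<lbrakk>f \<in> Hom C a b; g \<in> Hom C c d\<rbrakk> \<Longrightarrow> f \<otimes> g \<in> Hom C (a \<boxtimes> c) (b \<boxtimes> d)"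
    and TensM_assoc: "\<lbrakk>f \<in> Mor C; g \<in> Mor C; h \<in> Mor C\<rbrakk> \<Longrightarrow> (f \<otimes> g) \<otimes> h = f \<otimes> (g \<otimes> h)"
    and TensM_Unit_left: "f \<in> Mor C \<Longrightarrow> Ident C (Unit C) \<otimes> f = f"
    and TensM_Unit_right: "f \<in> Mor C \<Longrightarrow> f \<otimes> Ident C (Unit C) = f"
    and TensM_Ident: "\<lbrakk>a \<in> Obj C; b \<in> Obj C\<rbrakk> \<Longrightarrow> Ident C a \<otimes> Ident C b = Ident C (a \<boxtimes> b)"
    and TensM_Comp: "\<lbrakk>f \<in> Hom C a b; g \<in> Hom C b c; f' \<in> Hom C a' b'; g' \<in> Hom C b' c'\<rbrakk>
      \<Longrightarrow> (g \<cdot> f) \<otimes> (g' \<cdot> f') = (g \<otimes> g') \<cdot> (f \<otimes> f')"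
    and TensM_Add_left: "\<lbrakk>f \<in> Hom C a b; g \<in> Hom C a b; h \<in> Mor C\<rbrakk> \<Longrightarrow> (f \<oplus> g) \<otimes> h = f \<otimes> h \<oplus> g \<otimes> h"
    and TensM_Add_right: "\<lbrakk>f \<in> Hom C a b; g \<in> Hom C a b; h \<in> Mor C\<rbrakk> \<Longrightarrow> h \<otimes> (f \<oplus> g) = h \<otimes> f \<oplus> h \<otimes> g"
    and TensM_Scale_left: "\<lbrakk>f \<in> Mor C; g \<in> Mor C\<rbrakk> \<Longrightarrow> (z \<odot> f) \<otimes> g = z \<odot> (f \<otimes> g)"
    and TensM_Scale_right: "\<lbrakk>f \<in> Mor C; g \<in> Mor C\<rbrakk> \<Longrightarrow> f \<otimes> (z \<odot> g) = z \<odot> (f \<otimes> g)"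

text \<open>The two ways of rotating a morphism \<open>f : a \<rightarrow> b\<close> by \<open>\<pi>\<close>, giving morphisms \<open>b\<^sup>* \<rightarrow> a\<^sup>*\<close>;
  \<open>left_dual\<close> uses that \<open>a\<^sup>*\<^sup>* = a\<close>.\<close>

definition right_dual :: "('o, 'm) pcat \<Rightarrow> 'm \<Rightarrow> 'm" where
  "right_dual C f = (let a = Dom C f; b = Cod C f; da = Dual C a; db = Dual C b in
     (Ev C b \<otimes>\<^bsub>C\<^esub> Ident C da) \<cdot>\<^bsub>C\<^esub> (Ident C db \<otimes>\<^bsub>C\<^esub> f \<otimes>\<^bsub>C\<^esub> Ident C da)
       \<cdot>\<^bsub>C\<^esub> (Ident C db \<otimes>\<^bsub>C\<^esub> Coev C a))"

definition left_dual :: "('o, 'm) pcat \<Rightarrow> 'm \<Rightarrow> 'm" where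
  "left_dual C f = (let a = Dom C f; b = Cod C f; da = Dual C a; db = Dual C b in
     (Ident C da \<otimes>\<^bsub>C\<^esub> Ev C db) \<cdot>\<^bsub>C\<^esub> (Ident C da \<otimes>\<^bsub>C\<^esub> f \<otimes>\<^bsub>C\<^esub> Ident C db)
       \<cdot>\<^bsub>C\<^esub> (Coev C da \<otimes>\<^bsub>C\<^esub> Ident C db))"

text \<open>The last axiom makes the identity a natural transformation from the identity functor to the
  double dual functor, and \<open>Ev_TensO\<close> makes it monoidal.\<close>

locale pivotal_category = monoidal_category +
  assumes Dual_Obj: "a \<in> Obj C \<Longrightarrow> Dual C a \<in> Obj C"
    and Dual_Dual: "a \<in> Obj C \<Longrightarrow> Dual C (Dual C a) = a"
    and Dual_Unit: "Dual C (Unit C) = Unit C"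
    and Dual_TensO: "\<lbrakk>a \<in> Obj C; b \<in> Obj C\<rbrakk> \<Longrightarrow> Dual C (a \<boxtimes> b) = Dual C b \<boxtimes> Dual C a"
    and Ev_Hom: "a \<in> Obj C \<Longrightarrow> Ev C a \<in> Hom C (Dual C a \<boxtimes> a) (Unit C)"
    and Coev_Hom: "a \<in> Obj C \<Longrightarrow> Coev C a \<in> Hom C (Unit C) (a \<boxtimes> Dual C a)"
    and zigzag: "a \<in> Obj C \<Longrightarrow> (Ident C a \<otimes> Ev C a) \<cdot> (Coev C a \<otimes> Ident C a) = Ident C a"
    and zigzag_Dual: "a \<in> Obj C \<Longrightarrow>
      (Ev C a \<otimes> Ident C (Dual C a)) \<cdot> (Ident C (Dual C a) \<otimes> Coev C a) = Ident C (Dual C a)"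
    and Ev_TensO: "\<lbrakk>a \<in> Obj C; b \<in> Obj C\<rbrakk> \<Longrightarrow>
      Ev C (a \<boxtimes> b) = Ev C b \<cdot> (Ident C (Dual C b) \<otimes> Ev C a \<otimes> Ident C b)"
    and pivotal: "f \<in> Mor C \<Longrightarrow> left_dual C f = right_dual C f"

locale pivotal_star_category = pivotal_category +
  assumes Star_Hom: "f \<in> Hom C a b \<Longrightarrow> Star C f \<in> Hom C b a"
    and Star_Star: "f \<in> Mor C \<Longrightarrow> Star C (Star C f) = f"
    and Star_Comp: "\<lbrakk>f \<in> Hom C a b; g \<in> Hom C b c\<rbrakk> \<Longrightarrow> Star C (g \<cdot> f) = Star C f \<cdot> Star C g"
    and Star_Add: "\<lbrakk>f \<in> Hom C a b; g \<in> Hom C a b\<rbrakk> \<Longrightarrow> Star C (f \<oplus> g) = Star C f \<oplus> Star C g"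
    and Star_Scale: "f \<in> Mor C \<Longrightarrow> Star C (z \<odot> f) = cnj z \<odot> Star C f"
    and Star_TensM: "\<lbrakk>f \<in> Mor C; g \<in> Mor C\<rbrakk> \<Longrightarrow> Star C (f \<otimes> g) = Star C f \<otimes> Star C g"
    and Star_Ev: "a \<in> Obj C \<Longrightarrow> Star C (Ev C a) = Coev C (Dual C a)"

text \<open>Linear combinations of a list of morphisms \<open>a \<rightarrow> b\<close>.\<close>

fun lincomb :: "('o, 'm) pcat \<Rightarrow> 'o \<Rightarrow> 'o \<Rightarrow> (complex \<times> 'm) list \<Rightarrow> 'm" where
  "lincomb C a b [] = Zero C a b"
| "lincomb C a b ((z, f) # l) = z \<odot>\<^bsub>C\<^esub> f \<oplus>\<^bsub>C\<^esub> lincomb C a b l"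

text \<open>
  A unitary category is a C*-tensor category with finite-dimensional morphism spaces and simple unit.
  With finite-dimensional morphism spaces, being a C*-category (that is, carrying C*-norms for which
  all \<open>f\<^sup>* f\<close> are positive) amounts to \<open>proper\<close> and \<open>positive\<close>.
\<close>

locale unitary_category = pivotal_star_category +
  assumes finite_dim: "\<lbrakk>a \<in> Obj C; b \<in> Obj C\<rbrakk> \<Longrightarrow>
      \<exists>B. finite B \<and> B \<subseteq> Hom C a b \<and>
        (\<forall>f \<in> Hom C a b. \<exists>l. set (map snd l) \<subseteq> B \<and> f = lincomb C a b l)"
    and proper: "\<lbrakk>f \<in> Hom C a b; Star C f \<cdot> f = Zero C a a\<rbrakk> \<Longrightarrow> f = Zero C a b"
    and positive: "f \<in> Hom C a b \<Longrightarrow> \<exists>h \<in> Hom C a a. Star C f \<cdot> f = Star C h \<cdot> h"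
    and Unit_nonzero: "Ident C (Unit C) \<noteq> Zero C (Unit C) (Unit C)"
    and Unit_simple: "f \<in> Hom C (Unit C) (Unit C) \<Longrightarrow> \<exists>z. f = z \<odot> Ident C (Unit C)"

definition is_iso :: "('o, 'm) pcat \<Rightarrow> 'o \<Rightarrow> 'o \<Rightarrow> 'm \<Rightarrow> bool" where
  "is_iso C a b f \<longleftrightarrow> f \<in> Hom C a b \<and>
     (\<exists>g \<in> Hom C b a. g \<cdot>\<^bsub>C\<^esub> f = Ident C a \<and> f \<cdot>\<^bsub>C\<^esub> g = Ident C b)"

definition isomorphic :: "('o, 'm) pcat \<Rightarrow> 'o \<Rightarrow> 'o \<Rightarrow> bool" where
  "isomorphic C a b \<longleftrightarrow> (\<exists>f. is_iso C a b f)"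

definition is_unitary :: "('o, 'm) pcat \<Rightarrow> 'o \<Rightarrow> 'o \<Rightarrow> 'm \<Rightarrow> bool" where
  "is_unitary C a b f \<longleftrightarrow> f \<in> Hom C a b \<and>
     Star C f \<cdot>\<^bsub>C\<^esub> f = Ident C a \<and> f \<cdot>\<^bsub>C\<^esub> Star C f = Ident C b"


section \<open>Tensor functors and quotients\<close>

text \<open>\<open>FTens a b : F a \<otimes> F b \<rightarrow> F (a \<otimes> b)\<close> and \<open>FUnit : 1 \<rightarrow> F 1\<close> are the structure isomorphisms.\<close>

record ('o, 'm, 'p, 'k) tfunctor =
  FObj :: "'o \<Rightarrow> 'p"
  FMor :: "'m \<Rightarrow> 'k"
  FTens :: "'o \<Rightarrow> 'o \<Rightarrow> 'k"
  FUnit :: "'k"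

locale tensor_functor =
  fixes C :: "('o, 'm) pcat" and D :: "('p, 'k) pcat" and F :: "('o, 'm, 'p, 'k) tfunctor"
  assumes FObj_Obj: "a \<in> Obj C \<Longrightarrow> FObj F a \<in> Obj D"
    and FMor_Hom: "f \<in> Hom C a b \<Longrightarrow> FMor F f \<in> Hom D (FObj F a) (FObj F b)"
    and FMor_Ident: "a \<in> Obj C \<Longrightarrow> FMor F (Ident C a) = Ident D (FObj F a)"
    and FMor_Comp: "\<lbrakk>f \<in> Hom C a b; g \<in> Hom C b c\<rbrakk> \<Longrightarrow> FMor F (g \<cdot>\<^bsub>C\<^esub> f) = FMor F g \<cdot>\<^bsub>D\<^esub> FMor F f"
    and FMor_Add: "\<lbrakk>f \<in> Hom C a b; g \<in> Hom C a b\<rbrakk> \<Longrightarrow> FMor F (f \<oplus>\<^bsub>C\<^esub> g) = FMor F f \<oplus>\<^bsub>D\<^esub> FMor F g"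
    and FMor_Scale: "f \<in> Mor C \<Longrightarrow> FMor F (z \<odot>\<^bsub>C\<^esub> f) = z \<odot>\<^bsub>D\<^esub> FMor F f"
    and FTens_iso: "\<lbrakk>a \<in> Obj C; b \<in> Obj C\<rbrakk> \<Longrightarrow>
      is_iso D (FObj F a \<boxtimes>\<^bsub>D\<^esub> FObj F b) (FObj F (a \<boxtimes>\<^bsub>C\<^esub> b)) (FTens F a b)"
    and FTens_natural: "\<lbrakk>f \<in> Hom C a b; g \<in> Hom C c d\<rbrakk> \<Longrightarrow>
      FTens F b d \<cdot>\<^bsub>D\<^esub> (FMor F f \<otimes>\<^bsub>D\<^esub> FMor F g) = FMor F (f \<otimes>\<^bsub>C\<^esub> g) \<cdot>\<^bsub>D\<^esub> FTens F a c"
    and FTens_assoc: "\<lbrakk>a \<in> Obj C; b \<in> Obj C; c \<in> Obj C\<rbrakk> \<Longrightarrow>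
      FTens F (a \<boxtimes>\<^bsub>C\<^esub> b) c \<cdot>\<^bsub>D\<^esub> (FTens F a b \<otimes>\<^bsub>D\<^esub> Ident D (FObj F c)) =
      FTens F a (b \<boxtimes>\<^bsub>C\<^esub> c) \<cdot>\<^bsub>D\<^esub> (Ident D (FObj F a) \<otimes>\<^bsub>D\<^esub> FTens F b c)"
    and FUnit_iso: "is_iso D (Unit D) (FObj F (Unit C)) (FUnit F)"
    and FUnit_left: "a \<in> Obj C \<Longrightarrow>
      FTens F (Unit C) a \<cdot>\<^bsub>D\<^esub> (FUnit F \<otimes>\<^bsub>D\<^esub> Ident D (FObj F a)) = Ident D (FObj F a)"
    and FUnit_right: "a \<in> Obj C \<Longrightarrow>
      FTens F a (Unit C) \<cdot>\<^bsub>D\<^esub> (Ident D (FObj F a) \<otimes>\<^bsub>D\<^esub> FUnit F) = Ident D (FObj F a)"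

text \<open>
  \<open>F\<close> preserves the pivotal structure if the canonical isomorphism \<open>\<theta> : F (a\<^sup>*) \<rightarrow> (F a)\<^sup>*\<close>, which is
  determined by the first equation, also carries the evaluation \<open>a \<otimes> a\<^sup>* \<rightarrow> 1\<close> of \<open>a\<^sup>*\<close> to that of
  \<open>(F a)\<^sup>*\<close>.
\<close>

definition preserves_pivotal ::
    "('o, 'm) pcat \<Rightarrow> ('p, 'k) pcat \<Rightarrow> ('o, 'm, 'p, 'k) tfunctor \<Rightarrow> bool" where
  "preserves_pivotal C D F \<longleftrightarrow> (\<forall>a \<in> Obj C. \<exists>\<theta>.
     is_iso D (FObj F (Dual C a)) (Dual D (FObj F a)) \<theta> \<and>
     FUnit F \<cdot>\<^bsub>D\<^esub> Ev D (FObj F a) \<cdot>\<^bsub>D\<^esub> (\<theta> \<otimes>\<^bsub>D\<^esub> Ident D (FObj F a))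
       = FMor F (Ev C a) \<cdot>\<^bsub>D\<^esub> FTens F (Dual C a) a \<and>
     FUnit F \<cdot>\<^bsub>D\<^esub> Ev D (Dual D (FObj F a)) \<cdot>\<^bsub>D\<^esub> (Ident D (FObj F a) \<otimes>\<^bsub>D\<^esub> \<theta>)
       = FMor F (Ev C (Dual C a)) \<cdot>\<^bsub>D\<^esub> FTens F a (Dual C a))"

definition preserves_star ::
    "('o, 'm) pcat \<Rightarrow> ('p, 'k) pcat \<Rightarrow> ('o, 'm, 'p, 'k) tfunctor \<Rightarrow> bool" where
  "preserves_star C D F \<longleftrightarrow>
     (\<forall>f \<in> Mor C. FMor F (Star C f) = Star D (FMor F f)) \<and>
     (\<forall>a \<in> Obj C. \<forall>b \<in> Obj C.
        is_unitary D (FObj F a \<boxtimes>\<^bsub>D\<^esub> FObj F b) (FObj F (a \<boxtimes>\<^bsub>C\<^esub> b)) (FTens F a b)) \<and>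
     is_unitary D (Unit D) (FObj F (Unit C)) (FUnit F)"

definition faithful ::
    "('o, 'm) pcat \<Rightarrow> ('p, 'k) pcat \<Rightarrow> ('o, 'm, 'p, 'k) tfunctor \<Rightarrow> bool" where
  "faithful C D F \<longleftrightarrow> (\<forall>a \<in> Obj C. \<forall>b \<in> Obj C. inj_on (FMor F) (Hom C a b))"

text \<open>
  The target of a quotient functor is not assumed to be closed under direct sums or summands.  The
  simple objects of its completion are the pairs \<open>(d, p)\<close> with \<open>p\<close> a minimal idempotent on \<open>d\<close>; such
  a pair is a summand of \<open>F c\<close> iff \<open>p\<close> factors through \<open>F c\<close>.
\<close>

definition minimal_idempotent :: "('o, 'm) pcat \<Rightarrow> 'o \<Rightarrow> 'm \<Rightarrow> bool" where
  "minimal_idempotent C d p \<longleftrightarrow> p \<in> Hom C d d \<and> p \<cdot>\<^bsub>C\<^esub> p = p \<and> p \<noteq> Zero C d d \<and>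
     (\<forall>f \<in> Hom C d d. \<exists>z. p \<cdot>\<^bsub>C\<^esub> f \<cdot>\<^bsub>C\<^esub> p = z \<odot>\<^bsub>C\<^esub> p)"

definition dominant ::
    "('o, 'm) pcat \<Rightarrow> ('p, 'k) pcat \<Rightarrow> ('o, 'm, 'p, 'k) tfunctor \<Rightarrow> bool" where
  "dominant C D F \<longleftrightarrow> (\<forall>d \<in> Obj D. \<forall>p. minimal_idempotent D d p \<longrightarrow>
     (\<exists>c \<in> Obj C. \<exists>f \<in> Hom D d (FObj F c). \<exists>g \<in> Hom D (FObj F c) d. g \<cdot>\<^bsub>D\<^esub> f = p))"

definition unitary_quotient ::
    "('o, 'm) pcat \<Rightarrow> ('p, 'k) pcat \<Rightarrow> ('o, 'm, 'p, 'k) tfunctor \<Rightarrow> bool" where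
  "unitary_quotient C D F \<longleftrightarrow> unitary_category D \<and> tensor_functor C D F \<and>
     preserves_pivotal C D F \<and> preserves_star C D F \<and> faithful C D F \<and> dominant C D F"


section \<open>Diagram categories presented by generators and local relations\<close>

text \<open>
  The objects of a presented category are words of letters.  The morphisms are formal linear
  combinations of planar diagrams built from generating diagrams, modulo planar isotopy and local
  relations: classes of well-formed terms under the least congruence that contains the relations and
  satisfies the axioms of a strict monoidal linear category.
\<close>

datatype ('a, 'g) diag =
    DGen 'g
  | DId "'a list"
  | DZero "'a list" "'a list"
  | DComp "('a, 'g) diag" "('a, 'g) diag"
  | DTens "('a, 'g) diag" "('a, 'g) diag"
  | DAdd "('a, 'g) diag" "('a, 'g) diag"
  | DScale complex "('a, 'g) diag"

text \<open>\<open>let_ev a : [a\<^sup>*, a] \<rightarrow> []\<close> and \<open>let_coev a : [] \<rightarrow> [a, a\<^sup>*]\<close> are the cap and the cup of the letter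
  \<open>a\<close>; \<open>gen_star\<close> reflects generators vertically.\<close>

record ('a, 'g) presentation =
  letters :: "'a set"
  gens :: "'g set"
  gen_dom :: "'g \<Rightarrow> 'a list"
  gen_cod :: "'g \<Rightarrow> 'a list"
  rels :: "(('a, 'g) diag \<times> ('a, 'g) diag) set"
  let_dual :: "'a \<Rightarrow> 'a"
  let_ev :: "'a \<Rightarrow> ('a, 'g) diag"
  let_coev :: "'a \<Rightarrow> ('a, 'g) diag"
  gen_star :: "'g \<Rightarrow> 'g"

fun ddom :: "('a, 'g) presentation \<Rightarrow> ('a, 'g) diag \<Rightarrow> 'a list" where
  "ddom P (DGen g) = gen_dom P g"
| "ddom P (DId w) = w"
| "ddom P (DZero v w) = v"
| "ddom P (DComp t s) = ddom P s"
| "ddom P (DTens s t) = ddom P s @ ddom P t"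
| "ddom P (DAdd s t) = ddom P s"
| "ddom P (DScale z t) = ddom P t"

fun dcod :: "('a, 'g) presentation \<Rightarrow> ('a, 'g) diag \<Rightarrow> 'a list" where
  "dcod P (DGen g) = gen_cod P g"
| "dcod P (DId w) = w"
| "dcod P (DZero v w) = w"
| "dcod P (DComp t s) = dcod P t"
| "dcod P (DTens s t) = dcod P s @ dcod P t"
| "dcod P (DAdd s t) = dcod P s"
| "dcod P (DScale z t) = dcod P t"

fun wf_diag :: "('a, 'g) presentation \<Rightarrow> ('a, 'g) diag \<Rightarrow> bool" where
  "wf_diag P (DGen g) \<longleftrightarrow> g \<in> gens P"
| "wf_diag P (DId w) \<longleftrightarrow> set w \<subseteq> letters P"
| "wf_diag P (DZero v w) \<longleftrightarrow> set v \<subseteq> letters P \<and> set w \<subseteq> letters P"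
| "wf_diag P (DComp t s) \<longleftrightarrow> wf_diag P t \<and> wf_diag P s \<and> ddom P t = dcod P s"
| "wf_diag P (DTens s t) \<longleftrightarrow> wf_diag P s \<and> wf_diag P t"
| "wf_diag P (DAdd s t) \<longleftrightarrow> wf_diag P s \<and> wf_diag P t \<and> ddom P s = ddom P t \<and> dcod P s = dcod P t"
| "wf_diag P (DScale z t) \<longleftrightarrow> wf_diag P t"

definition diags :: "('a, 'g) presentation \<Rightarrow> 'a list \<Rightarrow> 'a list \<Rightarrow> ('a, 'g) diag set" where
  "diags P v w = {t. wf_diag P t \<and> ddom P t = v \<and> dcod P t = w}"

inductive deqv :: "('a, 'g) presentation \<Rightarrow> ('a, 'g) diag \<Rightarrow> ('a, 'g) diag \<Rightarrow> bool"
  for P :: "('a, 'g) presentation" where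
  refl: "wf_diag P t \<Longrightarrow> deqv P t t"
| sym: "deqv P s t \<Longrightarrow> deqv P t s"
| trans: "\<lbrakk>deqv P r s; deqv P s t\<rbrakk> \<Longrightarrow> deqv P r t"
| rel: "\<lbrakk>(s, t) \<in> rels P; s \<in> diags P v w; t \<in> diags P v w\<rbrakk> \<Longrightarrow> deqv P s t"
| cong_Comp: "\<lbrakk>deqv P s s'; deqv P t t'; ddom P t = dcod P s\<rbrakk> \<Longrightarrow> deqv P (DComp t s) (DComp t' s')"
| cong_Tens: "\<lbrakk>deqv P s s'; deqv P t t'\<rbrakk> \<Longrightarrow> deqv P (DTens s t) (DTens s' t')"
| cong_Add: "\<lbrakk>deqv P s s'; deqv P t t'; ddom P s = ddom P t; dcod P s = dcod P t\<rbrakk>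
    \<Longrightarrow> deqv P (DAdd s t) (DAdd s' t')"
| cong_Scale: "deqv P s s' \<Longrightarrow> deqv P (DScale z s) (DScale z s')"
| comp_assoc: "\<lbrakk>r \<in> diags P u v; s \<in> diags P v w; t \<in> diags P w x\<rbrakk>
    \<Longrightarrow> deqv P (DComp (DComp t s) r) (DComp t (DComp s r))"
| comp_id_right: "t \<in> diags P v w \<Longrightarrow> deqv P (DComp t (DId v)) t"
| comp_id_left: "t \<in> diags P v w \<Longrightarrow> deqv P (DComp (DId w) t) t"
| add_assoc: "\<lbrakk>r \<in> diags P v w; s \<in> diags P v w; t \<in> diags P v w\<rbrakk>
    \<Longrightarrow> deqv P (DAdd (DAdd r s) t) (DAdd r (DAdd s t))"
| add_commute: "\<lbrakk>s \<in> diags P v w; t \<in> diags P v w\<rbrakk> \<Longrightarrow> deqv P (DAdd s t) (DAdd t s)"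
| add_zero: "t \<in> diags P v w \<Longrightarrow> deqv P (DAdd t (DZero v w)) t"
| add_inverse: "t \<in> diags P v w \<Longrightarrow> deqv P (DAdd t (DScale (-1) t)) (DZero v w)"
| scale_one: "wf_diag P t \<Longrightarrow> deqv P (DScale 1 t) t"
| scale_scale: "wf_diag P t \<Longrightarrow> deqv P (DScale z (DScale z' t)) (DScale (z * z') t)"
| scale_add_left: "wf_diag P t \<Longrightarrow> deqv P (DScale (z + z') t) (DAdd (DScale z t) (DScale z' t))"
| scale_add_right: "\<lbrakk>s \<in> diags P v w; t \<in> diags P v w\<rbrakk>
    \<Longrightarrow> deqv P (DScale z (DAdd s t)) (DAdd (DScale z s) (DScale z t))"
| comp_add_left: "\<lbrakk>r \<in> diags P u v; s \<in> diags P v w; t \<in> diags P v w\<rbrakk>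
    \<Longrightarrow> deqv P (DComp (DAdd s t) r) (DAdd (DComp s r) (DComp t r))"
| comp_add_right: "\<lbrakk>r \<in> diags P u v; s \<in> diags P u v; t \<in> diags P v w\<rbrakk>
    \<Longrightarrow> deqv P (DComp t (DAdd r s)) (DAdd (DComp t r) (DComp t s))"
| comp_scale_left: "\<lbrakk>s \<in> diags P u v; t \<in> diags P v w\<rbrakk>
    \<Longrightarrow> deqv P (DComp (DScale z t) s) (DScale z (DComp t s))"
| comp_scale_right: "\<lbrakk>s \<in> diags P u v; t \<in> diags P v w\<rbrakk>
    \<Longrightarrow> deqv P (DComp t (DScale z s)) (DScale z (DComp t s))"
| tens_assoc: "\<lbrakk>wf_diag P r; wf_diag P s; wf_diag P t\<rbrakk>
    \<Longrightarrow> deqv P (DTens (DTens r s) t) (DTens r (DTens s t))"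
| tens_unit_left: "wf_diag P t \<Longrightarrow> deqv P (DTens (DId []) t) t"
| tens_unit_right: "wf_diag P t \<Longrightarrow> deqv P (DTens t (DId [])) t"
| tens_id: "\<lbrakk>set v \<subseteq> letters P; set w \<subseteq> letters P\<rbrakk> \<Longrightarrow> deqv P (DTens (DId v) (DId w)) (DId (v @ w))"
| interchange: "\<lbrakk>s \<in> diags P u v; t \<in> diags P v w; s' \<in> diags P u' v'; t' \<in> diags P v' w'\<rbrakk>
    \<Longrightarrow> deqv P (DTens (DComp t s) (DComp t' s')) (DComp (DTens t t') (DTens s s'))"
| tens_add_left: "\<lbrakk>r \<in> diags P v w; s \<in> diags P v w; wf_diag P t\<rbrakk>
    \<Longrightarrow> deqv P (DTens (DAdd r s) t) (DAdd (DTens r t) (DTens s t))"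
| tens_add_right: "\<lbrakk>r \<in> diags P v w; s \<in> diags P v w; wf_diag P t\<rbrakk>
    \<Longrightarrow> deqv P (DTens t (DAdd r s)) (DAdd (DTens t r) (DTens t s))"
| tens_scale_left: "\<lbrakk>wf_diag P s; wf_diag P t\<rbrakk> \<Longrightarrow> deqv P (DTens (DScale z s) t) (DScale z (DTens s t))"
| tens_scale_right: "\<lbrakk>wf_diag P s; wf_diag P t\<rbrakk> \<Longrightarrow> deqv P (DTens s (DScale z t)) (DScale z (DTens s t))"

definition cls :: "('a, 'g) presentation \<Rightarrow> ('a, 'g) diag \<Rightarrow> ('a, 'g) diag set" where
  "cls P t = {s. deqv P t s}"

definition rep :: "('a, 'g) diag set \<Rightarrow> ('a, 'g) diag" where
  "rep X = (SOME t. t \<in> X)"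

definition word_dual :: "('a, 'g) presentation \<Rightarrow> 'a list \<Rightarrow> 'a list" where
  "word_dual P w = rev (map (let_dual P) w)"

text \<open>The caps and cups of words are nested caps and cups.\<close>

fun word_ev :: "('a, 'g) presentation \<Rightarrow> 'a list \<Rightarrow> ('a, 'g) diag" where
  "word_ev P [] = DId []"
| "word_ev P (a # w) =
     DComp (word_ev P w) (DTens (DId (word_dual P w)) (DTens (let_ev P a) (DId w)))"

fun word_coev :: "('a, 'g) presentation \<Rightarrow> 'a list \<Rightarrow> ('a, 'g) diag" where
  "word_coev P [] = DId []"
| "word_coev P (a # w) =
     DComp (DTens (DId [a]) (DTens (word_coev P w) (DId [let_dual P a]))) (let_coev P a)"

fun diag_star :: "('a, 'g) presentation \<Rightarrow> ('a, 'g) diag \<Rightarrow> ('a, 'g) diag" where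
  "diag_star P (DGen g) = DGen (gen_star P g)"
| "diag_star P (DId w) = DId w"
| "diag_star P (DZero v w) = DZero w v"
| "diag_star P (DComp t s) = DComp (diag_star P s) (diag_star P t)"
| "diag_star P (DTens s t) = DTens (diag_star P s) (diag_star P t)"
| "diag_star P (DAdd s t) = DAdd (diag_star P s) (diag_star P t)"
| "diag_star P (DScale z t) = DScale (cnj z) (diag_star P t)"

definition presented :: "('a, 'g) presentation \<Rightarrow> ('a list, ('a, 'g) diag set) pcat" where
  "presented P = \<lparr>
     Obj = {w. set w \<subseteq> letters P},
     Mor = {cls P t | t. wf_diag P t},
     Dom = (\<lambda>X. ddom P (rep X)),
     Cod = (\<lambda>X. dcod P (rep X)),
     Ident = (\<lambda>w. cls P (DId w)),
     Comp = (\<lambda>Y X. cls P (DComp (rep Y) (rep X))),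
     Zero = (\<lambda>v w. cls P (DZero v w)),
     Add = (\<lambda>X Y. cls P (DAdd (rep X) (rep Y))),
     Scale = (\<lambda>z X. cls P (DScale z (rep X))),
     Unit = [],
     TensO = (@),
     TensM = (\<lambda>X Y. cls P (DTens (rep X) (rep Y))),
     Dual = word_dual P,
     Ev = (\<lambda>w. cls P (word_ev P w)),
     Coev = (\<lambda>w. cls P (word_coev P w)),
     Star = (\<lambda>X. cls P (diag_star P (rep X)))\<rparr>"


section \<open>The Fibonacci category\<close>

definition tau :: real where
  "tau = (1 + sqrt 5) / 2"

text \<open>The Temperley--Lieb category: there is one letter, the self-dual strand, so that the words are
  numbers of strands, and the diagrams are generated by the cap and the cup.\<close>

datatype tl_gen = Cup | Cap

type_synonym tl_diag = "(unit, tl_gen) diag"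

abbreviation strands :: "nat \<Rightarrow> unit list" where
  "strands n \<equiv> replicate n ()"

text \<open>The quantum integers \<open>[n]\<close> at \<open>[2] = \<tau>\<close>, and the Jones--Wenzl idempotents
  \<open>f\<^sup>(\<^sup>n\<^sup>)\<close> by Wenzl's recursion.\<close>

fun qint :: "nat \<Rightarrow> real" where
  "qint 0 = 0"
| "qint (Suc 0) = 1"
| "qint (Suc (Suc n)) = tau * qint (Suc n) - qint n"

fun jones_wenzl :: "nat \<Rightarrow> tl_diag" where
  "jones_wenzl 0 = DId []"
| "jones_wenzl (Suc 0) = DId (strands 1)"
| "jones_wenzl (Suc (Suc n)) =
     (let f = DTens (jones_wenzl (Suc n)) (DId (strands 1));
          e = DTens (DId (strands n)) (DComp (DGen Cup) (DGen Cap))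
      in DAdd f (DScale (of_real (- (qint (Suc n) / qint (Suc (Suc n))))) (DComp f (DComp e f))))"

text \<open>The relations are isotopy (the two zigzags), the loop parameter \<open>\<tau>\<close>, and the vanishing of
  \<open>f\<^sup>(\<^sup>4\<^sup>)\<close>, which generates the ideal of negligible morphisms and leaves the simple objects
  \<open>f\<^sup>(\<^sup>0\<^sup>), \<dots>, f\<^sup>(\<^sup>3\<^sup>)\<close>, the vertices of the Dynkin diagram \<open>A\<^sub>4\<close>.\<close>

definition TL_A4_presentation :: "(unit, tl_gen) presentation" where
  "TL_A4_presentation = \<lparr>
     letters = UNIV,
     gens = UNIV,
     gen_dom = (\<lambda>g. case g of Cup \<Rightarrow> [] | Cap \<Rightarrow> strands 2),
     gen_cod = (\<lambda>g. case g of Cup \<Rightarrow> strands 2 | Cap \<Rightarrow> []),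
     rels = {
       (DComp (DTens (DGen Cap) (DId (strands 1))) (DTens (DId (strands 1)) (DGen Cup)), DId (strands 1)),
       (DComp (DTens (DId (strands 1)) (DGen Cap)) (DTens (DGen Cup) (DId (strands 1))), DId (strands 1)),
       (DComp (DGen Cap) (DGen Cup), DScale (of_real tau) (DId [])),
       (jones_wenzl 4, DZero (strands 4) (strands 4))},
     let_dual = id,
     let_ev = (\<lambda>_. DGen Cap),
     let_coev = (\<lambda>_. DGen Cup),
     gen_star = (\<lambda>g. case g of Cup \<Rightarrow> Cap | Cap \<Rightarrow> Cup)\<rparr>"

definition full_subcategory :: "('o, 'm) pcat \<Rightarrow> 'o set \<Rightarrow> ('o, 'm) pcat" where
  "full_subcategory C S = C\<lparr>Obj := S, Mor := {f \<in> Mor C. Dom C f \<in> S \<and> Cod C f \<in> S}\<rparr>"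

text \<open>The idempotent completion: the objects are the pairs \<open>(a, p)\<close> with \<open>p\<close> a projection on \<open>a\<close>, and
  a morphism is stored together with its source and target.\<close>

definition karoubi ::
    "('o, 'm) pcat \<Rightarrow> ('o \<times> 'm, ('o \<times> 'm) \<times> 'm \<times> ('o \<times> 'm)) pcat" where
  "karoubi C = \<lparr>
     Obj = {(a, p). a \<in> Obj C \<and> p \<in> Hom C a a \<and> p \<cdot>\<^bsub>C\<^esub> p = p \<and> Star C p = p},
     Mor = {((a, p), f, (b, q)) | a p f b q.
       a \<in> Obj C \<and> p \<in> Hom C a a \<and> p \<cdot>\<^bsub>C\<^esub> p = p \<and> Star C p = p \<and>
       b \<in> Obj C \<and> q \<in> Hom C b b \<and> q \<cdot>\<^bsub>C\<^esub> q = q \<and> Star C q = q \<and>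
       f \<in> Hom C a b \<and> q \<cdot>\<^bsub>C\<^esub> f \<cdot>\<^bsub>C\<^esub> p = f},
     Dom = (\<lambda>(x, f, y). x),
     Cod = (\<lambda>(x, f, y). y),
     Ident = (\<lambda>(a, p). ((a, p), p, (a, p))),
     Comp = (\<lambda>(y, g, z) (x, f, y'). (x, g \<cdot>\<^bsub>C\<^esub> f, z)),
     Zero = (\<lambda>x y. (x, Zero C (fst x) (fst y), y)),
     Add = (\<lambda>(x, f, y) (x', g, y'). (x, f \<oplus>\<^bsub>C\<^esub> g, y)),
     Scale = (\<lambda>c (x, f, y). (x, c \<odot>\<^bsub>C\<^esub> f, y)),
     Unit = (Unit C, Ident C (Unit C)),
     TensO = (\<lambda>(a, p) (b, q). (a \<boxtimes>\<^bsub>C\<^esub> b, p \<otimes>\<^bsub>C\<^esub> q)),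
     TensM = (\<lambda>((a, p), f, (b, q)) ((a', p'), f', (b', q')).
       ((a \<boxtimes>\<^bsub>C\<^esub> a', p \<otimes>\<^bsub>C\<^esub> p'), f \<otimes>\<^bsub>C\<^esub> f', (b \<boxtimes>\<^bsub>C\<^esub> b', q \<otimes>\<^bsub>C\<^esub> q'))),
     Dual = (\<lambda>(a, p). (Dual C a, right_dual C p)),
     Ev = (\<lambda>(a, p). ((Dual C a \<boxtimes>\<^bsub>C\<^esub> a, right_dual C p \<otimes>\<^bsub>C\<^esub> p),
       Ev C a \<cdot>\<^bsub>C\<^esub> (right_dual C p \<otimes>\<^bsub>C\<^esub> p), (Unit C, Ident C (Unit C)))),
     Coev = (\<lambda>(a, p). ((Unit C, Ident C (Unit C)),
       (p \<otimes>\<^bsub>C\<^esub> right_dual C p) \<cdot>\<^bsub>C\<^esub> Coev C a, (a \<boxtimes>\<^bsub>C\<^esub> Dual C a, p \<otimes>\<^bsub>C\<^esub> right_dual C p))),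
     Star = (\<lambda>(x, f, y). (y, Star C f, x))\<rparr>"

type_synonym fib_obj = "unit list \<times> tl_diag set"
type_synonym fib_mor = "fib_obj \<times> tl_diag set \<times> fib_obj"

definition T2 :: "(fib_obj, fib_mor) pcat" where
  "T2 = karoubi (full_subcategory (presented TL_A4_presentation) {w. even (length w)})"

text \<open>The nontrivial simple object of \<open>T\<^sub>2\<close>, which equals its own dual.\<close>

definition fib :: fib_obj where
  "fib = (strands 2, cls TL_A4_presentation (jones_wenzl 2))"


section \<open>Free products\<close>

text \<open>
  The free product of a family of pivotal categories.  A letter is an object of one of the categories,
  tagged with the index of the category.  The generator \<open>Diagram i v w f\<close> is a diagram
  \<open>f : v\<^sub>1 \<otimes> \<dots> \<otimes> v\<^sub>k \<rightarrow> w\<^sub>1 \<otimes> \<dots> \<otimes> w\<^sub>l\<close> from the \<open>i\<close>-th category, regarded as a morphism between words.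
  Since strands of different types have no crossing, terms in these generators are planar disjoint
  unions of diagrams from the individual categories, and the relations are those that hold in the
  individual categories.
\<close>

datatype ('i, 'o, 'm) fp_gen = Diagram 'i "'o list" "'o list" 'm

definition tens_word :: "('o, 'm) pcat \<Rightarrow> 'o list \<Rightarrow> 'o" where
  "tens_word C w = foldr (TensO C) w (Unit C)"

inductive_set fp_rels ::
    "('i \<Rightarrow> ('o, 'm) pcat) \<Rightarrow> (('i \<times> 'o, ('i, 'o, 'm) fp_gen) diag \<times> ('i \<times> 'o, ('i, 'o, 'm) fp_gen) diag) set"
  for C :: "'i \<Rightarrow> ('o, 'm) pcat" where
  "(DGen (Diagram i w w (Ident (C i) (tens_word (C i) w))), DId (map (Pair i) w)) \<in> fp_rels C"
| "(DComp (DGen (Diagram i v w g)) (DGen (Diagram i u v f)), DGen (Diagram i u w (g \<cdot>\<^bsub>C i\<^esub> f))) \<in> fp_rels C"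
| "(DTens (DGen (Diagram i u v f)) (DGen (Diagram i u' v' f')),
    DGen (Diagram i (u @ u') (v @ v') (f \<otimes>\<^bsub>C i\<^esub> f'))) \<in> fp_rels C"
| "(DAdd (DGen (Diagram i v w f)) (DGen (Diagram i v w g)), DGen (Diagram i v w (f \<oplus>\<^bsub>C i\<^esub> g))) \<in> fp_rels C"
| "(DScale z (DGen (Diagram i v w f)), DGen (Diagram i v w (z \<odot>\<^bsub>C i\<^esub> f))) \<in> fp_rels C"

definition fp_presentation ::
    "('i \<Rightarrow> ('o, 'm) pcat) \<Rightarrow> ('i \<times> 'o, ('i, 'o, 'm) fp_gen) presentation" where
  "fp_presentation C = \<lparr>
     letters = {(i, a). a \<in> Obj (C i)},
     gens = {Diagram i v w f | i v w f. set v \<subseteq> Obj (C i) \<and> set w \<subseteq> Obj (C i) \<and>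
       f \<in> Hom (C i) (tens_word (C i) v) (tens_word (C i) w)},
     gen_dom = (\<lambda>g. case g of Diagram i v w f \<Rightarrow> map (Pair i) v),
     gen_cod = (\<lambda>g. case g of Diagram i v w f \<Rightarrow> map (Pair i) w),
     rels = fp_rels C,
     let_dual = (\<lambda>(i, a). (i, Dual (C i) a)),
     let_ev = (\<lambda>(i, a). DGen (Diagram i [Dual (C i) a, a] [] (Ev (C i) a))),
     let_coev = (\<lambda>(i, a). DGen (Diagram i [] [a, Dual (C i) a] (Coev (C i) a))),
     gen_star = (\<lambda>g. case g of Diagram i v w f \<Rightarrow> Diagram i w v (Star (C i) f))\<rparr>"

definition free_product ::
    "('i \<Rightarrow> ('o, 'm) pcat) \<Rightarrow> (('i \<times> 'o) list, ('i \<times> 'o, ('i, 'o, 'm) fp_gen) diag set) pcat" where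
  "free_product C = presented (fp_presentation C)"

datatype copy = Copy1 | Copy2

type_synonym letter = "copy \<times> fib_obj"
type_synonym word = "letter list"
type_synonym fp_mor = "(letter, (copy, fib_obj, fib_mor) fp_gen) diag set"

definition T2_T2 :: "(word, fp_mor) pcat" where
  "T2_T2 = free_product (\<lambda>_ :: copy. T2)"

abbreviation rho :: letter where
  "rho \<equiv> (Copy1, fib)"

abbreviation mu :: letter where
  "mu \<equiv> (Copy2, fib)"

fun alternating :: "'a \<Rightarrow> 'a \<Rightarrow> nat \<Rightarrow> 'a list" where
  "alternating a b 0 = []"
| "alternating a b (Suc k) = a # alternating b a k"

definition Pw :: "nat \<Rightarrow> word" where
  "Pw k = alternating rho mu k"

definition Qw :: "nat \<Rightarrow> word" where
  "Qw k = alternating mu rho k"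


section \<open>The quotients \<open>TT\<close>\<close>

text \<open>
  For \<open>f : F a \<rightarrow> F b\<close> and \<open>g : F c \<rightarrow> F d\<close>, the tensor product \<open>f \<otimes> g\<close> seen as a morphism
  \<open>F (a \<otimes> c) \<rightarrow> F (b \<otimes> d)\<close>.  The inverse of the structure isomorphism is its adjoint, as it is
  unitary for a functor preserving \<open>*\<close>.
\<close>

definition img_tens ::
    "('o, 'm) pcat \<Rightarrow> ('p, 'k) pcat \<Rightarrow> ('o, 'm, 'p, 'k) tfunctor \<Rightarrow> 'o \<Rightarrow> 'o \<Rightarrow> 'o \<Rightarrow> 'o \<Rightarrow> 'k \<Rightarrow> 'k \<Rightarrow> 'k" where
  "img_tens C D F a b c d f g = FTens F b d \<cdot>\<^bsub>D\<^esub> (f \<otimes>\<^bsub>D\<^esub> g) \<cdot>\<^bsub>D\<^esub> Star D (FTens F a c)"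

text \<open>For \<open>u : F b \<rightarrow> F c\<close>, the morphism \<open>id\<^sub>a \<otimes> u \<otimes> id\<^sub>d : F (a \<otimes> b \<otimes> d) \<rightarrow> F (a \<otimes> c \<otimes> d)\<close>.\<close>

definition whisker ::
    "('o, 'm) pcat \<Rightarrow> ('p, 'k) pcat \<Rightarrow> ('o, 'm, 'p, 'k) tfunctor \<Rightarrow> 'o \<Rightarrow> 'o \<Rightarrow> 'o \<Rightarrow> 'o \<Rightarrow> 'k \<Rightarrow> 'k" where
  "whisker C D F a b c d u =
     img_tens C D F a a (b \<boxtimes>\<^bsub>C\<^esub> d) (c \<boxtimes>\<^bsub>C\<^esub> d) (Ident D (FObj F a))
       (img_tens C D F b c d d u (Ident D (FObj F d)))"

text \<open>The rotations \<open>\<F>(U), \<F>\<^sup>-\<^sup>1(U) : Q\<^sub>n \<rightarrow> P\<^sub>n\<close> of \<open>U : P\<^sub>n \<rightarrow> Q\<^sub>n\<close>.\<close>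

definition rot ::
    "('p, 'k) pcat \<Rightarrow> (word, fp_mor, 'p, 'k) tfunctor \<Rightarrow> nat \<Rightarrow> 'k \<Rightarrow> 'k" where
  "rot D F n U = (let C = T2_T2; y = [last (Qw n)] in
     FMor F (Ident C (Pw n) \<otimes>\<^bsub>C\<^esub> Ev C y)
     \<cdot>\<^bsub>D\<^esub> whisker C D F [rho] (Pw n) (Qw n) y U
     \<cdot>\<^bsub>D\<^esub> FMor F (Coev C [rho] \<otimes>\<^bsub>C\<^esub> Ident C (Qw n)))"

definition rot_inv ::
    "('p, 'k) pcat \<Rightarrow> (word, fp_mor, 'p, 'k) tfunctor \<Rightarrow> nat \<Rightarrow> 'k \<Rightarrow> 'k" where
  "rot_inv D F n U = (let C = T2_T2; x = [last (Pw n)] in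
     FMor F (Ev C [mu] \<otimes>\<^bsub>C\<^esub> Ident C (Pw n))
     \<cdot>\<^bsub>D\<^esub> whisker C D F [mu] (Pw n) (Qw n) x U
     \<cdot>\<^bsub>D\<^esub> FMor F (Ident C (Qw n) \<otimes>\<^bsub>C\<^esub> Coev C x))"

text \<open>\<open>generated D F v w U a b\<close>: the morphisms \<open>F a \<rightarrow> F b\<close> obtained from those in the image of \<open>F\<close> and
  from \<open>U : F v \<rightarrow> F w\<close> by the operations of a linear tensor \<open>*\<close>-category.\<close>

inductive_set generated ::
    "('o, 'm) pcat \<Rightarrow> ('p, 'k) pcat \<Rightarrow> ('o, 'm, 'p, 'k) tfunctor \<Rightarrow> 'o \<Rightarrow> 'o \<Rightarrow> 'k \<Rightarrow> ('o \<times> 'k \<times> 'o) set"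
  for C D F v w U where
  image: "f \<in> Hom C a b \<Longrightarrow> (a, FMor F f, b) \<in> generated C D F v w U"
| generator: "(v, U, w) \<in> generated C D F v w U"
| star: "(a, f, b) \<in> generated C D F v w U \<Longrightarrow> (b, Star D f, a) \<in> generated C D F v w U"
| comp: "\<lbrakk>(a, f, b) \<in> generated C D F v w U; (b, g, c) \<in> generated C D F v w U\<rbrakk>
    \<Longrightarrow> (a, g \<cdot>\<^bsub>D\<^esub> f, c) \<in> generated C D F v w U"
| add: "\<lbrakk>(a, f, b) \<in> generated C D F v w U; (a, g, b) \<in> generated C D F v w U\<rbrakk>
    \<Longrightarrow> (a, f \<oplus>\<^bsub>D\<^esub> g, b) \<in> generated C D F v w U"
| scale: "(a, f, b) \<in> generated C D F v w U \<Longrightarrow> (a, z \<odot>\<^bsub>D\<^esub> f, b) \<in> generated C D F v w U"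
| tens: "\<lbrakk>(a, f, b) \<in> generated C D F v w U; (c, g, d) \<in> generated C D F v w U\<rbrakk>
    \<Longrightarrow> (a \<boxtimes>\<^bsub>C\<^esub> c, img_tens C D F a b c d f g, b \<boxtimes>\<^bsub>C\<^esub> d) \<in> generated C D F v w U"

definition is_TT ::
    "nat \<Rightarrow> complex \<Rightarrow> ('p, 'k) pcat \<Rightarrow> (word, fp_mor, 'p, 'k) tfunctor \<Rightarrow> 'k \<Rightarrow> bool" where
  "is_TT n \<omega> D F U \<longleftrightarrow>
     unitary_quotient T2_T2 D F \<and>
     n \<ge> 2 \<and> isomorphic D (FObj F (Pw n)) (FObj F (Qw n)) \<and>
     (\<forall>k. 2 \<le> k \<and> k < n \<longrightarrow> \<not> isomorphic D (FObj F (Pw k)) (FObj F (Qw k))) \<and>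
     is_unitary D (FObj F (Pw n)) (FObj F (Qw n)) U \<and>
     rot_inv D F n U = Star D U \<and> Star D U = inverse \<omega> \<odot>\<^bsub>D\<^esub> rot D F n U \<and>
     (\<forall>a \<in> Obj T2_T2. \<forall>b \<in> Obj T2_T2. \<forall>f \<in> Hom D (FObj F a) (FObj F b).
        (a, f, b) \<in> generated T2_T2 D F (Pw n) (Qw n) U)"

end

theory Submission
  imports Defs "Jordan_Normal_Form.Schur_Decomposition"
begin

no_notation monoid.mult (infixl "\<otimes>\<index>" 70) and ring.add (infixl "\<oplus>\<index>" 65)
  and module.smult (infixl "\<odot>\<index>" 70)

hide_const (open) Group.is_iso

text \<open>
  In a unitary quotient with \<open>P\<^sub>n \<cong> Q\<^sub>n\<close>, the words \<open>P\<^sub>k\<close>, \<open>Q\<^sub>k\<close> with \<open>k < n\<close> together with \<open>P\<^sub>n\<close> form a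
  set \<open>I\<close> of pairwise non-isomorphic simple objects through which all words decompose.
  For each word \<open>Y\<close>, the words act on \<open>\<Oplus>\<^sub>T Hom(T, YT)\<close> by tensoring on the right and projecting to the
  summands \<open>T\<close>.  The letters \<open>\<rho>\<close> and \<open>\<mu>\<close> act by matrices satisfying \<open>A\<^sup>2 = 1 + A\<close> and a braid relation of
  length \<open>n\<close>, so that each eigenvalue \<open>a\<close> of the product of both satisfies \<open>a\<^sup>n = 1 \<noteq> a\<close> or \<open>a\<^sup>2 - 3a + 1 = 0\<close>.
  The traces of a word, weighted by the dimensions of \<open>Y\<close> and summed over \<open>Y \<in> I\<close>, vanish unless the
  word contains the unit.  Fourier analysis then determines the weighted multiplicity of an
  \<open>n\<close>-th root of unity \<open>z \<noteq> 1\<close> as \<open>D (z + 1/z - 2) / (n (z + 1/z - 3))\<close>, where \<open>D\<close> is the global dimension.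
  It must be of the form \<open>p + q \<tau>\<close> with integers \<open>p\<close>, \<open>q\<close>, which is impossible for \<open>4 \<le> n \<le> 10\<close>, \<open>n \<noteq> 5\<close>; for
  \<open>n = 5\<close>, invariance of the multiplicities under cyclic rotation of \<open>Y\<close> gives \<open>11 | q\<close>, but \<open>q = 14\<close>.
\<close>

text \<open>Fourier inversion needs n consecutive moments of a spectrum made of n-th roots of unity,
  so the eigenvalues with \<open>a^2 - 3 a + 1 = 0\<close> have to be removed first. The weight
  \<open>1/a - 3 + a\<close> vanishes on them and involves only the moments from -1 to n. Moment 0
  is the global dimension, and moments 1 to n - 1 vanish because an alternating word of fewer than
  2n letters does not contain the unit. Moment -1 is accessible because a matrix with
  \<open>A^2 = 1 + A\<close> has inverse \<open>A - 1\<close>, which turns the inverse of the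
  product into a combination of words of at most two letters. Moment n belongs to a word of 2n
  letters, which may contain the unit; it is read off from the absence of the eigenvalue 1. The sum
  over \<open>Y\<close> is tractable because the dimensions of the \<open>Y\<close> are the weights
  that make bent bases of \<open>Hom(T, YT)\<close> resolve the identity of \<open>T T*\<close>;
  this cuts the strand \<open>Y\<close> and leaves the acting word with a map to the unit.
  Integrality comes from multiplicities being natural numbers and dimensions being powers of \<tau>.
  The relations of a Fibonacci object have to be derived from the vanishing of the fourth
  Jones-Wenzl idempotent.\<close>

section \<open>Categories presented by generators and relations\<close>

locale wf_presentation =
  fixes P :: "('a, 'g) presentation"
  assumes gens_letters: "g \<in> gens P \<Longrightarrow> set (gen_dom P g) \<subseteq> letters P \<and> set (gen_cod P g) \<subseteq> letters P"
begin

lemma wf_diag_letters: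
  "wf_diag P t \<Longrightarrow> set (ddom P t) \<subseteq> letters P \<and> set (dcod P t) \<subseteq> letters P"
  by (induction t) (use gens_letters in auto)

text \<open>This makes source and target of a class independent of the representative picked by
  \<open>rep\<close>.\<close>

lemma deqv_wf:
  "deqv P s t \<Longrightarrow> wf_diag P s \<and> wf_diag P t \<and> ddom P s = ddom P t \<and> dcod P s = dcod P t"
  by (induction rule: deqv.induct) (use wf_diag_letters in \<open>auto simp: diags_def\<close>)

lemma cls_eqI: "deqv P s t \<Longrightarrow> cls P s = cls P t"
  unfolding cls_def by (auto intro: deqv.sym deqv.trans)

lemma deqv_rep: "wf_diag P t \<Longrightarrow> deqv P t (rep (cls P t))"
  unfolding rep_def cls_def by (metis (mono_tags, lifting) deqv.refl mem_Collect_eq someI_ex)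

lemma
  assumes "wf_diag P t"
  shows wf_rep [simp]: "wf_diag P (rep (cls P t))"
    and ddom_rep [simp]: "ddom P (rep (cls P t)) = ddom P t"
    and dcod_rep [simp]: "dcod P (rep (cls P t)) = dcod P t"
  using deqv_wf [OF deqv_rep [OF assms]] by auto

lemma presented_Hom: "Hom (presented P) v w = cls P ` diags P v w"
  by (fastforce simp: Hom_def presented_def diags_def)

lemma presented_Mor: "f \<in> Mor (presented P) \<longleftrightarrow> (\<exists>t. wf_diag P t \<and> f = cls P t)"
  by (auto simp: presented_def)

lemma presented_Dom: "wf_diag P t \<Longrightarrow> Dom (presented P) (cls P t) = ddom P t"
  and presented_Cod: "wf_diag P t \<Longrightarrow> Cod (presented P) (cls P t) = dcod P t"
  by (simp_all add: presented_def)

lemma presented_Comp: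
  "\<lbrakk>wf_diag P s; wf_diag P t; ddom P t = dcod P s\<rbrakk>
    \<Longrightarrow> Comp (presented P) (cls P t) (cls P s) = cls P (DComp t s)"
  by (auto simp: presented_def intro!: cls_eqI deqv.cong_Comp intro: deqv.sym deqv_rep)

lemma presented_TensM:
  "\<lbrakk>wf_diag P s; wf_diag P t\<rbrakk> \<Longrightarrow> TensM (presented P) (cls P s) (cls P t) = cls P (DTens s t)"
  by (auto simp: presented_def intro!: cls_eqI deqv.cong_Tens intro: deqv.sym deqv_rep)

lemma presented_Add:
  "\<lbrakk>wf_diag P s; wf_diag P t; ddom P s = ddom P t; dcod P s = dcod P t\<rbrakk>
    \<Longrightarrow> Add (presented P) (cls P s) (cls P t) = cls P (DAdd s t)"
  by (auto simp: presented_def intro!: cls_eqI deqv.cong_Add intro: deqv.sym deqv_rep)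

lemma presented_Scale:
  "wf_diag P s \<Longrightarrow> Scale (presented P) z (cls P s) = cls P (DScale z s)"
  by (auto simp: presented_def intro!: cls_eqI deqv.cong_Scale intro: deqv.sym deqv_rep)

lemma presented_simps:
  "Obj (presented P) = {w. set w \<subseteq> letters P}"
  "Ident (presented P) w = cls P (DId w)"
  "Zero (presented P) v w = cls P (DZero v w)"
  "Unit (presented P) = []"
  "TensO (presented P) v w = v @ w"
  by (simp_all add: presented_def)

lemmas presented_ops =
  presented_Comp presented_TensM presented_Add presented_Scale presented_simps

lemma presented_HomE:
  assumes "f \<in> Hom (presented P) v w"
  obtains t where "f = cls P t" "wf_diag P t" "ddom P t = v" "dcod P t = w"
    "set v \<subseteq> letters P" "set w \<subseteq> letters P"
proof -
  obtain t where "f = cls P t" "wf_diag P t" "ddom P t = v" "dcod P t = w"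
    using assms by (auto simp: presented_Hom diags_def)
  then show thesis using wf_diag_letters [of t] that by auto
qed

lemma presented_MorE:
  assumes "f \<in> Mor (presented P)"
  obtains t where "f = cls P t" "wf_diag P t"
  using assms by (auto simp: presented_Mor)

lemma presented_HomI:
  "\<lbrakk>wf_diag P t; ddom P t = v; dcod P t = w\<rbrakk> \<Longrightarrow> cls P t \<in> Hom (presented P) v w"
  by (auto simp: presented_Hom diags_def)

text \<open>Once morphisms are replaced by classes of diagrams, each remaining axiom is either a
  closure property or one rule of \<open>deqv\<close> applied to well-typed diagrams.\<close>

theorem monoidal_category_presented: "monoidal_category (presented P)"
proof
  show "Dom (presented P) f \<in> Obj (presented P)" if "f \<in> Mor (presented P)" for f
    using that wf_diag_letters by (elim presented_MorE) (simp add: presented_Dom presented_ops)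
  show "Cod (presented P) f \<in> Obj (presented P)" if "f \<in> Mor (presented P)" for f
    using that wf_diag_letters by (elim presented_MorE) (simp add: presented_Cod presented_ops)
qed ((elim presented_HomE presented_MorE)?, (hypsubst)?,
     (simp add: presented_ops presented_HomI; fail |
      simp add: presented_ops, rule cls_eqI, rule deqv.intros, (simp add: diags_def)+; fail))+

end

section \<open>Rewriting calculus in linear and monoidal categories\<close>

context linear_category
begin

abbreviation idm ("\<i>") where "\<i> \<equiv> Ident C"
abbreviation cmp (infixr "\<star>" 70) where "g \<star> f \<equiv> Comp C g f"
abbreviation tns (infixr "\<otimes>\<^sub>c" 80) where "f \<otimes>\<^sub>c g \<equiv> TensM C f g"
abbreviation pls (infixl "\<oplus>\<^sub>c" 65) where "f \<oplus>\<^sub>c g \<equiv> Add C f g"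
abbreviation scl (infixr "\<odot>\<^sub>c" 75) where "z \<odot>\<^sub>c f \<equiv> Scale C z f"

lemma HomI: "\<lbrakk>f \<in> Mor C; Dom C f = a; Cod C f = b\<rbrakk> \<Longrightarrow> f \<in> Hom C a b"
  by (simp add: Hom_def)

lemma HomD:
  assumes "f \<in> Hom C a b"
  shows "f \<in> Mor C" "Dom C f = a" "Cod C f = b"
  using assms by (auto simp: Hom_def)

lemma Hom_Dom_Cod: "f \<in> Mor C \<Longrightarrow> f \<in> Hom C (Dom C f) (Cod C f)"
  by (simp add: Hom_def)

lemma Hom_Obj: "f \<in> Hom C a b \<Longrightarrow> a \<in> Obj C" "f \<in> Hom C a b \<Longrightarrow> b \<in> Obj C"
  using Dom_Obj Cod_Obj by (auto simp: Hom_def)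

lemma mor_Obj [simp]: "f \<in> Mor C \<Longrightarrow> Dom C f \<in> Obj C" "f \<in> Mor C \<Longrightarrow> Cod C f \<in> Obj C"
  using Dom_Obj Cod_Obj by auto

lemma mor_Ident [simp]:
  assumes "a \<in> Obj C"
  shows "\<i> a \<in> Mor C" "Dom C (\<i> a) = a" "Cod C (\<i> a) = a"
  using Ident_Hom [OF assms] by (auto simp: Hom_def)

lemma mor_Zero [simp]:
  assumes "a \<in> Obj C" "b \<in> Obj C"
  shows "Zero C a b \<in> Mor C" "Dom C (Zero C a b) = a" "Cod C (Zero C a b) = b"
  using Zero_Hom [OF assms] by (auto simp: Hom_def)

text \<open>Typing is split into membership, source and target, which the simplifier can compute for
  nested terms; with \<open>Hom\<close> it would have to guess intermediate objects.\<close>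

lemma mor_comp [simp]:
  assumes "g \<in> Mor C" "f \<in> Mor C" "Dom C g = Cod C f"
  shows "g \<star> f \<in> Mor C" "Dom C (g \<star> f) = Dom C f" "Cod C (g \<star> f) = Cod C g"
  using Comp_Hom [of f "Dom C f" "Cod C f" g "Cod C g"] assms by (auto simp: Hom_def)

lemma mor_add [simp]:
  assumes "g \<in> Mor C" "f \<in> Mor C" "Dom C g = Dom C f" "Cod C g = Cod C f"
  shows "g \<oplus>\<^sub>c f \<in> Mor C" "Dom C (g \<oplus>\<^sub>c f) = Dom C f" "Cod C (g \<oplus>\<^sub>c f) = Cod C f"
  using Add_Hom [of g "Dom C f" "Cod C f" f] assms by (auto simp: Hom_def)

lemma mor_scale [simp]:
  assumes "f \<in> Mor C"
  shows "z \<odot>\<^sub>c f \<in> Mor C" "Dom C (z \<odot>\<^sub>c f) = Dom C f" "Cod C (z \<odot>\<^sub>c f) = Cod C f"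
  using Scale_Hom [of f "Dom C f" "Cod C f" z] assms by (auto simp: Hom_def)

lemma assoc:
  assumes "f \<in> Mor C" "g \<in> Mor C" "h \<in> Mor C" "Dom C g = Cod C f" "Dom C h = Cod C g"
  shows "(h \<star> g) \<star> f = h \<star> g \<star> f"
  using Comp_assoc [of f "Dom C f" "Cod C f" g "Cod C g" h "Cod C h"] assms by (simp add: Hom_def)

lemma comp_ident [simp]:
  assumes "f \<in> Mor C"
  shows "Dom C f = a \<Longrightarrow> f \<star> \<i> a = f" "Cod C f = a \<Longrightarrow> \<i> a \<star> f = f"
    and "f \<star> \<i> (Dom C f) = f" "\<i> (Cod C f) \<star> f = f"
  using Comp_Ident_right Comp_Ident_left assms by (auto simp: Hom_def)

lemma comp_add_right:
  assumes "f \<in> Mor C" "g \<in> Mor C" "h \<in> Mor C" "Dom C f = Dom C g" "Cod C f = Cod C g" "Dom C h = Cod C g"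
  shows "h \<star> (f \<oplus>\<^sub>c g) = h \<star> f \<oplus>\<^sub>c h \<star> g"
  using Comp_Add_right [of f "Dom C g" "Cod C g" g h "Cod C h"] assms by (auto simp: Hom_def)

lemma comp_add_left:
  assumes "f \<in> Mor C" "g \<in> Mor C" "h \<in> Mor C" "Dom C f = Dom C g" "Cod C f = Cod C g" "Dom C g = Cod C h"
  shows "(f \<oplus>\<^sub>c g) \<star> h = f \<star> h \<oplus>\<^sub>c g \<star> h"
  using Comp_Add_left [of h "Dom C h" "Cod C h" f "Cod C g" g] assms by (auto simp: Hom_def)

lemma comp_scale [simp]:
  assumes "f \<in> Mor C" "g \<in> Mor C" "Dom C g = Cod C f"
  shows "g \<star> z \<odot>\<^sub>c f = z \<odot>\<^sub>c (g \<star> f)" "(z \<odot>\<^sub>c g) \<star> f = z \<odot>\<^sub>c (g \<star> f)"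
  using Comp_Scale_right [of f "Dom C f" "Cod C f" g "Cod C g"]
    Comp_Scale_left [of f "Dom C f" "Cod C f" g "Cod C g"] assms by (auto simp: Hom_def)

lemma scale_scale [simp]: "f \<in> Mor C \<Longrightarrow> z \<odot>\<^sub>c w \<odot>\<^sub>c f = (z * w) \<odot>\<^sub>c f"
  using Scale_Scale Hom_Dom_Cod by blast

lemma scale_one [simp]: "f \<in> Mor C \<Longrightarrow> 1 \<odot>\<^sub>c f = f"
  using Scale_one Hom_Dom_Cod by blast

lemma scale_add_left: "f \<in> Mor C \<Longrightarrow> (z + w) \<odot>\<^sub>c f = z \<odot>\<^sub>c f \<oplus>\<^sub>c w \<odot>\<^sub>c f"
  using Scale_add_left Hom_Dom_Cod by blast

lemma scale_add_right:
  assumes "f \<in> Mor C" "g \<in> Mor C" "Dom C f = Dom C g" "Cod C f = Cod C g"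
  shows "z \<odot>\<^sub>c (f \<oplus>\<^sub>c g) = z \<odot>\<^sub>c f \<oplus>\<^sub>c z \<odot>\<^sub>c g"
  using Scale_add_right [of f "Dom C f" "Cod C f" g] assms by (auto simp: Hom_def)

lemma add_assoc:
  assumes "f \<in> Mor C" "g \<in> Mor C" "h \<in> Mor C" "Dom C f = Dom C g" "Cod C f = Cod C g"
    "Dom C h = Dom C g" "Cod C h = Cod C g"
  shows "f \<oplus>\<^sub>c g \<oplus>\<^sub>c h = f \<oplus>\<^sub>c (g \<oplus>\<^sub>c h)"
  using Add_assoc [of f "Dom C g" "Cod C g" g h] assms by (auto simp: Hom_def)

lemma add_commute:
  assumes "f \<in> Mor C" "g \<in> Mor C" "Dom C f = Dom C g" "Cod C f = Cod C g"
  shows "f \<oplus>\<^sub>c g = g \<oplus>\<^sub>c f"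
  using Add_commute [of f "Dom C g" "Cod C g" g] assms by (auto simp: Hom_def)

lemma add_zero [simp]:
  assumes "f \<in> Mor C" "Dom C f = a" "Cod C f = b"
  shows "f \<oplus>\<^sub>c Zero C a b = f" "Zero C a b \<oplus>\<^sub>c f = f"
proof -
  have f: "f \<in> Hom C a b" and z: "Zero C a b \<in> Hom C a b"
    using assms by (auto simp: Hom_def)
  show "f \<oplus>\<^sub>c Zero C a b = f" using Add_Zero [OF f] .
  then show "Zero C a b \<oplus>\<^sub>c f = f" using Add_commute [OF f z] by simp
qed

lemma add_inverse: "f \<in> Mor C \<Longrightarrow> f \<oplus>\<^sub>c (-1) \<odot>\<^sub>c f = Zero C (Dom C f) (Cod C f)"
  using Add_inverse Hom_Dom_Cod by blast

lemma scale_zero_left: "f \<in> Mor C \<Longrightarrow> 0 \<odot>\<^sub>c f = Zero C (Dom C f) (Cod C f)"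
  using scale_add_left [of f 1 "-1"] add_inverse [of f] by simp

lemma add_cancel:
  assumes "f \<in> Mor C" "g \<in> Mor C" "h \<in> Mor C" "Dom C f = Dom C g" "Cod C f = Cod C g"
    "Dom C h = Dom C g" "Cod C h = Cod C g" "f \<oplus>\<^sub>c h = g \<oplus>\<^sub>c h"
  shows "f = g"
proof -
  have "f \<oplus>\<^sub>c h \<oplus>\<^sub>c (-1) \<odot>\<^sub>c h = g \<oplus>\<^sub>c h \<oplus>\<^sub>c (-1) \<odot>\<^sub>c h"
    using assms by simp
  then show ?thesis
    using assms(1-7) by (simp add: add_assoc add_inverse)
qed

lemma scale_Zero [simp]:
  assumes "a \<in> Obj C" "b \<in> Obj C"
  shows "z \<odot>\<^sub>c Zero C a b = Zero C a b"
proof -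
  have "z \<odot>\<^sub>c Zero C a b = z \<odot>\<^sub>c 0 \<odot>\<^sub>c Zero C a b"
    using scale_zero_left [of "Zero C a b"] assms by simp
  also have "\<dots> = 0 \<odot>\<^sub>c Zero C a b"
    using assms by (subst scale_scale) auto
  finally show ?thesis using scale_zero_left [of "Zero C a b"] assms by simp
qed

lemma comp_Zero [simp]:
  assumes "f \<in> Mor C"
  shows "a \<in> Obj C \<Longrightarrow> Dom C f = b \<Longrightarrow> f \<star> Zero C a b = Zero C a (Cod C f)"
    and "b \<in> Obj C \<Longrightarrow> Cod C f = a \<Longrightarrow> Zero C a b \<star> f = Zero C (Dom C f) b"
proof -
  show "f \<star> Zero C a b = Zero C a (Cod C f)" if "a \<in> Obj C" "Dom C f = b"
  proof -
    have b: "b \<in> Obj C" using assms that by auto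
    have "f \<star> Zero C a b = f \<star> 0 \<odot>\<^sub>c Zero C a b" using that b by simp
    also have "\<dots> = 0 \<odot>\<^sub>c (f \<star> Zero C a b)" using that b assms by (subst comp_scale) auto
    finally show ?thesis using that b assms by (simp add: scale_zero_left)
  qed
  show "Zero C a b \<star> f = Zero C (Dom C f) b" if "b \<in> Obj C" "Cod C f = a"
  proof -
    have b: "a \<in> Obj C" using assms that by auto
    have "Zero C a b \<star> f = (0 \<odot>\<^sub>c Zero C a b) \<star> f" using that b by simp
    also have "\<dots> = 0 \<odot>\<^sub>c (Zero C a b \<star> f)" using that b assms by (subst comp_scale) auto
    finally show ?thesis using that b assms by (simp add: scale_zero_left)
  qed
qed

lemma scale_cancel:
  assumes "z \<odot>\<^sub>c f = Zero C (Dom C f) (Cod C f)" "f \<in> Mor C" "z \<noteq> 0"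
  shows "f = Zero C (Dom C f) (Cod C f)"
proof -
  have "f = inverse z \<odot>\<^sub>c z \<odot>\<^sub>c f" using assms by (subst scale_scale) auto
  then show ?thesis using assms by (metis mor_Obj scale_Zero)
qed

lemma diff_eq_zero:
  assumes "f \<in> Mor C" "g \<in> Mor C" "Dom C f = Dom C g" "Cod C f = Cod C g"
    "f \<oplus>\<^sub>c (-1) \<odot>\<^sub>c g = Zero C (Dom C g) (Cod C g)"
  shows "f = g"
  by (rule add_cancel [of _ _ "(-1) \<odot>\<^sub>c g"]) (use assms in \<open>auto simp: add_inverse\<close>)

lemma is_isoE:
  assumes "is_iso C a b f"
  obtains g where "f \<in> Mor C" "Dom C f = a" "Cod C f = b" "g \<in> Mor C" "Dom C g = b" "Cod C g = a"
    "g \<star> f = \<i> a" "f \<star> g = \<i> b"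
  using assms unfolding Defs.is_iso_def by (auto simp: Hom_def)

lemma isomorphicI:
  assumes "f \<in> Hom C a b" "g \<in> Hom C b a" "g \<star> f = \<i> a" "f \<star> g = \<i> b"
  shows "isomorphic C a b"
  using assms unfolding isomorphic_def Defs.is_iso_def by blast

end

context monoidal_category
begin

lemma unit_Obj [simp]: "Unit C \<in> Obj C"
  by (rule Unit_Obj)

lemma tens_Obj [simp]: "\<lbrakk>a \<in> Obj C; b \<in> Obj C\<rbrakk> \<Longrightarrow> a \<boxtimes> b \<in> Obj C"
  by (rule TensO_Obj)

lemma tensO_simps [simp]:
  "a \<in> Obj C \<Longrightarrow> Unit C \<boxtimes> a = a"
  "a \<in> Obj C \<Longrightarrow> a \<boxtimes> Unit C = a"
  "\<lbrakk>a \<in> Obj C; b \<in> Obj C; c \<in> Obj C\<rbrakk> \<Longrightarrow> (a \<boxtimes> b) \<boxtimes> c = a \<boxtimes> b \<boxtimes> c"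
  by (simp_all add: TensO_Unit_left TensO_Unit_right TensO_assoc)

lemma mor_tens [simp]:
  assumes "g \<in> Mor C" "f \<in> Mor C"
  shows "g \<otimes>\<^sub>c f \<in> Mor C" "Dom C (g \<otimes>\<^sub>c f) = Dom C g \<boxtimes> Dom C f" "Cod C (g \<otimes>\<^sub>c f) = Cod C g \<boxtimes> Cod C f"
  using TensM_Hom [OF Hom_Dom_Cod Hom_Dom_Cod, OF assms] by (auto simp: Hom_def)

lemma tens_ident [simp]: "\<lbrakk>a \<in> Obj C; b \<in> Obj C\<rbrakk> \<Longrightarrow> \<i> a \<otimes>\<^sub>c \<i> b = \<i> (a \<boxtimes> b)"
  by (rule TensM_Ident)

lemma tens_unit [simp]:
  "f \<in> Mor C \<Longrightarrow> \<i> (Unit C) \<otimes>\<^sub>c f = f" "f \<in> Mor C \<Longrightarrow> f \<otimes>\<^sub>c \<i> (Unit C) = f"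
  by (simp_all add: TensM_Unit_left TensM_Unit_right)

lemma tens_assoc [simp]:
  "\<lbrakk>f \<in> Mor C; g \<in> Mor C; h \<in> Mor C\<rbrakk> \<Longrightarrow> (f \<otimes>\<^sub>c g) \<otimes>\<^sub>c h = f \<otimes>\<^sub>c g \<otimes>\<^sub>c h"
  by (rule TensM_assoc)

lemma tens_comp:
  assumes "f \<in> Mor C" "g \<in> Mor C" "f' \<in> Mor C" "g' \<in> Mor C" "Dom C g = Cod C f" "Dom C g' = Cod C f'"
  shows "(g \<otimes>\<^sub>c g') \<star> (f \<otimes>\<^sub>c f') = (g \<star> f) \<otimes>\<^sub>c (g' \<star> f')"
  using TensM_Comp [of f "Dom C f" "Cod C f" g "Cod C g" f' "Dom C f'" "Cod C f'" g' "Cod C g'"] assms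
  by (auto simp: Hom_def)

lemma tens_comp_left:
  assumes "f \<in> Mor C" "g \<in> Mor C" "Dom C g = Cod C f" "a \<in> Obj C"
  shows "(g \<star> f) \<otimes>\<^sub>c \<i> a = (g \<otimes>\<^sub>c \<i> a) \<star> (f \<otimes>\<^sub>c \<i> a)"
  using assms by (simp add: tens_comp)

lemma tens_comp_right:
  assumes "f \<in> Mor C" "g \<in> Mor C" "Dom C g = Cod C f" "a \<in> Obj C"
  shows "\<i> a \<otimes>\<^sub>c (g \<star> f) = (\<i> a \<otimes>\<^sub>c g) \<star> (\<i> a \<otimes>\<^sub>c f)"
  using assms by (simp add: tens_comp)

lemma tens_ident_assoc [simp]:
  "\<lbrakk>a \<in> Obj C; b \<in> Obj C; f \<in> Mor C\<rbrakk> \<Longrightarrow> \<i> (a \<boxtimes> b) \<otimes>\<^sub>c f = \<i> a \<otimes>\<^sub>c \<i> b \<otimes>\<^sub>c f"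
  by (simp flip: tens_ident)

text \<open>Two morphisms in disjoint regions may be slid past each other.\<close>

lemma slide:
  assumes "f \<in> Mor C" "g \<in> Mor C"
  shows "(f \<otimes>\<^sub>c \<i> (Cod C g)) \<star> (\<i> (Dom C f) \<otimes>\<^sub>c g) = f \<otimes>\<^sub>c g"
    "(\<i> (Cod C f) \<otimes>\<^sub>c g) \<star> (f \<otimes>\<^sub>c \<i> (Dom C g)) = f \<otimes>\<^sub>c g"
  using assms by (auto simp: tens_comp)

lemma tens_add_left:
  assumes "f \<in> Mor C" "g \<in> Mor C" "h \<in> Mor C" "Dom C f = Dom C g" "Cod C f = Cod C g"
  shows "(f \<oplus>\<^sub>c g) \<otimes>\<^sub>c h = f \<otimes>\<^sub>c h \<oplus>\<^sub>c g \<otimes>\<^sub>c h"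
  using TensM_Add_left [of f "Dom C g" "Cod C g" g h] assms by (auto simp: Hom_def)

lemma tens_add_right:
  assumes "f \<in> Mor C" "g \<in> Mor C" "h \<in> Mor C" "Dom C f = Dom C g" "Cod C f = Cod C g"
  shows "h \<otimes>\<^sub>c (f \<oplus>\<^sub>c g) = h \<otimes>\<^sub>c f \<oplus>\<^sub>c h \<otimes>\<^sub>c g"
  using TensM_Add_right [of f "Dom C g" "Cod C g" g h] assms by (auto simp: Hom_def)

lemma tens_scale [simp]:
  "\<lbrakk>f \<in> Mor C; g \<in> Mor C\<rbrakk> \<Longrightarrow> (z \<odot>\<^sub>c f) \<otimes>\<^sub>c g = z \<odot>\<^sub>c (f \<otimes>\<^sub>c g)"
  "\<lbrakk>f \<in> Mor C; g \<in> Mor C\<rbrakk> \<Longrightarrow> f \<otimes>\<^sub>c (z \<odot>\<^sub>c g) = z \<odot>\<^sub>c (f \<otimes>\<^sub>c g)"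
  by (simp_all add: TensM_Scale_left TensM_Scale_right)

lemma tens_Zero:
  assumes "f \<in> Mor C" "a \<in> Obj C" "b \<in> Obj C"
  shows "Zero C a b \<otimes>\<^sub>c f = Zero C (a \<boxtimes> Dom C f) (b \<boxtimes> Cod C f)"
    "f \<otimes>\<^sub>c Zero C a b = Zero C (Dom C f \<boxtimes> a) (Cod C f \<boxtimes> b)"
proof -
  have "0 \<odot>\<^sub>c (Zero C a b \<otimes>\<^sub>c f) = (0 \<odot>\<^sub>c Zero C a b) \<otimes>\<^sub>c f"
    using assms by (subst tens_scale) auto
  then show "Zero C a b \<otimes>\<^sub>c f = Zero C (a \<boxtimes> Dom C f) (b \<boxtimes> Cod C f)"
    using assms by (simp add: scale_zero_left)
  have "0 \<odot>\<^sub>c (f \<otimes>\<^sub>c Zero C a b) = f \<otimes>\<^sub>c (0 \<odot>\<^sub>c Zero C a b)"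
    using assms by (subst tens_scale) auto
  then show "f \<otimes>\<^sub>c Zero C a b = Zero C (Dom C f \<boxtimes> a) (Cod C f \<boxtimes> b)"
    using assms by (simp add: scale_zero_left)
qed

end

section \<open>Temperley-Lieb calculus on four strands\<close>

context linear_category
begin

text \<open>On four strands, \<open>e1\<close>, \<open>e2\<close>, \<open>e3\<close> are the
  Temperley-Lieb generators, \<open>a\<close> and \<open>b\<close> the second Jones-Wenzl idempotent
  on the first and last two strands, and \<open>g\<close> the third one on the first three. The
  second equation for \<open>g\<close> says that the fourth idempotent vanishes. The claim results
  from evaluating \<open>b g b\<close> by both equations: in the second, only the part of
  \<open>g\<close> containing \<open>e2\<close> survives next to \<open>e3\<close>, because
  \<open>b\<close> kills \<open>e3\<close>.\<close>

lemma jones_wenzl_algebra: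
  fixes t :: complex
  assumes x: "x \<in> Obj C"
    and H: "e1 \<in> Hom C x x" "e2 \<in> Hom C x x" "e3 \<in> Hom C x x" "a \<in> Hom C x x" "b \<in> Hom C x x"
    and a: "a = \<i> x \<oplus>\<^sub>c (- (1/t)) \<odot>\<^sub>c e1"
    and ab: "a \<star> b = b \<star> a" "a \<star> a = a" "b \<star> b = b" "b \<star> e3 = Zero C x x" "e3 \<star> b = Zero C x x"
    and ae: "a \<star> e3 = e3 \<star> a" "e3 \<star> e3 = t \<odot>\<^sub>c e3" "e2 \<star> e3 \<star> e2 = e2"
    and g: "g = a \<oplus>\<^sub>c (-1) \<odot>\<^sub>c (a \<star> e2 \<star> a)" "g = t \<odot>\<^sub>c (g \<star> e3 \<star> g)"
    and t: "t \<noteq> 0"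
  defines "F \<equiv> a \<star> b"
  shows "F = (1 + t) \<odot>\<^sub>c (F \<star> e2 \<star> F) \<oplus>\<^sub>c (-1) \<odot>\<^sub>c (F \<star> e2 \<star> e1 \<star> e3 \<star> e2 \<star> F)"
proof -
  note m [simp] = HomD [OF H(1)] HomD [OF H(2)] HomD [OF H(3)] HomD [OF H(4)] HomD [OF H(5)]
  have F [simp]: "F \<in> Mor C" "Dom C F = x" "Cod C F = x"
    unfolding F_def by simp_all
  have gm [simp]: "g \<in> Mor C" "Dom C g = x" "Cod C g = x"
    unfolding g(1) by simp_all
  have bae: "b \<star> a \<star> e3 = Zero C x x"
    using assoc [of e3 a b] assoc [of e3 b a] ab x by simp
  have eab: "e3 \<star> a \<star> b = Zero C x x"
    using assoc [of b a e3] assoc [of a b e3] assoc [of b e3 a] ab ae x by simp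
  have Fa: "b \<star> a = F" "a \<star> b = F" by (simp_all add: F_def ab)
  have bge: "b \<star> g \<star> e3 = (-1) \<odot>\<^sub>c (F \<star> e2 \<star> a \<star> e3)"
  proof -
    have "b \<star> g \<star> e3 = b \<star> a \<star> e3 \<oplus>\<^sub>c (-1) \<odot>\<^sub>c (b \<star> a \<star> e2 \<star> a \<star> e3)"
      unfolding g(1) using x by (simp add: comp_add_left comp_add_right assoc)
    also have "b \<star> a \<star> e2 \<star> a \<star> e3 = F \<star> e2 \<star> a \<star> e3"
      by (simp add: Fa(1)[symmetric] assoc)
    finally show ?thesis using bae x by simp
  qed
  have egb: "e3 \<star> g \<star> b = (-1) \<odot>\<^sub>c (e3 \<star> a \<star> e2 \<star> F)"
    unfolding g(1) using x eab by (simp add: comp_add_left comp_add_right assoc Fa)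
  have "b \<star> g \<star> b = F \<oplus>\<^sub>c (-1) \<odot>\<^sub>c (F \<star> e2 \<star> F)"
  proof -
    have "b \<star> g \<star> b = b \<star> F \<oplus>\<^sub>c (-1) \<odot>\<^sub>c (b \<star> a \<star> e2 \<star> F)"
      unfolding g(1) using x by (simp add: comp_add_left comp_add_right assoc Fa)
    also have "b \<star> F = F"
      using assoc [of a b b] by (simp add: Fa(1)[symmetric] ab)
    also have "b \<star> a \<star> e2 \<star> F = F \<star> e2 \<star> F"
      by (simp add: Fa(1)[symmetric] assoc)
    finally show ?thesis .
  qed
  moreover have "b \<star> g \<star> b = t \<odot>\<^sub>c (F \<star> e2 \<star> a \<star> e3 \<star> a \<star> e2 \<star> F)"
  proof -
    have "b \<star> g \<star> b = t \<odot>\<^sub>c (b \<star> g \<star> e3 \<star> g \<star> b)"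
      by (subst g(2)) (simp add: assoc)
    \<comment> \<open>Doubling \<open>e3\<close> allows the product to be cut into
      \<open>b g e3\<close> and \<open>e3 g b\<close>, each of which is already computed.\<close>
    also have "e3 \<star> g \<star> b = (1/t) \<odot>\<^sub>c (e3 \<star> e3 \<star> g \<star> b)"
    proof -
      have "t \<odot>\<^sub>c (e3 \<star> g \<star> b) = e3 \<star> e3 \<star> g \<star> b"
        using assoc [of "g \<star> b" e3 e3] ae(2) by simp
      then have "(1/t) \<odot>\<^sub>c t \<odot>\<^sub>c (e3 \<star> g \<star> b) = (1/t) \<odot>\<^sub>c (e3 \<star> e3 \<star> g \<star> b)"
        by simp
      then show ?thesis using t by simp
    qed
    also have "t \<odot>\<^sub>c (b \<star> g \<star> (1/t) \<odot>\<^sub>c (e3 \<star> e3 \<star> g \<star> b)) = (b \<star> g \<star> e3) \<star> (e3 \<star> g \<star> b)"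
      using t by (simp add: assoc)
    also have "\<dots> = F \<star> e2 \<star> a \<star> (e3 \<star> e3) \<star> a \<star> e2 \<star> F"
      unfolding bge egb by (simp add: assoc)
    also have "\<dots> = t \<odot>\<^sub>c (F \<star> e2 \<star> a \<star> e3 \<star> a \<star> e2 \<star> F)"
      unfolding ae(2) by simp
    finally show ?thesis .
  qed
  moreover have "F \<star> e2 \<star> a \<star> e3 \<star> a \<star> e2 \<star> F =
    F \<star> e2 \<star> F \<oplus>\<^sub>c (- (1/t)) \<odot>\<^sub>c (F \<star> e2 \<star> e1 \<star> e3 \<star> e2 \<star> F)"
  proof -
    \<comment> \<open>\<open>a\<close> commutes with \<open>e3\<close> and is idempotent, so one
      copy of it disappears and the other is expanded.\<close>
    have aea: "a \<star> e3 \<star> a = e3 \<oplus>\<^sub>c (- (1/t)) \<odot>\<^sub>c (e1 \<star> e3)"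
    proof -
      have "a \<star> e3 \<star> a = (a \<star> a) \<star> e3"
        using assoc [of e3 a a] ae(1) by simp
      also have "\<dots> = a \<star> e3" by (simp add: ab)
      also have "\<dots> = e3 \<oplus>\<^sub>c (- (1/t)) \<odot>\<^sub>c (e1 \<star> e3)"
        unfolding a using x by (simp add: comp_add_left)
      finally show ?thesis .
    qed
    have "F \<star> e2 \<star> a \<star> e3 \<star> a \<star> e2 \<star> F = F \<star> e2 \<star> (a \<star> e3 \<star> a) \<star> e2 \<star> F"
      by (simp add: assoc)
    also have "\<dots> = F \<star> (e2 \<star> e3 \<star> e2) \<star> F
        \<oplus>\<^sub>c (- (1/t)) \<odot>\<^sub>c (F \<star> e2 \<star> e1 \<star> e3 \<star> e2 \<star> F)"
      unfolding aea by (simp add: comp_add_left comp_add_right assoc)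
    finally show ?thesis by (simp add: ae)
  qed
  ultimately have "F \<oplus>\<^sub>c (-1) \<odot>\<^sub>c (F \<star> e2 \<star> F) =
      t \<odot>\<^sub>c (F \<star> e2 \<star> F) \<oplus>\<^sub>c (-1) \<odot>\<^sub>c (F \<star> e2 \<star> e1 \<star> e3 \<star> e2 \<star> F)"
    using t by (simp add: scale_add_right)
  then have "F \<star> e2 \<star> F \<oplus>\<^sub>c (F \<oplus>\<^sub>c (-1) \<odot>\<^sub>c (F \<star> e2 \<star> F)) = F \<star> e2 \<star> F \<oplus>\<^sub>c
      (t \<odot>\<^sub>c (F \<star> e2 \<star> F) \<oplus>\<^sub>c (-1) \<odot>\<^sub>c (F \<star> e2 \<star> e1 \<star> e3 \<star> e2 \<star> F))"
    by simp
  moreover have "F \<star> e2 \<star> F \<oplus>\<^sub>c (F \<oplus>\<^sub>c (-1) \<odot>\<^sub>c (F \<star> e2 \<star> F)) = F"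
    by (subst add_commute) (auto simp: add_assoc add_commute [of "(-1) \<odot>\<^sub>c (F \<star> e2 \<star> F)"] add_inverse)
  ultimately show ?thesis
    by (simp add: scale_add_left add_assoc)
qed

end

locale temperley_lieb = monoidal_category C for C :: "('o, 'm) pcat" (structure) +
  fixes s :: 'o and cup cap :: 'm and t :: complex
  assumes s [simp]: "s \<in> Obj C"
    and cup_Hom: "cup \<in> Hom C (Unit C) (s \<boxtimes> s)"
    and cap_Hom: "cap \<in> Hom C (s \<boxtimes> s) (Unit C)"
    and zigzag_left: "(cap \<otimes>\<^sub>c \<i> s) \<star> (\<i> s \<otimes>\<^sub>c cup) = \<i> s"
    and zigzag_right: "(\<i> s \<otimes>\<^sub>c cap) \<star> (cup \<otimes>\<^sub>c \<i> s) = \<i> s"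
    and loop: "cap \<star> cup = t \<odot>\<^sub>c \<i> (Unit C)"
    and golden: "t * t = t + 1"
begin

lemma cup_cap [simp]:
  "cup \<in> Mor C" "Dom C cup = Unit C" "Cod C cup = s \<boxtimes> s"
  "cap \<in> Mor C" "Dom C cap = s \<boxtimes> s" "Cod C cap = Unit C"
  using HomD [OF cup_Hom] HomD [OF cap_Hom] by simp_all

lemma t_nonzero: "t \<noteq> 0"
  using golden by auto

text \<open>\<open>f\<close> is the second Jones-Wenzl idempotent, whose image is the nontrivial
  Fibonacci object, and \<open>F\<close> is the identity of its square. \<open>p\<close> and
  \<open>p'\<close> contract and create the two inner of four strands; \<open>q\<close> and
  \<open>q'\<close> are nested arcs, the cap and cup of the doubled strand.\<close>

definition e where "e = cup \<star> cap"
definition f where "f = \<i> (s \<boxtimes> s) \<oplus>\<^sub>c (- (1/t)) \<odot>\<^sub>c e"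
definition p where "p = \<i> s \<otimes>\<^sub>c cap \<otimes>\<^sub>c \<i> s"
definition p' where "p' = \<i> s \<otimes>\<^sub>c cup \<otimes>\<^sub>c \<i> s"
definition q where "q = cap \<star> p"
definition q' where "q' = p' \<star> cup"
definition F where "F = f \<otimes>\<^sub>c f"

lemma mor_tl [simp]:
  "e \<in> Mor C" "Dom C e = s \<boxtimes> s" "Cod C e = s \<boxtimes> s"
  "f \<in> Mor C" "Dom C f = s \<boxtimes> s" "Cod C f = s \<boxtimes> s"
  "p \<in> Mor C" "Dom C p = s \<boxtimes> s \<boxtimes> s \<boxtimes> s" "Cod C p = s \<boxtimes> s"
  "p' \<in> Mor C" "Dom C p' = s \<boxtimes> s" "Cod C p' = s \<boxtimes> s \<boxtimes> s \<boxtimes> s"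
  "q \<in> Mor C" "Dom C q = s \<boxtimes> s \<boxtimes> s \<boxtimes> s" "Cod C q = Unit C"
  "q' \<in> Mor C" "Dom C q' = Unit C" "Cod C q' = s \<boxtimes> s \<boxtimes> s \<boxtimes> s"
  "F \<in> Mor C" "Dom C F = s \<boxtimes> s \<boxtimes> s \<boxtimes> s" "Cod C F = s \<boxtimes> s \<boxtimes> s \<boxtimes> s"
  by (simp_all add: e_def f_def p_def p'_def q_def q'_def F_def)

lemma cap_e: "cap \<star> e = t \<odot>\<^sub>c cap" and e_cup: "e \<star> cup = t \<odot>\<^sub>c cup"
  and e_e: "e \<star> e = t \<odot>\<^sub>c e"
proof -
  show 1: "cap \<star> e = t \<odot>\<^sub>c cap"
    using assoc [of cap cup cap] by (simp add: e_def loop)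
  show "e \<star> cup = t \<odot>\<^sub>c cup"
    by (simp add: e_def loop assoc)
  show "e \<star> e = t \<odot>\<^sub>c e"
    using 1 by (simp add: e_def assoc)
qed

lemma cap_f: "cap \<star> f = Zero C (s \<boxtimes> s) (Unit C)" and f_cup: "f \<star> cup = Zero C (Unit C) (s \<boxtimes> s)"
  using t_nonzero by (simp_all add: f_def comp_add_left comp_add_right cap_e e_cup add_inverse)

lemma e_f: "e \<star> f = Zero C (s \<boxtimes> s) (s \<boxtimes> s)" and f_e: "f \<star> e = Zero C (s \<boxtimes> s) (s \<boxtimes> s)"
  using assoc [of f cap cup] assoc [of cap cup f] by (simp_all add: e_def cap_f f_cup)

lemma f_f: "f \<star> f = f"
proof -
  have "f \<star> f = f \<oplus>\<^sub>c (- (1/t)) \<odot>\<^sub>c (e \<star> f)"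
    by (subst f_def) (simp add: comp_add_left)
  then show ?thesis by (simp add: e_f)
qed

lemma p_cup:
  "p \<star> (cup \<otimes>\<^sub>c \<i> (s \<boxtimes> s)) = \<i> (s \<boxtimes> s)"
  "p \<star> (\<i> s \<otimes>\<^sub>c \<i> s \<otimes>\<^sub>c cup) = \<i> (s \<boxtimes> s)"
  "(cap \<otimes>\<^sub>c \<i> (s \<boxtimes> s)) \<star> p' = \<i> (s \<boxtimes> s)"
  "(\<i> s \<otimes>\<^sub>c \<i> s \<otimes>\<^sub>c cap) \<star> p' = \<i> (s \<boxtimes> s)"
proof -
  have "p \<star> (cup \<otimes>\<^sub>c \<i> (s \<boxtimes> s)) = ((\<i> s \<otimes>\<^sub>c cap) \<star> (cup \<otimes>\<^sub>c \<i> s)) \<otimes>\<^sub>c \<i> s"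
    by (subst tens_comp_left) (auto simp: p_def)
  then show "p \<star> (cup \<otimes>\<^sub>c \<i> (s \<boxtimes> s)) = \<i> (s \<boxtimes> s)" by (simp add: zigzag_right)
  have "p \<star> (\<i> s \<otimes>\<^sub>c \<i> s \<otimes>\<^sub>c cup) = \<i> s \<otimes>\<^sub>c ((cap \<otimes>\<^sub>c \<i> s) \<star> (\<i> s \<otimes>\<^sub>c cup))"
    by (subst tens_comp_right) (auto simp: p_def)
  then show "p \<star> (\<i> s \<otimes>\<^sub>c \<i> s \<otimes>\<^sub>c cup) = \<i> (s \<boxtimes> s)" by (simp add: zigzag_left)
  have "(cap \<otimes>\<^sub>c \<i> (s \<boxtimes> s)) \<star> p' = ((cap \<otimes>\<^sub>c \<i> s) \<star> (\<i> s \<otimes>\<^sub>c cup)) \<otimes>\<^sub>c \<i> s"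
    by (subst tens_comp_left) (auto simp: p'_def)
  then show "(cap \<otimes>\<^sub>c \<i> (s \<boxtimes> s)) \<star> p' = \<i> (s \<boxtimes> s)" by (simp add: zigzag_left)
  have "(\<i> s \<otimes>\<^sub>c \<i> s \<otimes>\<^sub>c cap) \<star> p' = \<i> s \<otimes>\<^sub>c ((\<i> s \<otimes>\<^sub>c cap) \<star> (cup \<otimes>\<^sub>c \<i> s))"
    by (subst tens_comp_right) (auto simp: p'_def)
  then show "(\<i> s \<otimes>\<^sub>c \<i> s \<otimes>\<^sub>c cap) \<star> p' = \<i> (s \<boxtimes> s)" by (simp add: zigzag_right)
qed

lemma p_p': "p \<star> p' = t \<odot>\<^sub>c \<i> (s \<boxtimes> s)"
proof -
  have "p \<star> p' = \<i> s \<otimes>\<^sub>c (cap \<star> cup) \<otimes>\<^sub>c \<i> s"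
    by (simp add: p_def p'_def tens_comp)
  then show ?thesis by (simp add: loop)
qed

lemma q_cup:
  "q \<star> (cup \<otimes>\<^sub>c \<i> (s \<boxtimes> s)) = cap" "q \<star> (\<i> s \<otimes>\<^sub>c \<i> s \<otimes>\<^sub>c cup) = cap"
  "(cap \<otimes>\<^sub>c \<i> (s \<boxtimes> s)) \<star> q' = cup" "(\<i> s \<otimes>\<^sub>c \<i> s \<otimes>\<^sub>c cap) \<star> q' = cup"
proof -
  show "q \<star> (cup \<otimes>\<^sub>c \<i> (s \<boxtimes> s)) = cap" "q \<star> (\<i> s \<otimes>\<^sub>c \<i> s \<otimes>\<^sub>c cup) = cap"
    by (simp_all add: q_def assoc p_cup)
  have "(cap \<otimes>\<^sub>c \<i> (s \<boxtimes> s)) \<star> q' = ((cap \<otimes>\<^sub>c \<i> (s \<boxtimes> s)) \<star> p') \<star> cup"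
    by (simp add: q'_def assoc)
  then show "(cap \<otimes>\<^sub>c \<i> (s \<boxtimes> s)) \<star> q' = cup" by (simp add: p_cup)
  have "(\<i> s \<otimes>\<^sub>c \<i> s \<otimes>\<^sub>c cap) \<star> q' = ((\<i> s \<otimes>\<^sub>c \<i> s \<otimes>\<^sub>c cap) \<star> p') \<star> cup"
    by (simp add: q'_def assoc)
  then show "(\<i> s \<otimes>\<^sub>c \<i> s \<otimes>\<^sub>c cap) \<star> q' = cup" by (simp add: p_cup)
qed

lemma e_whisker:
  "e \<otimes>\<^sub>c \<i> (s \<boxtimes> s) = (cup \<otimes>\<^sub>c \<i> (s \<boxtimes> s)) \<star> (cap \<otimes>\<^sub>c \<i> (s \<boxtimes> s))"
  "\<i> s \<otimes>\<^sub>c \<i> s \<otimes>\<^sub>c e = (\<i> s \<otimes>\<^sub>c \<i> s \<otimes>\<^sub>c cup) \<star> (\<i> s \<otimes>\<^sub>c \<i> s \<otimes>\<^sub>c cap)"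
  by (simp_all add: e_def tens_comp)

lemma q_e:
  "q \<star> (e \<otimes>\<^sub>c \<i> (s \<boxtimes> s)) = cap \<otimes>\<^sub>c cap" "q \<star> (\<i> s \<otimes>\<^sub>c \<i> s \<otimes>\<^sub>c e) = cap \<otimes>\<^sub>c cap"
  "(e \<otimes>\<^sub>c \<i> (s \<boxtimes> s)) \<star> q' = cup \<otimes>\<^sub>c cup" "(\<i> s \<otimes>\<^sub>c \<i> s \<otimes>\<^sub>c e) \<star> q' = cup \<otimes>\<^sub>c cup"
proof -
  have "q \<star> (e \<otimes>\<^sub>c \<i> (s \<boxtimes> s)) = (q \<star> (cup \<otimes>\<^sub>c \<i> (s \<boxtimes> s))) \<star> (cap \<otimes>\<^sub>c \<i> (s \<boxtimes> s))"
    by (simp add: e_whisker assoc)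
  then show "q \<star> (e \<otimes>\<^sub>c \<i> (s \<boxtimes> s)) = cap \<otimes>\<^sub>c cap"
    using slide(2) [of cap cap] by (simp add: q_cup)
  have "q \<star> (\<i> s \<otimes>\<^sub>c \<i> s \<otimes>\<^sub>c e) = (q \<star> (\<i> s \<otimes>\<^sub>c \<i> s \<otimes>\<^sub>c cup)) \<star> (\<i> s \<otimes>\<^sub>c \<i> s \<otimes>\<^sub>c cap)"
    by (simp add: e_whisker assoc)
  then show "q \<star> (\<i> s \<otimes>\<^sub>c \<i> s \<otimes>\<^sub>c e) = cap \<otimes>\<^sub>c cap"
    using slide(1) [of cap cap] by (simp add: q_cup)
  have "(e \<otimes>\<^sub>c \<i> (s \<boxtimes> s)) \<star> q' = (cup \<otimes>\<^sub>c \<i> (s \<boxtimes> s)) \<star> ((cap \<otimes>\<^sub>c \<i> (s \<boxtimes> s)) \<star> q')"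
    by (simp add: e_whisker assoc)
  then show "(e \<otimes>\<^sub>c \<i> (s \<boxtimes> s)) \<star> q' = cup \<otimes>\<^sub>c cup"
    using slide(1) [of cup cup] by (simp add: q_cup)
  have "(\<i> s \<otimes>\<^sub>c \<i> s \<otimes>\<^sub>c e) \<star> q' = (\<i> s \<otimes>\<^sub>c \<i> s \<otimes>\<^sub>c cup) \<star> ((\<i> s \<otimes>\<^sub>c \<i> s \<otimes>\<^sub>c cap) \<star> q')"
    by (simp add: e_whisker assoc)
  then show "(\<i> s \<otimes>\<^sub>c \<i> s \<otimes>\<^sub>c e) \<star> q' = cup \<otimes>\<^sub>c cup"
    using slide(2) [of cup cup] by (simp add: q_cup)
qed

lemma f_whisker:
  "f \<otimes>\<^sub>c \<i> (s \<boxtimes> s) = \<i> (s \<boxtimes> s \<boxtimes> s \<boxtimes> s) \<oplus>\<^sub>c (- (1/t)) \<odot>\<^sub>c (e \<otimes>\<^sub>c \<i> (s \<boxtimes> s))"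
  "\<i> s \<otimes>\<^sub>c \<i> s \<otimes>\<^sub>c f = \<i> (s \<boxtimes> s \<boxtimes> s \<boxtimes> s) \<oplus>\<^sub>c (- (1/t)) \<odot>\<^sub>c (\<i> s \<otimes>\<^sub>c \<i> s \<otimes>\<^sub>c e)"
  by (simp_all add: f_def tens_add_left tens_add_right)

text \<open>Moving \<open>e\<close> from one end of a doubled arc to the other gives the same pair
  of caps or cups, so \<open>f\<close> can travel along the arc too.\<close>

lemma q_f:
  "q \<star> (f \<otimes>\<^sub>c \<i> (s \<boxtimes> s)) = q \<star> (\<i> s \<otimes>\<^sub>c \<i> s \<otimes>\<^sub>c f)"
  "(f \<otimes>\<^sub>c \<i> (s \<boxtimes> s)) \<star> q' = (\<i> s \<otimes>\<^sub>c \<i> s \<otimes>\<^sub>c f) \<star> q'"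
  by (simp_all add: f_whisker comp_add_left comp_add_right q_e)

lemma F_factor:
  "F = (f \<otimes>\<^sub>c \<i> (s \<boxtimes> s)) \<star> (\<i> s \<otimes>\<^sub>c \<i> s \<otimes>\<^sub>c f)"
  "F = (\<i> s \<otimes>\<^sub>c \<i> s \<otimes>\<^sub>c f) \<star> (f \<otimes>\<^sub>c \<i> (s \<boxtimes> s))"
  using slide [of f f] by (simp_all add: F_def)

lemma ff_whisker:
  "(f \<otimes>\<^sub>c \<i> (s \<boxtimes> s)) \<star> (f \<otimes>\<^sub>c \<i> (s \<boxtimes> s)) = f \<otimes>\<^sub>c \<i> (s \<boxtimes> s)"
  "(\<i> s \<otimes>\<^sub>c \<i> s \<otimes>\<^sub>c f) \<star> (\<i> s \<otimes>\<^sub>c \<i> s \<otimes>\<^sub>c f) = \<i> s \<otimes>\<^sub>c \<i> s \<otimes>\<^sub>c f"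
  by (simp_all add: tens_comp f_f)

lemma F_F: "F \<star> F = F"
  by (simp add: F_def tens_comp f_f)

text \<open>One of the two copies of \<open>f\<close> in \<open>F\<close> travels along the nested
  arc and is absorbed by the other.\<close>

lemma qF: "q \<star> F = q \<star> (\<i> s \<otimes>\<^sub>c \<i> s \<otimes>\<^sub>c f)"
  and Fq: "F \<star> q' = (f \<otimes>\<^sub>c \<i> (s \<boxtimes> s)) \<star> q'"
proof -
  have "q \<star> F = (q \<star> (f \<otimes>\<^sub>c \<i> (s \<boxtimes> s))) \<star> (\<i> s \<otimes>\<^sub>c \<i> s \<otimes>\<^sub>c f)"
    by (simp add: F_factor(1) assoc)
  also have "\<dots> = q \<star> (\<i> s \<otimes>\<^sub>c \<i> s \<otimes>\<^sub>c f) \<star> (\<i> s \<otimes>\<^sub>c \<i> s \<otimes>\<^sub>c f)"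
    unfolding q_f by (simp add: assoc)
  finally show "q \<star> F = q \<star> (\<i> s \<otimes>\<^sub>c \<i> s \<otimes>\<^sub>c f)" by (simp add: ff_whisker)
  have "F \<star> q' = (f \<otimes>\<^sub>c \<i> (s \<boxtimes> s)) \<star> (\<i> s \<otimes>\<^sub>c \<i> s \<otimes>\<^sub>c f) \<star> q'"
    by (simp add: F_factor(1) assoc)
  also have "\<dots> = ((f \<otimes>\<^sub>c \<i> (s \<boxtimes> s)) \<star> (f \<otimes>\<^sub>c \<i> (s \<boxtimes> s))) \<star> q'"
    by (simp add: q_f assoc)
  finally show "F \<star> q' = (f \<otimes>\<^sub>c \<i> (s \<boxtimes> s)) \<star> q'" by (simp add: ff_whisker)
qed

lemma q_q': "q \<star> q' = (t * t) \<odot>\<^sub>c \<i> (Unit C)"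
proof -
  have "q \<star> q' = cap \<star> (p \<star> p') \<star> cup"
    by (simp add: q_def q'_def assoc)
  then show ?thesis by (simp add: p_p' loop)
qed

text \<open>The loop value of the doubled strand: two free loops give \<open>t * t\<close>, and the
  correction in \<open>f\<close> subtracts 1.\<close>

lemma qFq: "q \<star> F \<star> q' = t \<odot>\<^sub>c \<i> (Unit C)"
proof -
  have "q \<star> F \<star> q' = (q \<star> F) \<star> q'" by (simp add: assoc)
  also have "\<dots> = q \<star> q' \<oplus>\<^sub>c (- (1/t)) \<odot>\<^sub>c (q \<star> (\<i> s \<otimes>\<^sub>c \<i> s \<otimes>\<^sub>c e) \<star> q')"
    unfolding qF f_whisker by (simp add: comp_add_left comp_add_right assoc)
  also have "q \<star> (\<i> s \<otimes>\<^sub>c \<i> s \<otimes>\<^sub>c e) \<star> q' =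
    (q \<star> (\<i> s \<otimes>\<^sub>c \<i> s \<otimes>\<^sub>c cup)) \<star> ((\<i> s \<otimes>\<^sub>c \<i> s \<otimes>\<^sub>c cap) \<star> q')"
    by (simp add: e_whisker assoc)
  also have "q \<star> q' \<oplus>\<^sub>c (- (1/t)) \<odot>\<^sub>c \<dots> = (t * t + (- (1/t)) * t) \<odot>\<^sub>c \<i> (Unit C)"
    unfolding q_cup q_q' loop using t_nonzero by (simp flip: scale_add_left)
  also have "t * t + (- (1/t)) * t = t" using t_nonzero by (simp add: golden)
  finally show ?thesis .
qed

text \<open>Fixes the normalisation of the trivalent vertex \<open>f p F\<close>. Of the four terms
  of \<open>F\<close>, three give multiples of the identity with sum \<open>t - 2/t\<close>; the
  fourth gives \<open>e\<close>, which \<open>f\<close> kills.\<close>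

lemma fpFpf: "f \<star> p \<star> F \<star> p' \<star> f = (1 / (t * t)) \<odot>\<^sub>c f"
proof -
  have pe: "p \<star> (e \<otimes>\<^sub>c \<i> (s \<boxtimes> s)) \<star> p' = \<i> (s \<boxtimes> s)" "p \<star> (\<i> s \<otimes>\<^sub>c \<i> s \<otimes>\<^sub>c e) \<star> p' = \<i> (s \<boxtimes> s)"
  proof -
    have "p \<star> (e \<otimes>\<^sub>c \<i> (s \<boxtimes> s)) \<star> p' = (p \<star> (cup \<otimes>\<^sub>c \<i> (s \<boxtimes> s))) \<star> ((cap \<otimes>\<^sub>c \<i> (s \<boxtimes> s)) \<star> p')"
      by (simp add: e_whisker assoc)
    then show "p \<star> (e \<otimes>\<^sub>c \<i> (s \<boxtimes> s)) \<star> p' = \<i> (s \<boxtimes> s)" by (simp add: p_cup)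
    have "p \<star> (\<i> s \<otimes>\<^sub>c \<i> s \<otimes>\<^sub>c e) \<star> p' =
      (p \<star> (\<i> s \<otimes>\<^sub>c \<i> s \<otimes>\<^sub>c cup)) \<star> ((\<i> s \<otimes>\<^sub>c \<i> s \<otimes>\<^sub>c cap) \<star> p')"
      by (simp add: e_whisker assoc)
    then show "p \<star> (\<i> s \<otimes>\<^sub>c \<i> s \<otimes>\<^sub>c e) \<star> p' = \<i> (s \<boxtimes> s)" by (simp add: p_cup)
  qed
  have pee: "p \<star> (e \<otimes>\<^sub>c e) \<star> p' = e"
  proof -
    have "e \<otimes>\<^sub>c e = (e \<otimes>\<^sub>c \<i> (s \<boxtimes> s)) \<star> (\<i> s \<otimes>\<^sub>c \<i> s \<otimes>\<^sub>c e)"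
      using slide(1) [of e e] by simp
    then have "p \<star> (e \<otimes>\<^sub>c e) \<star> p' = (p \<star> (cup \<otimes>\<^sub>c \<i> (s \<boxtimes> s))) \<star>
      ((cap \<otimes>\<^sub>c \<i> (s \<boxtimes> s)) \<star> (\<i> s \<otimes>\<^sub>c \<i> s \<otimes>\<^sub>c cup)) \<star> ((\<i> s \<otimes>\<^sub>c \<i> s \<otimes>\<^sub>c cap) \<star> p')"
      by (simp add: e_whisker assoc)
    also have "\<dots> = cap \<otimes>\<^sub>c cup"
      using slide(1) [of cap cup] by (simp add: p_cup)
    also have "\<dots> = e"
      using slide(2) [of cap cup] by (simp add: e_def)
    finally show ?thesis .
  qed
  have "F = \<i> (s \<boxtimes> s \<boxtimes> s \<boxtimes> s) \<oplus>\<^sub>c (- (1/t)) \<odot>\<^sub>c (e \<otimes>\<^sub>c \<i> (s \<boxtimes> s))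
      \<oplus>\<^sub>c (- (1/t)) \<odot>\<^sub>c (\<i> s \<otimes>\<^sub>c \<i> s \<otimes>\<^sub>c e) \<oplus>\<^sub>c (1/t * (1/t)) \<odot>\<^sub>c (e \<otimes>\<^sub>c e)"
    by (simp add: F_def f_def tens_add_left tens_add_right scale_add_right add_assoc)
  then have "p \<star> F \<star> p' = p \<star> p' \<oplus>\<^sub>c (- (1/t)) \<odot>\<^sub>c (p \<star> (e \<otimes>\<^sub>c \<i> (s \<boxtimes> s)) \<star> p')
      \<oplus>\<^sub>c (- (1/t)) \<odot>\<^sub>c (p \<star> (\<i> s \<otimes>\<^sub>c \<i> s \<otimes>\<^sub>c e) \<star> p') \<oplus>\<^sub>c (1/t * (1/t)) \<odot>\<^sub>c (p \<star> (e \<otimes>\<^sub>c e) \<star> p')"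
    by (simp add: comp_add_left comp_add_right)
  then have pFp: "p \<star> F \<star> p' = (t + (- (1/t)) + (- (1/t))) \<odot>\<^sub>c \<i> (s \<boxtimes> s) \<oplus>\<^sub>c (1/t * (1/t)) \<odot>\<^sub>c e"
    unfolding p_p' pe pee by (simp flip: scale_add_left)
  have "f \<star> p \<star> F \<star> p' \<star> f = f \<star> (p \<star> F \<star> p') \<star> f"
    by (simp add: assoc)
  also have "\<dots> = (t + (- (1/t)) + (- (1/t))) \<odot>\<^sub>c f"
    unfolding pFp by (simp add: comp_add_left comp_add_right f_f e_f)
  \<comment> \<open>Multiplied by \<open>t * t\<close>, this is \<open>t^3 - 2 t = 1\<close>, a
    consequence of \<open>golden\<close>.\<close>
  also have "t + (- (1/t)) + (- (1/t)) = 1 / (t * t)"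
  proof -
    have "t * t * t - 2 * t = t * (t + 1) - 2 * t" by (simp add: golden mult.assoc)
    also have "\<dots> = 1" by (simp add: golden algebra_simps)
    finally show ?thesis using t_nonzero by (simp add: field_simps)
  qed
  finally show ?thesis .
qed

text \<open>The inner contractions of the two nested arcs first produce \<open>p' p\<close>; its two
  factors then straighten against the outer cup and cap separately.\<close>

lemma q_zigzag:
  "(\<i> s \<otimes>\<^sub>c \<i> s \<otimes>\<^sub>c q) \<star> (q' \<otimes>\<^sub>c \<i> (s \<boxtimes> s)) = \<i> (s \<boxtimes> s)"
  "(q \<otimes>\<^sub>c \<i> (s \<boxtimes> s)) \<star> (\<i> s \<otimes>\<^sub>c \<i> s \<otimes>\<^sub>c q') = \<i> (s \<boxtimes> s)"
proof -
  have e2: "\<i> s \<otimes>\<^sub>c e \<otimes>\<^sub>c \<i> s = p' \<star> p"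
    by (simp add: e_def p_def p'_def tens_comp)
  have 1: "(\<i> s \<otimes>\<^sub>c \<i> s \<otimes>\<^sub>c p) \<star> (p' \<otimes>\<^sub>c \<i> (s \<boxtimes> s)) = p' \<star> p"
  proof -
    have "(\<i> s \<otimes>\<^sub>c \<i> s \<otimes>\<^sub>c p) \<star> (p' \<otimes>\<^sub>c \<i> (s \<boxtimes> s)) =
      \<i> s \<otimes>\<^sub>c ((\<i> (s \<boxtimes> s) \<otimes>\<^sub>c cap) \<star> (cup \<otimes>\<^sub>c \<i> (s \<boxtimes> s))) \<otimes>\<^sub>c \<i> s"
      by (simp add: p_def p'_def tens_comp_left tens_comp_right flip: tens_ident)
    also have "\<dots> = \<i> s \<otimes>\<^sub>c e \<otimes>\<^sub>c \<i> s"
      using slide [of cup cap] by (simp add: e_def del: tens_ident_assoc)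
    finally show ?thesis by (simp add: e2)
  qed
  have 2: "(p \<otimes>\<^sub>c \<i> (s \<boxtimes> s)) \<star> (\<i> s \<otimes>\<^sub>c \<i> s \<otimes>\<^sub>c p') = p' \<star> p"
  proof -
    have "(p \<otimes>\<^sub>c \<i> (s \<boxtimes> s)) \<star> (\<i> s \<otimes>\<^sub>c \<i> s \<otimes>\<^sub>c p') =
      \<i> s \<otimes>\<^sub>c ((cap \<otimes>\<^sub>c \<i> (s \<boxtimes> s)) \<star> (\<i> (s \<boxtimes> s) \<otimes>\<^sub>c cup)) \<otimes>\<^sub>c \<i> s"
      by (simp add: p_def p'_def tens_comp_left tens_comp_right flip: tens_ident)
    also have "\<dots> = \<i> s \<otimes>\<^sub>c e \<otimes>\<^sub>c \<i> s"
      using slide [of cap cup] by (simp add: e_def del: tens_ident_assoc)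
    finally show ?thesis by (simp add: e2)
  qed
  have "(\<i> s \<otimes>\<^sub>c \<i> s \<otimes>\<^sub>c q) \<star> (q' \<otimes>\<^sub>c \<i> (s \<boxtimes> s)) = (\<i> s \<otimes>\<^sub>c \<i> s \<otimes>\<^sub>c cap) \<star>
      ((\<i> s \<otimes>\<^sub>c \<i> s \<otimes>\<^sub>c p) \<star> (p' \<otimes>\<^sub>c \<i> (s \<boxtimes> s))) \<star> (cup \<otimes>\<^sub>c \<i> (s \<boxtimes> s))"
    by (simp add: q_def q'_def tens_comp_left tens_comp_right assoc)
  also have "\<dots> = ((\<i> s \<otimes>\<^sub>c \<i> s \<otimes>\<^sub>c cap) \<star> p') \<star> (p \<star> (cup \<otimes>\<^sub>c \<i> (s \<boxtimes> s)))"
    unfolding 1 by (simp add: assoc)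
  finally show "(\<i> s \<otimes>\<^sub>c \<i> s \<otimes>\<^sub>c q) \<star> (q' \<otimes>\<^sub>c \<i> (s \<boxtimes> s)) = \<i> (s \<boxtimes> s)" by (simp add: p_cup)
  have "(q \<otimes>\<^sub>c \<i> (s \<boxtimes> s)) \<star> (\<i> s \<otimes>\<^sub>c \<i> s \<otimes>\<^sub>c q') = (cap \<otimes>\<^sub>c \<i> (s \<boxtimes> s)) \<star>
      ((p \<otimes>\<^sub>c \<i> (s \<boxtimes> s)) \<star> (\<i> s \<otimes>\<^sub>c \<i> s \<otimes>\<^sub>c p')) \<star> (\<i> s \<otimes>\<^sub>c \<i> s \<otimes>\<^sub>c cup)"
    by (simp add: q_def q'_def tens_comp_left tens_comp_right assoc)
  also have "\<dots> = ((cap \<otimes>\<^sub>c \<i> (s \<boxtimes> s)) \<star> p') \<star> (p \<star> (\<i> s \<otimes>\<^sub>c \<i> s \<otimes>\<^sub>c cup))"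
    unfolding 2 by (simp add: assoc)
  finally show "(q \<otimes>\<^sub>c \<i> (s \<boxtimes> s)) \<star> (\<i> s \<otimes>\<^sub>c \<i> s \<otimes>\<^sub>c q') = \<i> (s \<boxtimes> s)" by (simp add: p_cup)
qed

text \<open>By \<open>qF\<close> and \<open>Fq\<close>, the idempotents on three doubled strands can
  be gathered into \<open>?m\<close>, which has \<open>f\<close> on the outer ones only. These slide
  out to the two ends, and \<open>q_zigzag\<close> straightens the rest.\<close>

lemma F_zigzag:
  "(f \<otimes>\<^sub>c (q \<star> F)) \<star> ((F \<star> q') \<otimes>\<^sub>c f) = f"
  "((q \<star> F) \<otimes>\<^sub>c f) \<star> (f \<otimes>\<^sub>c (F \<star> q')) = f"
proof -
  let ?u = "\<i> (s \<boxtimes> s)"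
  let ?m = "f \<otimes>\<^sub>c ?u \<otimes>\<^sub>c f"
  have "f \<otimes>\<^sub>c (q \<star> F) = (?u \<otimes>\<^sub>c q) \<star> ?m"
    unfolding qF using tens_comp [of f ?u "\<i> s \<otimes>\<^sub>c \<i> s \<otimes>\<^sub>c f" q] by simp
  moreover have "(F \<star> q') \<otimes>\<^sub>c f = ?m \<star> (q' \<otimes>\<^sub>c ?u)"
    unfolding Fq using tens_comp [of q' "f \<otimes>\<^sub>c ?u" ?u f] by simp
  moreover have "?m \<star> ?m = ?m"
    by (simp add: tens_comp f_f)
  moreover have "(?u \<otimes>\<^sub>c q) \<star> ?m \<star> (q' \<otimes>\<^sub>c ?u) = f"
  proof -
    have "?m = (f \<otimes>\<^sub>c ?u \<otimes>\<^sub>c ?u) \<star> (?u \<otimes>\<^sub>c ?u \<otimes>\<^sub>c f)"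
      by (simp add: tens_comp del: tens_ident tens_ident_assoc)
    moreover have "(?u \<otimes>\<^sub>c q) \<star> (f \<otimes>\<^sub>c ?u \<otimes>\<^sub>c ?u) = f \<star> (?u \<otimes>\<^sub>c q)"
      using slide [of f q] by simp
    moreover have "(?u \<otimes>\<^sub>c ?u \<otimes>\<^sub>c f) \<star> (q' \<otimes>\<^sub>c ?u) = (q' \<otimes>\<^sub>c ?u) \<star> f"
      using slide [of q' f] by simp
    ultimately have "(?u \<otimes>\<^sub>c q) \<star> ?m \<star> (q' \<otimes>\<^sub>c ?u) = f \<star> ((?u \<otimes>\<^sub>c q) \<star> (q' \<otimes>\<^sub>c ?u)) \<star> f"
      using assoc [of "q' \<otimes>\<^sub>c ?u" "?u \<otimes>\<^sub>c ?u \<otimes>\<^sub>c f" "f \<otimes>\<^sub>c ?u \<otimes>\<^sub>c ?u"]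
        assoc [of "(?u \<otimes>\<^sub>c ?u \<otimes>\<^sub>c f) \<star> (q' \<otimes>\<^sub>c ?u)" "f \<otimes>\<^sub>c ?u \<otimes>\<^sub>c ?u" "?u \<otimes>\<^sub>c q"]
      by (simp add: assoc)
    then show ?thesis using q_zigzag by (simp add: f_f)
  qed
  moreover have "((?u \<otimes>\<^sub>c q) \<star> ?m) \<star> (?m \<star> (q' \<otimes>\<^sub>c ?u)) = (?u \<otimes>\<^sub>c q) \<star> (?m \<star> ?m) \<star> (q' \<otimes>\<^sub>c ?u)"
    by (simp add: assoc)
  ultimately show "(f \<otimes>\<^sub>c (q \<star> F)) \<star> ((F \<star> q') \<otimes>\<^sub>c f) = f"
    by metis
next
  let ?u = "\<i> (s \<boxtimes> s)"
  let ?m = "f \<otimes>\<^sub>c ?u \<otimes>\<^sub>c f"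
  have "(q \<star> F) \<otimes>\<^sub>c f = (q \<otimes>\<^sub>c ?u) \<star> ?m"
    unfolding qF q_f(1)[symmetric] using tens_comp [of "f \<otimes>\<^sub>c ?u" q f ?u] by simp
  moreover have "f \<otimes>\<^sub>c (F \<star> q') = ?m \<star> (?u \<otimes>\<^sub>c q')"
    unfolding Fq q_f(2) using tens_comp [of ?u f q' "\<i> s \<otimes>\<^sub>c \<i> s \<otimes>\<^sub>c f"] by simp
  moreover have "?m \<star> ?m = ?m"
    by (simp add: tens_comp f_f)
  moreover have "(q \<otimes>\<^sub>c ?u) \<star> ?m \<star> (?u \<otimes>\<^sub>c q') = f"
  proof -
    have "?m = (?u \<otimes>\<^sub>c ?u \<otimes>\<^sub>c f) \<star> (f \<otimes>\<^sub>c ?u \<otimes>\<^sub>c ?u)"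
      by (simp add: tens_comp del: tens_ident tens_ident_assoc)
    moreover have "(q \<otimes>\<^sub>c ?u) \<star> (?u \<otimes>\<^sub>c ?u \<otimes>\<^sub>c f) = f \<star> (q \<otimes>\<^sub>c ?u)"
      using slide [of q f] by simp
    moreover have "(f \<otimes>\<^sub>c ?u \<otimes>\<^sub>c ?u) \<star> (?u \<otimes>\<^sub>c q') = (?u \<otimes>\<^sub>c q') \<star> f"
      using slide [of f q'] by simp
    ultimately have "(q \<otimes>\<^sub>c ?u) \<star> ?m \<star> (?u \<otimes>\<^sub>c q') = f \<star> ((q \<otimes>\<^sub>c ?u) \<star> (?u \<otimes>\<^sub>c q')) \<star> f"
      using assoc [of "?u \<otimes>\<^sub>c q'" "f \<otimes>\<^sub>c ?u \<otimes>\<^sub>c ?u" "?u \<otimes>\<^sub>c ?u \<otimes>\<^sub>c f"]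
        assoc [of "(f \<otimes>\<^sub>c ?u \<otimes>\<^sub>c ?u) \<star> (?u \<otimes>\<^sub>c q')" "?u \<otimes>\<^sub>c ?u \<otimes>\<^sub>c f" "q \<otimes>\<^sub>c ?u"]
      by (simp add: assoc)
    then show ?thesis using q_zigzag by (simp add: f_f)
  qed
  moreover have "((q \<otimes>\<^sub>c ?u) \<star> ?m) \<star> (?m \<star> (?u \<otimes>\<^sub>c q')) = (q \<otimes>\<^sub>c ?u) \<star> (?m \<star> ?m) \<star> (?u \<otimes>\<^sub>c q')"
    by (simp add: assoc)
  ultimately show "((q \<star> F) \<otimes>\<^sub>c f) \<star> (f \<otimes>\<^sub>c (F \<star> q')) = f"
    by metis
qed

text \<open>The fusion rule of the Fibonacci object. In \<open>jones_wenzl_algebra\<close>,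
  \<open>e2\<close> is \<open>p' p\<close> and \<open>e2 e1 e3 e2\<close> is \<open>q' q\<close>.
  Inserting \<open>f\<close> between \<open>p'\<close> and \<open>p\<close>, as the vertex requires,
  changes the coefficient of \<open>q' q\<close> from -1 to \<open>t - 1 = 1/t\<close>.\<close>

lemma F_decomposition:
  assumes g: "g = (f \<otimes>\<^sub>c \<i> s \<oplus>\<^sub>c (-1) \<odot>\<^sub>c ((f \<otimes>\<^sub>c \<i> s) \<star> (\<i> s \<otimes>\<^sub>c e) \<star> (f \<otimes>\<^sub>c \<i> s))) \<otimes>\<^sub>c \<i> s"
    and jw: "g = t \<odot>\<^sub>c (g \<star> (\<i> s \<otimes>\<^sub>c \<i> s \<otimes>\<^sub>c e) \<star> g)"
  shows "F = (1/t) \<odot>\<^sub>c ((F \<star> q') \<star> (q \<star> F)) \<oplus>\<^sub>c (t * t) \<odot>\<^sub>c ((F \<star> p' \<star> f) \<star> (f \<star> p \<star> F))"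
proof -
  let ?a = "f \<otimes>\<^sub>c \<i> (s \<boxtimes> s)" and ?b = "\<i> s \<otimes>\<^sub>c \<i> s \<otimes>\<^sub>c f"
  let ?e1 = "e \<otimes>\<^sub>c \<i> (s \<boxtimes> s)" and ?e2 = "\<i> s \<otimes>\<^sub>c e \<otimes>\<^sub>c \<i> s" and ?e3 = "\<i> s \<otimes>\<^sub>c \<i> s \<otimes>\<^sub>c e"
  let ?x = "s \<boxtimes> s \<boxtimes> s \<boxtimes> s"
  have ab: "?a \<star> ?b = F" "?b \<star> ?a = F" using F_factor by simp_all
  have e2: "?e2 = p' \<star> p"
    by (simp add: e_def p_def p'_def tens_comp)
  have e232: "?e2 \<star> ?e3 \<star> ?e2 = ?e2"
  proof -
    have "?e2 \<star> ?e3 \<star> ?e2 = p' \<star> (p \<star> (\<i> s \<otimes>\<^sub>c \<i> s \<otimes>\<^sub>c cup)) \<star> ((\<i> s \<otimes>\<^sub>c \<i> s \<otimes>\<^sub>c cap) \<star> p') \<star> p"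
      unfolding e2 e_whisker by (simp add: assoc)
    then show ?thesis by (simp add: p_cup e2)
  qed
  have n: "?e2 \<star> ?e1 \<star> ?e3 \<star> ?e2 = q' \<star> q"
  proof -
    have "?e2 \<star> ?e1 \<star> ?e3 \<star> ?e2 = p' \<star> (p \<star> (cup \<otimes>\<^sub>c \<i> (s \<boxtimes> s))) \<star>
      ((cap \<otimes>\<^sub>c \<i> (s \<boxtimes> s)) \<star> (\<i> s \<otimes>\<^sub>c \<i> s \<otimes>\<^sub>c cup)) \<star> ((\<i> s \<otimes>\<^sub>c \<i> s \<otimes>\<^sub>c cap) \<star> p') \<star> p"
      unfolding e2 e_whisker by (simp add: assoc)
    also have "(cap \<otimes>\<^sub>c \<i> (s \<boxtimes> s)) \<star> (\<i> s \<otimes>\<^sub>c \<i> s \<otimes>\<^sub>c cup) = cup \<star> cap"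
      using slide [of cap cup] by simp
    finally show ?thesis by (simp add: p_cup q_def q'_def assoc)
  qed
  have "F = (1 + t) \<odot>\<^sub>c (F \<star> ?e2 \<star> F) \<oplus>\<^sub>c (-1) \<odot>\<^sub>c (F \<star> ?e2 \<star> ?e1 \<star> ?e3 \<star> ?e2 \<star> F)"
  proof (rule jones_wenzl_algebra [of ?x ?e1 ?e2 ?e3 ?a ?b t g, unfolded ab])
    show "g = ?a \<oplus>\<^sub>c (-1) \<odot>\<^sub>c (?a \<star> ?e2 \<star> ?a)"
      unfolding g by (simp add: tens_add_left tens_comp_left)
    show "?b \<star> ?e3 = Zero C ?x ?x" "?e3 \<star> ?b = Zero C ?x ?x"
      by (simp_all add: tens_comp f_e e_f tens_Zero)
    show "?a \<star> ?e3 = ?e3 \<star> ?a"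
      using slide [of f e] by simp
    show "?e3 \<star> ?e3 = t \<odot>\<^sub>c ?e3"
      by (simp add: tens_comp e_e)
    show "?a \<star> ?a = ?a" "?b \<star> ?b = ?b"
      by (simp_all add: ff_whisker)
    show "?a = \<i> ?x \<oplus>\<^sub>c (- (1/t)) \<odot>\<^sub>c ?e1"
      by (simp add: f_whisker)
  qed (use jw t_nonzero e232 in \<open>simp_all add: HomI\<close>)
  also have "F \<star> ?e2 \<star> ?e1 \<star> ?e3 \<star> ?e2 \<star> F = F \<star> (?e2 \<star> ?e1 \<star> ?e3 \<star> ?e2) \<star> F"
    by (simp add: assoc)
  also have "\<dots> = F \<star> q' \<star> q \<star> F" unfolding n by (simp add: assoc)
  also have "F \<star> ?e2 \<star> F = F \<star> p' \<star> p \<star> F" unfolding e2 by (simp add: assoc)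
  finally have 1: "F = (1 + t) \<odot>\<^sub>c (F \<star> p' \<star> p \<star> F) \<oplus>\<^sub>c (-1) \<odot>\<^sub>c (F \<star> q' \<star> q \<star> F)" .
  have "(F \<star> p' \<star> f) \<star> (f \<star> p \<star> F) = F \<star> p' \<star> (f \<star> f) \<star> p \<star> F"
    by (simp add: assoc)
  also have "\<dots> = F \<star> p' \<star> p \<star> F \<oplus>\<^sub>c (- (1/t)) \<odot>\<^sub>c (F \<star> p' \<star> e \<star> p \<star> F)"
    unfolding f_f by (simp add: f_def comp_add_left comp_add_right)
  also have "F \<star> p' \<star> e \<star> p \<star> F = F \<star> q' \<star> q \<star> F"
    by (simp add: e_def q_def q'_def assoc)
  finally have "(1/t) \<odot>\<^sub>c ((F \<star> q') \<star> (q \<star> F)) \<oplus>\<^sub>c (t * t) \<odot>\<^sub>c ((F \<star> p' \<star> f) \<star> (f \<star> p \<star> F)) =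
    (1/t) \<odot>\<^sub>c (F \<star> q' \<star> q \<star> F) \<oplus>\<^sub>c
      ((t * t) \<odot>\<^sub>c (F \<star> p' \<star> p \<star> F) \<oplus>\<^sub>c (- t) \<odot>\<^sub>c (F \<star> q' \<star> q \<star> F))"
    using t_nonzero by (simp add: scale_add_right assoc)
  also have "\<dots> = (t * t) \<odot>\<^sub>c (F \<star> p' \<star> p \<star> F) \<oplus>\<^sub>c
      ((- t) \<odot>\<^sub>c (F \<star> q' \<star> q \<star> F) \<oplus>\<^sub>c (1/t) \<odot>\<^sub>c (F \<star> q' \<star> q \<star> F))"
    by (subst add_commute) (simp_all add: add_assoc)
  also have "\<dots> = (1 + t) \<odot>\<^sub>c (F \<star> p' \<star> p \<star> F) \<oplus>\<^sub>c (- t + 1/t) \<odot>\<^sub>c (F \<star> q' \<star> q \<star> F)"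
    by (simp add: golden add.commute flip: scale_add_left)
  also have "- t + 1/t = -1"
    using t_nonzero golden by (simp add: field_simps)
  finally show ?thesis using 1 by simp
qed

end

section \<open>The star operation and the Temperley-Lieb instance\<close>

locale star_presentation = wf_presentation +
  assumes gen_star: "g \<in> gens P \<Longrightarrow>
      gen_star P g \<in> gens P \<and> gen_dom P (gen_star P g) = gen_cod P g \<and> gen_cod P (gen_star P g) = gen_dom P g"
    and rel_star: "\<lbrakk>(s, t) \<in> rels P; s \<in> diags P v w; t \<in> diags P v w\<rbrakk>
      \<Longrightarrow> deqv P (diag_star P s) (diag_star P t)"
begin

lemma wf_diag_star:
  "wf_diag P t \<Longrightarrow> wf_diag P (diag_star P t) \<and> ddom P (diag_star P t) = dcod P t \<and> dcod P (diag_star P t) = ddom P t"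
  by (induction t) (use gen_star in auto)

lemma diags_star: "t \<in> diags P v w \<Longrightarrow> diag_star P t \<in> diags P w v"
  using wf_diag_star by (auto simp: diags_def)

text \<open>Reflection exchanges left and right rules for composition and preserves the remaining
  shapes, so only the relations of the presentation need an assumption.\<close>

lemma deqv_star: "deqv P s t \<Longrightarrow> deqv P (diag_star P s) (diag_star P t)"
proof (induction rule: deqv.induct)
  case (trans r s t) then show ?case by (blast intro: deqv.trans)
next
  case (sym s t) then show ?case by (blast intro: deqv.sym)
next
  case (rel s t v w) then show ?case by (rule rel_star)
next
  case (cong_Comp s s' t t')
  then show ?case using wf_diag_star deqv_wf by (auto intro!: deqv.cong_Comp)
next
  case (cong_Add s s' t t')
  then show ?case using wf_diag_star deqv_wf by (auto intro!: deqv.cong_Add)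
next
  case (comp_assoc r u v s w t x)
  then show ?case by (auto intro: deqv.sym deqv.comp_assoc diags_star)
next
  case (comp_id_right t v w)
  then show ?case using deqv.comp_id_left [OF diags_star] by auto
next
  case (comp_id_left t v w)
  then show ?case using deqv.comp_id_right [OF diags_star] by auto
next
  case (comp_add_left r u v s w t)
  then show ?case using deqv.comp_add_right [of "diag_star P s" P w v "diag_star P t" "diag_star P r" u] diags_star by auto
next
  case (comp_add_right r u v s t w)
  then show ?case using deqv.comp_add_left [of "diag_star P t" P w v "diag_star P r" u "diag_star P s"] diags_star by auto
next
  case (comp_scale_left s u v t w z)
  then show ?case using deqv.comp_scale_right [of "diag_star P t" P w v "diag_star P s" u] diags_star by auto
next
  case (comp_scale_right s u v t w z)
  then show ?case using deqv.comp_scale_left [of "diag_star P t" P w v "diag_star P s" u] diags_star by auto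
next
  case (interchange s u v t w s' u' v' t' w')
  then show ?case
    using deqv.interchange [of "diag_star P t" P w v "diag_star P s" u "diag_star P t'" w' v' "diag_star P s'" u']
      diags_star by (auto intro: deqv.sym)
next
  case (add_inverse t v w)
  then show ?case using deqv.add_inverse [OF diags_star] by auto
next
  case (scale_add_right s v w t z)
  then show ?case using deqv.scale_add_right [OF diags_star diags_star] by auto
next
  case (add_assoc r v w s t)
  then show ?case using deqv.add_assoc [OF diags_star diags_star diags_star] by auto
next
  case (add_commute s v w t)
  then show ?case using deqv.add_commute [OF diags_star diags_star] by auto
next
  case (add_zero t v w)
  then show ?case using deqv.add_zero [OF diags_star] by auto
next
  case (tens_add_left r v w s t)
  then show ?case using deqv.tens_add_left [OF diags_star diags_star] wf_diag_star by auto
next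
  case (tens_add_right r v w s t)
  then show ?case using deqv.tens_add_right [OF diags_star diags_star] wf_diag_star by auto
qed (use wf_diag_star in \<open>auto intro: deqv.intros\<close>)

lemma presented_Star: "wf_diag P t \<Longrightarrow> Star (presented P) (cls P t) = cls P (diag_star P t)"
  by (auto simp: presented_def intro!: cls_eqI deqv_star intro: deqv.sym deqv_rep)

end

abbreviation TL where "TL \<equiv> TL_A4_presentation"

lemma TL_simps [simp]:
  "letters TL = UNIV" "gens TL = UNIV" "gen_dom TL Cup = []" "gen_dom TL Cap = strands 2"
  "gen_cod TL Cup = strands 2" "gen_cod TL Cap = []" "gen_star TL Cup = Cap" "gen_star TL Cap = Cup"
  by (simp_all add: TL_A4_presentation_def)

lemma strands_append: "strands m @ strands n = strands (m + n)"
  by (simp add: replicate_add)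

lemma jones_wenzl_wf:
  "wf_diag TL (jones_wenzl n) \<and> ddom TL (jones_wenzl n) = strands n \<and> dcod TL (jones_wenzl n) = strands n"
proof (induction n rule: jones_wenzl.induct)
  case (3 n)
  have "strands (Suc n) @ strands 1 = strands (Suc (Suc n))" "strands n @ strands 2 = strands (Suc (Suc n))"
    unfolding strands_append by simp_all
  then show ?case using 3 by (simp add: Let_def)
qed auto

interpretation TLp: wf_presentation TL
  by unfold_locales simp

text \<open>The correction term \<open>f e f\<close> is a palindrome; after reflection only its
  bracketing differs.\<close>

lemma jones_wenzl_star: "deqv TL (diag_star TL (jones_wenzl n)) (jones_wenzl n)"
proof (induction n rule: jones_wenzl.induct)
  case (3 n)
  let ?f = "DTens (jones_wenzl (Suc n)) (DId (strands 1))"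
  let ?e = "DTens (DId (strands n)) (DComp (DGen Cup) (DGen Cap))"
  let ?f' = "diag_star TL ?f"
  have eq: "strands (Suc n) @ strands 1 = strands (Suc (Suc n))" "strands n @ strands 2 = strands (Suc (Suc n))"
    unfolding strands_append by simp_all
  have f: "deqv TL ?f' ?f"
    unfolding diag_star.simps by (intro deqv.cong_Tens 3 deqv.refl) simp
  have ff: "?f \<in> diags TL (strands (Suc (Suc n))) (strands (Suc (Suc n)))"
    using jones_wenzl_wf [of "Suc n"] eq by (simp add: diags_def)
  have ee: "?e \<in> diags TL (strands (Suc (Suc n))) (strands (Suc (Suc n)))"
    using eq by (simp add: diags_def)
  have ff': "?f' \<in> diags TL (strands (Suc (Suc n))) (strands (Suc (Suc n)))"
    using ff TLp.deqv_wf [OF f] by (simp add: diags_def)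
  have "deqv TL (DComp (DComp ?f' ?e) ?f') (DComp (DComp ?f ?e) ?f)"
    using f ff ee ff' by (intro deqv.cong_Comp deqv.refl) (auto simp: diags_def)
  then have "deqv TL (DComp (DComp ?f' ?e) ?f') (DComp ?f (DComp ?e ?f))"
    using deqv.comp_assoc [OF ff ee ff] by (rule deqv.trans)
  then have *: "deqv TL (DScale z (DComp (DComp ?f' ?e) ?f')) (DScale z (DComp ?f (DComp ?e ?f)))" for z
    by (rule deqv.cong_Scale)
  have "deqv TL (DAdd ?f' (DScale z (DComp (DComp ?f' ?e) ?f'))) (DAdd ?f (DScale z (DComp ?f (DComp ?e ?f))))" for z
    using ff ee ff' by (intro deqv.cong_Add f *) (auto simp: diags_def)
  then show ?case by (simp add: Let_def)
qed (auto intro: deqv.refl)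

interpretation TLs: star_presentation TL
proof
  show "gen_star TL g \<in> gens TL \<and> gen_dom TL (gen_star TL g) = gen_cod TL g \<and>
      gen_cod TL (gen_star TL g) = gen_dom TL g" for g
    by (cases g) auto
  have z: "deqv TL (DComp (DTens (DGen Cap) (DId (strands 1))) (DTens (DId (strands 1)) (DGen Cup))) (DId (strands 1))"
    "deqv TL (DComp (DTens (DId (strands 1)) (DGen Cap)) (DTens (DGen Cup) (DId (strands 1)))) (DId (strands 1))"
    "deqv TL (DComp (DGen Cap) (DGen Cup)) (DScale (of_real tau) (DId []))"
    by (rule deqv.rel; simp add: TL_A4_presentation_def diags_def numeral_2_eq_2)+
  have j: "deqv TL (jones_wenzl 4) (DZero (strands 4) (strands 4))"
    by (rule deqv.rel [of _ _ _ "strands 4" "strands 4"]) (use jones_wenzl_wf [of 4] in \<open>auto simp: TL_A4_presentation_def diags_def\<close>)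
  show "deqv TL (diag_star TL s) (diag_star TL t)" if "(s, t) \<in> rels TL" for s t
  proof -
    have "(s, t) = (jones_wenzl 4, DZero (strands 4) (strands 4)) \<Longrightarrow> ?thesis"
      using deqv.trans [OF jones_wenzl_star j] by simp
    moreover have "(s, t) \<noteq> (jones_wenzl 4, DZero (strands 4) (strands 4)) \<Longrightarrow> ?thesis"
      using that z by (auto simp: TL_A4_presentation_def)
    ultimately show ?thesis by blast
  qed
qed

interpretation TLc: monoidal_category "presented TL"
  by (rule TLp.monoidal_category_presented)

text \<open>Hence the coefficients in Wenzl's recursion for the second, third and fourth idempotent
  are \<open>1/tau\<close>, 1 and \<open>tau\<close>.\<close>

lemma qint_values: "qint 1 = 1" "qint 2 = tau" "qint 3 = tau" "qint 4 = 1"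
  and tau_golden: "tau * tau = tau + 1"
proof -
  show g: "tau * tau = tau + 1" by (simp add: tau_def field_simps)
  show "qint 1 = 1" "qint 2 = tau" "qint 3 = tau" "qint 4 = 1"
    by (simp_all add: numeral_eq_Suc g)
qed

interpretation TLt: temperley_lieb "presented TL" "[()]" "cls TL (DGen Cup)" "cls TL (DGen Cap)" "of_real tau"
proof
  show "[()] \<in> Obj (presented TL)" by (simp add: TLp.presented_ops)
  show "cls TL (DGen Cup) \<in> Hom (presented TL) (Unit (presented TL)) ([()] \<boxtimes>\<^bsub>presented TL\<^esub> [()])"
    "cls TL (DGen Cap) \<in> Hom (presented TL) ([()] \<boxtimes>\<^bsub>presented TL\<^esub> [()]) (Unit (presented TL))"
    by (simp_all add: TLp.presented_ops TLp.presented_HomI numeral_2_eq_2)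
  show "(complex_of_real tau) * of_real tau = of_real tau + 1"
    using tau_golden by (metis of_real_1 of_real_add of_real_mult)
qed (simp_all add: TLp.presented_ops numeral_2_eq_2, (rule TLp.cls_eqI, rule deqv.rel,
   simp add: TL_A4_presentation_def, (simp add: diags_def numeral_2_eq_2)+)+)


lemma TL_objects [simp]:
  "Unit (presented TL) = []" "v \<boxtimes>\<^bsub>presented TL\<^esub> w = v @ w" "Obj (presented TL) = UNIV"
  by (simp_all add: TLp.presented_ops)

lemma cls_jones_wenzl_rec:
  fixes n
  defines "G \<equiv> TensM (presented TL) (cls TL (jones_wenzl (Suc n))) (Ident (presented TL) [()])"
    and "E \<equiv> TensM (presented TL) (Ident (presented TL) (strands n)) TLt.e"
  shows "cls TL (jones_wenzl (Suc (Suc n))) = Add (presented TL) G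
    (Scale (presented TL) (of_real (- (qint (Suc n) / qint (Suc (Suc n)))))
      (Comp (presented TL) G (Comp (presented TL) E G)))"
proof -
  have E: "E = cls TL (DTens (DId (strands n)) (DComp (DGen Cup) (DGen Cap)))"
    unfolding E_def TLt.e_def by (simp add: TLp.presented_ops)
  have G: "G = cls TL (DTens (jones_wenzl (Suc n)) (DId [()]))"
    unfolding G_def using jones_wenzl_wf [of "Suc n"] by (simp add: TLp.presented_ops)
  have "strands (Suc n) @ [()] = strands (Suc (Suc n))" "strands n @ strands 2 = strands (Suc (Suc n))"
    using strands_append [of "Suc n" 1] strands_append [of n 2] by simp_all
  then show ?thesis
    unfolding E G using jones_wenzl_wf [of "Suc n"] by (simp add: TLp.presented_ops Let_def)
qed

lemma cls_jones_wenzl_2: "cls TL (jones_wenzl 2) = TLt.f"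
proof -
  have "qint (Suc 0) = 1" "qint (Suc (Suc 0)) = tau" using qint_values by (simp_all add: numeral_2_eq_2)
  moreover have "cls TL (jones_wenzl (Suc 0)) = Ident (presented TL) [()]"
    by (simp add: TLp.presented_ops)
  ultimately show ?thesis
    using cls_jones_wenzl_rec [of 0] TLc.tens_ident [of "[()]" "[()]"] TLc.tens_unit(1) [of TLt.e]
    by (simp add: numeral_2_eq_2 TLt.f_def del: qint.simps jones_wenzl.simps)
qed

text \<open>With \<open>?g\<close> the third idempotent and one further strand, the relation for the
  fourth idempotent reads \<open>?g = tau ?g e ?g\<close> with \<open>e\<close> on the last two
  strands, as \<open>F_decomposition\<close> demands.\<close>

lemma TL_F_decomposition:
  "TLt.F = Add (presented TL)
    (Scale (presented TL) (1 / of_real tau)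
      (Comp (presented TL) (Comp (presented TL) TLt.F TLt.q') (Comp (presented TL) TLt.q TLt.F)))
    (Scale (presented TL) (of_real tau * of_real tau)
      (Comp (presented TL) (Comp (presented TL) TLt.F (Comp (presented TL) TLt.p' TLt.f))
        (Comp (presented TL) TLt.f (Comp (presented TL) TLt.p TLt.F))))"
proof -
  have q: "qint (Suc 0) = 1" "qint (Suc (Suc 0)) = tau" "qint (Suc (Suc (Suc 0))) = tau"
    "qint (Suc (Suc (Suc (Suc 0)))) = 1"
    using qint_values by (simp_all add: numeral_eq_Suc del: qint.simps)
  have "tau \<noteq> 0" using tau_golden by auto
  have st: "strands 3 = [(), (), ()]" "strands 4 = [(), (), (), ()]"
    by (simp_all add: numeral_eq_Suc)
  let ?g3 = "cls TL (jones_wenzl 3)"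
  let ?g = "TensM (presented TL) ?g3 (Ident (presented TL) [()])"
  let ?h = "Comp (presented TL) ?g (Comp (presented TL) (TensM (presented TL) (Ident (presented TL) [()])
          (TensM (presented TL) (Ident (presented TL) [()]) TLt.e)) ?g)"
  have g3: "?g3 = Add (presented TL) (TensM (presented TL) TLt.f (Ident (presented TL) [()]))
    (Scale (presented TL) (-1) (Comp (presented TL) (TensM (presented TL) TLt.f (Ident (presented TL) [()]))
      (Comp (presented TL) (TensM (presented TL) (Ident (presented TL) [()]) TLt.e)
        (TensM (presented TL) TLt.f (Ident (presented TL) [()])))))"
    using cls_jones_wenzl_rec [of 1] cls_jones_wenzl_2 q \<open>tau \<noteq> 0\<close>
    by (simp add: numeral_3_eq_3 numeral_2_eq_2 del: qint.simps jones_wenzl.simps)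
  have "Zero (presented TL) (strands 4) (strands 4) = cls TL (jones_wenzl 4)"
  proof -
    have "deqv TL (jones_wenzl 4) (DZero (strands 4) (strands 4))"
      by (rule deqv.rel [of _ _ _ "strands 4" "strands 4"])
        (use jones_wenzl_wf [of 4] in \<open>auto simp: TL_A4_presentation_def diags_def\<close>)
    then show ?thesis using TLp.cls_eqI by (simp add: TLp.presented_ops)
  qed
  also have "\<dots> = Add (presented TL) ?g (Scale (presented TL) (- of_real tau) ?h)"
    using cls_jones_wenzl_rec [of 2] q TLc.tens_ident [of "[()]" "[()]"] TLc.tens_ident_assoc [of "[()]" "[()]" TLt.e]
    by (simp add: numeral_eq_Suc del: qint.simps jones_wenzl.simps TLc.tens_ident TLc.tens_ident_assoc)
  finally have z: "Add (presented TL) ?g (Scale (presented TL) (- of_real tau) ?h) =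
      Zero (presented TL) (strands 4) (strands 4)" by simp
  have [simp]: "?g3 \<in> Mor (presented TL)" "Dom (presented TL) ?g3 = strands 3" "Cod (presented TL) ?g3 = strands 3"
    using jones_wenzl_wf [of 3] by (auto simp: TLp.presented_Mor TLp.presented_Dom TLp.presented_Cod)
  have "?g = Scale (presented TL) (of_real tau) ?h"
  proof (rule TLc.diff_eq_zero)
    show "Add (presented TL) ?g (Scale (presented TL) (-1) (Scale (presented TL) (of_real tau) ?h)) =
      Zero (presented TL) (Dom (presented TL) (Scale (presented TL) (of_real tau) ?h))
        (Cod (presented TL) (Scale (presented TL) (of_real tau) ?h))"
      using z by (simp add: st)
  qed (simp_all add: st)
  then show ?thesis
    by (rule TLt.F_decomposition [rotated]) (simp add: g3)
qed

section \<open>The Fibonacci object in the idempotent completion\<close>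

abbreviation TLcat where "TLcat \<equiv> presented TL"

lemma TL_Star_tens: "\<lbrakk>f \<in> Mor TLcat; g \<in> Mor TLcat\<rbrakk> \<Longrightarrow>
    Star TLcat (TensM TLcat f g) = TensM TLcat (Star TLcat f) (Star TLcat g)"
  and TL_Star_Ident: "Star TLcat (Ident TLcat w) = Ident TLcat w"
  by (auto simp: TLp.presented_Mor TLp.presented_ops TLs.presented_Star TLs.wf_diag_star)

lemma TL_tens_unit [simp]:
  "f \<in> Mor TLcat \<Longrightarrow> TensM TLcat (Ident TLcat []) f = f"
  "f \<in> Mor TLcat \<Longrightarrow> TensM TLcat f (Ident TLcat []) = f"
  using TLc.tens_unit by simp_all

lemma TL_Star_f: "Star TLcat TLt.f = TLt.f"
  unfolding cls_jones_wenzl_2 [symmetric]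
  using jones_wenzl_wf [of 2] jones_wenzl_star [of 2] by (simp add: TLs.presented_Star TLp.cls_eqI)

lemma TL_Star_F: "Star TLcat TLt.F = TLt.F"
  by (simp add: TLt.F_def TL_Star_tens TL_Star_f)

lemma T2_Obj:
  "x \<in> Obj T2 \<longleftrightarrow> even (length (fst x)) \<and> snd x \<in> Hom TLcat (fst x) (fst x) \<and>
     Comp TLcat (snd x) (snd x) = snd x \<and> Star TLcat (snd x) = snd x"
  by (auto simp: T2_def karoubi_def full_subcategory_def Hom_def)

lemma T2_ops:
  "Ident T2 (a, p) = ((a, p), p, (a, p))"
  "Comp T2 (y, g, z) (x, f, y') = (x, Comp TLcat g f, z)"
  "Add T2 (x, f, y) (x', g, y') = (x, Add TLcat f g, y)"
  "Scale T2 c (x, f, y) = (x, Scale TLcat c f, y)"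
  "Unit T2 = ([], Ident TLcat [])"
  "TensO T2 (a, p) (b, q) = (a @ b, TensM TLcat p q)"
  "TensM T2 ((a, p), f, (b, q)) ((a', p'), f', (b', q')) =
     ((a @ a', TensM TLcat p p'), TensM TLcat f f', (b @ b', TensM TLcat q q'))"
  by (simp_all add: T2_def karoubi_def full_subcategory_def)

lemma T2_HomI:
  assumes "(a, p) \<in> Obj T2" "(b, q) \<in> Obj T2" "f \<in> Mor TLcat" "Dom TLcat f = a" "Cod TLcat f = b"
    "Comp TLcat q (Comp TLcat f p) = f"
  shows "((a, p), f, (b, q)) \<in> Hom T2 (a, p) (b, q)"
  using assms by (auto simp: T2_def karoubi_def full_subcategory_def Hom_def)

definition T2_unit where "T2_unit = ([] :: unit list, Ident TLcat [])"
definition fib2 where "fib2 = ([(), (), (), ()], TLt.F)"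
definition fib3 where "fib3 = ([(), (), (), (), (), ()], TensM TLcat TLt.f TLt.F)"

lemma fib_f: "fib = ([(), ()], TLt.f)"
  unfolding fib_def cls_jones_wenzl_2 by (simp add: numeral_2_eq_2)

lemma T2_objects: "T2_unit \<in> Obj T2" "fib \<in> Obj T2" "fib2 \<in> Obj T2" "fib3 \<in> Obj T2"
  by (simp_all add: T2_Obj T2_unit_def fib_f fib2_def fib3_def TL_Star_Ident TL_Star_f TL_Star_F TL_Star_tens
      TLc.HomI TLt.f_f TLt.F_F TLc.tens_comp)

lemma fib_tens_word:
  "tens_word T2 [] = T2_unit" "tens_word T2 [fib] = fib" "tens_word T2 [fib, fib] = fib2"
  "tens_word T2 [fib, fib, fib] = fib3"
  by (simp_all add: tens_word_def T2_ops T2_unit_def fib_f fib2_def fib3_def TLt.F_def)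

definition fib_coev where "fib_coev = (T2_unit, Comp TLcat TLt.F TLt.q', fib2)"
definition fib_ev where "fib_ev = (fib2, Comp TLcat TLt.q TLt.F, T2_unit)"
definition fib_mult where
  "fib_mult = (fib2, Comp TLcat TLt.f (Comp TLcat TLt.p TLt.F), fib)"
text \<open>The factor \<open>tau * tau\<close> compensates the scalar of \<open>TLt.fpFpf\<close>,
  so that splitting followed by merging is the identity.\<close>

definition fib_comult where
  "fib_comult = (fib, Scale TLcat (of_real tau * of_real tau) (Comp TLcat TLt.F (Comp TLcat TLt.p' TLt.f)), fib2)"

lemma TL_absorb:
  "g \<in> Mor TLcat \<Longrightarrow> Cod TLcat g = [(), ()] \<Longrightarrow> Comp TLcat TLt.f (Comp TLcat TLt.f g) = Comp TLcat TLt.f g"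
  "g \<in> Mor TLcat \<Longrightarrow> Cod TLcat g = [(), (), (), ()] \<Longrightarrow> Comp TLcat TLt.F (Comp TLcat TLt.F g) = Comp TLcat TLt.F g"
  using TLc.assoc [of g TLt.f TLt.f] TLc.assoc [of g TLt.F TLt.F] by (simp_all add: TLt.f_f TLt.F_F)

lemma fib_morphisms:
  "fib_coev \<in> Hom T2 T2_unit fib2" "fib_ev \<in> Hom T2 fib2 T2_unit"
  "fib_mult \<in> Hom T2 fib2 fib" "fib_comult \<in> Hom T2 fib fib2"
  "Ident T2 T2_unit \<in> Hom T2 T2_unit T2_unit" "Ident T2 fib \<in> Hom T2 fib fib" "Ident T2 fib2 \<in> Hom T2 fib2 fib2"
  using T2_objects
  by (auto simp: fib_coev_def fib_ev_def fib_mult_def fib_comult_def T2_unit_def fib_f fib2_def T2_ops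
      TLc.assoc TL_absorb TLt.f_f TLt.F_F intro!: T2_HomI)

lemma fib_relations:
  "Comp T2 fib_ev fib_coev = Scale T2 (of_real tau) (Ident T2 T2_unit)"
  "Comp T2 fib_mult fib_comult = Ident T2 fib"
  "Add T2 (Scale T2 (1 / of_real tau) (Comp T2 fib_coev fib_ev)) (Comp T2 fib_comult fib_mult) = Ident T2 fib2"
  "Comp T2 (TensM T2 (Ident T2 fib) fib_ev) (TensM T2 fib_coev (Ident T2 fib)) = Ident T2 fib"
  "Comp T2 (TensM T2 fib_ev (Ident T2 fib)) (TensM T2 (Ident T2 fib) fib_coev) = Ident T2 fib"
proof -
  have [simp]: "tau \<noteq> 0" using tau_golden by auto
  note d = fib_coev_def fib_ev_def fib_mult_def fib_comult_def T2_unit_def fib_f fib2_def T2_ops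
  have 1: "Comp TLcat (Comp TLcat TLt.q TLt.F) (Comp TLcat TLt.F TLt.q') = Scale TLcat (of_real tau) (Ident TLcat [])"
    using TLt.qFq by (simp add: TLc.assoc TL_absorb)
  show "Comp T2 fib_ev fib_coev = Scale T2 (of_real tau) (Ident T2 T2_unit)"
    by (simp add: d 1)
  have 2: "Comp TLcat (Comp TLcat TLt.f (Comp TLcat TLt.p TLt.F)) (Scale TLcat (of_real tau * of_real tau)
      (Comp TLcat TLt.F (Comp TLcat TLt.p' TLt.f))) = TLt.f"
    using TLt.fpFpf by (simp add: TLc.assoc TL_absorb)
  show "Comp T2 fib_mult fib_comult = Ident T2 fib"
    by (simp add: d 2)
  have 3: "TLc.pls (TLc.scl (1 / of_real tau) (TLc.cmp (TLc.cmp TLt.F TLt.q') (TLc.cmp TLt.q TLt.F)))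
      (TLc.cmp (TLc.scl (of_real tau * of_real tau) (TLc.cmp TLt.F (TLc.cmp TLt.p' TLt.f)))
        (TLc.cmp TLt.f (TLc.cmp TLt.p TLt.F))) = TLt.F"
    by (rule HOL.trans [OF _ TL_F_decomposition [symmetric]]) simp
  show "Add T2 (Scale T2 (1 / of_real tau) (Comp T2 fib_coev fib_ev)) (Comp T2 fib_comult fib_mult) = Ident T2 fib2"
    by (simp only: d 3)
  show "Comp T2 (TensM T2 (Ident T2 fib) fib_ev) (TensM T2 fib_coev (Ident T2 fib)) = Ident T2 fib"
    "Comp T2 (TensM T2 fib_ev (Ident T2 fib)) (TensM T2 (Ident T2 fib) fib_coev) = Ident T2 fib"
    using TLt.F_zigzag by (simp_all add: d)
qed

lemma fib_composites:
  "Comp T2 fib_coev fib_ev \<in> Hom T2 fib2 fib2" "Comp T2 fib_comult fib_mult \<in> Hom T2 fib2 fib2"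
  using T2_objects
  by (auto simp: fib_coev_def fib_ev_def fib_mult_def fib_comult_def T2_unit_def fib_f fib2_def T2_ops
      TLc.assoc TL_absorb TLt.f_f TLt.F_F intro!: T2_HomI)

text \<open>A morphism of the completion must absorb the idempotents at its two ends. This is
  checked for the individual factors of the zigzags, as their transfer to the free product
  requires.\<close>

lemma fib_zigzag_factors:
  "TensM T2 fib_coev (Ident T2 fib) \<in> Hom T2 fib fib3" "TensM T2 (Ident T2 fib) fib_ev \<in> Hom T2 fib3 fib"
  "TensM T2 (Ident T2 fib) fib_coev \<in> Hom T2 fib fib3" "TensM T2 fib_ev (Ident T2 fib) \<in> Hom T2 fib3 fib"
proof -
  \<comment> \<open>The two bracketings of the third tensor power yield the same idempotent, so one
    object \<open>fib3\<close> serves both zigzags.\<close>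
  have FF: "TLc.tns TLt.F TLt.f = TLc.tns TLt.f TLt.F"
    by (simp add: TLt.F_def)
  have l: "TLc.cmp (TLc.tns g TLt.f) TLt.f = TLc.tns g TLt.f" "TLc.cmp (TLc.tns TLt.f g) TLt.f = TLc.tns TLt.f g"
    if "g \<in> Mor TLcat" "Dom TLcat g = []" for g
    using that TLc.tens_comp [of "TLc.idm []" g TLt.f TLt.f] TLc.tens_comp [of TLt.f TLt.f "TLc.idm []" g]
    by (simp_all add: TLt.f_f)
  have r: "TLc.cmp TLt.f (TLc.tns g TLt.f) = TLc.tns g TLt.f" "TLc.cmp TLt.f (TLc.tns TLt.f g) = TLc.tns TLt.f g"
    if "g \<in> Mor TLcat" "Cod TLcat g = []" for g
    using that TLc.tens_comp [of g "TLc.idm []" TLt.f TLt.f] TLc.tens_comp [of TLt.f TLt.f g "TLc.idm []"]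
    by (simp_all add: TLt.f_f)
  have o: "([], TLc.idm []) \<in> Obj T2" "([(), ()], TLt.f) \<in> Obj T2" "([(), (), (), ()], TLt.F) \<in> Obj T2"
    "([(), (), (), (), (), ()], TLc.tns TLt.f TLt.F) \<in> Obj T2"
    using T2_objects by (simp_all add: T2_unit_def fib_f fib2_def fib3_def)
  note d = fib_coev_def fib_ev_def T2_unit_def fib_f fib2_def fib3_def T2_ops
  show "TensM T2 fib_coev (Ident T2 fib) \<in> Hom T2 fib fib3"
    using o by (simp add: d FF, intro T2_HomI)
      (simp_all add: l TLc.tens_comp TLt.f_f TL_absorb flip: FF)
  show "TensM T2 (Ident T2 fib) fib_ev \<in> Hom T2 fib3 fib"
    using o by (simp add: d, intro T2_HomI)
      (simp_all add: r TLc.tens_comp TLt.f_f TLt.F_F TLc.assoc)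
  show "TensM T2 (Ident T2 fib) fib_coev \<in> Hom T2 fib fib3"
    using o by (simp add: d, intro T2_HomI)
      (simp_all add: l TLc.tens_comp TLt.f_f TL_absorb)
  show "TensM T2 fib_ev (Ident T2 fib) \<in> Hom T2 fib3 fib"
    using o by (simp add: d FF, intro T2_HomI)
      (simp_all add: r TLc.tens_comp TLt.f_f TLt.F_F TLc.assoc flip: FF)
qed

section \<open>Diagrams of one factor inside a free product\<close>

lemma fp_wf_presentation: "wf_presentation (fp_presentation C)"
  by unfold_locales (auto simp: fp_presentation_def)

definition fp_mor where
  "fp_mor C i v w f = cls (fp_presentation C) (DGen (Diagram i v w f))"

lemma fp_diags:
  assumes "set v \<subseteq> Obj (C i)" "set w \<subseteq> Obj (C i)" "f \<in> Hom (C i) (tens_word (C i) v) (tens_word (C i) w)"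
  shows "DGen (Diagram i v w f) \<in> diags (fp_presentation C) (map (Pair i) v) (map (Pair i) w)"
  using assms by (simp add: diags_def fp_presentation_def)

lemma fp_mor_Hom:
  assumes "set v \<subseteq> Obj (C i)" "set w \<subseteq> Obj (C i)" "f \<in> Hom (C i) (tens_word (C i) v) (tens_word (C i) w)"
  shows "fp_mor C i v w f \<in> Hom (free_product C) (map (Pair i) v) (map (Pair i) w)"
  unfolding fp_mor_def free_product_def wf_presentation.presented_Hom [OF fp_wf_presentation]
  using fp_diags [where C = C and i = i and v = v and w = w and f = f] assms by blast

lemma fp_rels: "rels (fp_presentation C) = fp_rels C" "letters (fp_presentation C) = {(i, a). a \<in> Obj (C i)}"
  by (simp_all add: fp_presentation_def)

text \<open>Relations of a presentation apply between well-formed diagrams. As no category axioms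
  are assumed of \<open>C i\<close>, the typing of each result is a hypothesis.\<close>

lemma fp_mor_ops:
  fixes C :: "'i \<Rightarrow> ('o, 'm) pcat"
  assumes v: "set v \<subseteq> Obj (C i)" and w: "set w \<subseteq> Obj (C i)"
    and f: "f \<in> Hom (C i) (tens_word (C i) v) (tens_word (C i) w)"
  shows "\<lbrakk>set u \<subseteq> Obj (C i); g \<in> Hom (C i) (tens_word (C i) w) (tens_word (C i) u);
      Comp (C i) g f \<in> Hom (C i) (tens_word (C i) v) (tens_word (C i) u)\<rbrakk>
    \<Longrightarrow> Comp (free_product C) (fp_mor C i w u g) (fp_mor C i v w f) = fp_mor C i v u (Comp (C i) g f)"
    and "\<lbrakk>set v' \<subseteq> Obj (C i); set w' \<subseteq> Obj (C i); g \<in> Hom (C i) (tens_word (C i) v') (tens_word (C i) w');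
      TensM (C i) f g \<in> Hom (C i) (tens_word (C i) (v @ v')) (tens_word (C i) (w @ w'))\<rbrakk>
    \<Longrightarrow> TensM (free_product C) (fp_mor C i v w f) (fp_mor C i v' w' g) = fp_mor C i (v @ v') (w @ w') (TensM (C i) f g)"
    and "\<lbrakk>g \<in> Hom (C i) (tens_word (C i) v) (tens_word (C i) w);
      Add (C i) f g \<in> Hom (C i) (tens_word (C i) v) (tens_word (C i) w)\<rbrakk>
    \<Longrightarrow> Add (free_product C) (fp_mor C i v w f) (fp_mor C i v w g) = fp_mor C i v w (Add (C i) f g)"
    and "Scale (C i) z f \<in> Hom (C i) (tens_word (C i) v) (tens_word (C i) w)
    \<Longrightarrow> Scale (free_product C) z (fp_mor C i v w f) = fp_mor C i v w (Scale (C i) z f)"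
    and "Ident (C i) (tens_word (C i) v) \<in> Hom (C i) (tens_word (C i) v) (tens_word (C i) v)
    \<Longrightarrow> Ident (free_product C) (map (Pair i) v) = fp_mor C i v v (Ident (C i) (tens_word (C i) v))"
proof -
  interpret wf_presentation "fp_presentation C" by (rule fp_wf_presentation)
  note D = fp_diags [where C = C and i = i]
  have Df: "DGen (Diagram i v w f) \<in> diags (fp_presentation C) (map (Pair i) v) (map (Pair i) w)"
    by (rule D) (rule v w f)+
  let ?P = "fp_presentation C"
  {
    assume u: "set u \<subseteq> Obj (C i)" and g: "g \<in> Hom (C i) (tens_word (C i) w) (tens_word (C i) u)"
      and gf: "Comp (C i) g f \<in> Hom (C i) (tens_word (C i) v) (tens_word (C i) u)"
    have "deqv ?P (DComp (DGen (Diagram i w u g)) (DGen (Diagram i v w f))) (DGen (Diagram i v u (Comp (C i) g f)))"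
      by (rule deqv.rel [OF _ _ D [where v = v and w = u, OF v u gf]])
        (use Df D [where v = w and w = u, OF w u g] in \<open>auto simp: fp_rels diags_def intro: fp_rels.intros\<close>)
    then show "Comp (free_product C) (fp_mor C i w u g) (fp_mor C i v w f) = fp_mor C i v u (Comp (C i) g f)"
      using Df D [where v = w and w = u, OF w u g] by (auto simp: free_product_def fp_mor_def presented_ops diags_def cls_eqI)
  }
  {
    assume v': "set v' \<subseteq> Obj (C i)" and w': "set w' \<subseteq> Obj (C i)"
      and g: "g \<in> Hom (C i) (tens_word (C i) v') (tens_word (C i) w')"
      and fg: "TensM (C i) f g \<in> Hom (C i) (tens_word (C i) (v @ v')) (tens_word (C i) (w @ w'))"
    have "deqv ?P (DTens (DGen (Diagram i v w f)) (DGen (Diagram i v' w' g)))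
        (DGen (Diagram i (v @ v') (w @ w') (TensM (C i) f g)))"
      by (rule deqv.rel [OF _ _ D [where v = "v @ v'" and w = "w @ w'", OF _ _ fg]])
        (use Df D [where v = v' and w = w', OF v' w' g] v w v' w' in \<open>auto simp: fp_rels diags_def intro: fp_rels.intros\<close>)
    then show "TensM (free_product C) (fp_mor C i v w f) (fp_mor C i v' w' g) =
        fp_mor C i (v @ v') (w @ w') (TensM (C i) f g)"
      using Df D [where v = v' and w = w', OF v' w' g] by (auto simp: free_product_def fp_mor_def presented_ops diags_def cls_eqI)
  }
  {
    assume g: "g \<in> Hom (C i) (tens_word (C i) v) (tens_word (C i) w)"
      and fg: "Add (C i) f g \<in> Hom (C i) (tens_word (C i) v) (tens_word (C i) w)"
    have "deqv ?P (DAdd (DGen (Diagram i v w f)) (DGen (Diagram i v w g))) (DGen (Diagram i v w (Add (C i) f g)))"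
      by (rule deqv.rel [OF _ _ D [where v = v and w = w, OF v w fg]])
        (use Df D [where v = v and w = w, OF v w g] in \<open>auto simp: fp_rels diags_def intro: fp_rels.intros\<close>)
    then show "Add (free_product C) (fp_mor C i v w f) (fp_mor C i v w g) = fp_mor C i v w (Add (C i) f g)"
      using Df D [where v = v and w = w, OF v w g] by (auto simp: free_product_def fp_mor_def presented_ops diags_def cls_eqI)
  }
  {
    assume zf: "Scale (C i) z f \<in> Hom (C i) (tens_word (C i) v) (tens_word (C i) w)"
    have "deqv ?P (DScale z (DGen (Diagram i v w f))) (DGen (Diagram i v w (Scale (C i) z f)))"
      by (rule deqv.rel [OF _ _ D [where v = v and w = w, OF v w zf]])
        (use Df in \<open>auto simp: fp_rels diags_def intro: fp_rels.intros\<close>)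
    then show "Scale (free_product C) z (fp_mor C i v w f) = fp_mor C i v w (Scale (C i) z f)"
      using Df by (auto simp: free_product_def fp_mor_def presented_ops diags_def cls_eqI)
  }
  {
    assume z: "Ident (C i) (tens_word (C i) v) \<in> Hom (C i) (tens_word (C i) v) (tens_word (C i) v)"
    have "deqv ?P (DGen (Diagram i v v (Ident (C i) (tens_word (C i) v)))) (DId (map (Pair i) v))"
      by (rule deqv.rel [OF _ D [where v = v and w = v, OF v v z]])
        (use v in \<open>auto simp: fp_rels diags_def intro: fp_rels.intros\<close>)
    then show "Ident (free_product C) (map (Pair i) v) = fp_mor C i v v (Ident (C i) (tens_word (C i) v))"
      by (simp add: free_product_def fp_mor_def presented_ops cls_eqI)
  }
qed

interpretation FP: monoidal_category T2_T2
  unfolding T2_T2_def free_product_def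
  by (rule wf_presentation.monoidal_category_presented [OF fp_wf_presentation])

lemma T2_T2_objects: "TensO T2_T2 v w = v @ w" "Unit T2_T2 = []"
  "[(i, fib)] \<in> Obj T2_T2"
  using T2_objects
  by (auto simp: T2_T2_def free_product_def wf_presentation.presented_simps [OF fp_wf_presentation] fp_rels)


text \<open>The relations hold between single diagrams of the \<open>i\<close>-th copy, and
  \<open>fp_mor_ops\<close> carries each operation across.\<close>

lemma T2_T2_fibonacci:
  fixes i :: copy
  defines "X \<equiv> [(i, fib)]"
  obtains c c' v v' where
    "c \<in> Hom T2_T2 [] (X @ X)" "c' \<in> Hom T2_T2 (X @ X) []"
    "v \<in> Hom T2_T2 (X @ X) X" "v' \<in> Hom T2_T2 X (X @ X)"
    "Comp T2_T2 c' c = Scale T2_T2 (of_real tau) (Ident T2_T2 [])"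
    "Comp T2_T2 v v' = Ident T2_T2 X"
    "Add T2_T2 (Scale T2_T2 (1 / of_real tau) (Comp T2_T2 c c')) (Comp T2_T2 v' v) = Ident T2_T2 (X @ X)"
    "Comp T2_T2 (TensM T2_T2 (Ident T2_T2 X) c') (TensM T2_T2 c (Ident T2_T2 X)) = Ident T2_T2 X"
    "Comp T2_T2 (TensM T2_T2 c' (Ident T2_T2 X)) (TensM T2_T2 (Ident T2_T2 X) c) = Ident T2_T2 X"
proof -
  let ?C = "\<lambda>_ :: copy. T2"
  let ?m = "fp_mor ?C i"
  note T = T2_T2_def
  note o = T2_objects fib_morphisms fib_zigzag_factors
  note tw = fib_tens_word
  note H = fp_mor_Hom [where C = ?C and i = i]
  note ops = fp_mor_ops [where C = ?C and i = i]
  have c: "?m [] [fib, fib] fib_coev \<in> Hom T2_T2 [] (X @ X)"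
    using H [of "[]" "[fib, fib]" fib_coev] o tw by (simp add: T X_def)
  have c': "?m [fib, fib] [] fib_ev \<in> Hom T2_T2 (X @ X) []"
    using H [of "[fib, fib]" "[]" fib_ev] o tw by (simp add: T X_def)
  have v: "?m [fib, fib] [fib] fib_mult \<in> Hom T2_T2 (X @ X) X"
    using H [of "[fib, fib]" "[fib]" fib_mult] o tw by (simp add: T X_def)
  have v': "?m [fib] [fib, fib] fib_comult \<in> Hom T2_T2 X (X @ X)"
    using H [of "[fib]" "[fib, fib]" fib_comult] o tw by (simp add: T X_def)
  have i0: "Ident T2_T2 [] = ?m [] [] (Ident T2 T2_unit)"
    using ops(5) [where v = "[]" and w = "[]" and f = "Ident T2 T2_unit"] o tw by (simp add: T)
  have i1: "Ident T2_T2 X = ?m [fib] [fib] (Ident T2 fib)"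
    using ops(5) [where v = "[fib]" and w = "[fib]" and f = "Ident T2 fib"] o tw by (simp add: T X_def)
  have i2: "Ident T2_T2 (X @ X) = ?m [fib, fib] [fib, fib] (Ident T2 fib2)"
    using ops(5) [where v = "[fib, fib]" and w = "[fib, fib]" and f = "Ident T2 fib2"] o tw by (simp add: T X_def)
  have T2_Scale_Hom: "Scale T2 z f \<in> Hom T2 x y" if "f \<in> Hom T2 x y" for z f x y
    using that by (auto simp: T2_def karoubi_def full_subcategory_def Hom_def)
  have cev: "Comp T2 fib_coev fib_ev \<in> Hom T2 fib2 fib2" "Comp T2 fib_comult fib_mult \<in> Hom T2 fib2 fib2"
    using fib_composites by simp_all
  have 1: "Comp T2_T2 (?m [fib, fib] [] fib_ev) (?m [] [fib, fib] fib_coev) = Scale T2_T2 (of_real tau) (Ident T2_T2 [])"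
  proof -
    have "Comp T2_T2 (?m [fib, fib] [] fib_ev) (?m [] [fib, fib] fib_coev) =
        ?m [] [] (Scale T2 (of_real tau) (Ident T2 T2_unit))"
      using ops(1) [where v = "[]" and w = "[fib, fib]" and u = "[]" and f = fib_coev and g = fib_ev] o tw
        fib_relations T2_Scale_Hom by (simp add: T)
    also have "\<dots> = Scale T2_T2 (of_real tau) (Ident T2_T2 [])"
      using ops(4) [where v = "[]" and w = "[]" and f = "Ident T2 T2_unit" and z = "of_real tau"] o tw
        T2_Scale_Hom i0 by (simp add: T)
    finally show ?thesis .
  qed
  have 2: "Comp T2_T2 (?m [fib, fib] [fib] fib_mult) (?m [fib] [fib, fib] fib_comult) = Ident T2_T2 X"
    using ops(1) [where v = "[fib]" and w = "[fib, fib]" and u = "[fib]" and f = fib_comult and g = fib_mult] o tw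
      fib_relations i1 by (simp add: T)
  have 3: "Add T2_T2 (Scale T2_T2 (1 / of_real tau) (Comp T2_T2 (?m [] [fib, fib] fib_coev) (?m [fib, fib] [] fib_ev)))
     (Comp T2_T2 (?m [fib] [fib, fib] fib_comult) (?m [fib, fib] [fib] fib_mult)) = Ident T2_T2 (X @ X)"
  proof -
    have "Comp T2_T2 (?m [] [fib, fib] fib_coev) (?m [fib, fib] [] fib_ev) = ?m [fib, fib] [fib, fib] (Comp T2 fib_coev fib_ev)"
      using ops(1) [where v = "[fib, fib]" and w = "[]" and u = "[fib, fib]" and g = fib_coev and f = fib_ev] o tw cev
      by (simp add: T)
    moreover have "Comp T2_T2 (?m [fib] [fib, fib] fib_comult) (?m [fib, fib] [fib] fib_mult) =
        ?m [fib, fib] [fib, fib] (Comp T2 fib_comult fib_mult)"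
      using ops(1) [where v = "[fib, fib]" and w = "[fib]" and u = "[fib, fib]" and g = fib_comult and f = fib_mult] o tw cev
      by (simp add: T)
    moreover have "Scale T2_T2 z (?m [fib, fib] [fib, fib] (Comp T2 fib_coev fib_ev)) =
        ?m [fib, fib] [fib, fib] (Scale T2 z (Comp T2 fib_coev fib_ev))" for z
      using ops(4) [where v = "[fib, fib]" and w = "[fib, fib]" and z = z and f = "Comp T2 fib_coev fib_ev"] o tw cev
        T2_Scale_Hom by (simp add: T)
    moreover have "Add T2_T2 (?m [fib, fib] [fib, fib] (Scale T2 (1 / of_real tau) (Comp T2 fib_coev fib_ev)))
        (?m [fib, fib] [fib, fib] (Comp T2 fib_comult fib_mult)) = ?m [fib, fib] [fib, fib] (Ident T2 fib2)"
      using ops(3) [where v = "[fib, fib]" and w = "[fib, fib]" and f = "Scale T2 (1 / of_real tau) (Comp T2 fib_coev fib_ev)"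
          and g = "Comp T2 fib_comult fib_mult"] o tw cev T2_Scale_Hom fib_relations by (simp add: T)
    ultimately show ?thesis using i2 by simp
  qed
  have 4: "Comp T2_T2 (TensM T2_T2 (Ident T2_T2 X) (?m [fib, fib] [] fib_ev))
      (TensM T2_T2 (?m [] [fib, fib] fib_coev) (Ident T2_T2 X)) = Ident T2_T2 X"
  proof -
    have "TensM T2_T2 (Ident T2_T2 X) (?m [fib, fib] [] fib_ev) = ?m [fib, fib, fib] [fib] (TensM T2 (Ident T2 fib) fib_ev)"
      unfolding i1 using ops(2) [where v = "[fib]" and w = "[fib]" and v' = "[fib, fib]" and w' = "[]"
          and f = "Ident T2 fib" and g = fib_ev] o tw by (simp add: T)
    moreover have "TensM T2_T2 (?m [] [fib, fib] fib_coev) (Ident T2_T2 X) =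
        ?m [fib] [fib, fib, fib] (TensM T2 fib_coev (Ident T2 fib))"
      unfolding i1 using ops(2) [where v = "[]" and w = "[fib, fib]" and v' = "[fib]" and w' = "[fib]"
          and f = fib_coev and g = "Ident T2 fib"] o tw by (simp add: T)
    ultimately show ?thesis
      using ops(1) [where v = "[fib]" and w = "[fib, fib, fib]" and u = "[fib]" and
          f = "TensM T2 fib_coev (Ident T2 fib)" and g = "TensM T2 (Ident T2 fib) fib_ev"] o tw fib_relations i1
      by (simp add: T)
  qed
  have 5: "Comp T2_T2 (TensM T2_T2 (?m [fib, fib] [] fib_ev) (Ident T2_T2 X))
      (TensM T2_T2 (Ident T2_T2 X) (?m [] [fib, fib] fib_coev)) = Ident T2_T2 X"
  proof -
    have "TensM T2_T2 (?m [fib, fib] [] fib_ev) (Ident T2_T2 X) = ?m [fib, fib, fib] [fib] (TensM T2 fib_ev (Ident T2 fib))"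
      unfolding i1 using ops(2) [where v = "[fib, fib]" and w = "[]" and v' = "[fib]" and w' = "[fib]"
          and g = "Ident T2 fib" and f = fib_ev] o tw by (simp add: T)
    moreover have "TensM T2_T2 (Ident T2_T2 X) (?m [] [fib, fib] fib_coev) =
        ?m [fib] [fib, fib, fib] (TensM T2 (Ident T2 fib) fib_coev)"
      unfolding i1 using ops(2) [where v = "[fib]" and w = "[fib]" and v' = "[]" and w' = "[fib, fib]"
          and g = fib_coev and f = "Ident T2 fib"] o tw by (simp add: T)
    ultimately show ?thesis
      using ops(1) [where v = "[fib]" and w = "[fib, fib, fib]" and u = "[fib]" and
          f = "TensM T2 (Ident T2 fib) fib_coev" and g = "TensM T2 fib_ev (Ident T2 fib)"] o tw fib_relations i1
      by (simp add: T)
  qed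
  show thesis by (rule that [OF c c' v v' 1 2 3 4 5])
qed

section \<open>Isomorphic objects and images under tensor functors\<close>

context linear_category
begin

lemma isomorphic_refl: "a \<in> Obj C \<Longrightarrow> isomorphic C a a"
  by (rule isomorphicI [of "\<i> a" _ _ "\<i> a"]) (auto simp: HomI)

lemma isomorphic_sym: "isomorphic C a b \<Longrightarrow> isomorphic C b a"
  unfolding isomorphic_def Defs.is_iso_def by blast

lemma isomorphic_trans:
  assumes "isomorphic C a b" "isomorphic C b c"
  shows "isomorphic C a c"
proof -
  obtain f where "is_iso C a b f" using assms(1) by (auto simp: isomorphic_def)
  then obtain f' where f [simp]: "f \<in> Mor C" "Dom C f = a" "Cod C f = b" "f' \<in> Mor C" "Dom C f' = b" "Cod C f' = a"
      and ff: "f' \<star> f = \<i> a" "f \<star> f' = \<i> b" by (rule is_isoE)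
  obtain g where "is_iso C b c g" using assms(2) by (auto simp: isomorphic_def)
  then obtain g' where g [simp]: "g \<in> Mor C" "Dom C g = b" "Cod C g = c" "g' \<in> Mor C" "Dom C g' = c" "Cod C g' = b"
      and gg: "g' \<star> g = \<i> b" "g \<star> g' = \<i> c" by (rule is_isoE)
  have "(f' \<star> g') \<star> (g \<star> f) = f' \<star> (g' \<star> g) \<star> f" "(g \<star> f) \<star> (f' \<star> g') = g \<star> (f \<star> f') \<star> g'"
    by (simp_all add: assoc)
  then show ?thesis
    by (intro isomorphicI [of "g \<star> f" _ _ "f' \<star> g'"]) (auto simp: HomI ff gg)
qed

end

lemma (in monoidal_category) isomorphic_tens:
  assumes "isomorphic C a b" "isomorphic C c d"
  shows "isomorphic C (a \<boxtimes> c) (b \<boxtimes> d)"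
proof -
  obtain f where "is_iso C a b f" using assms(1) by (auto simp: isomorphic_def)
  then obtain f' where f [simp]: "f \<in> Mor C" "Dom C f = a" "Cod C f = b" "f' \<in> Mor C" "Dom C f' = b" "Cod C f' = a"
      and ff: "f' \<star> f = \<i> a" "f \<star> f' = \<i> b" by (rule is_isoE)
  obtain g where "is_iso C c d g" using assms(2) by (auto simp: isomorphic_def)
  then obtain g' where g [simp]: "g \<in> Mor C" "Dom C g = c" "Cod C g = d" "g' \<in> Mor C" "Dom C g' = d" "Cod C g' = c"
      and gg: "g' \<star> g = \<i> c" "g \<star> g' = \<i> d" by (rule is_isoE)
  have [simp]: "a \<in> Obj C" "b \<in> Obj C" "c \<in> Obj C" "d \<in> Obj C"
    using f g mor_Obj by metis+
  show ?thesis
    by (rule isomorphicI [of "f \<otimes>\<^sub>c g" _ _ "f' \<otimes>\<^sub>c g'"]) (auto simp: HomI tens_comp ff gg)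
qed

text \<open>A monoidal certificate that \<open>x\<close> is a self-dual object with loop value
  \<tau> and square \<open>1 + x\<close>: \<open>c\<close>, \<open>c'\<close> are cup and cap,
  \<open>v\<close>, \<open>v'\<close> the two trivalent vertices. Only the linear monoidal structure
  occurs in it, so a tensor functor can transport it.\<close>

definition fib_object where
  "fib_object C x c c' v v' \<longleftrightarrow> x \<in> Obj C \<and>
     c \<in> Hom C (Unit C) (x \<boxtimes>\<^bsub>C\<^esub> x) \<and> c' \<in> Hom C (x \<boxtimes>\<^bsub>C\<^esub> x) (Unit C) \<and>
     v \<in> Hom C (x \<boxtimes>\<^bsub>C\<^esub> x) x \<and> v' \<in> Hom C x (x \<boxtimes>\<^bsub>C\<^esub> x) \<and>
     Comp C c' c = Scale C (of_real tau) (Ident C (Unit C)) \<and>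
     Comp C v v' = Ident C x \<and>
     Add C (Scale C (1 / of_real tau) (Comp C c c')) (Comp C v' v) = Ident C (x \<boxtimes>\<^bsub>C\<^esub> x) \<and>
     Comp C (TensM C (Ident C x) c') (TensM C c (Ident C x)) = Ident C x \<and>
     Comp C (TensM C c' (Ident C x)) (TensM C (Ident C x) c) = Ident C x"

lemma T2_T2_fib_object: "\<exists>c c' v v'. fib_object T2_T2 [(i, fib)] c c' v v'"
  by (rule T2_T2_fibonacci [of i]) (auto simp: fib_object_def T2_T2_objects)

text \<open>The images of the four morphisms are conjugated by the structure isomorphisms. Loop,
  vertex and completeness relations follow by cancelling inverses; the zigzags need the coherence
  axioms.\<close>

lemma (in tensor_functor) fib_object_image:
  assumes C: "monoidal_category C" and D: "monoidal_category D" and x: "fib_object C x c c' v v'"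
  shows "\<exists>c c' v v'. fib_object D (FObj F x) c c' v v'"
proof -
  interpret C: monoidal_category C by (rule C)
  interpret D: monoidal_category D by (rule D)
  let ?G = "FMor F" and ?t = "FTens F" and ?x = "FObj F x" and ?u = "FUnit F"
  have X [simp]: "x \<in> Obj C" "?x \<in> Obj D"
    and H: "c \<in> Hom C (Unit C) (x \<boxtimes>\<^bsub>C\<^esub> x)" "c' \<in> Hom C (x \<boxtimes>\<^bsub>C\<^esub> x) (Unit C)"
      "v \<in> Hom C (x \<boxtimes>\<^bsub>C\<^esub> x) x" "v' \<in> Hom C x (x \<boxtimes>\<^bsub>C\<^esub> x)"
    using x FObj_Obj by (auto simp: fib_object_def)
  note [simp] = C.HomD [OF H(1)] C.HomD [OF H(2)] C.HomD [OF H(3)] C.HomD [OF H(4)]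
  note GH [simp] = D.HomD [OF FMor_Hom [OF H(1)]] D.HomD [OF FMor_Hom [OF H(2)]]
    D.HomD [OF FMor_Hom [OF H(3)]] D.HomD [OF FMor_Hom [OF H(4)]]
  obtain u' where u [simp]: "?u \<in> Mor D" "Dom D ?u = Unit D" "Cod D ?u = FObj F (Unit C)"
      "u' \<in> Mor D" "Dom D u' = FObj F (Unit C)" "Cod D u' = Unit D"
      and uu: "D.cmp u' ?u = D.idm (Unit D)" "D.cmp ?u u' = D.idm (FObj F (Unit C))"
    using FUnit_iso by (rule D.is_isoE)
  obtain t' where t [simp]: "?t x x \<in> Mor D" "Dom D (?t x x) = ?x \<boxtimes>\<^bsub>D\<^esub> ?x" "Cod D (?t x x) = FObj F (x \<boxtimes>\<^bsub>C\<^esub> x)"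
      "t' \<in> Mor D" "Dom D t' = FObj F (x \<boxtimes>\<^bsub>C\<^esub> x)" "Cod D t' = ?x \<boxtimes>\<^bsub>D\<^esub> ?x"
      and tt: "D.cmp t' (?t x x) = D.idm (?x \<boxtimes>\<^bsub>D\<^esub> ?x)" "D.cmp (?t x x) t' = D.idm (FObj F (x \<boxtimes>\<^bsub>C\<^esub> x))"
    using FTens_iso [OF X(1) X(1)] by (rule D.is_isoE)
  have tm: "?t a b \<in> Mor D" "Dom D (?t a b) = FObj F a \<boxtimes>\<^bsub>D\<^esub> FObj F b" "Cod D (?t a b) = FObj F (a \<boxtimes>\<^bsub>C\<^esub> b)"
    if "a \<in> Obj C" "b \<in> Obj C" for a b
    using FTens_iso [OF that] by (auto elim!: D.is_isoE)
  have O [simp]: "FObj F a \<in> Obj D" if "a \<in> Obj C" for a by (rule FObj_Obj [OF that])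
  define k where "k = D.cmp t' (D.cmp (?G c) ?u)"
  define k' where "k' = D.cmp u' (D.cmp (?G c') (?t x x))"
  define w where "w = D.cmp (?G v) (?t x x)"
  define w' where "w' = D.cmp t' (?G v')"
  have km [simp]: "k \<in> Mor D" "Dom D k = Unit D" "Cod D k = ?x \<boxtimes>\<^bsub>D\<^esub> ?x"
    "k' \<in> Mor D" "Dom D k' = ?x \<boxtimes>\<^bsub>D\<^esub> ?x" "Cod D k' = Unit D"
    "w \<in> Mor D" "Dom D w = ?x \<boxtimes>\<^bsub>D\<^esub> ?x" "Cod D w = ?x"
    "w' \<in> Mor D" "Dom D w' = ?x" "Cod D w' = ?x \<boxtimes>\<^bsub>D\<^esub> ?x"
    by (simp_all add: k_def k'_def w_def w'_def)
  have tt1: "D.cmp (?t x x) (D.cmp t' g) = g" if "g \<in> Mor D" "Cod D g = FObj F (x \<boxtimes>\<^bsub>C\<^esub> x)" for g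
    using that D.assoc [of g t' "?t x x"] by (simp add: tt)
  have uu1: "D.cmp ?u (D.cmp u' g) = g" if "g \<in> Mor D" "Cod D g = FObj F (Unit C)" for g
    using that D.assoc [of g u' ?u] by (simp add: uu)
  note GC = FMor_Comp [symmetric]
  have 1: "D.cmp k' k = D.scl (of_real tau) (D.idm (Unit D))"
  proof -
    have "D.cmp k' k = D.cmp u' (D.cmp (D.cmp (?G c') (?G c)) ?u)"
      by (simp add: k_def k'_def D.assoc tt1)
    also have "D.cmp (?G c') (?G c) = D.scl (of_real tau) (D.idm (FObj F (Unit C)))"
      using x by (simp add: GC [OF H(1) H(2)] fib_object_def FMor_Scale FMor_Ident)
    finally show ?thesis by (simp add: uu)
  qed
  have 2: "D.cmp w w' = D.idm ?x"
  proof -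
    have "D.cmp w w' = D.cmp (?G v) (?G v')" by (simp add: w_def w'_def D.assoc tt1)
    also have "\<dots> = D.idm ?x" using x by (simp add: GC [OF H(4) H(3)] fib_object_def FMor_Ident)
    finally show ?thesis .
  qed
  have 3: "D.pls (D.scl (1 / of_real tau) (D.cmp k k')) (D.cmp w' w) = D.idm (?x \<boxtimes>\<^bsub>D\<^esub> ?x)"
  proof -
    have "D.cmp k k' = D.cmp t' (D.cmp (D.cmp (?G c) (?G c')) (?t x x))"
      by (simp add: k_def k'_def D.assoc uu1)
    moreover have "D.cmp w' w = D.cmp t' (D.cmp (D.cmp (?G v') (?G v)) (?t x x))"
      by (simp add: w_def w'_def D.assoc)
    ultimately have "D.pls (D.scl (1 / of_real tau) (D.cmp k k')) (D.cmp w' w) = D.cmp t' (D.cmp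
      (D.pls (D.scl (1 / of_real tau) (D.cmp (?G c) (?G c'))) (D.cmp (?G v') (?G v))) (?t x x))"
      by (simp add: D.comp_add_left D.comp_add_right)
    also have "D.pls (D.scl (1 / of_real tau) (D.cmp (?G c) (?G c'))) (D.cmp (?G v') (?G v)) =
        ?G (C.pls (C.scl (1 / of_real tau) (C.cmp c c')) (C.cmp v' v))"
      by (subst FMor_Add [of _ "x \<boxtimes>\<^bsub>C\<^esub> x" "x \<boxtimes>\<^bsub>C\<^esub> x"])
        (simp_all add: C.HomI FMor_Scale FMor_Comp [OF H(2) H(1)] FMor_Comp [OF H(3) H(4)])
    also have "\<dots> = D.idm (FObj F (x \<boxtimes>\<^bsub>C\<^esub> x))"
      using x by (simp add: fib_object_def FMor_Ident)
    finally show ?thesis by (simp add: tt)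
  qed
  have Gk: "D.cmp (?G c) ?u = D.cmp (?t x x) k" "D.cmp (?G c') (?t x x) = D.cmp ?u k'"
    by (simp_all add: k_def k'_def tt1 uu1)
  note I = C.Ident_Hom [OF X(1)]
  have GI: "?G (C.idm x) = D.idm ?x" by (simp add: FMor_Ident)
  have 4: "D.cmp (D.tns (D.idm ?x) k') (D.tns k (D.idm ?x)) = D.idm ?x"
  proof -
    \<comment> \<open>Unit coherence inserts \<open>?u\<close>; naturality then joins it to the
      image of \<open>c\<close>, and associativity of \<open>?t\<close> prepares the cancellation
      with the other half of the zigzag.\<close>
    have "?G (C.tns c (C.idm x)) = D.cmp (?G (C.tns c (C.idm x))) (D.cmp (?t (Unit C) x) (D.tns ?u (D.idm ?x)))"
      using FUnit_left [OF X(1)] D.HomD [OF FMor_Hom [OF C.TensM_Hom [OF H(1) I]]] by simp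
    also have "\<dots> = D.cmp (D.cmp (?G (C.tns c (C.idm x))) (?t (Unit C) x)) (D.tns ?u (D.idm ?x))"
      using tm [of "Unit C" x] D.HomD [OF FMor_Hom [OF C.TensM_Hom [OF H(1) I]]] by (simp add: D.assoc)
    also have "\<dots> = D.cmp (?t (x \<boxtimes>\<^bsub>C\<^esub> x) x) (D.tns (D.cmp (?G c) ?u) (D.idm ?x))"
      using FTens_natural [OF H(1) I] tm [of "x \<boxtimes>\<^bsub>C\<^esub> x" x] by (simp add: D.assoc D.tens_comp GI flip: FTens_natural [OF H(1) I])
    also have "\<dots> = D.cmp (D.cmp (?t (x \<boxtimes>\<^bsub>C\<^esub> x) x) (D.tns (?t x x) (D.idm ?x))) (D.tns k (D.idm ?x))"
      unfolding Gk using tm [of "x \<boxtimes>\<^bsub>C\<^esub> x" x] by (simp add: D.assoc D.tens_comp)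
    also have "\<dots> = D.cmp (?t x (x \<boxtimes>\<^bsub>C\<^esub> x)) (D.cmp (D.tns (D.idm ?x) (?t x x)) (D.tns k (D.idm ?x)))"
      unfolding FTens_assoc [OF X(1) X(1) X(1)] using tm [of x "x \<boxtimes>\<^bsub>C\<^esub> x"] by (simp add: D.assoc)
    finally have r: "?G (C.tns c (C.idm x)) = \<dots>" .
    have "D.cmp (?G (C.tns (C.idm x) c')) (D.cmp (?t x (x \<boxtimes>\<^bsub>C\<^esub> x)) (D.tns (D.idm ?x) (?t x x))) =
        D.cmp (D.cmp (?t x (Unit C)) (D.tns (D.idm ?x) (?G c'))) (D.tns (D.idm ?x) (?t x x))"
      using FTens_natural [OF I H(2)] tm [of x "x \<boxtimes>\<^bsub>C\<^esub> x"] D.HomD [OF FMor_Hom [OF C.TensM_Hom [OF I H(2)]]]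
      by (simp add: D.assoc GI)
    also have "\<dots> = D.cmp (D.cmp (?t x (Unit C)) (D.tns (D.idm ?x) ?u)) (D.tns (D.idm ?x) k')"
      using tm [of x "Unit C"] by (simp add: D.assoc D.tens_comp Gk)
    also have "\<dots> = D.tns (D.idm ?x) k'"
      using FUnit_right [OF X(1)] by simp
    finally have l: "D.cmp (?G (C.tns (C.idm x) c')) (D.cmp (?t x (x \<boxtimes>\<^bsub>C\<^esub> x)) (D.tns (D.idm ?x) (?t x x))) =
        D.tns (D.idm ?x) k'" .
    have "D.idm ?x = ?G (C.cmp (C.tns (C.idm x) c') (C.tns c (C.idm x)))"
      using x by (simp add: fib_object_def GI)
    also have "\<dots> = D.cmp (?G (C.tns (C.idm x) c')) (?G (C.tns c (C.idm x)))"
      by (rule FMor_Comp) (use C.TensM_Hom [OF H(1) I] C.TensM_Hom [OF I H(2)] in simp_all)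
    also have "\<dots> = D.cmp (D.tns (D.idm ?x) k') (D.tns k (D.idm ?x))"
      unfolding r l [symmetric] using tm [of x "x \<boxtimes>\<^bsub>C\<^esub> x"] D.HomD [OF FMor_Hom [OF C.TensM_Hom [OF I H(2)]]]
      by (simp add: D.assoc)
    finally show ?thesis by simp
  qed
  have 5: "D.cmp (D.tns k' (D.idm ?x)) (D.tns (D.idm ?x) k) = D.idm ?x"
  proof -
    have "?G (C.tns (C.idm x) c) = D.cmp (?G (C.tns (C.idm x) c)) (D.cmp (?t x (Unit C)) (D.tns (D.idm ?x) ?u))"
      using FUnit_right [OF X(1)] D.HomD [OF FMor_Hom [OF C.TensM_Hom [OF I H(1)]]] by simp
    also have "\<dots> = D.cmp (D.cmp (?G (C.tns (C.idm x) c)) (?t x (Unit C))) (D.tns (D.idm ?x) ?u)"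
      using tm [of x "Unit C"] D.HomD [OF FMor_Hom [OF C.TensM_Hom [OF I H(1)]]] by (simp add: D.assoc)
    also have "\<dots> = D.cmp (?t x (x \<boxtimes>\<^bsub>C\<^esub> x)) (D.tns (D.idm ?x) (D.cmp (?G c) ?u))"
      using FTens_natural [OF I H(1)] tm [of x "x \<boxtimes>\<^bsub>C\<^esub> x"] by (simp add: D.assoc D.tens_comp GI flip: FTens_natural [OF I H(1)])
    also have "\<dots> = D.cmp (D.cmp (?t x (x \<boxtimes>\<^bsub>C\<^esub> x)) (D.tns (D.idm ?x) (?t x x))) (D.tns (D.idm ?x) k)"
      unfolding Gk using tm [of x "x \<boxtimes>\<^bsub>C\<^esub> x"] by (simp add: D.assoc D.tens_comp)
    also have "\<dots> = D.cmp (?t (x \<boxtimes>\<^bsub>C\<^esub> x) x) (D.cmp (D.tns (?t x x) (D.idm ?x)) (D.tns (D.idm ?x) k))"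
      unfolding FTens_assoc [OF X(1) X(1) X(1), symmetric] using tm [of "x \<boxtimes>\<^bsub>C\<^esub> x" x] by (simp add: D.assoc)
    finally have r: "?G (C.tns (C.idm x) c) = \<dots>" .
    have "D.cmp (?G (C.tns c' (C.idm x))) (D.cmp (?t (x \<boxtimes>\<^bsub>C\<^esub> x) x) (D.tns (?t x x) (D.idm ?x))) =
        D.cmp (D.cmp (?t (Unit C) x) (D.tns (?G c') (D.idm ?x))) (D.tns (?t x x) (D.idm ?x))"
      using FTens_natural [OF H(2) I] tm [of "x \<boxtimes>\<^bsub>C\<^esub> x" x] D.HomD [OF FMor_Hom [OF C.TensM_Hom [OF H(2) I]]]
      by (simp add: D.assoc GI)
    also have "\<dots> = D.cmp (D.cmp (?t (Unit C) x) (D.tns ?u (D.idm ?x))) (D.tns k' (D.idm ?x))"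
      using tm [of "Unit C" x] by (simp add: D.assoc D.tens_comp Gk)
    also have "\<dots> = D.tns k' (D.idm ?x)"
      using FUnit_left [OF X(1)] by simp
    finally have l: "D.cmp (?G (C.tns c' (C.idm x))) (D.cmp (?t (x \<boxtimes>\<^bsub>C\<^esub> x) x) (D.tns (?t x x) (D.idm ?x))) =
        D.tns k' (D.idm ?x)" .
    have "D.idm ?x = ?G (C.cmp (C.tns c' (C.idm x)) (C.tns (C.idm x) c))"
      using x by (simp add: fib_object_def GI)
    also have "\<dots> = D.cmp (?G (C.tns c' (C.idm x))) (?G (C.tns (C.idm x) c))"
      by (rule FMor_Comp) (use C.TensM_Hom [OF I H(1)] C.TensM_Hom [OF H(2) I] in simp_all)
    also have "\<dots> = D.cmp (D.tns k' (D.idm ?x)) (D.tns (D.idm ?x) k)"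
      unfolding r l [symmetric] using tm [of "x \<boxtimes>\<^bsub>C\<^esub> x" x] D.HomD [OF FMor_Hom [OF C.TensM_Hom [OF H(2) I]]]
      by (simp add: D.assoc)
    finally show ?thesis by simp
  qed
  have "fib_object D ?x k k' w w'"
    unfolding fib_object_def using 1 2 3 4 5 by (simp add: D.HomI)
  then show ?thesis by blast
qed

text \<open>After this, a word in the source may be replaced by a tensor product of images of its
  letters, and the functor no longer appears.\<close>

lemma tensor_functor_word_image:
  fixes C :: "('a list, 'm) pcat" and D :: "('p, 'k) pcat"
  assumes F: "tensor_functor C D F" and D: "monoidal_category D" and U: "Unit C = []" "\<And>v w. v \<boxtimes>\<^bsub>C\<^esub> w = v @ w"
    and C: "monoidal_category C" and w: "\<And>a. a \<in> set w \<Longrightarrow> [a] \<in> Obj C"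
  shows "w \<in> Obj C \<and> isomorphic D (foldr (\<lambda>a. TensO D (FObj F [a])) w (Unit D)) (FObj F w)"
proof -
  interpret C: monoidal_category C by (rule C)
  interpret D: monoidal_category D by (rule D)
  interpret tensor_functor C D F by (rule F)
  show ?thesis using w
  proof (induction w)
    case Nil
    then show ?case using FUnit_iso C.Unit_Obj U by (auto simp: isomorphic_def)
  next
    case (Cons a w)
    then have a: "[a] \<in> Obj C" and w: "w \<in> Obj C" by auto
    have "isomorphic D (FObj F [a] \<boxtimes>\<^bsub>D\<^esub> FObj F w) (FObj F ([a] @ w))"
      using FTens_iso [OF a w] U by (auto simp: isomorphic_def)
    then show ?case
      using D.isomorphic_trans [OF D.isomorphic_tens [OF D.isomorphic_refl [OF FObj_Obj [OF a]]]]
        Cons C.TensO_Obj [OF a w] U by auto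
  qed
qed

section \<open>Traces in pivotal categories\<close>

context pivotal_category
begin

abbreviation dual ("_\<^sup>d" [1000] 1000) where "a\<^sup>d \<equiv> Dual C a"

lemma dual_simps [simp]:
  "a \<in> Obj C \<Longrightarrow> a\<^sup>d \<in> Obj C" "a \<in> Obj C \<Longrightarrow> (a\<^sup>d)\<^sup>d = a"
  "\<lbrakk>a \<in> Obj C; b \<in> Obj C\<rbrakk> \<Longrightarrow> (a \<boxtimes> b)\<^sup>d = b\<^sup>d \<boxtimes> a\<^sup>d" "Dual C (Unit C) = Unit C"
  by (simp_all add: Dual_Obj Dual_Dual Dual_TensO Dual_Unit)

lemma mor_ev [simp]:
  assumes "a \<in> Obj C"
  shows "Ev C a \<in> Mor C" "Dom C (Ev C a) = a\<^sup>d \<boxtimes> a" "Cod C (Ev C a) = Unit C"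
    "Coev C a \<in> Mor C" "Dom C (Coev C a) = Unit C" "Cod C (Coev C a) = a \<boxtimes> a\<^sup>d"
  using HomD [OF Ev_Hom [OF assms]] HomD [OF Coev_Hom [OF assms]] by simp_all

text \<open>A morphism on one leg of a cup moves to the other leg as its dual; the bend inside
  \<open>right_dual\<close> is straightened by a zigzag.\<close>

lemma coev_slide:
  assumes [simp]: "f \<in> Mor C" "Dom C f = a" "Cod C f = b"
  shows "(\<i> b \<otimes>\<^sub>c right_dual C f) \<star> Coev C b = (f \<otimes>\<^sub>c \<i> (a\<^sup>d)) \<star> Coev C a"
proof -
  have ab [simp]: "a \<in> Obj C" "b \<in> Obj C" using assms mor_Obj by metis+
  let ?k = "(f \<otimes>\<^sub>c \<i> (a\<^sup>d)) \<star> Coev C a"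
  have k [simp]: "?k \<in> Mor C" "Dom C ?k = Unit C" "Cod C ?k = b \<boxtimes> a\<^sup>d" by simp_all
  have "right_dual C f = (Ev C b \<otimes>\<^sub>c \<i> (a\<^sup>d)) \<star> (\<i> (b\<^sup>d) \<otimes>\<^sub>c ?k)"
    by (simp add: right_dual_def Let_def tens_comp)
  then have "(\<i> b \<otimes>\<^sub>c right_dual C f) \<star> Coev C b =
      (\<i> b \<otimes>\<^sub>c Ev C b \<otimes>\<^sub>c \<i> (a\<^sup>d)) \<star> (\<i> b \<otimes>\<^sub>c \<i> (b\<^sup>d) \<otimes>\<^sub>c ?k) \<star> Coev C b"
    by (simp add: tens_comp_right assoc)
  also have "(\<i> b \<otimes>\<^sub>c \<i> (b\<^sup>d) \<otimes>\<^sub>c ?k) \<star> Coev C b = (Coev C b \<otimes>\<^sub>c \<i> b \<otimes>\<^sub>c \<i> (a\<^sup>d)) \<star> ?k"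
    using slide [of "Coev C b" ?k] by simp
  also have "(\<i> b \<otimes>\<^sub>c Ev C b \<otimes>\<^sub>c \<i> (a\<^sup>d)) \<star> (Coev C b \<otimes>\<^sub>c \<i> b \<otimes>\<^sub>c \<i> (a\<^sup>d)) \<star> ?k =
      (((\<i> b \<otimes>\<^sub>c Ev C b) \<star> (Coev C b \<otimes>\<^sub>c \<i> b)) \<otimes>\<^sub>c \<i> (a\<^sup>d)) \<star> ?k"
    by (simp add: tens_comp_left assoc del: tens_ident)
  finally show ?thesis by (simp add: zigzag)
qed

lemma ev_slide:
  assumes [simp]: "f \<in> Mor C" "Dom C f = a" "Cod C f = b"
  shows "Ev C (a\<^sup>d) \<star> (\<i> a \<otimes>\<^sub>c left_dual C f) = Ev C (b\<^sup>d) \<star> (f \<otimes>\<^sub>c \<i> (b\<^sup>d))"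
proof -
  have ab [simp]: "a \<in> Obj C" "b \<in> Obj C" using assms mor_Obj by metis+
  let ?k = "Ev C (b\<^sup>d) \<star> (f \<otimes>\<^sub>c \<i> (b\<^sup>d))"
  have k [simp]: "?k \<in> Mor C" "Dom C ?k = a \<boxtimes> b\<^sup>d" "Cod C ?k = Unit C" by simp_all
  have "left_dual C f = (\<i> (a\<^sup>d) \<otimes>\<^sub>c ?k) \<star> (Coev C (a\<^sup>d) \<otimes>\<^sub>c \<i> (b\<^sup>d))"
    by (simp add: left_dual_def Let_def tens_comp_right assoc)
  then have "Ev C (a\<^sup>d) \<star> (\<i> a \<otimes>\<^sub>c left_dual C f) =
      (Ev C (a\<^sup>d) \<star> (\<i> a \<otimes>\<^sub>c \<i> (a\<^sup>d) \<otimes>\<^sub>c ?k)) \<star> (\<i> a \<otimes>\<^sub>c Coev C (a\<^sup>d) \<otimes>\<^sub>c \<i> (b\<^sup>d))"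
    by (simp add: tens_comp_right assoc)
  also have "Ev C (a\<^sup>d) \<star> (\<i> a \<otimes>\<^sub>c \<i> (a\<^sup>d) \<otimes>\<^sub>c ?k) = ?k \<star> (Ev C (a\<^sup>d) \<otimes>\<^sub>c \<i> a \<otimes>\<^sub>c \<i> (b\<^sup>d))"
    using slide [of "Ev C (a\<^sup>d)" ?k] by simp
  also have "(?k \<star> (Ev C (a\<^sup>d) \<otimes>\<^sub>c \<i> a \<otimes>\<^sub>c \<i> (b\<^sup>d))) \<star> (\<i> a \<otimes>\<^sub>c Coev C (a\<^sup>d) \<otimes>\<^sub>c \<i> (b\<^sup>d)) =
      ?k \<star> (((Ev C (a\<^sup>d) \<otimes>\<^sub>c \<i> a) \<star> (\<i> a \<otimes>\<^sub>c Coev C (a\<^sup>d))) \<otimes>\<^sub>c \<i> (b\<^sup>d))"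
    by (simp add: tens_comp_left assoc del: tens_ident)
  finally show ?thesis using zigzag_Dual [of "a\<^sup>d"] by simp
qed

definition tr where "tr a f = Ev C (a\<^sup>d) \<star> (f \<otimes>\<^sub>c \<i> (a\<^sup>d)) \<star> Coev C a"

lemma mor_tr [simp]:
  assumes "f \<in> Mor C" "Dom C f = a" "Cod C f = a" "a \<in> Obj C"
  shows "tr a f \<in> Mor C" "Dom C (tr a f) = Unit C" "Cod C (tr a f) = Unit C"
  using assms by (simp_all add: tr_def)

lemma mor_right_dual:
  assumes [simp]: "f \<in> Mor C" "Dom C f = a" "Cod C f = b"
  shows "right_dual C f \<in> Mor C" "Dom C (right_dual C f) = b\<^sup>d" "Cod C (right_dual C f) = a\<^sup>d"
proof -
  have [simp]: "a \<in> Obj C" "b \<in> Obj C" using assms mor_Obj by metis+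
  show "right_dual C f \<in> Mor C" "Dom C (right_dual C f) = b\<^sup>d" "Cod C (right_dual C f) = a\<^sup>d"
    by (simp_all add: right_dual_def Let_def)
qed

text \<open>\<open>f\<close> is moved around the closed strand. It passes the cup as its right dual
  and the cap as its left dual, which agree by the pivotal axiom.\<close>

lemma tr_commute:
  assumes [simp]: "f \<in> Mor C" "Dom C f = a" "Cod C f = b" "g \<in> Mor C" "Dom C g = b" "Cod C g = a"
  shows "tr a (g \<star> f) = tr b (f \<star> g)"
proof -
  have [simp]: "a \<in> Obj C" "b \<in> Obj C" using assms mor_Obj by metis+
  note [simp] = mor_right_dual [OF assms(1-3)]
  have "tr a (g \<star> f) = Ev C (a\<^sup>d) \<star> (g \<otimes>\<^sub>c \<i> (a\<^sup>d)) \<star> (f \<otimes>\<^sub>c \<i> (a\<^sup>d)) \<star> Coev C a"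
    by (simp add: tr_def tens_comp_left assoc)
  also have "\<dots> = Ev C (a\<^sup>d) \<star> ((g \<otimes>\<^sub>c \<i> (a\<^sup>d)) \<star> (\<i> b \<otimes>\<^sub>c right_dual C f)) \<star> Coev C b"
    by (simp add: coev_slide [OF assms(1-3), symmetric] assoc)
  also have "(g \<otimes>\<^sub>c \<i> (a\<^sup>d)) \<star> (\<i> b \<otimes>\<^sub>c right_dual C f) = (\<i> a \<otimes>\<^sub>c left_dual C f) \<star> (g \<otimes>\<^sub>c \<i> (b\<^sup>d))"
    using slide [of g "right_dual C f"] by (simp add: pivotal)
  also have "Ev C (a\<^sup>d) \<star> \<dots> \<star> Coev C b = (Ev C (a\<^sup>d) \<star> (\<i> a \<otimes>\<^sub>c left_dual C f)) \<star> (g \<otimes>\<^sub>c \<i> (b\<^sup>d)) \<star> Coev C b"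
    by (simp add: pivotal assoc)
  also have "\<dots> = tr b (f \<star> g)"
    by (simp add: ev_slide [OF assms(1-3)] tr_def tens_comp_left assoc)
  finally show ?thesis .
qed

lemma tr_add:
  assumes "f \<in> Mor C" "g \<in> Mor C" "Dom C f = a" "Cod C f = a" "Dom C g = a" "Cod C g = a" "a \<in> Obj C"
  shows "tr a (f \<oplus>\<^sub>c g) = tr a f \<oplus>\<^sub>c tr a g"
  using assms by (simp add: tr_def tens_add_left comp_add_left comp_add_right)

lemma tr_scale:
  assumes "f \<in> Mor C" "Dom C f = a" "Cod C f = a" "a \<in> Obj C"
  shows "tr a (z \<odot>\<^sub>c f) = z \<odot>\<^sub>c tr a f"
  using assms by (simp add: tr_def)

text \<open>The partial trace, which closes only the right factor \<open>b\<close>.\<close>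

definition ptr where "ptr a b f = (\<i> a \<otimes>\<^sub>c Ev C (b\<^sup>d)) \<star> (f \<otimes>\<^sub>c \<i> (b\<^sup>d)) \<star> (\<i> a \<otimes>\<^sub>c Coev C b)"

end

context pivotal_star_category
begin

lemma mor_star [simp]:
  assumes "f \<in> Mor C"
  shows "Star C f \<in> Mor C" "Dom C (Star C f) = Cod C f" "Cod C (Star C f) = Dom C f"
  using HomD [OF Star_Hom [OF Hom_Dom_Cod [OF assms]]] by simp_all

lemma star_comp:
  "\<lbrakk>f \<in> Mor C; g \<in> Mor C; Dom C g = Cod C f\<rbrakk> \<Longrightarrow> Star C (g \<star> f) = Star C f \<star> Star C g"
  using Star_Comp [of f "Dom C f" "Cod C f" g "Cod C g"] by (simp add: Hom_def)

lemma star_ident [simp]: assumes [simp]: "a \<in> Obj C" shows "Star C (\<i> a) = \<i> a"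
proof -
  have "Star C (Star C (\<i> a) \<star> \<i> a) = Star C (\<i> a)"
    by (subst star_comp) (simp_all add: Star_Star)
  then show ?thesis by (simp add: Star_Star)
qed

text \<open>The axioms give the nested form for evaluations; the star operation transfers it to
  coevaluations.\<close>

lemma coev_tens:
  assumes [simp]: "a \<in> Obj C" "b \<in> Obj C"
  shows "Coev C (a \<boxtimes> b) = (\<i> a \<otimes>\<^sub>c Coev C b \<otimes>\<^sub>c \<i> (a\<^sup>d)) \<star> Coev C a"
proof -
  have s: "Star C (Ev C (x\<^sup>d)) = Coev C x" if "x \<in> Obj C" for x
    using Star_Ev [of "x\<^sup>d"] that by simp
  have "Coev C (a \<boxtimes> b) = Star C (Ev C ((a \<boxtimes> b)\<^sup>d))" by (rule s [symmetric]) simp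
  also have "Ev C ((a \<boxtimes> b)\<^sup>d) = Ev C (a\<^sup>d) \<star> (\<i> a \<otimes>\<^sub>c Ev C (b\<^sup>d) \<otimes>\<^sub>c \<i> (a\<^sup>d))"
    using Ev_TensO [of "b\<^sup>d" "a\<^sup>d"] by simp
  also have "Star C \<dots> = (\<i> a \<otimes>\<^sub>c Coev C b \<otimes>\<^sub>c \<i> (a\<^sup>d)) \<star> Coev C a"
    by (subst star_comp) (simp_all add: s Star_TensM)
  finally show ?thesis .
qed

lemma tr_tens:
  assumes [simp]: "f \<in> Mor C" "Dom C f = a \<boxtimes> b" "Cod C f = a \<boxtimes> b" "a \<in> Obj C" "b \<in> Obj C"
  shows "tr (a \<boxtimes> b) f = tr a (ptr a b f)"
proof -
  have ev: "Ev C ((a \<boxtimes> b)\<^sup>d) = Ev C (a\<^sup>d) \<star> (\<i> a \<otimes>\<^sub>c Ev C (b\<^sup>d) \<otimes>\<^sub>c \<i> (a\<^sup>d))"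
    using Ev_TensO [of "b\<^sup>d" "a\<^sup>d"] by simp
  show ?thesis
    unfolding tr_def ev coev_tens [OF assms(4,5)]
    by (simp add: ptr_def tens_comp_left assoc flip: tens_ident)
qed

lemma mor_ptr [simp]:
  assumes "f \<in> Mor C" "Dom C f = a \<boxtimes> b" "Cod C f = a \<boxtimes> b" "a \<in> Obj C" "b \<in> Obj C"
  shows "ptr a b f \<in> Mor C" "Dom C (ptr a b f) = a" "Cod C (ptr a b f) = a"
  using assms by (simp_all add: ptr_def)

end

section \<open>Simple objects, Schur's lemma and positive dimensions\<close>

definition (in linear_category) simple where
  "simple a \<longleftrightarrow> a \<in> Obj C \<and> \<i> a \<noteq> Zero C a a \<and> (\<forall>f \<in> Hom C a a. \<exists>z. f = z \<odot>\<^sub>c \<i> a)"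

text \<open>The scalar by which an endomorphism of a simple object acts; on other arguments the
  value is unspecified.\<close>

definition (in linear_category) sc where "sc a f = (THE z. f = z \<odot>\<^sub>c \<i> a)"

context linear_category
begin

lemma scale_ident_inject:
  assumes "simple a" "z \<odot>\<^sub>c \<i> a = w \<odot>\<^sub>c \<i> a"
  shows "z = w"
proof (rule ccontr)
  assume "z \<noteq> w"
  have a [simp]: "a \<in> Obj C" using assms by (simp add: simple_def)
  have "(z - w) \<odot>\<^sub>c \<i> a = z \<odot>\<^sub>c \<i> a \<oplus>\<^sub>c (-1) \<odot>\<^sub>c w \<odot>\<^sub>c \<i> a"
    using scale_add_left [of "\<i> a" z "- w"] by simp
  also have "\<dots> = Zero C a a" using assms(2) by (simp add: scale_zero_left flip: scale_add_left)
  finally show False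
    using scale_cancel [of "z - w" "\<i> a"] \<open>z \<noteq> w\<close> assms(1) by (simp add: simple_def)
qed

lemma sc_scale_ident [simp]: "simple a \<Longrightarrow> sc a (z \<odot>\<^sub>c \<i> a) = z"
  unfolding sc_def by (rule the_equality) (auto dest: scale_ident_inject)

lemma simple_Obj [simp]: "simple a \<Longrightarrow> a \<in> Obj C"
  by (simp add: simple_def)

lemma sc_ident [simp]: "simple a \<Longrightarrow> sc a (\<i> a) = 1"
  using sc_scale_ident [of a 1] by simp

lemma sc_Zero [simp]: "simple a \<Longrightarrow> sc a (Zero C a a) = 0"
  using sc_scale_ident [of a 0] scale_zero_left [of "\<i> a"] by simp

lemma scE:
  assumes "simple a" "f \<in> Mor C" "Dom C f = a" "Cod C f = a"
  shows "f = sc a f \<odot>\<^sub>c \<i> a"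
proof -
  obtain z where "f = z \<odot>\<^sub>c \<i> a" using assms by (auto simp: simple_def Hom_def)
  then show ?thesis using assms by simp
qed

lemma sc_add:
  assumes "simple a" "f \<in> Mor C" "Dom C f = a" "Cod C f = a" "g \<in> Mor C" "Dom C g = a" "Cod C g = a"
  shows "sc a (f \<oplus>\<^sub>c g) = sc a f + sc a g"
proof -
  obtain z w where "f = z \<odot>\<^sub>c \<i> a" "g = w \<odot>\<^sub>c \<i> a"
    using scE [OF assms(1-4)] scE [OF assms(1,5-7)] by blast
  then show ?thesis using assms(1) by (simp flip: scale_add_left)
qed

lemma sc_scale:
  assumes "simple a" "f \<in> Mor C" "Dom C f = a" "Cod C f = a"
  shows "sc a (z \<odot>\<^sub>c f) = z * sc a f"
proof -
  obtain w where "f = w \<odot>\<^sub>c \<i> a"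
    using scE [OF assms] by blast
  then show ?thesis using assms(1) by simp
qed

lemma sc_comp:
  assumes "simple a" "f \<in> Mor C" "Dom C f = a" "Cod C f = a"
  shows "g \<in> Mor C \<Longrightarrow> Dom C g = a \<Longrightarrow> g \<star> f = sc a f \<odot>\<^sub>c g"
    and "h \<in> Mor C \<Longrightarrow> Cod C h = a \<Longrightarrow> f \<star> h = sc a f \<odot>\<^sub>c h"
proof -
  show "g \<star> f = sc a f \<odot>\<^sub>c g" if "g \<in> Mor C" "Dom C g = a"
    using that assms(1) by (subst scE [OF assms]) simp
  show "f \<star> h = sc a f \<odot>\<^sub>c h" if "h \<in> Mor C" "Cod C h = a"
    using that assms(1) by (subst scE [OF assms]) simp
qed

end

context unitary_category
begin

lemma simple_unit [simp]: "simple (Unit C)"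
  unfolding simple_def using Unit_Obj Unit_nonzero Unit_simple by blast

abbreviation scu where "scu \<equiv> sc (Unit C)"

definition dm where "dm a = scu (tr a (\<i> a))"

lemma simple_star_comp:
  assumes "simple a" "f \<in> Mor C" "Dom C f = a" "f \<noteq> Zero C a (Cod C f)"
  shows "sc a (Star C f \<star> f) \<noteq> 0"
proof
  assume "sc a (Star C f \<star> f) = 0"
  moreover obtain z where z: "Star C f \<star> f = z \<odot>\<^sub>c \<i> a"
    using scE [of a "Star C f \<star> f"] assms by auto
  ultimately have "Star C f \<star> f = Zero C a a"
    using assms scale_zero_left [of "\<i> a"] by simp
  then show False
    using proper [of f a "Cod C f"] assms by (auto simp: Hom_def)
qed

text \<open>\<open>f* f\<close> and \<open>f f*\<close> are scalars, equal because both multiply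
  \<open>f\<close> in \<open>f f* f\<close>. For nonzero \<open>f\<close> the scalar is nonzero by
  properness, and a multiple of \<open>f*\<close> inverts \<open>f\<close>.\<close>

lemma schur:
  assumes a: "simple a" and b: "simple b" and f: "f \<in> Hom C a b" and ab: "\<not> isomorphic C a b"
  shows "f = Zero C a b"
proof (rule ccontr)
  assume nz: "f \<noteq> Zero C a b"
  note [simp] = HomD [OF f] simple_Obj [OF a] simple_Obj [OF b]
  obtain z where fz: "Star C f \<star> f = z \<odot>\<^sub>c \<i> a"
    using scE [of a "Star C f \<star> f"] a by auto
  obtain w where fw: "f \<star> Star C f = w \<odot>\<^sub>c \<i> b"
    using scE [of b "f \<star> Star C f"] b by auto
  have z: "z \<noteq> 0" using simple_star_comp [OF a, of f] nz a by (auto simp: fz)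
  have zw: "z \<odot>\<^sub>c f = w \<odot>\<^sub>c f"
    using assoc [of f "Star C f" f] fz fw by simp
  have "z = w"
  proof (rule ccontr)
    assume "z \<noteq> w"
    have "(z - w) \<odot>\<^sub>c f = z \<odot>\<^sub>c f \<oplus>\<^sub>c (-1) \<odot>\<^sub>c w \<odot>\<^sub>c f"
      using scale_add_left [of f z "- w"] by simp
    also have "\<dots> = Zero C a b"
      unfolding zw using add_inverse [of "w \<odot>\<^sub>c f"] by simp
    finally show False
      using scale_cancel [of "z - w" f] \<open>z \<noteq> w\<close> nz by simp
  qed
  then have "isomorphic C a b"
    using z fz fw by (intro isomorphicI [of f _ _ "inverse z \<odot>\<^sub>c Star C f"]) (auto simp: HomI)
  then show False using ab by simp
qed

lemma scu_tr_commute: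
  assumes "f \<in> Mor C" "Dom C f = a" "Cod C f = b" "g \<in> Mor C" "Dom C g = b" "Cod C g = a"
  shows "scu (tr a (g \<star> f)) = scu (tr b (f \<star> g))"
  using tr_commute [OF assms] by simp

lemma dm_isomorphic:
  assumes "isomorphic C a b"
  shows "dm a = dm b"
proof -
  obtain f where "is_iso C a b f" using assms by (auto simp: isomorphic_def)
  then obtain g where "f \<in> Mor C" "Dom C f = a" "Cod C f = b" "g \<in> Mor C" "Dom C g = b" "Cod C g = a"
    "g \<star> f = \<i> a" "f \<star> g = \<i> b" by (rule is_isoE)
  then show ?thesis using scu_tr_commute [of f a b g] by (simp add: dm_def)
qed

lemma scu_tr_scale:
  assumes "f \<in> Mor C" "Dom C f = a" "Cod C f = a" "a \<in> Obj C"
  shows "scu (tr a (z \<odot>\<^sub>c f)) = z * scu (tr a f)"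
  using assms by (simp add: tr_scale sc_scale)

lemma scu_tr_add:
  assumes "f \<in> Mor C" "g \<in> Mor C" "Dom C f = a" "Cod C f = a" "Dom C g = a" "Cod C g = a" "a \<in> Obj C"
  shows "scu (tr a (f \<oplus>\<^sub>c g)) = scu (tr a f) + scu (tr a g)"
  using assms by (simp add: tr_add sc_add)

lemma dm_tens:
  assumes [simp]: "a \<in> Obj C" "b \<in> Obj C"
  shows "dm (a \<boxtimes> b) = dm a * dm b"
proof -
  have "ptr a b (\<i> (a \<boxtimes> b)) = \<i> a \<otimes>\<^sub>c tr b (\<i> b)"
    by (simp add: ptr_def tr_def tens_comp)
  also have "tr b (\<i> b) = dm b \<odot>\<^sub>c \<i> (Unit C)"
    unfolding dm_def by (rule scE [OF simple_unit]) simp_all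
  also have "\<i> a \<otimes>\<^sub>c \<dots> = dm b \<odot>\<^sub>c \<i> a" by simp
  finally have "tr (a \<boxtimes> b) (\<i> (a \<boxtimes> b)) = dm b \<odot>\<^sub>c tr a (\<i> a)"
    by (simp add: tr_tens tr_scale)
  then show ?thesis by (simp add: dm_def sc_scale)
qed

text \<open>Multiplicativity leaves only the values 0 and 1, and 0 contradicts the zigzag for the
  unit.\<close>

lemma dm_unit [simp]: "dm (Unit C) = 1"
proof -
  let ?u = "Unit C"
  have "dm ?u * (dm ?u - 1) = 0" using dm_tens [of ?u ?u] by (simp add: algebra_simps)
  moreover have "dm ?u \<noteq> 0"
  proof
    assume "dm ?u = 0"
    moreover have "tr ?u (\<i> ?u) = dm ?u \<odot>\<^sub>c \<i> ?u"
      unfolding dm_def by (rule scE [OF simple_unit]) simp_all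
    ultimately have "Ev C ?u \<star> Coev C ?u = Zero C ?u ?u"
      using scale_zero_left [of "\<i> ?u"] by (simp add: tr_def)
    moreover have "(\<i> ?u \<otimes>\<^sub>c Ev C ?u) \<star> (Coev C ?u \<otimes>\<^sub>c \<i> ?u) = \<i> ?u" by (rule zigzag) simp
    ultimately show False using Unit_nonzero by simp
  qed
  ultimately show ?thesis by simp
qed

text \<open>By \<open>positive\<close> the square is that of an endomorphism of the unit, hence a
  squared modulus.\<close>

lemma scu_star_comp:
  assumes [simp]: "f \<in> Mor C" "Dom C f = Unit C"
  shows "\<exists>r\<ge>0. scu (Star C f \<star> f) = complex_of_real r"
proof -
  obtain h where h: "h \<in> Hom C (Unit C) (Unit C)" "Star C f \<star> f = Star C h \<star> h"
    using positive [of f "Unit C" "Cod C f"] by (auto simp: Hom_def)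
  note [simp] = HomD [OF h(1)]
  obtain z where z: "h = z \<odot>\<^sub>c \<i> (Unit C)"
    using scE [OF simple_unit, of h] by auto
  then have "Star C h \<star> h = (cnj z * z) \<odot>\<^sub>c \<i> (Unit C)"
    by (simp add: Star_Scale mult.commute)
  then have "scu (Star C f \<star> f) = complex_of_real ((cmod z)\<^sup>2)"
    using h(2) by (simp add: complex_norm_square mult.commute del: of_real_power)
  then show ?thesis by (metis zero_le_power2)
qed

text \<open>The trace is itself a square \<open>g* g\<close>, with \<open>g\<close> the cup carrying
  \<open>f\<close> on one leg.\<close>

lemma tr_star_comp:
  assumes [simp]: "f \<in> Mor C" "Dom C f = a"
  shows "\<exists>r\<ge>0. scu (tr a (Star C f \<star> f)) = complex_of_real r"
proof -
  have [simp]: "a \<in> Obj C" using assms mor_Obj by metis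
  have s: "Star C (Coev C a) = Ev C (a\<^sup>d)"
    using Star_Ev [of "a\<^sup>d"] Star_Star [of "Ev C (a\<^sup>d)"] by simp
  have "tr a (Star C f \<star> f) = Star C ((f \<otimes>\<^sub>c \<i> (a\<^sup>d)) \<star> Coev C a) \<star> (f \<otimes>\<^sub>c \<i> (a\<^sup>d)) \<star> Coev C a"
    by (simp add: tr_def star_comp s Star_TensM tens_comp_left assoc)
  then show ?thesis using scu_star_comp [of "(f \<otimes>\<^sub>c \<i> (a\<^sup>d)) \<star> Coev C a"] by simp
qed

lemma dm_nonneg:
  assumes "a \<in> Obj C"
  shows "\<exists>r\<ge>0. dm a = complex_of_real r"
  using tr_star_comp [of "\<i> a" a] assms by (simp add: dm_def)

end

section \<open>Direct sum decompositions and dual bases\<close>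

context linear_category
begin

definition lin :: "'o \<Rightarrow> 'o \<Rightarrow> ('m \<Rightarrow> complex) \<Rightarrow> bool" where
  "lin a b \<Lambda> \<longleftrightarrow> (\<forall>f \<in> Hom C a b. \<forall>g \<in> Hom C a b. \<Lambda> (f \<oplus>\<^sub>c g) = \<Lambda> f + \<Lambda> g) \<and>
     (\<forall>f \<in> Hom C a b. \<forall>z. \<Lambda> (z \<odot>\<^sub>c f) = z * \<Lambda> f)"

lemma lin_compose:
  assumes "lin c d \<Lambda>" "\<And>f. f \<in> Hom C a b \<Longrightarrow> G f \<in> Hom C c d"
    "\<And>f g. \<lbrakk>f \<in> Hom C a b; g \<in> Hom C a b\<rbrakk> \<Longrightarrow> G (f \<oplus>\<^sub>c g) = G f \<oplus>\<^sub>c G g"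
    "\<And>f z. f \<in> Hom C a b \<Longrightarrow> G (z \<odot>\<^sub>c f) = z \<odot>\<^sub>c G f"
  shows "lin a b (\<lambda>f. \<Lambda> (G f))"
  using assms by (simp add: lin_def)

lemma lin_comp_right: "\<lbrakk>lin a c \<Lambda>; x \<in> Hom C a b\<rbrakk> \<Longrightarrow> lin b c (\<lambda>y. \<Lambda> (y \<star> x))"
  by (rule lin_compose) (auto simp: Hom_def comp_add_left)

lemma lin_comp_left: "\<lbrakk>lin a c \<Lambda>; x \<in> Hom C b c\<rbrakk> \<Longrightarrow> lin a b (\<lambda>y. \<Lambda> (x \<star> y))"
  by (rule lin_compose) (auto simp: Hom_def comp_add_right)

lemma lin_sc: "simple a \<Longrightarrow> lin a a (sc a)"
  by (auto simp: lin_def Hom_def sc_add sc_scale)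

lemma lin_scale: "lin a b \<Lambda> \<Longrightarrow> lin a b (\<lambda>f. z * \<Lambda> f)" "lin a b \<Lambda> \<Longrightarrow> lin a b (\<lambda>f. \<Lambda> f * z)"
  by (simp_all add: lin_def algebra_simps)

lemma lin_sum: "(\<And>i. i \<in> J \<Longrightarrow> lin a b (\<Lambda> i)) \<Longrightarrow> lin a b (\<lambda>f. \<Sum>i\<in>J. \<Lambda> i f)"
  by (simp add: lin_def sum.distrib sum_distrib_left)

lemma lin_Zero: "lin a b \<Lambda> \<Longrightarrow> a \<in> Obj C \<Longrightarrow> b \<in> Obj C \<Longrightarrow> \<Lambda> (Zero C a b) = 0"
  unfolding lin_def by (metis Zero_Hom mult_zero_left scale_zero_left mor_Zero)

text \<open>A finite biproduct decomposition of \<open>z\<close> into objects \<open>w i\<close>.  Completeness is phrased through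
  linear functionals, so that only sums of complex numbers occur.\<close>

definition splitting where
  "splitting z K w u u' \<longleftrightarrow> finite K \<and> z \<in> Obj C \<and>
     (\<forall>i \<in> K. u i \<in> Hom C (w i) z \<and> u' i \<in> Hom C z (w i)) \<and>
     (\<forall>i \<in> K. \<forall>j \<in> K. u' i \<star> u j = (if i = j then \<i> (w i) else Zero C (w j) (w i))) \<and>
     (\<forall>\<Lambda>. lin z z \<Lambda> \<longrightarrow> \<Lambda> (\<i> z) = (\<Sum>i\<in>K. \<Lambda> (u i \<star> u' i)))"

lemma splittingD:
  assumes "splitting z K w u u'"
  shows "finite K" "z \<in> Obj C"
    and "i \<in> K \<Longrightarrow> u i \<in> Hom C (w i) z" "i \<in> K \<Longrightarrow> u' i \<in> Hom C z (w i)" "i \<in> K \<Longrightarrow> w i \<in> Obj C"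
    and "i \<in> K \<Longrightarrow> j \<in> K \<Longrightarrow> u' i \<star> u j = (if i = j then \<i> (w i) else Zero C (w j) (w i))"
    and "lin z z \<Lambda> \<Longrightarrow> \<Lambda> (\<i> z) = (\<Sum>i\<in>K. \<Lambda> (u i \<star> u' i))"
  using assms Hom_Obj unfolding splitting_def by blast+

lemma splitting_mor:
  assumes "splitting z K w u u'" "i \<in> K"
  shows "u i \<in> Mor C" "Dom C (u i) = w i" "Cod C (u i) = z"
    "u' i \<in> Mor C" "Dom C (u' i) = z" "Cod C (u' i) = w i" "w i \<in> Obj C"
  using splittingD(3,4,5) [OF assms] by (auto simp: Hom_def)

lemma splitting_expand:
  assumes s: "splitting z K w u u'" and l: "lin a z \<Lambda>" and x: "x \<in> Hom C a z"
  shows "\<Lambda> x = (\<Sum>i\<in>K. \<Lambda> (u i \<star> u' i \<star> x))"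
proof -
  have "\<Lambda> x = \<Lambda> (\<i> z \<star> x)" using x by (simp add: Hom_def)
  also have "\<dots> = (\<Sum>i\<in>K. \<Lambda> ((u i \<star> u' i) \<star> x))"
    by (rule splittingD(7) [OF s lin_comp_right [OF l x]])
  also have "\<dots> = (\<Sum>i\<in>K. \<Lambda> (u i \<star> u' i \<star> x))"
    using x by (intro sum.cong HOL.refl) (simp add: splitting_mor [OF s] assoc Hom_def)
  finally show ?thesis .
qed

lemma splitting_expand_left:
  assumes s: "splitting z K w u u'" and l: "lin z a \<Lambda>" and x: "x \<in> Hom C z a"
  shows "\<Lambda> x = (\<Sum>i\<in>K. \<Lambda> ((x \<star> u i) \<star> u' i))"
proof -
  have "\<Lambda> x = \<Lambda> (x \<star> \<i> z)" using x by (simp add: Hom_def)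
  also have "\<dots> = (\<Sum>i\<in>K. \<Lambda> (x \<star> (u i \<star> u' i)))"
    by (rule splittingD(7) [OF s lin_comp_left [OF l x]])
  also have "\<dots> = (\<Sum>i\<in>K. \<Lambda> ((x \<star> u i) \<star> u' i))"
    using x by (intro sum.cong HOL.refl) (simp add: splitting_mor [OF s] assoc Hom_def)
  finally show ?thesis .
qed

lemma splitting_iso:
  assumes "f \<in> Hom C a z" "g \<in> Hom C z a" "g \<star> f = \<i> a" "f \<star> g = \<i> z"
  shows "splitting z {k} (\<lambda>_. a) (\<lambda>_. f) (\<lambda>_. g)"
  using assms Hom_Obj by (auto simp: splitting_def)

lemma splitting_id: "a \<in> Obj C \<Longrightarrow> splitting a {k} (\<lambda>_. a) (\<lambda>_. \<i> a) (\<lambda>_. \<i> a)"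
  by (rule splitting_iso) (auto simp: HomI)

lemma splitting_comp:
  assumes s: "splitting z K w u u'" and t: "\<And>i. i \<in> K \<Longrightarrow> splitting (w i) (J i) (y i) (v i) (v' i)"
  shows "splitting z (Sigma K J) (\<lambda>(i, j). y i j) (\<lambda>(i, j). u i \<star> v i j) (\<lambda>(i, j). v' i j \<star> u' i)"
  unfolding splitting_def
proof (intro conjI ballI allI impI)
  note m = splitting_mor [OF s] splitting_mor [OF t]
  show "finite (Sigma K J)"
    using splittingD(1) [OF s] splittingD(1) [OF t] by (rule finite_SigmaI)
  show "z \<in> Obj C" using splittingD(2) s by blast
  show "(case k of (i, j) \<Rightarrow> u i \<star> v i j) \<in> Hom C (case k of (i, j) \<Rightarrow> y i j) z"
    "(case k of (i, j) \<Rightarrow> v' i j \<star> u' i) \<in> Hom C z (case k of (i, j) \<Rightarrow> y i j)"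
    if "k \<in> Sigma K J" for k
    using that by (auto intro!: HomI simp: m)
  show "(case k of (i, j) \<Rightarrow> v' i j \<star> u' i) \<star> (case l of (i, j) \<Rightarrow> u i \<star> v i j) =
      (if k = l then \<i> (case k of (i, j) \<Rightarrow> y i j) else Zero C (case l of (i, j) \<Rightarrow> y i j) (case k of (i, j) \<Rightarrow> y i j))"
    if kl: "k \<in> Sigma K J" "l \<in> Sigma K J" for k l
  proof -
    obtain i j i' j' where d: "k = (i, j)" "l = (i', j')" "i \<in> K" "j \<in> J i" "i' \<in> K" "j' \<in> J i'"
      using kl by auto
    have "(v' i j \<star> u' i) \<star> (u i' \<star> v i' j') = v' i j \<star> (u' i \<star> u i') \<star> v i' j'"
      using d by (simp add: m assoc)
    also have "\<dots> = (if k = l then \<i> (y i j) else Zero C (y i' j') (y i j))"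
      using d splittingD(6) [OF s, of i i'] splittingD(6) [OF t, of i j j'] by (auto simp: m)
    finally show ?thesis by (simp add: d)
  qed
  show "\<Lambda> (\<i> z) = (\<Sum>k\<in>Sigma K J. \<Lambda> ((case k of (i, j) \<Rightarrow> u i \<star> v i j) \<star> (case k of (i, j) \<Rightarrow> v' i j \<star> u' i)))"
    if L: "lin z z \<Lambda>" for \<Lambda>
  proof -
    have "\<Lambda> (\<i> z) = (\<Sum>i\<in>K. \<Lambda> (u i \<star> u' i))" by (rule splittingD(7) [OF s L])
    also have "\<dots> = (\<Sum>i\<in>K. \<Sum>j\<in>J i. \<Lambda> ((u i \<star> v i j) \<star> (v' i j \<star> u' i)))"
    proof (rule sum.cong [OF HOL.refl])
      fix i assume i: "i \<in> K"
      have "lin z (w i) (\<lambda>y. \<Lambda> (u i \<star> y))"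
        by (rule lin_comp_left [OF L]) (rule splittingD(3) [OF s i])
      from splitting_expand [OF t [OF i] this splittingD(4) [OF s i]]
      show "\<Lambda> (u i \<star> u' i) = (\<Sum>j\<in>J i. \<Lambda> ((u i \<star> v i j) \<star> (v' i j \<star> u' i)))"
        using i by (simp add: m assoc)
    qed
    also have "\<dots> = (\<Sum>(i, j)\<in>Sigma K J. \<Lambda> ((u i \<star> v i j) \<star> (v' i j \<star> u' i)))"
      using splittingD(1) [OF s] splittingD(1) [OF t] by (subst sum.Sigma) auto
    finally show ?thesis by (simp add: case_prod_unfold)
  qed
qed

lemma splitting_reindex:
  assumes s: "splitting z K w u u'" and b: "bij_betw h L K"
  shows "splitting z L (w \<circ> h) (u \<circ> h) (u' \<circ> h)"
proof -
  have hL: "h i \<in> K" if "i \<in> L" for i using b that by (auto simp: bij_betw_def)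
  have inj: "h i = h j \<longleftrightarrow> i = j" if "i \<in> L" "j \<in> L" for i j
    using b that by (auto simp: bij_betw_def inj_on_def)
  have "(\<Sum>i\<in>L. \<Lambda> (u (h i) \<star> u' (h i))) = (\<Sum>i\<in>K. \<Lambda> (u i \<star> u' i))" for \<Lambda> :: "'m \<Rightarrow> complex"
    using sum.reindex_bij_betw [OF b, of "\<lambda>i. \<Lambda> (u i \<star> u' i)"] by simp
  then show ?thesis
    using s hL inj bij_betw_finite [OF b] unfolding splitting_def by simp
qed

definition simple_family where
  "simple_family I ob \<longleftrightarrow> (\<forall>T \<in> I. simple (ob T)) \<and>
     (\<forall>T \<in> I. \<forall>T' \<in> I. T \<noteq> T' \<longrightarrow> (\<forall>f \<in> Hom C (ob T) (ob T'). f = Zero C (ob T) (ob T')))"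

text \<open>For fixed \<open>T\<close>, the \<open>g i\<close> with \<open>t i = T\<close> are a
  basis of \<open>Hom (ob T) z\<close>, and the \<open>g' i\<close> are the dual basis of
  \<open>Hom z (ob T)\<close> for the pairing by \<open>sc\<close>.\<close>

definition basis where
  "basis I ob z J t g g' \<longleftrightarrow> (\<forall>i \<in> J. t i \<in> I) \<and> splitting z J (\<lambda>i. ob (t i)) g g'"

text \<open>Summands of a type other than \<open>T\<close> vanish since distinct members of the
  family have no maps between them; the others contribute a scalar by simplicity.\<close>

lemma basis_expand:
  assumes I: "simple_family I ob" and b: "basis I ob z J t g g'" and T: "T \<in> I"
    and l: "lin (ob T) z \<Lambda>" and x: "x \<in> Hom C (ob T) z"
  shows "\<Lambda> x = (\<Sum>i\<in>{i \<in> J. t i = T}. sc (ob T) (g' i \<star> x) * \<Lambda> (g i))"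
proof -
  have s: "splitting z J (\<lambda>i. ob (t i)) g g'" and t: "\<And>i. i \<in> J \<Longrightarrow> t i \<in> I"
    using b by (auto simp: basis_def)
  note m = splitting_mor [OF s]
  have xm [simp]: "x \<in> Mor C" "Dom C x = ob T" "Cod C x = z" using x by (auto simp: Hom_def)
  have sT: "simple (ob T)" using I T by (auto simp: simple_family_def)
  have "\<Lambda> x = (\<Sum>i\<in>J. \<Lambda> (g i \<star> g' i \<star> x))" by (rule splitting_expand [OF s l x])
  also have "\<dots> = (\<Sum>i\<in>J. if t i = T then sc (ob T) (g' i \<star> x) * \<Lambda> (g i) else 0)"
  proof (rule sum.cong [OF HOL.refl])
    fix i assume i: "i \<in> J"
    show "\<Lambda> (g i \<star> g' i \<star> x) = (if t i = T then sc (ob T) (g' i \<star> x) * \<Lambda> (g i) else 0)"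
    proof (cases "t i = T")
      case True
      then have "g i \<star> g' i \<star> x = sc (ob T) (g' i \<star> x) \<odot>\<^sub>c g i"
        using i m [OF i] sT by (intro sc_comp) auto
      then show ?thesis
        using True l splittingD(3) [OF s i] by (simp add: lin_def)
    next
      case False
      then have "g' i \<star> x = Zero C (ob T) (ob (t i))"
        using I T t [OF i] m [OF i] by (auto simp: simple_family_def HomI)
      then show ?thesis
        using False m [OF i] sT lin_Zero [OF l] splittingD(2) [OF s] by simp
    qed
  qed
  also have "\<dots> = (\<Sum>i\<in>{i \<in> J. t i = T}. sc (ob T) (g' i \<star> x) * \<Lambda> (g i))"
    using splittingD(1) [OF s] by (simp add: sum.inter_filter)
  finally show ?thesis .
qed

lemma basis_expand_left:
  assumes I: "simple_family I ob" and b: "basis I ob z J t g g'" and T: "T \<in> I"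
    and l: "lin z (ob T) \<Lambda>" and x: "x \<in> Hom C z (ob T)"
  shows "\<Lambda> x = (\<Sum>i\<in>{i \<in> J. t i = T}. sc (ob T) (x \<star> g i) * \<Lambda> (g' i))"
proof -
  have s: "splitting z J (\<lambda>i. ob (t i)) g g'" and t: "\<And>i. i \<in> J \<Longrightarrow> t i \<in> I"
    using b by (auto simp: basis_def)
  note m = splitting_mor [OF s]
  have xm [simp]: "x \<in> Mor C" "Dom C x = z" "Cod C x = ob T" using x by (auto simp: Hom_def)
  have sT: "simple (ob T)" using I T by (auto simp: simple_family_def)
  have "\<Lambda> x = (\<Sum>i\<in>J. \<Lambda> ((x \<star> g i) \<star> g' i))" by (rule splitting_expand_left [OF s l x])
  also have "\<dots> = (\<Sum>i\<in>J. if t i = T then sc (ob T) (x \<star> g i) * \<Lambda> (g' i) else 0)"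
  proof (rule sum.cong [OF HOL.refl])
    fix i assume i: "i \<in> J"
    show "\<Lambda> ((x \<star> g i) \<star> g' i) = (if t i = T then sc (ob T) (x \<star> g i) * \<Lambda> (g' i) else 0)"
    proof (cases "t i = T")
      case True
      then have "(x \<star> g i) \<star> g' i = sc (ob T) (x \<star> g i) \<odot>\<^sub>c g' i"
        using i m [OF i] sT by (intro sc_comp) auto
      then show ?thesis
        using True l splittingD(4) [OF s i] by (simp add: lin_def)
    next
      case False
      then have "x \<star> g i = Zero C (ob (t i)) (ob T)"
        using I T t [OF i] m [OF i] by (auto simp: simple_family_def HomI)
      then show ?thesis
        using False m [OF i] sT lin_Zero [OF l] splittingD(2) [OF s] by simp
    qed
  qed
  also have "\<dots> = (\<Sum>i\<in>{i \<in> J. t i = T}. sc (ob T) (x \<star> g i) * \<Lambda> (g' i))"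
    using splittingD(1) [OF s] by (simp add: sum.inter_filter)
  finally show ?thesis .
qed

text \<open>The sum of tensors of dual basis vectors is the canonical element of
  \<open>Hom T z\<close> tensor \<open>Hom z T\<close>. Expanding one basis in the other on the
  first argument and contracting on the second shows it.\<close>

lemma basis_independent:
  assumes I: "simple_family I ob" and b: "basis I ob z J t g g'" and c: "basis I ob z L r h h'" and T: "T \<in> I"
    and l1: "\<And>y. y \<in> Hom C z (ob T) \<Longrightarrow> lin (ob T) z (\<lambda>x. \<Psi> x y)"
    and l2: "\<And>x. x \<in> Hom C (ob T) z \<Longrightarrow> lin z (ob T) (\<Psi> x)"
  shows "(\<Sum>i\<in>{i \<in> J. t i = T}. \<Psi> (g i) (g' i)) = (\<Sum>j\<in>{j \<in> L. r j = T}. \<Psi> (h j) (h' j))"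
proof -
  let ?J = "{i \<in> J. t i = T}" and ?L = "{j \<in> L. r j = T}"
  have g: "g i \<in> Hom C (ob T) z" "g' i \<in> Hom C z (ob T)" if "i \<in> ?J" for i
    using b that splittingD(3,4) [of z J "\<lambda>i. ob (t i)" g g' i] by (auto simp: basis_def)
  have h: "h i \<in> Hom C (ob T) z" "h' i \<in> Hom C z (ob T)" if "i \<in> ?L" for i
    using c that splittingD(3,4) [of z L "\<lambda>i. ob (r i)" h h' i] by (auto simp: basis_def)
  have "(\<Sum>i\<in>?J. \<Psi> (g i) (g' i)) = (\<Sum>i\<in>?J. \<Sum>j\<in>?L. sc (ob T) (h' j \<star> g i) * \<Psi> (h j) (g' i))"
  proof (rule sum.cong [OF HOL.refl])
    fix i assume i: "i \<in> ?J"
    show "\<Psi> (g i) (g' i) = (\<Sum>j\<in>?L. sc (ob T) (h' j \<star> g i) * \<Psi> (h j) (g' i))"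
      by (rule basis_expand [OF I c T l1 [OF g(2) [OF i]] g(1) [OF i]])
  qed
  also have "\<dots> = (\<Sum>j\<in>?L. \<Sum>i\<in>?J. sc (ob T) (h' j \<star> g i) * \<Psi> (h j) (g' i))"
    by (rule sum.swap)
  also have "\<dots> = (\<Sum>j\<in>?L. \<Psi> (h j) (h' j))"
  proof (rule sum.cong [OF HOL.refl])
    fix j assume j: "j \<in> ?L"
    show "(\<Sum>i\<in>?J. sc (ob T) (h' j \<star> g i) * \<Psi> (h j) (g' i)) = \<Psi> (h j) (h' j)"
      by (rule basis_expand_left [OF I b T l2 [OF h(1) [OF j]] h(2) [OF j], symmetric])
  qed
  finally show ?thesis .
qed

lemma basis_dual:
  assumes "basis I ob z J t g g'" "i \<in> J" "j \<in> J" "t i = T" "t j = T" "simple (ob T)"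
  shows "sc (ob T) (g' i \<star> g j) = (if i = j then 1 else 0)"
  using assms splittingD(6) [of z J "\<lambda>i. ob (t i)" g g' i j] by (auto simp: basis_def)

lemma basis_mor:
  assumes "basis I ob z J t g g'" "i \<in> J"
  shows "g i \<in> Mor C" "Dom C (g i) = ob (t i)" "Cod C (g i) = z"
    "g' i \<in> Mor C" "Dom C (g' i) = z" "Cod C (g' i) = ob (t i)"
  using splitting_mor [of z J "\<lambda>i. ob (t i)" g g' i] assms by (auto simp: basis_def)

lemma basis_finite: "basis I ob z J t g g' \<Longrightarrow> finite J"
  by (auto simp: basis_def splitting_def)

lemma basis_Obj: "basis I ob z J t g g' \<Longrightarrow> z \<in> Obj C"
  by (auto simp: basis_def splitting_def)

lemma basis_singleton:
  "\<lbrakk>simple_family I ob; T \<in> I\<rbrakk> \<Longrightarrow> basis I ob (ob T) {k} (\<lambda>_. T) (\<lambda>_. \<i> (ob T)) (\<lambda>_. \<i> (ob T))"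
  using splitting_id [of "ob T" k] by (auto simp: basis_def simple_family_def simple_def)

lemma basis_comp:
  assumes "splitting z K w u u'" "\<And>i. i \<in> K \<Longrightarrow> basis I ob (w i) (J i) (t i) (g i) (g' i)"
  shows "basis I ob z (Sigma K J) (\<lambda>(i, j). t i j) (\<lambda>(i, j). u i \<star> g i j) (\<lambda>(i, j). g' i j \<star> u' i)"
  using splitting_comp [OF assms(1), of J "\<lambda>i j. ob (t i j)" g g'] assms(2)
  by (auto simp: basis_def case_prod_unfold)

text \<open>Composed decompositions have ever larger index types. Moving them to natural numbers
  allows one fixed type for all objects.\<close>

lemma basis_nat:
  assumes "basis I ob z J t g g'"
  shows "\<exists>(L :: nat set) r h h'. basis I ob z L r h h' \<and> r ` L = t ` J"
proof -
  have "finite J" using basis_finite [OF assms] .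
  then obtain b where b: "bij_betw b {..<card J} J"
    using ex_bij_betw_nat_finite [of J] by (auto simp: atLeast0LessThan)
  have "basis I ob z {..<card J} (t \<circ> b) (g \<circ> b) (g' \<circ> b)"
    using splitting_reindex [OF _ b, of z "\<lambda>i. ob (t i)" g g'] assms b
    by (auto simp: basis_def comp_def bij_betw_def)
  moreover have "(t \<circ> b) ` {..<card J} = t ` J"
    using b by (auto simp: bij_betw_def simp flip: image_image)
  ultimately show ?thesis by blast
qed

end

context monoidal_category
begin

lemma splitting_tens_right:
  assumes s: "splitting z K w u u'" and a [simp]: "a \<in> Obj C"
  shows "splitting (z \<boxtimes> a) K (\<lambda>i. w i \<boxtimes> a) (\<lambda>i. u i \<otimes>\<^sub>c \<i> a) (\<lambda>i. u' i \<otimes>\<^sub>c \<i> a)"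
  unfolding splitting_def
proof (intro conjI ballI allI impI)
  note m = splitting_mor [OF s]
  have [simp]: "z \<in> Obj C" using splittingD(2) [OF s] .
  show "finite K" "z \<boxtimes> a \<in> Obj C" using splittingD(1) [OF s] by simp_all
  show "u i \<otimes>\<^sub>c \<i> a \<in> Hom C (w i \<boxtimes> a) (z \<boxtimes> a)" "u' i \<otimes>\<^sub>c \<i> a \<in> Hom C (z \<boxtimes> a) (w i \<boxtimes> a)" if "i \<in> K" for i
    using m [OF that] by (auto intro: HomI)
  show "(u' i \<otimes>\<^sub>c \<i> a) \<star> (u j \<otimes>\<^sub>c \<i> a) = (if i = j then \<i> (w i \<boxtimes> a) else Zero C (w j \<boxtimes> a) (w i \<boxtimes> a))"
    if "i \<in> K" "j \<in> K" for i j
    using that splittingD(6) [OF s that] by (simp add: m tens_comp tens_Zero)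
  show "\<Lambda> (\<i> (z \<boxtimes> a)) = (\<Sum>i\<in>K. \<Lambda> ((u i \<otimes>\<^sub>c \<i> a) \<star> (u' i \<otimes>\<^sub>c \<i> a)))" if L: "lin (z \<boxtimes> a) (z \<boxtimes> a) \<Lambda>" for \<Lambda>
  proof -
    have "lin z z (\<lambda>y. \<Lambda> (y \<otimes>\<^sub>c \<i> a))"
      by (rule lin_compose [OF L]) (auto simp: Hom_def tens_add_left)
    from splittingD(7) [OF s this] show ?thesis by (simp add: m tens_comp)
  qed
qed

lemma splitting_tens_left:
  assumes s: "splitting z K w u u'" and a [simp]: "a \<in> Obj C"
  shows "splitting (a \<boxtimes> z) K (\<lambda>i. a \<boxtimes> w i) (\<lambda>i. \<i> a \<otimes>\<^sub>c u i) (\<lambda>i. \<i> a \<otimes>\<^sub>c u' i)"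
  unfolding splitting_def
proof (intro conjI ballI allI impI)
  note m = splitting_mor [OF s]
  have [simp]: "z \<in> Obj C" using splittingD(2) [OF s] .
  show "finite K" "a \<boxtimes> z \<in> Obj C" using splittingD(1) [OF s] by simp_all
  show "\<i> a \<otimes>\<^sub>c u i \<in> Hom C (a \<boxtimes> w i) (a \<boxtimes> z)" "\<i> a \<otimes>\<^sub>c u' i \<in> Hom C (a \<boxtimes> z) (a \<boxtimes> w i)" if "i \<in> K" for i
    using m [OF that] by (auto intro: HomI)
  show "(\<i> a \<otimes>\<^sub>c u' i) \<star> (\<i> a \<otimes>\<^sub>c u j) = (if i = j then \<i> (a \<boxtimes> w i) else Zero C (a \<boxtimes> w j) (a \<boxtimes> w i))"
    if "i \<in> K" "j \<in> K" for i j
    using that splittingD(6) [OF s that] by (simp add: m tens_comp tens_Zero)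
  show "\<Lambda> (\<i> (a \<boxtimes> z)) = (\<Sum>i\<in>K. \<Lambda> ((\<i> a \<otimes>\<^sub>c u i) \<star> (\<i> a \<otimes>\<^sub>c u' i)))" if L: "lin (a \<boxtimes> z) (a \<boxtimes> z) \<Lambda>" for \<Lambda>
  proof -
    have "lin z z (\<lambda>y. \<Lambda> (\<i> a \<otimes>\<^sub>c y))"
      by (rule lin_compose [OF L]) (auto simp: Hom_def tens_add_right)
    from splittingD(7) [OF s this] show ?thesis by (simp add: m tens_comp)
  qed
qed

text \<open>The truth value \<open>True\<close> indexes the summand \<open>x\<close>. Orthogonality
  of the two summands is not among the relations; composing completeness with \<open>c\<close> gives
  \<open>c = c + v' v c\<close>, so \<open>v c = 0\<close>, and \<open>c' v' = 0\<close>
  similarly.\<close>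

lemma splitting_fib_object:
  assumes x: "fib_object C x c c' v v'"
  shows "splitting (x \<boxtimes> x) UNIV (\<lambda>b. if b then x else Unit C) (\<lambda>b. if b then v' else c)
    (\<lambda>b. if b then v else (1 / of_real tau) \<odot>\<^sub>c c')"
proof -
  have [simp]: "x \<in> Obj C"
    and H: "c \<in> Hom C (Unit C) (x \<boxtimes> x)" "c' \<in> Hom C (x \<boxtimes> x) (Unit C)"
      "v \<in> Hom C (x \<boxtimes> x) x" "v' \<in> Hom C x (x \<boxtimes> x)"
    and r: "c' \<star> c = of_real tau \<odot>\<^sub>c \<i> (Unit C)" "v \<star> v' = \<i> x"
      "(1 / of_real tau) \<odot>\<^sub>c (c \<star> c') \<oplus>\<^sub>c v' \<star> v = \<i> (x \<boxtimes> x)"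
    using x by (auto simp: fib_object_def)
  note [simp] = HomD [OF H(1)] HomD [OF H(2)] HomD [OF H(3)] HomD [OF H(4)]
  have t [simp]: "tau \<noteq> 0" using tau_golden by auto
  have vc: "v \<star> c = Zero C (Unit C) x"
  proof -
    have "c \<oplus>\<^sub>c v' \<star> v \<star> c = ((1 / of_real tau) \<odot>\<^sub>c (c \<star> c') \<oplus>\<^sub>c v' \<star> v) \<star> c"
      by (simp add: comp_add_left assoc r(1))
    also have "\<dots> = Zero C (Unit C) (x \<boxtimes> x) \<oplus>\<^sub>c c" unfolding r(3) by simp
    finally have "v' \<star> v \<star> c \<oplus>\<^sub>c c = Zero C (Unit C) (x \<boxtimes> x) \<oplus>\<^sub>c c"
      using add_commute [of c "v' \<star> v \<star> c"] by simp
    then have "v' \<star> v \<star> c = Zero C (Unit C) (x \<boxtimes> x)"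
      by (rule add_cancel [rotated 7]) simp_all
    then have "v \<star> v' \<star> v \<star> c = Zero C (Unit C) x" by simp
    then show ?thesis using assoc [of "v \<star> c" v' v] r(2) by simp
  qed
  have cv: "c' \<star> v' = Zero C x (Unit C)"
  proof -
    have "c' \<oplus>\<^sub>c (c' \<star> v') \<star> v = c' \<star> ((1 / of_real tau) \<odot>\<^sub>c (c \<star> c') \<oplus>\<^sub>c v' \<star> v)"
    proof -
      have "c' \<star> c \<star> c' = of_real tau \<odot>\<^sub>c c'" using assoc [of c' c c'] r(1) by simp
      then show ?thesis by (simp add: comp_add_right assoc)
    qed
    also have "\<dots> = Zero C (x \<boxtimes> x) (Unit C) \<oplus>\<^sub>c c'" unfolding r(3) by simp
    finally have "(c' \<star> v') \<star> v \<oplus>\<^sub>c c' = Zero C (x \<boxtimes> x) (Unit C) \<oplus>\<^sub>c c'"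
      using add_commute [of c' "(c' \<star> v') \<star> v"] by simp
    then have "(c' \<star> v') \<star> v = Zero C (x \<boxtimes> x) (Unit C)"
      by (rule add_cancel [rotated 7]) simp_all
    then have "((c' \<star> v') \<star> v) \<star> v' = Zero C x (Unit C)" by simp
    then show ?thesis using assoc [of v' v "c' \<star> v'"] r(2) by simp
  qed
  show ?thesis
    unfolding splitting_def
  proof (intro conjI ballI allI impI)
    show "\<Lambda> (\<i> (x \<boxtimes> x)) = (\<Sum>b\<in>UNIV. \<Lambda> ((if b then v' else c) \<star> (if b then v else (1 / of_real tau) \<odot>\<^sub>c c')))"
      if "lin (x \<boxtimes> x) (x \<boxtimes> x) \<Lambda>" for \<Lambda>
      unfolding r(3) [symmetric] using that by (simp add: lin_def HomI UNIV_bool add.commute)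
  qed (auto simp: H HomI vc cv r)
qed

end

section \<open>Fibonacci objects in a unitary category\<close>

lemma tau_gt_1: "tau > 1"
  by (simp add: tau_def)

lemma tau_less_2: "tau < 2"
proof -
  have "sqrt 5 < sqrt 9" by (rule real_sqrt_less_mono) simp
  then show ?thesis by (simp add: tau_def)
qed

lemma golden_root: "\<lbrakk>(d::real) * d = d + 1; d \<ge> 0\<rbrakk> \<Longrightarrow> d = tau"
proof -
  assume d: "d * d = d + 1" "d \<ge> 0"
  have "(d - tau) * (d + tau - 1) = d * d - d - (tau * tau - tau)" by (simp add: algebra_simps)
  also have "\<dots> = 0" using d tau_golden by simp
  finally show ?thesis using d tau_gt_1 by auto
qed

context unitary_category
begin

abbreviation hom0 where "hom0 a b \<equiv> \<forall>f \<in> Hom C a b. f = Zero C a b"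

lemma hom0_star:
  assumes "hom0 a b"
  shows "hom0 b a"
proof
  fix f assume f: "f \<in> Hom C b a"
  note [simp] = HomD [OF f]
  have ab [simp]: "a \<in> Obj C" "b \<in> Obj C" using Hom_Obj [OF f] by auto
  have "Star C f = Zero C a b" using assms by (simp add: HomI)
  then have "f = Star C (0 \<odot>\<^sub>c Zero C a b)" using Star_Star [of f] by simp
  also have "\<dots> = 0 \<odot>\<^sub>c Star C (Zero C a b)" by (subst Star_Scale) simp_all
  also have "\<dots> = Zero C b a" by (simp add: scale_zero_left)
  finally show "f = Zero C b a" .
qed

lemma tr_projection:
  assumes "p \<in> Mor C" "Dom C p = a" "Cod C p = a" "Star C p \<star> p = p"
  shows "\<exists>r\<ge>0. scu (tr a p) = complex_of_real r"
  using tr_star_comp [of p a] assms by simp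

text \<open>The scalar \<open>f* f\<close> is positive, so dividing by its square root makes the
  state isometric.\<close>

lemma normalize_state:
  assumes f: "f \<in> Hom C (Unit C) x" and nz: "f \<noteq> Zero C (Unit C) x"
  obtains g z where "g \<in> Hom C (Unit C) x" "Star C g \<star> g = \<i> (Unit C)" "f = z \<odot>\<^sub>c g"
proof -
  note [simp] = HomD [OF f]
  obtain r where r: "r \<ge> 0" "scu (Star C f \<star> f) = complex_of_real r"
    using scu_star_comp [of f] by auto
  have "r \<noteq> 0" using simple_star_comp [of "Unit C" f] nz r(2) by auto
  then have r0: "r > 0" using r by simp
  have ff: "Star C f \<star> f = complex_of_real r \<odot>\<^sub>c \<i> (Unit C)"
    unfolding r(2) [symmetric] by (rule scE) simp_all
  define w where "w = complex_of_real (1 / sqrt r)"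
  have w: "cnj w * w * complex_of_real r = 1"
  proof -
    have "cnj w * w * complex_of_real r = complex_of_real ((1 / sqrt r) * (1 / sqrt r) * r)"
      unfolding w_def by (simp only: of_real_mult complex_cnj_complex_of_real)
    also have "(1 / sqrt r) * (1 / sqrt r) * r = 1"
      using r0 by (simp add: field_simps)
    finally show ?thesis by simp
  qed
  then have w0: "w \<noteq> 0" by auto
  show thesis
  proof (rule that [of "w \<odot>\<^sub>c f" "inverse w"])
    show "Star C (w \<odot>\<^sub>c f) \<star> (w \<odot>\<^sub>c f) = \<i> (Unit C)"
      using w by (simp add: Star_Scale ff mult.commute mult.left_commute)
    show "f = inverse w \<odot>\<^sub>c w \<odot>\<^sub>c f" using w0 by simp
  qed (simp add: HomI)
qed

end

locale fib_obj = unitary_category C for C :: "('o, 'm) pcat" (structure) +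
  fixes x :: 'o and c c' v v' :: 'm
  assumes fib: "fib_object C x c c' v v'"
begin

lemma x [simp]: "x \<in> Obj C"
  using fib by (simp add: fib_object_def)

lemma fib_mor [simp]:
  "c \<in> Mor C" "Dom C c = Unit C" "Cod C c = x \<boxtimes> x"
  "c' \<in> Mor C" "Dom C c' = x \<boxtimes> x" "Cod C c' = Unit C"
  "v \<in> Mor C" "Dom C v = x \<boxtimes> x" "Cod C v = x"
  "v' \<in> Mor C" "Dom C v' = x" "Cod C v' = x \<boxtimes> x"
  using fib by (auto simp: fib_object_def Hom_def)

lemma fib_rel:
  "c' \<star> c = of_real tau \<odot>\<^sub>c \<i> (Unit C)" "v \<star> v' = \<i> x"
  "(1 / of_real tau) \<odot>\<^sub>c (c \<star> c') \<oplus>\<^sub>c v' \<star> v = \<i> (x \<boxtimes> x)"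
  "(\<i> x \<otimes>\<^sub>c c') \<star> (c \<otimes>\<^sub>c \<i> x) = \<i> x" "(c' \<otimes>\<^sub>c \<i> x) \<star> (\<i> x \<otimes>\<^sub>c c) = \<i> x"
  using fib by (auto simp: fib_object_def)

lemma tau_nz [simp]: "tau \<noteq> 0"
  using tau_gt_1 by simp

text \<open>The trace of the fusion rule gives \<open>d^2 = d + 1\<close>, and nonnegativity of
  \<open>d\<close> excludes the conjugate root.\<close>

lemma dm_x: "dm x = complex_of_real tau"
proof -
  have "dm x * dm x = scu (tr (x \<boxtimes> x) (\<i> (x \<boxtimes> x)))"
    by (simp add: dm_tens [symmetric]) (simp add: dm_def)
  also have "\<dots> = 1 / of_real tau * scu (tr (x \<boxtimes> x) (c \<star> c')) + scu (tr (x \<boxtimes> x) (v' \<star> v))"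
    by (subst fib_rel(3) [symmetric]) (simp add: scu_tr_add scu_tr_scale)
  also have "scu (tr (x \<boxtimes> x) (c \<star> c')) = of_real tau * dm (Unit C)"
    using scu_tr_commute [of c' "x \<boxtimes> x" "Unit C" c] by (simp add: fib_rel scu_tr_scale dm_def)
  also have "scu (tr (x \<boxtimes> x) (v' \<star> v)) = dm x"
    using scu_tr_commute [of v "x \<boxtimes> x" x v'] by (simp add: fib_rel dm_def)
  finally have d: "dm x * dm x = dm x + 1" by simp
  obtain r where r: "r \<ge> 0" "dm x = complex_of_real r" using dm_nonneg [of x] by auto
  have "complex_of_real (r * r) = complex_of_real (r + 1)" using d r by simp
  then have "r * r = r + 1" by (simp only: of_real_eq_iff)
  then show ?thesis using r golden_root by simp
qed

lemma fib_expand: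
  assumes [simp]: "g \<in> Mor C" "Cod C g = a \<boxtimes> x \<boxtimes> x \<boxtimes> b" "a \<in> Obj C" "b \<in> Obj C"
  shows "g = (1 / of_real tau) \<odot>\<^sub>c ((\<i> a \<otimes>\<^sub>c c \<otimes>\<^sub>c \<i> b) \<star> (\<i> a \<otimes>\<^sub>c c' \<otimes>\<^sub>c \<i> b) \<star> g)
    \<oplus>\<^sub>c (\<i> a \<otimes>\<^sub>c v' \<otimes>\<^sub>c \<i> b) \<star> (\<i> a \<otimes>\<^sub>c v \<otimes>\<^sub>c \<i> b) \<star> g"
proof -
  have "g = (\<i> a \<otimes>\<^sub>c \<i> (x \<boxtimes> x) \<otimes>\<^sub>c \<i> b) \<star> g" by simp
  also have "\<dots> = (\<i> a \<otimes>\<^sub>c ((1 / of_real tau) \<odot>\<^sub>c (c \<star> c') \<oplus>\<^sub>c v' \<star> v) \<otimes>\<^sub>c \<i> b) \<star> g"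
    by (simp only: fib_rel)
  also have "\<dots> = (1 / of_real tau) \<odot>\<^sub>c ((\<i> a \<otimes>\<^sub>c c \<otimes>\<^sub>c \<i> b) \<star> (\<i> a \<otimes>\<^sub>c c' \<otimes>\<^sub>c \<i> b) \<star> g)
    \<oplus>\<^sub>c (\<i> a \<otimes>\<^sub>c v' \<otimes>\<^sub>c \<i> b) \<star> (\<i> a \<otimes>\<^sub>c v \<otimes>\<^sub>c \<i> b) \<star> g"
    by (simp add: tens_add_left tens_add_right comp_add_left tens_comp_left tens_comp_right assoc)
  finally show ?thesis .
qed

text \<open>Fusing the two copies of \<open>x\<close> decomposes the morphism space into those from
  \<open>a\<close> and from \<open>a x\<close>.\<close>

lemma hom0_fuse:
  assumes 1: "hom0 a b" and 2: "hom0 (a \<boxtimes> x) b" and [simp]: "a \<in> Obj C" "b \<in> Obj C"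
  shows "hom0 (a \<boxtimes> x \<boxtimes> x) b"
proof
  fix f assume f: "f \<in> Hom C (a \<boxtimes> x \<boxtimes> x) b"
  note [simp] = HomD [OF f]
  have "f = f \<star> \<i> (a \<boxtimes> x \<boxtimes> x)" by simp
  also have "\<i> (a \<boxtimes> x \<boxtimes> x) = (1 / of_real tau) \<odot>\<^sub>c ((\<i> a \<otimes>\<^sub>c c) \<star> (\<i> a \<otimes>\<^sub>c c'))
    \<oplus>\<^sub>c (\<i> a \<otimes>\<^sub>c v') \<star> (\<i> a \<otimes>\<^sub>c v)"
    using fib_expand [of "\<i> (a \<boxtimes> x \<boxtimes> x)" a "Unit C"] by simp
  also have "f \<star> \<dots> = (1 / of_real tau) \<odot>\<^sub>c ((f \<star> (\<i> a \<otimes>\<^sub>c c)) \<star> (\<i> a \<otimes>\<^sub>c c'))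
    \<oplus>\<^sub>c (f \<star> (\<i> a \<otimes>\<^sub>c v')) \<star> (\<i> a \<otimes>\<^sub>c v)"
    by (simp add: comp_add_right assoc)
  also have "f \<star> (\<i> a \<otimes>\<^sub>c c) = Zero C a b" using 1 by (simp add: HomI)
  also have "f \<star> (\<i> a \<otimes>\<^sub>c v') = Zero C (a \<boxtimes> x) b" using 2 by (simp add: HomI)
  finally show "f = Zero C (a \<boxtimes> x \<boxtimes> x) b" by simp
qed

text \<open>Frobenius reciprocity: the strand \<open>x\<close> is bent from target to source, and
  bending it back recovers the morphism.\<close>

lemma hom0_frobenius:
  assumes 1: "hom0 (a \<boxtimes> x) b" and [simp]: "a \<in> Obj C" "b \<in> Obj C"
  shows "hom0 a (b \<boxtimes> x)"
proof
  fix f assume f: "f \<in> Hom C a (b \<boxtimes> x)"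
  note [simp] = HomD [OF f]
  let ?g = "(\<i> b \<otimes>\<^sub>c c') \<star> (f \<otimes>\<^sub>c \<i> x)"
  have "?g = Zero C (a \<boxtimes> x) b" using 1 by (simp add: HomI)
  then have "(?g \<otimes>\<^sub>c \<i> x) \<star> (\<i> a \<otimes>\<^sub>c c) = Zero C a (b \<boxtimes> x)" by (simp add: tens_Zero)
  moreover have "(?g \<otimes>\<^sub>c \<i> x) \<star> (\<i> a \<otimes>\<^sub>c c) =
    (\<i> b \<otimes>\<^sub>c c' \<otimes>\<^sub>c \<i> x) \<star> (f \<otimes>\<^sub>c \<i> (x \<boxtimes> x)) \<star> (\<i> a \<otimes>\<^sub>c c)"
    by (simp add: tens_comp_left assoc)
  moreover have "(f \<otimes>\<^sub>c \<i> (x \<boxtimes> x)) \<star> (\<i> a \<otimes>\<^sub>c c) = (\<i> b \<otimes>\<^sub>c \<i> x \<otimes>\<^sub>c c) \<star> f"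
    using slide [of f c] by simp
  moreover have "(\<i> b \<otimes>\<^sub>c c' \<otimes>\<^sub>c \<i> x) \<star> (\<i> b \<otimes>\<^sub>c \<i> x \<otimes>\<^sub>c c) \<star> f =
     (\<i> b \<otimes>\<^sub>c ((c' \<otimes>\<^sub>c \<i> x) \<star> (\<i> x \<otimes>\<^sub>c c))) \<star> f"
    by (simp add: tens_comp_right assoc)
  ultimately show "f = Zero C a (b \<boxtimes> x)" by (simp add: fib_rel)
qed

lemma frobenius_left:
  assumes [simp]: "f \<in> Mor C" "Dom C f = x \<boxtimes> y" "Cod C f = x \<boxtimes> z" "y \<in> Obj C" "z \<in> Obj C"
  shows "f = (\<i> x \<otimes>\<^sub>c ((c' \<otimes>\<^sub>c \<i> z) \<star> (\<i> x \<otimes>\<^sub>c f))) \<star> (c \<otimes>\<^sub>c \<i> (x \<boxtimes> y))"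
proof -
  have "(\<i> x \<otimes>\<^sub>c ((c' \<otimes>\<^sub>c \<i> z) \<star> (\<i> x \<otimes>\<^sub>c f))) \<star> (c \<otimes>\<^sub>c \<i> (x \<boxtimes> y)) =
    (\<i> x \<otimes>\<^sub>c c' \<otimes>\<^sub>c \<i> z) \<star> (\<i> x \<otimes>\<^sub>c \<i> x \<otimes>\<^sub>c f) \<star> (c \<otimes>\<^sub>c \<i> (x \<boxtimes> y))"
    by (simp add: tens_comp_right assoc)
  also have "(\<i> x \<otimes>\<^sub>c \<i> x \<otimes>\<^sub>c f) \<star> (c \<otimes>\<^sub>c \<i> (x \<boxtimes> y)) = (c \<otimes>\<^sub>c \<i> x \<otimes>\<^sub>c \<i> z) \<star> f"
    using slide [of c f] by simp
  also have "(\<i> x \<otimes>\<^sub>c c' \<otimes>\<^sub>c \<i> z) \<star> (c \<otimes>\<^sub>c \<i> x \<otimes>\<^sub>c \<i> z) \<star> f = (((\<i> x \<otimes>\<^sub>c c') \<star> (c \<otimes>\<^sub>c \<i> x)) \<otimes>\<^sub>c \<i> z) \<star> f"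
    by (simp add: tens_comp_left assoc del: tens_ident)
  also have "\<dots> = f" by (simp add: fib_rel)
  finally show ?thesis by simp
qed

text \<open>Bending identifies \<open>End (x y)\<close> with \<open>Hom (x x y) y\<close>, which
  fusion reduces to the line \<open>End y\<close>, since \<open>Hom (x y) y\<close> is zero. The
  dimension hypothesis ensures that \<open>x y\<close> is not zero.\<close>

lemma simple_tens:
  assumes y: "simple y" and h: "hom0 (x \<boxtimes> y) y" and d: "dm y \<noteq> 0"
  shows "simple (x \<boxtimes> y)"
  unfolding simple_def
proof (intro conjI ballI)
  have [simp]: "y \<in> Obj C" using y by simp
  show "x \<boxtimes> y \<in> Obj C" by simp
  show "\<i> (x \<boxtimes> y) \<noteq> Zero C (x \<boxtimes> y) (x \<boxtimes> y)"
  proof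
    assume "\<i> (x \<boxtimes> y) = Zero C (x \<boxtimes> y) (x \<boxtimes> y)"
    then have "0 \<odot>\<^sub>c \<i> (x \<boxtimes> y) = \<i> (x \<boxtimes> y)" by (simp add: scale_zero_left)
    then have "dm (x \<boxtimes> y) = 0"
      unfolding dm_def using scu_tr_scale [of "\<i> (x \<boxtimes> y)" "x \<boxtimes> y" 0] by simp
    then show False using d dm_x by (simp add: dm_tens)
  qed
  fix f assume f: "f \<in> Hom C (x \<boxtimes> y) (x \<boxtimes> y)"
  note [simp] = HomD [OF f]
  let ?g = "(c' \<otimes>\<^sub>c \<i> y) \<star> (\<i> x \<otimes>\<^sub>c f)"
  define z where "z = sc y (?g \<star> (c \<otimes>\<^sub>c \<i> y))"
  have gc: "?g \<star> (c \<otimes>\<^sub>c \<i> y) = z \<odot>\<^sub>c \<i> y"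
    unfolding z_def by (rule scE [OF y]) simp_all
  have gv: "?g \<star> (v' \<otimes>\<^sub>c \<i> y) = Zero C (x \<boxtimes> y) y"
    using h by (simp add: HomI)
  have "?g = ?g \<star> \<i> (x \<boxtimes> x \<boxtimes> y)" by simp
  also have "\<i> (x \<boxtimes> x \<boxtimes> y) = (1 / of_real tau) \<odot>\<^sub>c ((c \<otimes>\<^sub>c \<i> y) \<star> (c' \<otimes>\<^sub>c \<i> y))
    \<oplus>\<^sub>c (v' \<otimes>\<^sub>c \<i> y) \<star> (v \<otimes>\<^sub>c \<i> y)"
    using fib_expand [of "\<i> (x \<boxtimes> x \<boxtimes> y)" "Unit C" y] by simp
  also have "?g \<star> \<dots> = (1 / of_real tau) \<odot>\<^sub>c ((?g \<star> (c \<otimes>\<^sub>c \<i> y)) \<star> (c' \<otimes>\<^sub>c \<i> y))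
    \<oplus>\<^sub>c (?g \<star> (v' \<otimes>\<^sub>c \<i> y)) \<star> (v \<otimes>\<^sub>c \<i> y)"
    by (simp add: comp_add_right assoc)
  finally have g: "?g = (z / of_real tau) \<odot>\<^sub>c (c' \<otimes>\<^sub>c \<i> y)"
    unfolding gc gv by simp
  have "f = (\<i> x \<otimes>\<^sub>c ?g) \<star> (c \<otimes>\<^sub>c \<i> (x \<boxtimes> y))"
    by (rule frobenius_left) simp_all
  also have "\<dots> = (z / of_real tau) \<odot>\<^sub>c (((\<i> x \<otimes>\<^sub>c c') \<star> (c \<otimes>\<^sub>c \<i> x)) \<otimes>\<^sub>c \<i> y)"
    unfolding g by (simp add: tens_comp_left)
  also have "\<dots> = (z / of_real tau) \<odot>\<^sub>c \<i> (x \<boxtimes> y)" by (simp add: fib_rel)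
  finally show "\<exists>z. f = z \<odot>\<^sub>c \<i> (x \<boxtimes> y)" by blast
qed

text \<open>If \<open>x\<close> contained the unit, then \<open>End x\<close> would be spanned by \<open>1\<close> and the projection \<open>f f\<^sup>*\<close> onto
  the unit, and the complementary summand \<open>e\<close> would occur in \<open>x \<otimes> x\<close> only once, although
  \<open>e \<otimes> f f\<^sup>*\<close> and \<open>f f\<^sup>* \<otimes> e\<close> are orthogonal.\<close>

lemma hom0_unit: "hom0 (Unit C) x"
proof (rule ccontr)
  assume "\<not> hom0 (Unit C) x"
  then obtain f0 where f0: "f0 \<in> Hom C (Unit C) x" "f0 \<noteq> Zero C (Unit C) x" by auto
  obtain f where f: "f \<in> Hom C (Unit C) x" and ff: "Star C f \<star> f = \<i> (Unit C)"
    by (rule normalize_state [OF f0])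
  note [simp] = HomD [OF f]
  let ?s = "Star C f" and ?u = "Unit C"
  let ?p = "f \<star> ?s"
  define e where "e = \<i> x \<oplus>\<^sub>c (-1) \<odot>\<^sub>c ?p"
  have em [simp]: "e \<in> Mor C" "Dom C e = x" "Cod C e = x" by (simp_all add: e_def)
  have se: "?s \<star> e = Zero C x ?u"
    using assoc [of ?s f ?s] by (simp add: e_def comp_add_right ff add_inverse)
  have ef: "e \<star> f = Zero C ?u x"
    by (simp add: e_def comp_add_left assoc ff add_inverse)
  have pe: "?p \<star> e = Zero C x x" by (simp add: assoc se)
  have ee: "e \<star> e = e"
  proof -
    have "e \<star> e = e \<oplus>\<^sub>c (-1) \<odot>\<^sub>c (?p \<star> e)"
      by (subst e_def) (simp add: comp_add_left)
    then show ?thesis by (simp add: pe)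
  qed
  have stp: "Star C ?p = ?p" by (simp add: star_comp Star_Star)
  have ste: "Star C e = e"
  proof -
    have "Star C e = Star C (\<i> x) \<oplus>\<^sub>c Star C ((-1) \<odot>\<^sub>c ?p)"
      unfolding e_def by (rule Star_Add [of _ x x]) (simp_all add: HomI)
    then show ?thesis by (simp add: Star_Scale stp e_def)
  qed
  have trp: "scu (tr x ?p) = 1"
    using scu_tr_commute [of ?s x ?u f] by (simp add: ff dm_def [symmetric])
  have tre: "scu (tr x e) = of_real tau - 1"
  proof -
    have "scu (tr x e) = dm x + (-1) * scu (tr x ?p)"
      unfolding e_def dm_def by (subst scu_tr_add; (subst scu_tr_scale)?; simp)
    then show ?thesis by (simp add: dm_x trp)
  qed
  \<comment> \<open>A second, orthogonal unit summand would leave a projection \<open>?r\<close> of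
    trace \<tau> - 2, which is negative.\<close>
  have one: "\<exists>z. g = z \<odot>\<^sub>c f" if g: "g \<in> Hom C ?u x" for g
  proof -
    note [simp] = HomD [OF g]
    obtain z where z: "?s \<star> g = z \<odot>\<^sub>c \<i> ?u" using scE [of ?u "?s \<star> g"] by auto
    let ?h = "g \<oplus>\<^sub>c (- z) \<odot>\<^sub>c f"
    have "?h = Zero C ?u x"
    proof (rule ccontr)
      assume nz: "?h \<noteq> Zero C ?u x"
      have "?h \<in> Hom C ?u x" by (simp add: HomI)
      then obtain k w where k: "k \<in> Hom C ?u x" "Star C k \<star> k = \<i> ?u" "?h = w \<odot>\<^sub>c k"
        using normalize_state nz by metis
      note [simp] = HomD [OF k(1)]
      have w0: "w \<noteq> 0" using nz k(3) scale_zero_left [of k] by auto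
      have "w \<odot>\<^sub>c (?s \<star> k) = ?s \<star> ?h" unfolding k(3) by simp
      also have "\<dots> = Zero C ?u ?u"
        by (simp add: comp_add_right z ff flip: scale_add_left) (simp add: scale_zero_left)
      finally have sk: "?s \<star> k = Zero C ?u ?u"
        using scale_cancel [of w "?s \<star> k"] w0 by simp
      have ek: "e \<star> k = k" by (simp add: e_def comp_add_left assoc sk)
      have ke: "Star C k \<star> e = Star C k"
      proof -
        have "Star C (e \<star> k) = Star C k \<star> e" by (simp add: star_comp ste)
        then show ?thesis by (simp add: ek)
      qed
      let ?q = "k \<star> Star C k"
      have qq: "?q \<star> ?q = ?q" using assoc [of "Star C k" k "Star C k"] by (simp add: assoc k(2))
      have eq: "e \<star> ?q = ?q" "?q \<star> e = ?q"
        using assoc [of "Star C k" k e] by (simp_all add: ek ke assoc)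
      let ?r = "e \<oplus>\<^sub>c (-1) \<odot>\<^sub>c ?q"
      have "Star C ?r = Star C e \<oplus>\<^sub>c Star C ((-1) \<odot>\<^sub>c ?q)"
        by (rule Star_Add [of _ x x]) (simp_all add: HomI)
      then have str: "Star C ?r = ?r" by (simp add: Star_Scale star_comp Star_Star ste)
      have "?r \<star> ?r = e \<star> e \<oplus>\<^sub>c (-1) \<odot>\<^sub>c (?q \<star> e) \<oplus>\<^sub>c ((-1) \<odot>\<^sub>c (e \<star> ?q) \<oplus>\<^sub>c ?q \<star> ?q)"
        by (simp add: comp_add_left comp_add_right scale_add_right)
      also have "\<dots> = e \<oplus>\<^sub>c (-1) \<odot>\<^sub>c ?q \<oplus>\<^sub>c ((-1) \<odot>\<^sub>c ?q \<oplus>\<^sub>c ?q)"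
        by (simp only: ee eq qq)
      also have "(-1) \<odot>\<^sub>c ?q \<oplus>\<^sub>c ?q = Zero C x x"
        by (subst add_commute) (simp_all add: add_inverse)
      finally have rr: "Star C ?r \<star> ?r = ?r" unfolding str by simp
      have trq: "scu (tr x ?q) = 1"
        using scu_tr_commute [of "Star C k" x ?u k] by (simp add: k(2) dm_def [symmetric])
      have "scu (tr x ?r) = scu (tr x e) + (-1) * scu (tr x ?q)"
        by (subst scu_tr_add; (subst scu_tr_scale)?; simp)
      also have "\<dots> = complex_of_real (tau - 2)" by (simp add: tre trq)
      finally have t: "scu (tr x ?r) = complex_of_real (tau - 2)" .
      obtain y where "y \<ge> 0" "scu (tr x ?r) = complex_of_real y"
        using tr_projection [OF _ _ _ rr, of x] by auto
      then have "tau - 2 \<ge> 0" unfolding t by (simp only: of_real_eq_iff)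
      moreover have "tau < 2" by (rule tau_less_2)
      ultimately show False by simp
    qed
    then have "g = z \<odot>\<^sub>c f"
      using diff_eq_zero [of g "z \<odot>\<^sub>c f"] by simp
    then show ?thesis by blast
  qed
  \<comment> \<open>Bending sends \<open>End x\<close> to \<open>Hom 1 (x x)\<close>, which is
    spanned by \<open>c\<close> and \<open>v' f\<close>; these correspond to the identity and to
    \<open>b\<close>.\<close>
  define b where "b = (\<i> x \<otimes>\<^sub>c c') \<star> ((v' \<star> f) \<otimes>\<^sub>c \<i> x)"
  have bm [simp]: "b \<in> Mor C" "Dom C b = x" "Cod C b = x" by (simp_all add: b_def)
  have end_span: "\<exists>z w. a = z \<odot>\<^sub>c \<i> x \<oplus>\<^sub>c w \<odot>\<^sub>c b" if a: "a \<in> Hom C x x" for a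
  proof -
    note [simp] = HomD [OF a]
    let ?k = "(a \<otimes>\<^sub>c \<i> x) \<star> c"
    obtain z where z: "c' \<star> ?k = z \<odot>\<^sub>c \<i> ?u" using scE [of ?u "c' \<star> ?k"] by auto
    have "v \<star> ?k \<in> Hom C ?u x" by (simp add: HomI)
    then obtain w where w: "v \<star> ?k = w \<odot>\<^sub>c f" using one by blast
    have k: "?k = (z / of_real tau) \<odot>\<^sub>c c \<oplus>\<^sub>c w \<odot>\<^sub>c (v' \<star> f)"
      using fib_expand [of ?k ?u ?u] by (simp add: z w)
    have "(\<i> x \<otimes>\<^sub>c c') \<star> (?k \<otimes>\<^sub>c \<i> x) = (\<i> x \<otimes>\<^sub>c c') \<star> (a \<otimes>\<^sub>c \<i> (x \<boxtimes> x)) \<star> (c \<otimes>\<^sub>c \<i> x)"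
      by (simp add: tens_comp_left)
    also have "\<dots> = ((\<i> x \<otimes>\<^sub>c c') \<star> (a \<otimes>\<^sub>c \<i> (x \<boxtimes> x))) \<star> (c \<otimes>\<^sub>c \<i> x)"
      by (simp add: assoc)
    also have "(\<i> x \<otimes>\<^sub>c c') \<star> (a \<otimes>\<^sub>c \<i> (x \<boxtimes> x)) = a \<star> (\<i> x \<otimes>\<^sub>c c')"
      using slide [of a c'] by simp
    also have "(a \<star> (\<i> x \<otimes>\<^sub>c c')) \<star> (c \<otimes>\<^sub>c \<i> x) = a"
      by (simp add: assoc fib_rel)
    finally have "a = (\<i> x \<otimes>\<^sub>c c') \<star> (?k \<otimes>\<^sub>c \<i> x)" by simp
    also have "\<dots> = (z / of_real tau) \<odot>\<^sub>c \<i> x \<oplus>\<^sub>c w \<odot>\<^sub>c b"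
      unfolding k by (simp add: tens_add_left comp_add_right fib_rel b_def)
    finally show ?thesis by blast
  qed
  obtain z0 w0 where p0: "?p = z0 \<odot>\<^sub>c \<i> x \<oplus>\<^sub>c w0 \<odot>\<^sub>c b"
    using end_span [of ?p] by (auto simp: HomI)
  have tau1: "complex_of_real tau \<noteq> 1" using tau_gt_1 by simp
  \<comment> \<open>If the projection onto the unit were scalar it would be the identity, of trace
    \<tau> instead of 1.\<close>
  have w0: "w0 \<noteq> 0"
  proof
    assume "w0 = 0"
    then have p: "?p = z0 \<odot>\<^sub>c \<i> x" using p0 by (simp add: scale_zero_left)
    then have "?p \<star> f = z0 \<odot>\<^sub>c f" by simp
    then have "f = z0 \<odot>\<^sub>c f" by (simp add: assoc ff)
    then have "?s \<star> f = ?s \<star> z0 \<odot>\<^sub>c f" by (rule arg_cong)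
    also have "\<dots> = z0 \<odot>\<^sub>c (?s \<star> f)" by simp
    finally have "?s \<star> f = z0 \<odot>\<^sub>c (?s \<star> f)" .
    then have "z0 = 1" using scale_ident_inject [of ?u 1 z0] by (simp add: ff)
    then show False
      using trp p tau1 dm_x by (simp add: dm_def)
  qed
  \<comment> \<open>\<open>b\<close> is a combination of the identity and the projection onto the
    unit, and the latter kills \<open>e\<close>.\<close>
  have ae: "\<exists>z. a \<star> e = z \<odot>\<^sub>c e" if a: "a \<in> Hom C x x" for a
  proof -
    obtain z w where zw: "a = z \<odot>\<^sub>c \<i> x \<oplus>\<^sub>c w \<odot>\<^sub>c b" using end_span [OF a] by blast
    have "Zero C x x = z0 \<odot>\<^sub>c e \<oplus>\<^sub>c w0 \<odot>\<^sub>c (b \<star> e)"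
      unfolding pe [symmetric] p0 by (simp add: comp_add_left)
    then have "(1/w0) \<odot>\<^sub>c Zero C x x = (1/w0) \<odot>\<^sub>c (z0 \<odot>\<^sub>c e \<oplus>\<^sub>c w0 \<odot>\<^sub>c (b \<star> e))" by simp
    then have "Zero C x x = (z0/w0) \<odot>\<^sub>c e \<oplus>\<^sub>c b \<star> e"
      using w0 by (simp add: scale_add_right)
    then have "b \<star> e \<oplus>\<^sub>c (z0/w0) \<odot>\<^sub>c e = (- (z0/w0)) \<odot>\<^sub>c e \<oplus>\<^sub>c (z0/w0) \<odot>\<^sub>c e"
      using add_commute [of "b \<star> e" "(z0/w0) \<odot>\<^sub>c e"] by (simp add: scale_zero_left flip: scale_add_left)
    then have be: "b \<star> e = (- (z0/w0)) \<odot>\<^sub>c e"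
      by (rule add_cancel [rotated 7]) simp_all
    have "a \<star> e = (z + w * (- (z0/w0))) \<odot>\<^sub>c e"
      unfolding zw by (simp add: comp_add_left be flip: scale_add_left)
    then show ?thesis by blast
  qed
  \<comment> \<open>\<open>c' s\<close> is a multiple of \<open>f*\<close>, so it vanishes on
    \<open>e\<close>; only the part of \<open>s\<close> through \<open>v'\<close> remains, and
    \<open>ae\<close> makes it a multiple.\<close>
  have co_e: "\<exists>z. s = z \<odot>\<^sub>c (v' \<star> e)" if s: "s \<in> Hom C x (x \<boxtimes> x)" "s \<star> e = s" for s
  proof -
    note [simp] = HomD [OF s(1)]
    have "Star C (c' \<star> s) \<in> Hom C ?u x" by (simp add: HomI)
    then obtain z where z: "Star C (c' \<star> s) = z \<odot>\<^sub>c f" using one by blast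
    have cs: "c' \<star> s = cnj z \<odot>\<^sub>c ?s"
      using Star_Star [of "c' \<star> s"] by (simp add: z Star_Scale)
    have "c' \<star> s = (c' \<star> s) \<star> e" using s(2) by (simp add: assoc)
    also have "\<dots> = Zero C x ?u" unfolding cs by (simp add: se)
    finally have c0: "c' \<star> s = Zero C x ?u" .
    have "v \<star> s \<in> Hom C x x" by (simp add: HomI)
    then obtain w where "(v \<star> s) \<star> e = w \<odot>\<^sub>c e" using ae by blast
    then have w: "v \<star> s = w \<odot>\<^sub>c e" using s(2) by (simp add: assoc)
    have "s = w \<odot>\<^sub>c (v' \<star> e)"
      using fib_expand [of s ?u ?u] by (simp add: c0 w)
    then show ?thesis by blast
  qed
  \<comment> \<open>These embed the summand \<open>e\<close> into \<open>x x\<close> next to a unit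
    on the right and on the left. By \<open>co_e\<close> both are multiples of one morphism.\<close>
  let ?a = "(\<i> x \<otimes>\<^sub>c f) \<star> e" and ?b = "(f \<otimes>\<^sub>c \<i> x) \<star> e"
  have "?a \<in> Hom C x (x \<boxtimes> x)" "?a \<star> e = ?a" "?b \<in> Hom C x (x \<boxtimes> x)" "?b \<star> e = ?b"
    by (simp_all add: HomI assoc ee)
  then obtain \<alpha> \<beta> where ab: "?a = \<alpha> \<odot>\<^sub>c (v' \<star> e)" "?b = \<beta> \<odot>\<^sub>c (v' \<star> e)"
    using co_e by meson
  have sa: "(\<i> x \<otimes>\<^sub>c ?s) \<star> ?a = e"
    using assoc [of e "\<i> x \<otimes>\<^sub>c f" "\<i> x \<otimes>\<^sub>c ?s"] by (simp add: tens_comp ff)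
  have sb: "(?s \<otimes>\<^sub>c \<i> x) \<star> ?b = e"
    using assoc [of e "f \<otimes>\<^sub>c \<i> x" "?s \<otimes>\<^sub>c \<i> x"] by (simp add: tens_comp ff)
  have sab: "(?s \<otimes>\<^sub>c \<i> x) \<star> ?a = Zero C x x"
  proof -
    have "(?s \<otimes>\<^sub>c \<i> x) \<star> ?a = ((?s \<otimes>\<^sub>c \<i> x) \<star> (\<i> x \<otimes>\<^sub>c f)) \<star> e" by (simp add: assoc)
    also have "(?s \<otimes>\<^sub>c \<i> x) \<star> (\<i> x \<otimes>\<^sub>c f) = f \<star> ?s"
      using slide [of ?s f] by simp
    finally show ?thesis by (simp add: pe)
  qed
  have "e = Zero C x x"
  proof (cases "\<alpha> = 0")
    case True
    then have "?a = Zero C x (x \<boxtimes> x)" using ab(1) scale_zero_left [of "v' \<star> e"] by simp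
    then show ?thesis using sa by simp
  next
    case False
    then have "v' \<star> e = (1/\<alpha>) \<odot>\<^sub>c ?a" using ab(1) by simp
    then have "?b = (\<beta>/\<alpha>) \<odot>\<^sub>c ?a" using ab(2) by simp
    then have "(?s \<otimes>\<^sub>c \<i> x) \<star> ?b = (?s \<otimes>\<^sub>c \<i> x) \<star> (\<beta>/\<alpha>) \<odot>\<^sub>c ?a" by simp
    also have "\<dots> = (\<beta>/\<alpha>) \<odot>\<^sub>c ((?s \<otimes>\<^sub>c \<i> x) \<star> ?a)" by (rule comp_scale) simp_all
    finally show ?thesis unfolding sab sb by simp
  qed
  then have "scu (tr x e) = 0"
    using scu_tr_scale [of e x 0] scale_zero_left [of e] by simp
  then show False using tre tau1 by simp
qed

lemma simple_x: "simple x"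
  using simple_tens [OF simple_unit] hom0_star [OF hom0_unit] by simp

end

section \<open>Alternating words and their simple summands\<close>

definition word_obj where "word_obj C X w = foldr (\<lambda>a. TensO C (X a)) w (Unit C)"

text \<open>Letters are truth values, so that exchanging the two letters is negation and statements
  about both kinds of words become one.\<close>

definition alt :: "bool \<Rightarrow> nat \<Rightarrow> bool list" where "alt a k = alternating a (\<not> a) k"

lemma alt_simps [simp]: "alt a 0 = []" "alt a (Suc k) = a # alt (\<not> a) k"
  by (simp_all add: alt_def)

lemma length_alt [simp]: "length (alt a k) = k"
  by (induction k arbitrary: a) auto

lemma alt_append: "alt a (j + k) = alt a j @ alt (if even j then a else \<not> a) k"
  by (induction j arbitrary: a) auto

lemma alt_snoc: "k \<ge> 1 \<Longrightarrow> alt a k = alt a (k - 1) @ [if odd k then a else \<not> a]"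
  using alt_append [of a "k - 1" 1] by (cases k) auto

lemma alt_neq: "k \<ge> 1 \<Longrightarrow> alt a k = alt b j \<longleftrightarrow> a = b \<and> k = j"
  by (cases k; cases j) (auto dest: arg_cong [of _ _ length])

text \<open>What is extracted from a quotient: two Fibonacci objects in a unitary category, and
  \<open>n\<close> as the first length at which the two alternating words become isomorphic.\<close>

locale fib_words = unitary_category C for C :: "('o, 'm) pcat" (structure) +
  fixes X :: "bool \<Rightarrow> 'o" and cu ca mu co :: "bool \<Rightarrow> 'm" and n :: nat
  assumes fibs: "fib_object C (X a) (cu a) (ca a) (mu a) (co a)"
    and n3: "3 \<le> n"
    and iso_n: "isomorphic C (word_obj C X (alt a n)) (word_obj C X (alt (\<not> a) n))"
    and not_iso: "\<lbrakk>2 \<le> k; k < n\<rbrakk> \<Longrightarrow> \<not> isomorphic C (word_obj C X (alt a k)) (word_obj C X (alt (\<not> a) k))"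
begin

sublocale F: fib_obj C "X a" "cu a" "ca a" "mu a" "co a" for a
  by unfold_locales (rule fibs)

abbreviation ob where "ob \<equiv> word_obj C X"

lemma ob_simps [simp]: "ob [] = Unit C" "ob (a # w) = X a \<boxtimes> ob w"
  by (simp_all add: word_obj_def)

lemma ob_Obj [simp]: "ob w \<in> Obj C"
  by (induction w) auto

lemma ob_append [simp]: "ob (u @ w) = ob u \<boxtimes> ob w"
  by (induction u) auto

lemma dm_ob: "dm (ob w) = complex_of_real tau ^ length w"
  by (induction w) (auto simp: dm_tens F.dm_x)

text \<open>In length 1, an isomorphism of the letters tensored with its inverse would give one in
  length 2.\<close>

lemma not_iso_1: "\<lbrakk>1 \<le> k; k < n\<rbrakk> \<Longrightarrow> \<not> isomorphic C (ob (alt a k)) (ob (alt (\<not> a) k))"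
proof (cases "k = 1")
  case True
  show ?thesis
  proof
    assume "isomorphic C (ob (alt a k)) (ob (alt (\<not> a) k))"
    then have "isomorphic C (X a) (X (\<not> a))" using True by simp
    then have "isomorphic C (X a \<boxtimes> X (\<not> a)) (X (\<not> a) \<boxtimes> X a)"
      by (intro isomorphic_tens isomorphic_sym [of "X a"])
    then show False using not_iso [of 2 a] n3 by (simp add: numeral_2_eq_2)
  qed
qed (use not_iso in auto)

lemma schur_hom0: "\<lbrakk>simple a; simple b; \<not> isomorphic C a b\<rbrakk> \<Longrightarrow> hom0 a b"
  using schur by blast

text \<open>Both claims need joint induction. Simplicity in length k + 1 follows from
  \<open>simple_tens\<close> and the second claim in length k. For the second claim in length k + 1,
  the last letter is moved to the source and fused; this leaves the claim in length k and Schur's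
  lemma for non-isomorphic simple words of length k + 1.\<close>

lemma simple_alt_aux:
  "k < n \<Longrightarrow> (\<forall>a. simple (ob (alt a k))) \<and> (\<forall>a. hom0 (ob (alt (\<not> a) k)) (ob (alt a (Suc k))))"
proof (induction k)
  case 0
  then show ?case using F.hom0_unit by simp
next
  case (Suc k)
  have IH: "simple (ob (alt a k))" "hom0 (ob (alt (\<not> a) k)) (ob (alt a (Suc k)))" for a
    using Suc by auto
  have S: "simple (ob (alt a (Suc k)))" for a
  proof -
    have "simple (X a \<boxtimes> ob (alt (\<not> a) k))"
    proof (rule F.simple_tens)
      show "simple (ob (alt (\<not> a) k))" by (rule IH)
      show "dm (ob (alt (\<not> a) k)) \<noteq> 0" by (simp add: dm_ob)
      show "hom0 (X a \<boxtimes> ob (alt (\<not> a) k)) (ob (alt (\<not> a) k))"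
        using hom0_star [OF IH(2)] by simp
    qed
    then show ?thesis by simp
  qed
  have Z: "hom0 (ob (alt (\<not> a) (Suc k))) (ob (alt a (Suc (Suc k))))" for a
  proof -
    \<comment> \<open>The words of lengths k + 1 and k + 2 with opposite first letters end in the
      same letter, so the moved letter meets an equal one.\<close>
    let ?l = "if odd (Suc (Suc k)) then a else \<not> a"
    have "alt a (Suc (Suc k)) = alt a (Suc k) @ [?l]"
      using alt_snoc [of "Suc (Suc k)" a] by (auto simp del: alt_simps)
    then have 1: "ob (alt a (Suc (Suc k))) = ob (alt a (Suc k)) \<boxtimes> X ?l"
      by (simp only: ob_append ob_simps tensO_simps F.x)
    have "alt (\<not> a) (Suc k) = alt (\<not> a) k @ [?l]"
      using alt_snoc [of "Suc k" "\<not> a"] by (auto simp del: alt_simps)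
    then have 2: "ob (alt (\<not> a) (Suc k)) = ob (alt (\<not> a) k) \<boxtimes> X ?l"
      by (simp only: ob_append ob_simps tensO_simps F.x)
    have "hom0 (ob (alt (\<not> a) k) \<boxtimes> X ?l \<boxtimes> X ?l) (ob (alt a (Suc k)))"
    proof (rule F.hom0_fuse)
      show "hom0 (ob (alt (\<not> a) k)) (ob (alt a (Suc k)))" by (rule IH)
      have "hom0 (ob (alt (\<not> a) (Suc k))) (ob (alt a (Suc k)))"
      proof (rule schur_hom0 [OF S S])
        show "\<not> isomorphic C (ob (alt (\<not> a) (Suc k))) (ob (alt a (Suc k)))"
          using not_iso_1 [of "Suc k" "\<not> a"] Suc.prems by simp
      qed
      then show "hom0 (ob (alt (\<not> a) k) \<boxtimes> X ?l) (ob (alt a (Suc k)))"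
        unfolding 2 .
    qed simp_all
    then have "hom0 (ob (alt (\<not> a) (Suc k)) \<boxtimes> X ?l) (ob (alt a (Suc k)))"
      unfolding 2 by (simp only: tensO_simps ob_Obj F.x)
    then show ?thesis
      unfolding 1 by (rule F.hom0_frobenius) simp_all
  qed
  show ?case using S Z by blast
qed

lemma simple_alt:
  assumes "k \<le> n"
  shows "simple (ob (alt a k))"
proof (cases "k < n")
  case True
  then show ?thesis using simple_alt_aux by blast
next
  case False
  then have k: "k = Suc (n - 1)" using assms n3 by simp
  have "simple (X a \<boxtimes> ob (alt (\<not> a) (n - 1)))"
  proof (rule F.simple_tens)
    have aux: "simple (ob (alt (\<not> a) (n - 1)))" "hom0 (ob (alt (\<not> a) (n - 1))) (ob (alt a (Suc (n - 1))))"
      using simple_alt_aux [of "n - 1"] n3 by auto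
    show "simple (ob (alt (\<not> a) (n - 1)))" by (rule aux)
    show "dm (ob (alt (\<not> a) (n - 1))) \<noteq> 0" by (simp add: dm_ob)
    show "hom0 (X a \<boxtimes> ob (alt (\<not> a) (n - 1))) (ob (alt (\<not> a) (n - 1)))"
      using hom0_star [OF aux(2)] by simp
  qed
  then show ?thesis using k by simp
qed

text \<open>\<open>alt False n\<close> represents both words of length n, and \<open>k = 0\<close>
  gives the unit for either letter.\<close>

definition I where "I = {alt a k | a k. k < n} \<union> {alt False n}"

lemma alt_I: "k < n \<Longrightarrow> alt a k \<in> I" "alt False n \<in> I"
  by (auto simp: I_def)

lemma nil_I: "[] \<in> I"
  using alt_I(1) [of 0] n3 by simp

lemma I_E:
  assumes "T \<in> I"
  obtains a k where "T = alt a k" "k < n" | "T = alt False n"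
  using assms by (auto simp: I_def)

lemma finite_I: "finite I"
proof -
  have "I \<subseteq> (\<lambda>(a, k). alt a k) ` (UNIV \<times> {..n})" by (auto simp: I_def)
  then show ?thesis by (rule finite_subset) simp
qed

lemma length_I: "T \<in> I \<Longrightarrow> length T \<le> n"
  by (auto elim!: I_E)

lemma top_I: "\<lbrakk>T \<in> I; length T = n\<rbrakk> \<Longrightarrow> T = alt False n"
  by (erule I_E) auto

lemma simple_I: "T \<in> I \<Longrightarrow> simple (ob T)"
  by (auto elim!: I_E simp: simple_alt)

text \<open>Dimensions are powers of \<tau> > 1 and therefore separate different lengths; equal
  lengths are separated by minimality of \<open>n\<close>.\<close>

lemma family: "simple_family I ob"
  unfolding simple_family_def
proof (intro conjI ballI impI)
  fix T T' f
  assume T: "T \<in> I" "T' \<in> I" "T \<noteq> T'" and f: "f \<in> Hom C (ob T) (ob T')"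
  have "\<not> isomorphic C (ob T) (ob T')"
  proof
    assume i: "isomorphic C (ob T) (ob T')"
    then have "complex_of_real tau ^ length T = of_real tau ^ length T'"
      using dm_isomorphic by (metis dm_ob)
    then have "tau ^ length T = tau ^ length T'" by (metis of_real_eq_iff of_real_power)
    then have l: "length T = length T'" using tau_gt_1 by simp
    obtain a k where a: "T = alt a k" using T by (auto elim!: I_E)
    obtain b k' where b': "T' = alt b k'" using T by (auto elim!: I_E)
    then have b: "T' = alt b k" using l a by simp
    have "a \<noteq> b"
    proof
      assume "a = b"
      then show False using T(3) a b by simp
    qed
    moreover have "k \<ge> 1" using T a b by (cases k) auto
    moreover have "k < n"
    proof (rule ccontr)
      assume "\<not> k < n"
      then have "k = n" using length_I [OF T(1)] a by simp
      then have "length T = n" "length T' = n" using a b by simp_all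
      then show False using T top_I by metis
    qed
    ultimately show False using not_iso_1 [of k a] i a b by (cases a; cases b) auto
  qed
  then show "f = Zero C (ob T) (ob T')"
    using schur [OF simple_I simple_I] T f by blast
qed (rule simple_I)

text \<open>The lower bound \<open>m\<close> on the lengths of the summands measures how far the
  object stays away from containing the unit, the word of length 0.\<close>

definition dec :: "'o \<Rightarrow> nat \<Rightarrow> bool" where
  "dec z m \<longleftrightarrow> (\<exists>(J :: nat set) t g g'. basis I ob z J t g g' \<and> (\<forall>i \<in> J. m \<le> length (t i)))"

lemma dec_I: "T \<in> I \<Longrightarrow> dec (ob T) (length T)"
  unfolding dec_def using basis_singleton [OF family, of T "0 :: nat"] by blast

lemma dec_comp:
  assumes s: "splitting z K w u u'" and d: "\<And>i. i \<in> K \<Longrightarrow> dec (w i) m"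
  shows "dec z m"
proof -
  have "\<exists>J t g g'. \<forall>i\<in>K. basis I ob (w i) (J i :: nat set) (t i) (g i) (g' i) \<and> (\<forall>j\<in>J i. m \<le> length (t i j))"
    using d unfolding dec_def by metis
  then obtain J t g g' where b: "\<And>i. i \<in> K \<Longrightarrow> basis I ob (w i) (J i :: nat set) (t i) (g i) (g' i)"
    and m: "\<And>i j. i \<in> K \<Longrightarrow> j \<in> J i \<Longrightarrow> m \<le> length (t i j)" by blast
  obtain L :: "nat set" and r h h' where
    c: "basis I ob z L r h h'" "r ` L = (\<lambda>(i, j). t i j) ` Sigma K J"
    using basis_nat [OF basis_comp [OF s b]] by blast
  have "m \<le> length (r i)" if "i \<in> L" for i
  proof -
    have "r i \<in> (\<lambda>(i, j). t i j) ` Sigma K J" using c(2) that by blast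
    then show ?thesis using m by auto
  qed
  then show ?thesis unfolding dec_def using c(1) by blast
qed

lemma dec_iso:
  assumes "isomorphic C a z" "dec a m"
  shows "dec z m"
proof -
  obtain f g where "f \<in> Hom C a z" "g \<in> Hom C z a" "g \<star> f = \<i> a" "f \<star> g = \<i> z"
    using assms(1) unfolding isomorphic_def Defs.is_iso_def by blast
  then show ?thesis
    using dec_comp [OF splitting_iso [of f a z g "()"]] assms(2) by blast
qed

lemma dec_mono: "dec z m \<Longrightarrow> m' \<le> m \<Longrightarrow> dec z m'"
  unfolding dec_def using order_trans by meson

lemma dec_alt:
  assumes "k \<le> n"
  shows "dec (ob (alt a k)) k"
proof (cases "k < n \<or> a = False")
  case True
  then have "alt a k \<in> I" using assms alt_I(1) [of k a] alt_I(2) by (cases "k < n") auto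
  then show ?thesis using dec_I by fastforce
next
  case False
  then have "k = n" "a = True" using assms by auto
  then show ?thesis
    using dec_iso [OF iso_n [of False], of n] dec_I [OF alt_I(2)] by simp
qed

lemma dec_alt_last:
  assumes "k \<le> n" "1 \<le> k"
  shows "dec (ob (alt a k) \<boxtimes> X (if odd k then a else \<not> a)) (k - 1)"
proof -
  let ?l = "if odd k then a else \<not> a"
  let ?z = "ob (alt a (k - 1))"
  have k: "ob (alt a k) = ?z \<boxtimes> X ?l"
    by (subst alt_snoc [OF assms(2)]) simp
  have "dec (?z \<boxtimes> X ?l \<boxtimes> X ?l) (k - 1)"
  proof (rule dec_comp [OF splitting_tens_left [OF splitting_fib_object [OF fibs]]])
    show "dec (?z \<boxtimes> (if b then X ?l else Unit C)) (k - 1)" for b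
      using dec_alt [of "k - 1" a] dec_mono [OF dec_alt [of k a], of "k - 1"] assms k by (cases b) auto
  qed simp
  then show ?thesis using k by simp
qed

text \<open>Appending a letter equal to the last one fuses and loses at most one letter; appending
  the other letter lengthens the word, except at length n.\<close>

lemma dec_step:
  assumes "T \<in> I"
  shows "dec (ob T \<boxtimes> X a) (length T - 1)"
proof -
  obtain b k where T: "T = alt b k" "k \<le> n" using assms by (auto elim!: I_E intro: less_imp_le)
  consider "k = 0" | "k \<ge> 1" "a = (if odd k then b else \<not> b)" | "k \<ge> 1" "a \<noteq> (if odd k then b else \<not> b)" "k < n"
    | "k \<ge> 1" "a \<noteq> (if odd k then b else \<not> b)" "k = n"
    using T(2) by fastforce
  then show ?thesis
  proof cases
    case 1
    have "dec (ob (alt a 1)) 0" using dec_mono [OF dec_alt [of 1 a]] n3 by simp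
    then show ?thesis using 1 T by simp
  next
    case 2
    then show ?thesis using dec_alt_last [of k b] T by simp
  next
    case 3
    have "alt b (Suc k) = T @ [a]"
      using 3 T alt_snoc [of "Suc k" b] by (auto simp del: alt_simps)
    then have "ob (alt b (Suc k)) = ob T \<boxtimes> X a"
      by (metis F.x ob_append ob_simps tensO_simps(2))
    then show ?thesis using dec_mono [OF dec_alt [of "Suc k" b], of "k - 1"] 3 T by simp
  next
    case 4
    \<comment> \<open>\<open>T\<close> is exchanged for the isomorphic word of length n that does
      end in \<open>a\<close>.\<close>
    have "dec (ob (alt (\<not> b) n) \<boxtimes> X a) (n - 1)"
      using dec_alt_last [of n "\<not> b"] 4 n3 by (auto split: if_splits)
    moreover have "isomorphic C (ob (alt (\<not> b) n) \<boxtimes> X a) (ob T \<boxtimes> X a)"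
      using isomorphic_tens [OF iso_n [of "\<not> b"] isomorphic_refl [of "X a"]] T 4 by simp
    ultimately show ?thesis using dec_iso T 4 by simp
  qed
qed

lemma dec_append: "T \<in> I \<Longrightarrow> dec (ob T \<boxtimes> ob w) (length T - length w)"
proof (induction w arbitrary: T)
  case Nil
  then show ?case using dec_I by simp
next
  case (Cons a w)
  obtain J :: "nat set" and t g g' where b: "basis I ob (ob T \<boxtimes> X a) J t g g'"
    and m: "\<And>i. i \<in> J \<Longrightarrow> length T - 1 \<le> length (t i)"
    using dec_step [OF Cons.prems, of a] unfolding dec_def by blast
  have "dec ((ob T \<boxtimes> X a) \<boxtimes> ob w) (length T - length (a # w))"
  proof (rule dec_comp [OF splitting_tens_right])
    show "splitting (ob T \<boxtimes> X a) J (\<lambda>i. ob (t i)) g g'" using b by (simp add: basis_def)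
    fix i assume i: "i \<in> J"
    then have "t i \<in> I" using b by (auto simp: basis_def)
    from dec_mono [OF Cons.IH [OF this]]
    show "dec (ob (t i) \<boxtimes> ob w) (length T - length (a # w))" using m [OF i] by simp
  qed simp
  then show ?case by simp
qed

lemma dec_word: "dec (ob w) 0"
  using dec_append [OF nil_I, of w] by simp

lemma dec_alt_append:
  assumes "k \<le> n"
  shows "dec (ob (alt a k) \<boxtimes> ob w) (k - length w)"
proof -
  obtain J :: "nat set" and t g g' where b: "basis I ob (ob (alt a k)) J t g g'"
    and m: "\<And>i. i \<in> J \<Longrightarrow> k \<le> length (t i)"
    using dec_alt [OF assms, of a] unfolding dec_def by blast
  show ?thesis
  proof (rule dec_comp [OF splitting_tens_right])
    show "splitting (ob (alt a k)) J (\<lambda>i. ob (t i)) g g'" using b by (simp add: basis_def)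
    fix i assume i: "i \<in> J"
    then have "t i \<in> I" using b by (auto simp: basis_def)
    from dec_mono [OF dec_append [OF this, of w]]
    show "dec (ob (t i) \<boxtimes> ob w) (k - length w)" using m [OF i] by simp
  qed simp
qed

text \<open>Up to length n the word is simple. Beyond that, the first n letters form a simple word,
  and each of the k - n further letters costs at most one; at least 2n - k > 0 remain.\<close>

lemma dec_alt_pos:
  assumes "1 \<le> k" "k < 2 * n"
  shows "dec (ob (alt a k)) 1"
proof (cases "k \<le> n")
  case True
  then show ?thesis using dec_mono [OF dec_alt [OF True, of a]] assms by simp
next
  case False
  let ?w = "alt (if even n then a else \<not> a) (k - n)"
  have "alt a k = alt a n @ ?w" using alt_append [of a n "k - n"] False by simp
  then have "dec (ob (alt a k)) (n - (k - n))"
    using dec_alt_append [of n a ?w] by simp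
  then show ?thesis using dec_mono False assms by simp
qed

text \<open>States that \<open>Hom z 1\<close> is zero, in the form in which it is applied: after a
  linear functional.\<close>

lemma no_unit:
  assumes d: "dec z 1" and l: "lin z (Unit C) \<Lambda>" and f: "f \<in> Hom C z (Unit C)"
  shows "\<Lambda> f = 0"
proof -
  obtain J :: "nat set" and t g g' where b: "basis I ob z J t g g'" and m: "\<And>i. i \<in> J \<Longrightarrow> 1 \<le> length (t i)"
    using d unfolding dec_def by blast
  have "\<Lambda> f = (\<Sum>i\<in>{i \<in> J. t i = []}. sc (ob []) (f \<star> g i) * \<Lambda> (g' i))"
    by (rule basis_expand_left [OF family b nil_I]) (use l f in simp_all)
  also have "{i \<in> J. t i = []} = {}" using m by fastforce
  finally show ?thesis by simp
qed

lemma ex_word_basis: "\<exists>B. case B of (J :: nat set, t, g, g') \<Rightarrow> basis I ob (ob w) J t g g'"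
  using dec_word [of w] unfolding dec_def by auto

text \<open>An arbitrary decomposition is fixed for every word; \<open>basis_independent\<close>
  later allows exchanging it for an adapted one.\<close>

definition word_basis :: "bool list \<Rightarrow> nat set \<times> (nat \<Rightarrow> bool list) \<times> (nat \<Rightarrow> 'm) \<times> (nat \<Rightarrow> 'm)" where
  "word_basis w = (SOME B. case B of (J, t, g, g') \<Rightarrow> basis I ob (ob w) J t g g')"

definition BJ where "BJ w = fst (word_basis w)"
definition Bt where "Bt w = fst (snd (word_basis w))"
definition Bg where "Bg w = fst (snd (snd (word_basis w)))"
definition Bh where "Bh w = snd (snd (snd (word_basis w)))"

lemma word_basis: "basis I ob (ob w) (BJ w) (Bt w) (Bg w) (Bh w)"
  using someI_ex [OF ex_word_basis [of w]]
  by (simp add: BJ_def Bt_def Bg_def Bh_def word_basis_def case_prod_unfold)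

text \<open>Indices of the basis of \<open>Hom T (ob w)\<close>.\<close>

definition B where "B w T = {i \<in> BJ w. Bt w i = T}"

lemma finite_B: "finite (B w T)"
  using basis_finite [OF word_basis] by (simp add: B_def)

lemma B_mor:
  assumes "i \<in> B w T"
  shows "Bg w i \<in> Mor C" "Dom C (Bg w i) = ob T" "Cod C (Bg w i) = ob w"
    "Bh w i \<in> Mor C" "Dom C (Bh w i) = ob w" "Cod C (Bh w i) = ob T"
  using basis_mor [OF word_basis, of i w] assms by (auto simp: B_def)

lemma B_dual:
  assumes "i \<in> B w T" "j \<in> B w T" "T \<in> I"
  shows "sc (ob T) (Bh w i \<star> Bg w j) = (if i = j then 1 else 0)"
  using assms basis_dual [OF word_basis, of i w j T] simple_I by (auto simp: B_def)

lemma B_expand: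
  assumes "T \<in> I" "lin (ob T) (ob w) \<Lambda>" "x \<in> Hom C (ob T) (ob w)"
  shows "\<Lambda> x = (\<Sum>i\<in>B w T. sc (ob T) (Bh w i \<star> x) * \<Lambda> (Bg w i))"
  unfolding B_def by (rule basis_expand [OF family word_basis assms])

lemma B_expand_left:
  assumes "T \<in> I" "lin (ob w) (ob T) \<Lambda>" "x \<in> Hom C (ob w) (ob T)"
  shows "\<Lambda> x = (\<Sum>i\<in>B w T. sc (ob T) (x \<star> Bg w i) * \<Lambda> (Bh w i))"
  unfolding B_def by (rule basis_expand_left [OF family word_basis assms])

lemma B_independent:
  assumes "basis I ob (ob w) J t g g'" "T \<in> I"
    and "\<And>y. y \<in> Hom C (ob w) (ob T) \<Longrightarrow> lin (ob T) (ob w) (\<lambda>x. \<Psi> x y)"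
    and "\<And>x. x \<in> Hom C (ob T) (ob w) \<Longrightarrow> lin (ob w) (ob T) (\<Psi> x)"
  shows "(\<Sum>i\<in>B w T. \<Psi> (Bg w i) (Bh w i)) = (\<Sum>i\<in>{i \<in> J. t i = T}. \<Psi> (g i) (g' i))"
  unfolding B_def by (rule basis_independent [OF family word_basis assms])

end

section \<open>The matrices by which words act\<close>

context fib_words
begin

lemma I_Obj [simp]: "T \<in> I \<Longrightarrow> simple (ob T)"
  by (rule simple_I)

text \<open>The scalar of the loop \<open>T -> a r -> y a r -> y T -> T\<close>, in which
  \<open>f\<close> creates the strand \<open>y\<close> on the left before \<open>g'\<close> removes
  \<open>r\<close>.\<close>

definition phi where
  "phi T y r f f' g g' = sc (ob T) (f' \<star> (\<i> y \<otimes>\<^sub>c g') \<star> (f \<otimes>\<^sub>c \<i> r) \<star> g)"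

lemma phi_lin:
  assumes T: "T \<in> I" and [simp]: "y \<in> Obj C" "r \<in> Obj C" "a \<in> Obj C"
  shows
    "\<lbrakk>f \<in> Hom C a (y \<boxtimes> a); f' \<in> Hom C (y \<boxtimes> ob T) (ob T); g' \<in> Hom C (a \<boxtimes> r) (ob T)\<rbrakk>
      \<Longrightarrow> lin (ob T) (a \<boxtimes> r) (\<lambda>g. phi T y r f f' g g')"
    "\<lbrakk>f \<in> Hom C a (y \<boxtimes> a); f' \<in> Hom C (y \<boxtimes> ob T) (ob T); g \<in> Hom C (ob T) (a \<boxtimes> r)\<rbrakk>
      \<Longrightarrow> lin (a \<boxtimes> r) (ob T) (phi T y r f f' g)"
    "\<lbrakk>f' \<in> Hom C (y \<boxtimes> ob T) (ob T); g \<in> Hom C (ob T) (a \<boxtimes> r); g' \<in> Hom C (a \<boxtimes> r) (ob T)\<rbrakk>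
      \<Longrightarrow> lin a (y \<boxtimes> a) (\<lambda>f. phi T y r f f' g g')"
    "\<lbrakk>f \<in> Hom C a (y \<boxtimes> a); g \<in> Hom C (ob T) (a \<boxtimes> r); g' \<in> Hom C (a \<boxtimes> r) (ob T)\<rbrakk>
      \<Longrightarrow> lin (y \<boxtimes> ob T) (ob T) (\<lambda>f'. phi T y r f f' g g')"
  unfolding phi_def
  by (rule lin_compose [OF lin_sc [OF I_Obj [OF T]]];
      auto simp: Hom_def tens_add_left tens_add_right comp_add_left comp_add_right)+

lemma phi_independent:
  assumes "T' \<in> I" "T \<in> I" "f \<in> Hom C (ob T) (ob Y \<boxtimes> ob T)" "f' \<in> Hom C (ob Y \<boxtimes> ob T') (ob T')"
    and "basis I ob (ob T \<boxtimes> ob R) J t g g'"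
  shows "(\<Sum>i\<in>B (T @ R) T'. phi T' (ob Y) (ob R) f f' (Bg (T @ R) i) (Bh (T @ R) i)) =
    (\<Sum>i\<in>{i \<in> J. t i = T'}. phi T' (ob Y) (ob R) f f' (g i) (g' i))"
  by (rule B_independent) (use assms phi_lin(1,2) in auto)

text \<open>The matrix, in the chosen bases, of the map sending \<open>f : T -> Y T\<close> to the
  sum over \<open>j\<close> of \<open>(Y g'_j) (f R) g_j : T' -> Y T'\<close>. Here
  \<open>g_j\<close> and \<open>g'_j\<close> are dual bases for \<open>T'\<close> inside
  \<open>T R\<close>.\<close>

definition Mx where
  "Mx Y R = (\<lambda>(T', k) (T, i). \<Sum>j\<in>B (T @ R) T'.
     phi T' (ob Y) (ob R) (Bg (Y @ T) i) (Bh (Y @ T') k) (Bg (T @ R) j) (Bh (T @ R) j))"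

definition K where "K Y = (SIGMA T:I. B (Y @ T) T)"

lemma finite_K: "finite (K Y)"
  unfolding K_def using finite_I finite_B by (rule finite_SigmaI)

lemma B_Hom:
  assumes "i \<in> B (Y @ T) T'"
  shows "Bg (Y @ T) i \<in> Hom C (ob T') (ob Y \<boxtimes> ob T)" "Bh (Y @ T) i \<in> Hom C (ob Y \<boxtimes> ob T) (ob T')"
  using B_mor [OF assms] by (auto intro: HomI)

lemma Mx_basis:
  assumes "(T, i) \<in> K Y" "(T', k) \<in> K Y" "basis I ob (ob T \<boxtimes> ob R) J t g g'"
  shows "Mx Y R (T', k) (T, i) = (\<Sum>j\<in>{j \<in> J. t j = T'}. phi T' (ob Y) (ob R) (Bg (Y @ T) i) (Bh (Y @ T') k) (g j) (g' j))"
  unfolding Mx_def prod.case by (rule phi_independent) (use assms B_Hom in \<open>auto simp: K_def\<close>)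

lemma Mx_Nil:
  assumes a: "a \<in> K Y" and b: "b \<in> K Y"
  shows "Mx Y [] a b = (if a = b then 1 else 0)"
proof -
  obtain T' k where A: "a = (T', k)" "T' \<in> I" "k \<in> B (Y @ T') T'" using a by (auto simp: K_def)
  obtain T i where Bb: "b = (T, i)" "T \<in> I" "i \<in> B (Y @ T) T" using b by (auto simp: K_def)
  have "basis I ob (ob T \<boxtimes> ob []) {()} (\<lambda>_. T) (\<lambda>_. \<i> (ob T)) (\<lambda>_. \<i> (ob T))"
    using basis_singleton [OF family Bb(2), of "()"] by simp
  then have "Mx Y [] a b = (\<Sum>j\<in>{j \<in> {()}. T = T'}.
      phi T' (ob Y) (ob []) (Bg (Y @ T) i) (Bh (Y @ T') k) (\<i> (ob T)) (\<i> (ob T)))"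
    unfolding A(1) Bb(1) using a b A(1) Bb(1) by (intro Mx_basis) simp_all
  also have "\<dots> = (if a = b then 1 else 0)"
  proof (cases "T = T'")
    case True
    then show ?thesis
      using A Bb B_mor [OF A(3)] B_mor [OF Bb(3)] B_dual [OF A(3), of i]
      by (simp add: phi_def)
  qed (use A Bb in simp)
  finally show ?thesis .
qed

text \<open>The sum over dual bases for \<open>T R R'\<close> may use the decomposition that first
  splits \<open>T R\<close> and then the tensor product of each summand with \<open>R'\<close>. The
  part acting with \<open>R\<close> is then a morphism from a summand to \<open>Y\<close> times that
  summand, and expanding it produces the matrix product. \<open>R\<close> acts first and hence
  stands on the right.\<close>

lemma Mx_append:
  assumes a: "a \<in> K Y" and b: "b \<in> K Y"
  shows "Mx Y (R @ R') a b = (\<Sum>e\<in>K Y. Mx Y R' a e * Mx Y R e b)"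
proof -
  obtain T'' k where A: "a = (T'', k)" "T'' \<in> I" "k \<in> B (Y @ T'') T''" using a by (auto simp: K_def)
  obtain T i where Bb: "b = (T, i)" "T \<in> I" "i \<in> B (Y @ T) T" using b by (auto simp: K_def)
  let ?y = "ob Y" and ?r = "ob R" and ?s = "ob R'"
  let ?f = "Bg (Y @ T) i" and ?h = "Bh (Y @ T'') k"
  note fm [simp] = B_mor [OF Bb(3)] and hm [simp] = B_mor [OF A(3)]
  let ?g = "Bg (T @ R)" and ?g' = "Bh (T @ R)" and ?t = "Bt (T @ R)"
  have s: "splitting (ob T \<boxtimes> ?r) (BJ (T @ R)) (\<lambda>j. ob (?t j)) ?g ?g'"
    and tI: "\<And>j. j \<in> BJ (T @ R) \<Longrightarrow> ?t j \<in> I"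
    using word_basis [of "T @ R"] by (simp_all add: basis_def)
  have wb: "basis I ob (ob (?t j) \<boxtimes> ?s) (BJ (?t j @ R')) (Bt (?t j @ R')) (Bg (?t j @ R')) (Bh (?t j @ R'))" for j
    using word_basis [of "?t j @ R'"] by simp
  have bb: "basis I ob (ob T \<boxtimes> ob (R @ R')) (SIGMA j:BJ (T @ R). BJ (?t j @ R'))
      (\<lambda>(j, l). Bt (?t j @ R') l) (\<lambda>(j, l). (?g j \<otimes>\<^sub>c \<i> ?s) \<star> Bg (?t j @ R') l)
      (\<lambda>(j, l). Bh (?t j @ R') l \<star> (?g' j \<otimes>\<^sub>c \<i> ?s))"
    using basis_comp [OF splitting_tens_right [OF s ob_Obj [of R']] wb] by simp
  let ?G = "\<lambda>j l. phi T'' ?y (ob (R @ R')) ?f ?h ((?g j \<otimes>\<^sub>c \<i> ?s) \<star> Bg (?t j @ R') l)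
      (Bh (?t j @ R') l \<star> (?g' j \<otimes>\<^sub>c \<i> ?s))"
  have "Mx Y (R @ R') a b = (\<Sum>p\<in>{p \<in> SIGMA j:BJ (T @ R). BJ (?t j @ R'). (case p of (j, l) \<Rightarrow> Bt (?t j @ R') l) = T''}.
      case p of (j, l) \<Rightarrow> ?G j l)"
    using Mx_basis [OF _ _ bb, of i Y T'' k] a b A Bb by (simp add: case_prod_unfold)
  also have "{p \<in> SIGMA j:BJ (T @ R). BJ (?t j @ R'). (case p of (j, l) \<Rightarrow> Bt (?t j @ R') l) = T''} =
      (SIGMA j:BJ (T @ R). B (?t j @ R') T'')"
    by (auto simp: B_def)
  also have "(\<Sum>p\<in>(SIGMA j:BJ (T @ R). B (?t j @ R') T''). case p of (j, l) \<Rightarrow> ?G j l) =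
      (\<Sum>j\<in>BJ (T @ R). \<Sum>l\<in>B (?t j @ R') T''. ?G j l)"
    using basis_finite [OF word_basis] finite_B by (simp add: sum.Sigma)
  also have "\<dots> = (\<Sum>j\<in>BJ (T @ R). \<Sum>m\<in>B (Y @ ?t j) (?t j). Mx Y R' a (?t j, m) *
      phi (?t j) ?y ?r ?f (Bh (Y @ ?t j) m) (?g j) (?g' j))"
  proof (rule sum.cong [OF HOL.refl])
    fix j assume j: "j \<in> BJ (T @ R)"
    let ?T = "?t j"
    have TI: "?T \<in> I" using tI j .
    note gm [simp] = basis_mor [OF word_basis j, simplified]
    \<comment> \<open>The image of \<open>?f\<close> under \<open>R\<close>, cut down to the summand
      \<open>?T\<close> of \<open>T R\<close>.\<close>
    let ?x = "(\<i> ?y \<otimes>\<^sub>c ?g' j) \<star> (?f \<otimes>\<^sub>c \<i> ?r) \<star> ?g j"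
    have xm [simp]: "?x \<in> Mor C" "Dom C ?x = ob ?T" "Cod C ?x = ?y \<boxtimes> ob ?T" by simp_all
    have x: "?x \<in> Hom C (ob ?T) (ob (Y @ ?T))" by (simp add: HomI)
    have "(\<Sum>l\<in>B (?T @ R') T''. ?G j l) = (\<Sum>l\<in>B (?T @ R') T''.
        phi T'' ?y ?s ?x ?h (Bg (?T @ R') l) (Bh (?T @ R') l))"
    proof (rule sum.cong [OF HOL.refl])
      fix l assume l: "l \<in> B (?T @ R') T''"
      note [simp] = B_mor [OF l, simplified]
      show "?G j l = phi T'' ?y ?s ?x ?h (Bg (?T @ R') l) (Bh (?T @ R') l)"
        by (simp add: phi_def tens_comp_left tens_comp_right assoc)
    qed
    also have "\<dots> = (\<Sum>l\<in>B (?T @ R') T''. \<Sum>m\<in>B (Y @ ?T) ?T. sc (ob ?T) (Bh (Y @ ?T) m \<star> ?x) *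
        phi T'' ?y ?s (Bg (Y @ ?T) m) ?h (Bg (?T @ R') l) (Bh (?T @ R') l))"
    proof (rule sum.cong [OF HOL.refl])
      fix l assume l: "l \<in> B (?T @ R') T''"
      note [simp] = B_mor [OF l, simplified]
      have "lin (ob ?T) (ob (Y @ ?T)) (\<lambda>f. phi T'' ?y ?s f ?h (Bg (?T @ R') l) (Bh (?T @ R') l))"
        using phi_lin(3) [OF A(2), of ?y ?s "ob ?T" ?h "Bg (?T @ R') l" "Bh (?T @ R') l"] by (simp add: HomI)
      from B_expand [OF TI this x]
      show "phi T'' ?y ?s ?x ?h (Bg (?T @ R') l) (Bh (?T @ R') l) =
          (\<Sum>m\<in>B (Y @ ?T) ?T. sc (ob ?T) (Bh (Y @ ?T) m \<star> ?x) *
            phi T'' ?y ?s (Bg (Y @ ?T) m) ?h (Bg (?T @ R') l) (Bh (?T @ R') l))" .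
    qed
    also have "\<dots> = (\<Sum>m\<in>B (Y @ ?T) ?T. sc (ob ?T) (Bh (Y @ ?T) m \<star> ?x) * Mx Y R' a (?T, m))"
      by (subst sum.swap) (simp add: Mx_def A sum_distrib_left)
    also have "\<dots> = (\<Sum>m\<in>B (Y @ ?T) ?T. Mx Y R' a (?T, m) * phi ?T ?y ?r ?f (Bh (Y @ ?T) m) (?g j) (?g' j))"
      by (simp add: phi_def mult.commute)
    finally show "(\<Sum>l\<in>B (?T @ R') T''. ?G j l) = \<dots>" .
  qed
  also have "\<dots> = (\<Sum>T'\<in>I. \<Sum>j\<in>B (T @ R) T'. \<Sum>m\<in>B (Y @ T') T'. Mx Y R' a (T', m) *
      phi T' ?y ?r ?f (Bh (Y @ T') m) (?g j) (?g' j))"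
  proof -
    have "(\<Sum>T'\<in>I. \<Sum>j\<in>B (T @ R) T'. \<Sum>m\<in>B (Y @ T') T'. Mx Y R' a (T', m) *
        phi T' ?y ?r ?f (Bh (Y @ T') m) (?g j) (?g' j)) =
      (\<Sum>T'\<in>I. \<Sum>j\<in>B (T @ R) T'. \<Sum>m\<in>B (Y @ ?t j) (?t j). Mx Y R' a (?t j, m) *
        phi (?t j) ?y ?r ?f (Bh (Y @ ?t j) m) (?g j) (?g' j))"
      by (intro sum.cong HOL.refl) (auto simp: B_def)
    also have "\<dots> = (\<Sum>j\<in>BJ (T @ R). \<Sum>m\<in>B (Y @ ?t j) (?t j). Mx Y R' a (?t j, m) *
        phi (?t j) ?y ?r ?f (Bh (Y @ ?t j) m) (?g j) (?g' j))"
      unfolding B_def [of "T @ R"]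
      by (rule sum.group) (use basis_finite [OF word_basis] finite_I tI in auto)
    finally show ?thesis by simp
  qed
  also have "\<dots> = (\<Sum>T'\<in>I. \<Sum>m\<in>B (Y @ T') T'. Mx Y R' a (T', m) * Mx Y R (T', m) b)"
    by (rule sum.cong [OF HOL.refl], subst sum.swap) (simp add: Mx_def Bb sum_distrib_left)
  also have "\<dots> = (\<Sum>e\<in>K Y. Mx Y R' a e * Mx Y R e b)"
    unfolding K_def using finite_I finite_B by (subst sum.Sigma) (auto simp: case_prod_unfold)
  finally show ?thesis .
qed

text \<open>With a basis adapted to the splitting of \<open>R\<close>, the injection slides past
  \<open>f\<close> and cancels against its own projection.\<close>

lemma Mx_split:
  assumes a: "a \<in> K Y" and b: "b \<in> K Y" and s: "splitting (ob R) L (\<lambda>k. ob (r k)) u u'"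
  shows "Mx Y R a b = (\<Sum>k\<in>L. Mx Y (r k) a b)"
proof -
  obtain T' m where A: "a = (T', m)" "T' \<in> I" "m \<in> B (Y @ T') T'" using a by (auto simp: K_def)
  obtain T i where Bb: "b = (T, i)" "T \<in> I" "i \<in> B (Y @ T) T" using b by (auto simp: K_def)
  let ?y = "ob Y"
  let ?f = "Bg (Y @ T) i" and ?h = "Bh (Y @ T') m"
  note fm [simp] = B_mor [OF Bb(3), simplified] and hm [simp] = B_mor [OF A(3), simplified]
  have wb: "basis I ob (ob T \<boxtimes> ob (r k)) (BJ (T @ r k)) (Bt (T @ r k)) (Bg (T @ r k)) (Bh (T @ r k))" for k
    using word_basis [of "T @ r k"] by simp
  have bb: "basis I ob (ob T \<boxtimes> ob R) (SIGMA k:L. BJ (T @ r k))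
      (\<lambda>(k, j). Bt (T @ r k) j) (\<lambda>(k, j). (\<i> (ob T) \<otimes>\<^sub>c u k) \<star> Bg (T @ r k) j)
      (\<lambda>(k, j). Bh (T @ r k) j \<star> (\<i> (ob T) \<otimes>\<^sub>c u' k))"
    by (rule basis_comp [OF splitting_tens_left [OF s ob_Obj [of T]] wb])
  let ?G = "\<lambda>k j. phi T' ?y (ob R) ?f ?h ((\<i> (ob T) \<otimes>\<^sub>c u k) \<star> Bg (T @ r k) j) (Bh (T @ r k) j \<star> (\<i> (ob T) \<otimes>\<^sub>c u' k))"
  have "Mx Y R a b = (\<Sum>p\<in>{p \<in> SIGMA k:L. BJ (T @ r k). (case p of (k, j) \<Rightarrow> Bt (T @ r k) j) = T'}.
      case p of (k, j) \<Rightarrow> ?G k j)"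
    using Mx_basis [OF _ _ bb, of i Y T' m] a b A Bb by (simp add: case_prod_unfold)
  also have "{p \<in> SIGMA k:L. BJ (T @ r k). (case p of (k, j) \<Rightarrow> Bt (T @ r k) j) = T'} = (SIGMA k:L. B (T @ r k) T')"
    by (auto simp: B_def)
  also have "(\<Sum>p\<in>(SIGMA k:L. B (T @ r k) T'). case p of (k, j) \<Rightarrow> ?G k j) = (\<Sum>k\<in>L. \<Sum>j\<in>B (T @ r k) T'. ?G k j)"
    using splittingD(1) [OF s] finite_B by (simp add: sum.Sigma)
  also have "\<dots> = (\<Sum>k\<in>L. Mx Y (r k) a b)"
  proof (rule sum.cong [OF HOL.refl])
    fix k assume k: "k \<in> L"
    note [simp] = splitting_mor [OF s k]
    have uu: "u' k \<star> u k = \<i> (ob (r k))" using splittingD(6) [OF s k k] by simp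
    have "?G k j = phi T' ?y (ob (r k)) ?f ?h (Bg (T @ r k) j) (Bh (T @ r k) j)" if j: "j \<in> B (T @ r k) T'" for j
    proof -
      note [simp] = B_mor [OF j, simplified]
      have "(\<i> ?y \<otimes>\<^sub>c \<i> (ob T) \<otimes>\<^sub>c u' k) \<star> (?f \<otimes>\<^sub>c \<i> (ob R)) \<star> (\<i> (ob T) \<otimes>\<^sub>c u k) =
          ?f \<otimes>\<^sub>c \<i> (ob (r k))"
      proof -
        have "(?f \<otimes>\<^sub>c \<i> (ob R)) \<star> (\<i> (ob T) \<otimes>\<^sub>c u k) = (\<i> (?y \<boxtimes> ob T) \<otimes>\<^sub>c u k) \<star> (?f \<otimes>\<^sub>c \<i> (ob (r k)))"
          using slide [of ?f "u k"] by simp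
        then have "(\<i> ?y \<otimes>\<^sub>c \<i> (ob T) \<otimes>\<^sub>c u' k) \<star> (?f \<otimes>\<^sub>c \<i> (ob R)) \<star> (\<i> (ob T) \<otimes>\<^sub>c u k) =
          (\<i> ?y \<otimes>\<^sub>c \<i> (ob T) \<otimes>\<^sub>c (u' k \<star> u k)) \<star> (?f \<otimes>\<^sub>c \<i> (ob (r k)))"
          by (simp add: tens_comp_right assoc)
        then show ?thesis by (simp add: uu)
      qed
      then have "(\<i> ?y \<otimes>\<^sub>c \<i> (ob T) \<otimes>\<^sub>c u' k) \<star> (?f \<otimes>\<^sub>c \<i> (ob R)) \<star> (\<i> (ob T) \<otimes>\<^sub>c u k) \<star> Bg (T @ r k) j =
          (?f \<otimes>\<^sub>c \<i> (ob (r k))) \<star> Bg (T @ r k) j"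
        by (simp flip: assoc)
      then show ?thesis
        by (simp add: phi_def tens_comp_right assoc)
    qed
    then show "(\<Sum>j\<in>B (T @ r k) T'. ?G k j) = Mx Y (r k) a b"
      by (simp add: Mx_def A Bb)
  qed
  finally show ?thesis .
qed

lemma Mx_fuse:
  assumes "a \<in> K Y" "b \<in> K Y"
  shows "Mx Y [l, l] a b = Mx Y [] a b + Mx Y [l] a b"
proof -
  have "splitting (ob [l, l]) UNIV (\<lambda>k. ob (if k then [l] else [])) (\<lambda>b. if b then co l else cu l)
      (\<lambda>b. if b then mu l else (1 / of_real tau) \<odot>\<^sub>c ca l)"
    using splitting_fib_object [OF fibs [of l]] by (simp add: if_distrib cong: if_cong)
  from Mx_split [OF assms this] show ?thesis by (simp add: UNIV_bool)
qed

lemma Mx_alt_n: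
  assumes "a \<in> K Y" "b \<in> K Y"
  shows "Mx Y (alt l n) a b = Mx Y (alt (\<not> l) n) a b"
proof -
  obtain f g where "f \<in> Hom C (ob (alt (\<not> l) n)) (ob (alt l n))" "g \<in> Hom C (ob (alt l n)) (ob (alt (\<not> l) n))"
    "g \<star> f = \<i> (ob (alt (\<not> l) n))" "f \<star> g = \<i> (ob (alt l n))"
    using isomorphic_sym [OF iso_n [of l]] unfolding isomorphic_def Defs.is_iso_def by blast
  from Mx_split [OF assms splitting_iso [OF this, of "()"]] show ?thesis by simp
qed

end

text \<open>\<open>Ev\<close> and \<open>c'\<close> both exhibit a dual of \<open>x\<close>; the
  comparison maps built from one cup and the other cap are mutually inverse by the zigzags.\<close>

lemma (in fib_obj) self_dual: "isomorphic C (x\<^sup>d) x"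
proof -
  let ?\<alpha> = "(Ev C x \<otimes>\<^sub>c \<i> x) \<star> (\<i> (x\<^sup>d) \<otimes>\<^sub>c c)" and ?\<beta> = "(c' \<otimes>\<^sub>c \<i> (x\<^sup>d)) \<star> (\<i> x \<otimes>\<^sub>c Coev C x)"
  have ab [simp]: "?\<alpha> \<in> Mor C" "Dom C ?\<alpha> = x\<^sup>d" "Cod C ?\<alpha> = x" "?\<beta> \<in> Mor C" "Dom C ?\<beta> = x" "Cod C ?\<beta> = x\<^sup>d"
    by simp_all
  have 1: "Ev C x \<star> (?\<beta> \<otimes>\<^sub>c \<i> x) = c'"
  proof -
    have "Ev C x \<star> (?\<beta> \<otimes>\<^sub>c \<i> x) = (Ev C x \<star> (c' \<otimes>\<^sub>c \<i> (x\<^sup>d) \<otimes>\<^sub>c \<i> x)) \<star> (\<i> x \<otimes>\<^sub>c Coev C x \<otimes>\<^sub>c \<i> x)"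
      by (simp add: tens_comp_left assoc)
    also have "Ev C x \<star> (c' \<otimes>\<^sub>c \<i> (x\<^sup>d) \<otimes>\<^sub>c \<i> x) = c' \<star> (\<i> x \<otimes>\<^sub>c \<i> x \<otimes>\<^sub>c Ev C x)"
      using slide [of c' "Ev C x"] by simp
    also have "(c' \<star> (\<i> x \<otimes>\<^sub>c \<i> x \<otimes>\<^sub>c Ev C x)) \<star> (\<i> x \<otimes>\<^sub>c Coev C x \<otimes>\<^sub>c \<i> x) =
        c' \<star> (\<i> x \<otimes>\<^sub>c ((\<i> x \<otimes>\<^sub>c Ev C x) \<star> (Coev C x \<otimes>\<^sub>c \<i> x)))"
      by (simp add: tens_comp_right assoc)
    finally show ?thesis by (simp add: zigzag)
  qed
  have 2: "c' \<star> (?\<alpha> \<otimes>\<^sub>c \<i> x) = Ev C x"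
  proof -
    have "c' \<star> (?\<alpha> \<otimes>\<^sub>c \<i> x) = (c' \<star> (Ev C x \<otimes>\<^sub>c \<i> x \<otimes>\<^sub>c \<i> x)) \<star> (\<i> (x\<^sup>d) \<otimes>\<^sub>c c \<otimes>\<^sub>c \<i> x)"
      by (simp add: tens_comp_left assoc)
    also have "c' \<star> (Ev C x \<otimes>\<^sub>c \<i> x \<otimes>\<^sub>c \<i> x) = Ev C x \<star> (\<i> (x\<^sup>d) \<otimes>\<^sub>c \<i> x \<otimes>\<^sub>c c')"
      using slide [of "Ev C x" c'] by simp
    also have "(Ev C x \<star> (\<i> (x\<^sup>d) \<otimes>\<^sub>c \<i> x \<otimes>\<^sub>c c')) \<star> (\<i> (x\<^sup>d) \<otimes>\<^sub>c c \<otimes>\<^sub>c \<i> x) =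
        Ev C x \<star> (\<i> (x\<^sup>d) \<otimes>\<^sub>c ((\<i> x \<otimes>\<^sub>c c') \<star> (c \<otimes>\<^sub>c \<i> x)))"
      by (simp add: tens_comp_right assoc)
    finally show ?thesis by (simp add: fib_rel)
  qed
  have 3: "?\<alpha> \<star> ?\<beta> = \<i> x"
  proof -
    have "?\<alpha> \<star> ?\<beta> = (Ev C x \<otimes>\<^sub>c \<i> x) \<star> (\<i> (x\<^sup>d) \<otimes>\<^sub>c c) \<star> ?\<beta>" by (simp add: assoc)
    also have "(\<i> (x\<^sup>d) \<otimes>\<^sub>c c) \<star> ?\<beta> = (?\<beta> \<otimes>\<^sub>c \<i> x \<otimes>\<^sub>c \<i> x) \<star> (\<i> x \<otimes>\<^sub>c c)"
      using slide [of ?\<beta> c] by simp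
    also have "(Ev C x \<otimes>\<^sub>c \<i> x) \<star> (?\<beta> \<otimes>\<^sub>c \<i> x \<otimes>\<^sub>c \<i> x) \<star> (\<i> x \<otimes>\<^sub>c c) = ((Ev C x \<star> (?\<beta> \<otimes>\<^sub>c \<i> x)) \<otimes>\<^sub>c \<i> x) \<star> (\<i> x \<otimes>\<^sub>c c)"
      by (simp add: tens_comp_left assoc)
    finally show ?thesis unfolding 1 by (simp add: fib_rel)
  qed
  have 4: "?\<beta> \<star> ?\<alpha> = \<i> (x\<^sup>d)"
  proof -
    have "?\<beta> \<star> ?\<alpha> = (c' \<otimes>\<^sub>c \<i> (x\<^sup>d)) \<star> (\<i> x \<otimes>\<^sub>c Coev C x) \<star> ?\<alpha>" by (simp add: assoc)
    also have "(\<i> x \<otimes>\<^sub>c Coev C x) \<star> ?\<alpha> = (?\<alpha> \<otimes>\<^sub>c \<i> x \<otimes>\<^sub>c \<i> (x\<^sup>d)) \<star> (\<i> (x\<^sup>d) \<otimes>\<^sub>c Coev C x)"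
      using slide [of ?\<alpha> "Coev C x"] by simp
    also have "(c' \<otimes>\<^sub>c \<i> (x\<^sup>d)) \<star> (?\<alpha> \<otimes>\<^sub>c \<i> x \<otimes>\<^sub>c \<i> (x\<^sup>d)) \<star> (\<i> (x\<^sup>d) \<otimes>\<^sub>c Coev C x) =
        ((c' \<star> (?\<alpha> \<otimes>\<^sub>c \<i> x)) \<otimes>\<^sub>c \<i> (x\<^sup>d)) \<star> (\<i> (x\<^sup>d) \<otimes>\<^sub>c Coev C x)"
      by (simp add: tens_comp_left [of "?\<alpha> \<otimes>\<^sub>c \<i> x" c'] assoc del: tens_ident)
    finally show ?thesis unfolding 2 by (simp add: zigzag_Dual)
  qed
  show ?thesis
    by (rule isomorphicI [OF _ _ 4 3]) (simp_all add: HomI)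
qed

section \<open>Traces weighted by dimensions\<close>

context fib_words
begin

lemma dual_word: "isomorphic C ((ob w)\<^sup>d) (ob (rev w))"
proof (induction w)
  case Nil
  then show ?case using isomorphic_refl [of "Unit C"] by simp
next
  case (Cons a w)
  then show ?case using isomorphic_tens [OF Cons F.self_dual [of a]] by simp
qed

lemma dm_dual: "dm ((ob w)\<^sup>d) = complex_of_real tau ^ length w"
  using dm_isomorphic [OF dual_word] dm_ob by simp

definition sharp where "sharp s t f = (\<i> s \<otimes>\<^sub>c Ev C (t\<^sup>d)) \<star> (f \<otimes>\<^sub>c \<i> (t\<^sup>d))"
definition flat where "flat s t f = (f \<otimes>\<^sub>c \<i> (t\<^sup>d)) \<star> (\<i> s \<otimes>\<^sub>c Coev C t)"

lemma mor_sharp [simp]: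
  assumes "f \<in> Mor C" "Dom C f = t" "Cod C f = s \<boxtimes> t" "s \<in> Obj C" "t \<in> Obj C"
  shows "sharp s t f \<in> Mor C" "Dom C (sharp s t f) = t \<boxtimes> t\<^sup>d" "Cod C (sharp s t f) = s"
  using assms by (simp_all add: sharp_def)

lemma mor_flat [simp]:
  assumes "f \<in> Mor C" "Dom C f = s \<boxtimes> t" "Cod C f = t" "s \<in> Obj C" "t \<in> Obj C"
  shows "flat s t f \<in> Mor C" "Dom C (flat s t f) = s" "Cod C (flat s t f) = t \<boxtimes> t\<^sup>d"
  using assms by (simp_all add: flat_def)

lemma sharp_flat:
  assumes "f \<in> Mor C" "Dom C f = t" "Cod C f = s \<boxtimes> t" "s \<in> Obj C" "t \<in> Obj C"
    and "g \<in> Mor C" "Dom C g = s \<boxtimes> t" "Cod C g = t"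
  shows "sharp s t f \<star> flat s t g = ptr s t (f \<star> g)"
  using assms by (simp add: sharp_def flat_def ptr_def tens_comp_left assoc)

lemma sharp_bend:
  assumes [simp]: "f \<in> Mor C" "Dom C f = t" "Cod C f = s \<boxtimes> t" "s \<in> Obj C" "t \<in> Obj C"
  shows "(sharp s t f \<otimes>\<^sub>c \<i> t) \<star> (\<i> t \<otimes>\<^sub>c Coev C (t\<^sup>d)) = f"
proof -
  have "(sharp s t f \<otimes>\<^sub>c \<i> t) \<star> (\<i> t \<otimes>\<^sub>c Coev C (t\<^sup>d)) =
    (\<i> s \<otimes>\<^sub>c Ev C (t\<^sup>d) \<otimes>\<^sub>c \<i> t) \<star> (f \<otimes>\<^sub>c \<i> (t\<^sup>d \<boxtimes> t)) \<star> (\<i> t \<otimes>\<^sub>c Coev C (t\<^sup>d))"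
    by (simp add: sharp_def tens_comp_left assoc)
  also have "(f \<otimes>\<^sub>c \<i> (t\<^sup>d \<boxtimes> t)) \<star> (\<i> t \<otimes>\<^sub>c Coev C (t\<^sup>d)) = (\<i> (s \<boxtimes> t) \<otimes>\<^sub>c Coev C (t\<^sup>d)) \<star> f"
    using slide [of f "Coev C (t\<^sup>d)"] by simp
  also have "(\<i> s \<otimes>\<^sub>c Ev C (t\<^sup>d) \<otimes>\<^sub>c \<i> t) \<star> (\<i> (s \<boxtimes> t) \<otimes>\<^sub>c Coev C (t\<^sup>d)) \<star> f =
     (\<i> s \<otimes>\<^sub>c ((Ev C (t\<^sup>d) \<otimes>\<^sub>c \<i> t) \<star> (\<i> t \<otimes>\<^sub>c Coev C (t\<^sup>d)))) \<star> f"
    by (simp add: tens_comp_right assoc)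
  finally show ?thesis using zigzag_Dual [of "t\<^sup>d"] by simp
qed

lemma flat_bend:
  assumes [simp]: "f \<in> Mor C" "Dom C f = s \<boxtimes> t" "Cod C f = t" "s \<in> Obj C" "t \<in> Obj C"
  shows "(\<i> t \<otimes>\<^sub>c Ev C t) \<star> (flat s t f \<otimes>\<^sub>c \<i> t) = f"
proof -
  have "(\<i> t \<otimes>\<^sub>c Ev C t) \<star> (flat s t f \<otimes>\<^sub>c \<i> t) =
    ((\<i> t \<otimes>\<^sub>c Ev C t) \<star> (f \<otimes>\<^sub>c \<i> (t\<^sup>d \<boxtimes> t))) \<star> (\<i> s \<otimes>\<^sub>c Coev C t \<otimes>\<^sub>c \<i> t)"
    by (simp add: flat_def tens_comp_left assoc)
  also have "(\<i> t \<otimes>\<^sub>c Ev C t) \<star> (f \<otimes>\<^sub>c \<i> (t\<^sup>d \<boxtimes> t)) = f \<star> (\<i> (s \<boxtimes> t) \<otimes>\<^sub>c Ev C t)"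
    using slide [of f "Ev C t"] by simp
  also have "(f \<star> (\<i> (s \<boxtimes> t) \<otimes>\<^sub>c Ev C t)) \<star> (\<i> s \<otimes>\<^sub>c Coev C t \<otimes>\<^sub>c \<i> t) =
    f \<star> (\<i> s \<otimes>\<^sub>c ((\<i> t \<otimes>\<^sub>c Ev C t) \<star> (Coev C t \<otimes>\<^sub>c \<i> t)))"
    by (simp add: tens_comp_right assoc)
  finally show ?thesis by (simp add: zigzag)
qed

lemma sharp_of_bend:
  assumes [simp]: "w \<in> Mor C" "Dom C w = t \<boxtimes> t\<^sup>d" "Cod C w = s" "s \<in> Obj C" "t \<in> Obj C"
  shows "sharp s t ((w \<otimes>\<^sub>c \<i> t) \<star> (\<i> t \<otimes>\<^sub>c Coev C (t\<^sup>d))) = w"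
proof -
  have "sharp s t ((w \<otimes>\<^sub>c \<i> t) \<star> (\<i> t \<otimes>\<^sub>c Coev C (t\<^sup>d))) =
    ((\<i> s \<otimes>\<^sub>c Ev C (t\<^sup>d)) \<star> (w \<otimes>\<^sub>c \<i> (t \<boxtimes> t\<^sup>d))) \<star> (\<i> t \<otimes>\<^sub>c Coev C (t\<^sup>d) \<otimes>\<^sub>c \<i> (t\<^sup>d))"
    by (simp add: sharp_def tens_comp_left assoc)
  also have "(\<i> s \<otimes>\<^sub>c Ev C (t\<^sup>d)) \<star> (w \<otimes>\<^sub>c \<i> (t \<boxtimes> t\<^sup>d)) = w \<star> (\<i> (t \<boxtimes> t\<^sup>d) \<otimes>\<^sub>c Ev C (t\<^sup>d))"
    using slide [of w "Ev C (t\<^sup>d)"] by simp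
  also have "(w \<star> (\<i> (t \<boxtimes> t\<^sup>d) \<otimes>\<^sub>c Ev C (t\<^sup>d))) \<star> (\<i> t \<otimes>\<^sub>c Coev C (t\<^sup>d) \<otimes>\<^sub>c \<i> (t\<^sup>d)) =
    w \<star> (\<i> t \<otimes>\<^sub>c ((\<i> (t\<^sup>d) \<otimes>\<^sub>c Ev C (t\<^sup>d)) \<star> (Coev C (t\<^sup>d) \<otimes>\<^sub>c \<i> (t\<^sup>d))))"
    by (simp add: tens_comp_right assoc)
  finally show ?thesis using zigzag [of "t\<^sup>d"] by simp
qed

text \<open>The maps obtained by bending \<open>Hom T (S \<otimes> T)\<close> to \<open>Hom (T \<otimes> T\<^sup>*) S\<close> form, up to the factors
  \<open>d\<^sub>S / d\<^sub>T\<close>, a basis adapted to \<open>T \<otimes> T\<^sup>*\<close>.\<close>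

lemma bent_completeness:
  assumes T: "T \<in> I" and l: "lin (ob T \<boxtimes> (ob T)\<^sup>d) (ob T \<boxtimes> (ob T)\<^sup>d) \<Lambda>"
  shows "(\<Sum>S\<in>I. dm (ob S) * (\<Sum>i\<in>B (S @ T) T. \<Lambda> (flat (ob S) (ob T) (Bh (S @ T) i) \<star> sharp (ob S) (ob T) (Bg (S @ T) i)))) =
    dm (ob T) * \<Lambda> (\<i> (ob T \<boxtimes> (ob T)\<^sup>d))"
proof -
  let ?t = "ob T"
  let ?z = "?t \<boxtimes> ?t\<^sup>d"
  have "isomorphic C (ob (T @ rev T)) ?z"
    using isomorphic_tens [OF isomorphic_refl [of ?t] isomorphic_sym [OF dual_word [of T]]] by simp
  then have "dec ?z 0" by (rule dec_iso) (rule dec_word)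
  then obtain J :: "nat set" and t w w' where b: "basis I ob ?z J t w w'" unfolding dec_def by blast
  have s: "splitting ?z J (\<lambda>j. ob (t j)) w w'" and tI: "\<And>j. j \<in> J \<Longrightarrow> t j \<in> I"
    using b by (auto simp: basis_def)
  note wm = basis_mor [OF b]
  define fj where "fj j = (w' j \<otimes>\<^sub>c \<i> ?t) \<star> (\<i> ?t \<otimes>\<^sub>c Coev C (?t\<^sup>d))" for j
  have fjm [simp]: "fj j \<in> Mor C" "Dom C (fj j) = ?t" "Cod C (fj j) = ob (t j) \<boxtimes> ?t" if "j \<in> J" for j
    using wm [OF that] by (simp_all add: fj_def)
  have fjs: "sharp (ob (t j)) ?t (fj j) = w' j" if "j \<in> J" for j
    using wm [OF that] unfolding fj_def by (intro sharp_of_bend) auto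
  have main: "dm (ob S) * (\<Sum>i\<in>B (S @ T) T. \<Lambda> (flat (ob S) ?t (Bh (S @ T) i) \<star> sharp (ob S) ?t (Bg (S @ T) i))) =
    dm ?t * (\<Sum>j\<in>{j \<in> J. t j = S}. \<Lambda> (w j \<star> w' j))" if S: "S \<in> I" for S
  proof -
    let ?s = "ob S" and ?f = "Bg (S @ T)" and ?h = "Bh (S @ T)"
    have d0: "dm ?s \<noteq> 0" by (simp add: dm_ob)
    \<comment> \<open>The left side is a trace over \<open>S\<close> and the right side one over
      \<open>T\<close>. Partial trace and cyclicity identify them; this is where the ratio of
      dimensions originates.\<close>
    have Bw: "dm ?s * sc ?s (w' j \<star> flat ?s ?t (?h i)) = sc ?t (?h i \<star> fj j) * dm ?t"
      if j: "j \<in> J" "t j = S" and i: "i \<in> B (S @ T) T" for i j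
    proof -
      note [simp] = B_mor [OF i, simplified] wm [OF j(1)]
      have e: "w' j \<star> flat ?s ?t (?h i) = ptr ?s ?t (fj j \<star> ?h i)"
        using sharp_flat [of "fj j" ?t ?s "?h i"] fjs [OF j(1)] fjm [OF j(1)] j(2) by simp
      have "dm ?s * sc ?s (w' j \<star> flat ?s ?t (?h i)) =
          scu (tr ?s (sc ?s (w' j \<star> flat ?s ?t (?h i)) \<odot>\<^sub>c \<i> ?s))"
        by (simp add: scu_tr_scale dm_def)
      also have "sc ?s (w' j \<star> flat ?s ?t (?h i)) \<odot>\<^sub>c \<i> ?s = w' j \<star> flat ?s ?t (?h i)"
        using S j(2) by (intro scE [symmetric]) auto
      also have "scu (tr ?s \<dots>) = scu (tr (?s \<boxtimes> ?t) (fj j \<star> ?h i))"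
        unfolding e using fjm [OF j(1)] j(2) by (simp add: tr_tens)
      also have "\<dots> = scu (tr ?t (?h i \<star> fj j))"
        by (rule scu_tr_commute) (use fjm [OF j(1)] j(2) in simp_all)
      also have "?h i \<star> fj j = sc ?t (?h i \<star> fj j) \<odot>\<^sub>c \<i> ?t"
        using fjm [OF j(1)] j(2) T by (intro scE) auto
      also have "scu (tr ?t \<dots>) = sc ?t (?h i \<star> fj j) * dm ?t"
        by (simp add: scu_tr_scale dm_def)
      finally show ?thesis .
    qed
    have "dm ?s * (\<Sum>i\<in>B (S @ T) T. \<Lambda> (flat ?s ?t (?h i) \<star> sharp ?s ?t (?f i))) =
      (\<Sum>i\<in>B (S @ T) T. \<Sum>j\<in>{j \<in> J. t j = S}. dm ?t * (sc ?t (?h i \<star> fj j) * \<Lambda> (w j \<star> sharp ?s ?t (?f i))))"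
      unfolding sum_distrib_left
    proof (rule sum.cong [OF HOL.refl])
      fix i assume i: "i \<in> B (S @ T) T"
      note [simp] = B_mor [OF i, simplified]
      have "lin ?s ?z (\<lambda>y. \<Lambda> (y \<star> sharp ?s ?t (?f i)))"
        by (rule lin_comp_right [OF l]) (simp add: HomI)
      from basis_expand [OF family b S this, of "flat ?s ?t (?h i)"]
      have "\<Lambda> (flat ?s ?t (?h i) \<star> sharp ?s ?t (?f i)) =
        (\<Sum>j\<in>{j \<in> J. t j = S}. sc ?s (w' j \<star> flat ?s ?t (?h i)) * \<Lambda> (w j \<star> sharp ?s ?t (?f i)))"
        by (simp add: HomI)
      then show "dm ?s * \<Lambda> (flat ?s ?t (?h i) \<star> sharp ?s ?t (?f i)) =
        (\<Sum>j\<in>{j \<in> J. t j = S}. dm ?t * (sc ?t (?h i \<star> fj j) * \<Lambda> (w j \<star> sharp ?s ?t (?f i))))"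
        unfolding sum_distrib_left using Bw [OF _ _ i]
        by (simp add: sum_distrib_left mult.assoc [symmetric] mult.commute [of _ "dm ?t"])
    qed
    also have "\<dots> = (\<Sum>j\<in>{j \<in> J. t j = S}. dm ?t * (\<Sum>i\<in>B (S @ T) T. sc ?t (?h i \<star> fj j) * \<Lambda> (w j \<star> sharp ?s ?t (?f i))))"
      by (subst sum.swap) (simp add: sum_distrib_left)
    also have "\<dots> = (\<Sum>j\<in>{j \<in> J. t j = S}. dm ?t * \<Lambda> (w j \<star> w' j))"
    proof (rule sum.cong [OF HOL.refl])
      fix j assume j: "j \<in> {j \<in> J. t j = S}"
      then have jJ: "j \<in> J" and tj: "t j = S" by auto
      note [simp] = wm [OF jJ]
      \<comment> \<open>The coefficients are those of \<open>fj j\<close> in the basis of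
        \<open>Hom T (S T)\<close>, so the sum over \<open>i\<close> reassembles it, and
        \<open>sharp\<close> turns it back into \<open>w' j\<close>.\<close>
      have "lin ?t (ob (S @ T)) (\<lambda>f. \<Lambda> (w j \<star> sharp ?s ?t f))"
        by (rule lin_compose [OF l])
          (auto simp: Hom_def tj sharp_def tens_add_left comp_add_left comp_add_right)
      from B_expand [OF T this, of "fj j"]
      have "\<Lambda> (w j \<star> sharp ?s ?t (fj j)) = (\<Sum>i\<in>B (S @ T) T. sc ?t (?h i \<star> fj j) * \<Lambda> (w j \<star> sharp ?s ?t (?f i)))"
        using fjm [OF jJ] tj by (simp add: HomI)
      then show "dm ?t * (\<Sum>i\<in>B (S @ T) T. sc ?t (?h i \<star> fj j) * \<Lambda> (w j \<star> sharp ?s ?t (?f i))) = dm ?t * \<Lambda> (w j \<star> w' j)"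
        using fjs [OF jJ] tj by simp
    qed
    finally show ?thesis by (simp add: sum_distrib_left)
  qed
  have "(\<Sum>S\<in>I. dm (ob S) * (\<Sum>i\<in>B (S @ T) T. \<Lambda> (flat (ob S) ?t (Bh (S @ T) i) \<star> sharp (ob S) ?t (Bg (S @ T) i)))) =
    dm ?t * (\<Sum>S\<in>I. \<Sum>j\<in>{j \<in> J. t j = S}. \<Lambda> (w j \<star> w' j))"
    using main by (simp add: sum_distrib_left)
  also have "(\<Sum>S\<in>I. \<Sum>j\<in>{j \<in> J. t j = S}. \<Lambda> (w j \<star> w' j)) = (\<Sum>j\<in>J. \<Lambda> (w j \<star> w' j))"
    by (rule sum.group) (use splittingD(1) [OF s] finite_I tI in auto)
  also have "\<dots> = \<Lambda> (\<i> ?z)" by (rule splittingD(7) [OF s l, symmetric])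
  finally show ?thesis .
qed

definition trM where "trM Y R = (\<Sum>a\<in>K Y. Mx Y R a a)"

lemma trM_eq: "trM Y R = (\<Sum>T\<in>I. \<Sum>i\<in>B (Y @ T) T. \<Sum>j\<in>B (T @ R) T.
    phi T (ob Y) (ob R) (Bg (Y @ T) i) (Bh (Y @ T) i) (Bg (T @ R) j) (Bh (T @ R) j))"
  unfolding trM_def K_def using finite_I finite_B by (subst sum.Sigma) (auto simp: Mx_def case_prod_unfold)

text \<open>Closes the strand \<open>t\<close> of \<open>h : t r -> t\<close> to a loop on the left,
  leaving a morphism from \<open>r\<close> to the unit.\<close>

definition psi where "psi t r h = Ev C t \<star> (\<i> (t\<^sup>d) \<otimes>\<^sub>c h) \<star> (Coev C (t\<^sup>d) \<otimes>\<^sub>c \<i> r)"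

text \<open>Seen from \<open>T T*\<close>, the strand \<open>S\<close> is a flattened map followed
  by a sharpened one. By \<open>bent_completeness\<close> the weighted sum replaces it by the
  identity of \<open>T T*\<close>, which separates the two ends of the strand.\<close>

lemma weighted_phi:
  assumes T: "T \<in> I" and g: "g \<in> Hom C (ob T) (ob T \<boxtimes> r)" and h: "h \<in> Hom C (ob T \<boxtimes> r) (ob T)" and r [simp]: "r \<in> Obj C"
  shows "(\<Sum>S\<in>I. dm (ob S) * (\<Sum>i\<in>B (S @ T) T. phi T (ob S) r (Bg (S @ T) i) (Bh (S @ T) i) g h)) =
    dm (ob T) * sc (ob T) ((\<i> (ob T) \<otimes>\<^sub>c psi (ob T) r h) \<star> g)"
proof -
  let ?t = "ob T"
  let ?z = "?t \<boxtimes> ?t\<^sup>d"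
  note [simp] = HomD [OF g] HomD [OF h]
  define \<Lambda> where "\<Lambda> y = sc ?t ((\<i> ?t \<otimes>\<^sub>c Ev C ?t) \<star> (y \<otimes>\<^sub>c h) \<star> (\<i> ?t \<otimes>\<^sub>c Coev C (?t\<^sup>d) \<otimes>\<^sub>c \<i> r) \<star> g)" for y
  have l: "lin ?z ?z \<Lambda>"
    unfolding \<Lambda>_def by (rule lin_compose [OF lin_sc [OF I_Obj [OF T]]])
      (auto simp: Hom_def tens_add_left comp_add_left comp_add_right)
  have "phi T (ob S) r (Bg (S @ T) i) (Bh (S @ T) i) g h =
      \<Lambda> (flat (ob S) ?t (Bh (S @ T) i) \<star> sharp (ob S) ?t (Bg (S @ T) i))" if i: "i \<in> B (S @ T) T" for S i
  proof -
    let ?s = "ob S" and ?f = "Bg (S @ T) i" and ?h = "Bh (S @ T) i"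
    note [simp] = B_mor [OF i, simplified]
    let ?a = "flat ?s ?t ?h" and ?b = "sharp ?s ?t ?f"
    have "(?a \<star> ?b) \<otimes>\<^sub>c h = (?a \<otimes>\<^sub>c \<i> ?t) \<star> (?b \<otimes>\<^sub>c h)"
      using tens_comp [of ?b ?a h "\<i> ?t"] by simp
    also have "?b \<otimes>\<^sub>c h = (\<i> ?s \<otimes>\<^sub>c h) \<star> (?b \<otimes>\<^sub>c \<i> (?t \<boxtimes> r))"
      using slide(2) [of ?b h] by simp
    finally have "(\<i> ?t \<otimes>\<^sub>c Ev C ?t) \<star> ((?a \<star> ?b) \<otimes>\<^sub>c h) \<star> (\<i> ?t \<otimes>\<^sub>c Coev C (?t\<^sup>d) \<otimes>\<^sub>c \<i> r) \<star> g =
      ((\<i> ?t \<otimes>\<^sub>c Ev C ?t) \<star> (?a \<otimes>\<^sub>c \<i> ?t)) \<star> (\<i> ?s \<otimes>\<^sub>c h) \<star>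
        ((((?b \<otimes>\<^sub>c \<i> ?t) \<star> (\<i> ?t \<otimes>\<^sub>c Coev C (?t\<^sup>d))) \<otimes>\<^sub>c \<i> r)) \<star> g"
      by (simp add: tens_comp_left assoc)
    also have "\<dots> = ?h \<star> (\<i> ?s \<otimes>\<^sub>c h) \<star> (?f \<otimes>\<^sub>c \<i> r) \<star> g"
      using flat_bend [of ?h ?s ?t] sharp_bend [of ?f ?t ?s] by simp
    finally show ?thesis by (simp add: phi_def \<Lambda>_def)
  qed
  then have "(\<Sum>S\<in>I. dm (ob S) * (\<Sum>i\<in>B (S @ T) T. phi T (ob S) r (Bg (S @ T) i) (Bh (S @ T) i) g h)) =
    (\<Sum>S\<in>I. dm (ob S) * (\<Sum>i\<in>B (S @ T) T. \<Lambda> (flat (ob S) ?t (Bh (S @ T) i) \<star> sharp (ob S) ?t (Bg (S @ T) i))))"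
    by simp
  also have "\<dots> = dm ?t * \<Lambda> (\<i> ?z)" by (rule bent_completeness [OF T l])
  also have "\<Lambda> (\<i> ?z) = sc ?t ((\<i> ?t \<otimes>\<^sub>c psi ?t r h) \<star> g)"
    by (simp add: \<Lambda>_def psi_def tens_comp_right assoc)
  finally show ?thesis .
qed

lemma weighted_trM:
  "(\<Sum>S\<in>I. dm (ob S) * trM S R) = (\<Sum>T\<in>I. \<Sum>j\<in>B (T @ R) T. dm (ob T) *
    sc (ob T) ((\<i> (ob T) \<otimes>\<^sub>c psi (ob T) (ob R) (Bh (T @ R) j)) \<star> Bg (T @ R) j))"
proof -
  have "(\<Sum>S\<in>I. dm (ob S) * trM S R) = (\<Sum>S\<in>I. \<Sum>T\<in>I. \<Sum>j\<in>B (T @ R) T. dm (ob S) * (\<Sum>i\<in>B (S @ T) T.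
      phi T (ob S) (ob R) (Bg (S @ T) i) (Bh (S @ T) i) (Bg (T @ R) j) (Bh (T @ R) j)))"
    unfolding trM_eq sum_distrib_left by (intro sum.cong HOL.refl sum.swap)
  also have "\<dots> = (\<Sum>T\<in>I. \<Sum>j\<in>B (T @ R) T. \<Sum>S\<in>I. dm (ob S) * (\<Sum>i\<in>B (S @ T) T.
      phi T (ob S) (ob R) (Bg (S @ T) i) (Bh (S @ T) i) (Bg (T @ R) j) (Bh (T @ R) j)))"
    by (subst sum.swap, intro sum.cong HOL.refl sum.swap)
  also have "\<dots> = (\<Sum>T\<in>I. \<Sum>j\<in>B (T @ R) T. dm (ob T) *
    sc (ob T) ((\<i> (ob T) \<otimes>\<^sub>c psi (ob T) (ob R) (Bh (T @ R) j)) \<star> Bg (T @ R) j))"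
  proof (intro sum.cong HOL.refl weighted_phi)
    fix T j assume "T \<in> I" "j \<in> B (T @ R) T"
    then show "Bg (T @ R) j \<in> Hom C (ob T) (ob T \<boxtimes> ob R)" "Bh (T @ R) j \<in> Hom C (ob T \<boxtimes> ob R) (ob T)"
      using B_mor [of j "T @ R" T] by (simp_all add: HomI)
  qed simp_all
  finally show ?thesis .
qed

text \<open>After the strand is cut, every term contains a morphism from \<open>R\<close> to the
  unit, and \<open>no_unit\<close> applies.\<close>

theorem weighted_trM_zero:
  assumes "dec (ob R) 1"
  shows "(\<Sum>S\<in>I. dm (ob S) * trM S R) = 0"
  unfolding weighted_trM
proof (intro sum.neutral ballI)
  fix T j assume T: "T \<in> I" and j: "j \<in> B (T @ R) T"
  note [simp] = B_mor [OF j, simplified]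
  have "lin (ob R) (Unit C) (\<lambda>p. sc (ob T) ((\<i> (ob T) \<otimes>\<^sub>c p) \<star> Bg (T @ R) j))"
    by (rule lin_compose [OF lin_sc [OF I_Obj [OF T]]])
      (auto simp: Hom_def tens_add_right comp_add_left)
  from no_unit [OF assms this, of "psi (ob T) (ob R) (Bh (T @ R) j)"]
  show "dm (ob T) * sc (ob T) ((\<i> (ob T) \<otimes>\<^sub>c psi (ob T) (ob R) (Bh (T @ R) j)) \<star> Bg (T @ R) j) = 0"
    by (simp add: psi_def HomI)
qed

text \<open>With empty \<open>R\<close>, the closed loop contributes the dimension of
  \<open>T*\<close>, equal to that of \<open>T\<close>; together with the weight of \<open>T\<close>
  this is its square.\<close>

theorem weighted_trM_Nil:
  "(\<Sum>S\<in>I. dm (ob S) * trM S []) = (\<Sum>T\<in>I. complex_of_real tau ^ (2 * length T))"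
  unfolding weighted_trM
proof (rule sum.cong [OF HOL.refl])
  fix T assume T: "T \<in> I"
  let ?t = "ob T"
  have "(\<Sum>j\<in>B (T @ []) T. dm ?t * sc ?t ((\<i> ?t \<otimes>\<^sub>c psi ?t (ob []) (Bh (T @ []) j)) \<star> Bg (T @ []) j)) =
    (\<Sum>j\<in>{j \<in> {()}. T = T}. dm ?t * sc ?t ((\<i> ?t \<otimes>\<^sub>c psi ?t (ob []) (\<i> ?t)) \<star> \<i> ?t))"
  proof (rule B_independent [where \<Psi> = "\<lambda>g h. dm ?t * sc ?t ((\<i> ?t \<otimes>\<^sub>c psi ?t (ob []) h) \<star> g)"])
    show "basis I ob (ob (T @ [])) {()} (\<lambda>_. T) (\<lambda>_. \<i> ?t) (\<lambda>_. \<i> ?t)"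
      using basis_singleton [OF family T, of "()"] by simp
    show "lin ?t (ob (T @ [])) (\<lambda>x. dm ?t * sc ?t ((\<i> ?t \<otimes>\<^sub>c psi ?t (ob []) y) \<star> x))"
      if "y \<in> Hom C (ob (T @ [])) ?t" for y
      using that by (intro lin_scale lin_compose [OF lin_sc [OF I_Obj [OF T]]])
        (auto simp: Hom_def psi_def comp_add_right)
    show "lin (ob (T @ [])) ?t (\<lambda>y. dm ?t * sc ?t ((\<i> ?t \<otimes>\<^sub>c psi ?t (ob []) y) \<star> x))"
      if "x \<in> Hom C ?t (ob (T @ []))" for x
      using that by (intro lin_scale lin_compose [OF lin_sc [OF I_Obj [OF T]]])
        (auto simp: Hom_def psi_def tens_add_right comp_add_left comp_add_right)
  qed (rule T)
  also have "\<dots> = dm ?t * sc ?t (\<i> ?t \<otimes>\<^sub>c tr (?t\<^sup>d) (\<i> (?t\<^sup>d)))"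
    by (simp add: psi_def tr_def)
  also have "tr (?t\<^sup>d) (\<i> (?t\<^sup>d)) = dm (?t\<^sup>d) \<odot>\<^sub>c \<i> (Unit C)"
    unfolding dm_def by (rule scE [OF simple_unit]) simp_all
  also have "dm ?t * sc ?t (\<i> ?t \<otimes>\<^sub>c (dm (?t\<^sup>d) \<odot>\<^sub>c \<i> (Unit C))) = complex_of_real tau ^ (2 * length T)"
    using T by (simp add: dm_ob dm_dual mult_2 power_add)
  finally show "(\<Sum>j\<in>B (T @ []) T. dm ?t * sc ?t ((\<i> ?t \<otimes>\<^sub>c psi ?t (ob []) (Bh (T @ []) j)) \<star> Bg (T @ []) j)) =
    complex_of_real tau ^ (2 * length T)" .
qed

end

section \<open>Cyclic invariance and additivity in the auxiliary word\<close>

lemma sum_Sigma_pair: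
  assumes "finite A" "\<And>x. x \<in> A \<Longrightarrow> finite (B x)"
  shows "(\<Sum>p\<in>Sigma A B. G p) = (\<Sum>x\<in>A. \<Sum>y\<in>B x. G (x, y))"
  using sum.Sigma [of A B "\<lambda>x y. G (x, y)"] assms by simp

context fib_words
begin

lemma trM_basis:
  assumes b: "\<And>T. T \<in> I \<Longrightarrow> basis I ob (ob Y \<boxtimes> ob T) (J T) (t T) (f T) (f' T)"
  shows "trM Y R = (\<Sum>T\<in>I. \<Sum>i\<in>{i \<in> J T. t T i = T}. \<Sum>j\<in>B (T @ R) T.
    phi T (ob Y) (ob R) (f T i) (f' T i) (Bg (T @ R) j) (Bh (T @ R) j))"
  unfolding trM_eq
proof (rule sum.cong [OF HOL.refl])
  fix T assume T: "T \<in> I"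
  show "(\<Sum>i\<in>B (Y @ T) T. \<Sum>j\<in>B (T @ R) T. phi T (ob Y) (ob R) (Bg (Y @ T) i) (Bh (Y @ T) i) (Bg (T @ R) j) (Bh (T @ R) j)) =
    (\<Sum>i\<in>{i \<in> J T. t T i = T}. \<Sum>j\<in>B (T @ R) T. phi T (ob Y) (ob R) (f T i) (f' T i) (Bg (T @ R) j) (Bh (T @ R) j))"
  proof (rule B_independent)
    show "basis I ob (ob (Y @ T)) (J T) (t T) (f T) (f' T)" using b [OF T] by simp
    note g = B_Hom [of _ T R T]
    show "lin (ob T) (ob (Y @ T)) (\<lambda>x. \<Sum>j\<in>B (T @ R) T. phi T (ob Y) (ob R) x y (Bg (T @ R) j) (Bh (T @ R) j))"
      if "y \<in> Hom C (ob (Y @ T)) (ob T)" for y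
      using that phi_lin(3) [OF T ob_Obj ob_Obj ob_Obj] g by (intro lin_sum) simp
    show "lin (ob (Y @ T)) (ob T) (\<lambda>y. \<Sum>j\<in>B (T @ R) T. phi T (ob Y) (ob R) x y (Bg (T @ R) j) (Bh (T @ R) j))"
      if "x \<in> Hom C (ob T) (ob (Y @ T))" for x
      using that phi_lin(4) [OF T ob_Obj ob_Obj ob_Obj] g by (intro lin_sum) simp
  qed (rule T)
qed

text \<open>\<open>Hom T (U Y T)\<close> is decomposed through the summands \<open>S\<close> of
  \<open>Y T\<close>. The map \<open>S R -> S\<close> obtained by closing \<open>Y\<close> is
  expanded in the dual basis for \<open>S\<close> in \<open>S R\<close>, which splits each term into
  one factor for \<open>Y\<close> and one for \<open>U\<close>.\<close>

lemma trM_append: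
  "trM (U @ Y) R = (\<Sum>T\<in>I. \<Sum>S\<in>I. \<Sum>k\<in>B (Y @ T) S. \<Sum>l\<in>B (U @ S) T. \<Sum>j\<in>B (T @ R) T. \<Sum>m\<in>B (S @ R) S.
     phi S (ob Y) (ob R) (Bg (Y @ T) k) (Bh (Y @ T) k) (Bg (S @ R) m) (Bh (T @ R) j) *
     phi T (ob U) (ob R) (Bg (U @ S) l) (Bh (U @ S) l) (Bg (T @ R) j) (Bh (S @ R) m))"
proof -
  let ?u = "ob U" and ?y = "ob Y" and ?r = "ob R"
  have s: "splitting (?y \<boxtimes> ob T) (BJ (Y @ T)) (\<lambda>k. ob (Bt (Y @ T) k)) (Bg (Y @ T)) (Bh (Y @ T))" for T
    using word_basis [of "Y @ T"] by (simp add: basis_def)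
  have tI: "k \<in> BJ (Y @ T) \<Longrightarrow> Bt (Y @ T) k \<in> I" for T k
    using word_basis [of "Y @ T"] by (simp add: basis_def)
  have bb: "basis I ob (ob (U @ Y) \<boxtimes> ob T) (SIGMA k:BJ (Y @ T). BJ (U @ Bt (Y @ T) k))
      (\<lambda>(k, l). Bt (U @ Bt (Y @ T) k) l) (\<lambda>(k, l). (\<i> ?u \<otimes>\<^sub>c Bg (Y @ T) k) \<star> Bg (U @ Bt (Y @ T) k) l)
      (\<lambda>(k, l). Bh (U @ Bt (Y @ T) k) l \<star> (\<i> ?u \<otimes>\<^sub>c Bh (Y @ T) k))" for T
  proof -
    have "basis I ob (?u \<boxtimes> ob (Bt (Y @ T) k)) (BJ (U @ Bt (Y @ T) k)) (Bt (U @ Bt (Y @ T) k))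
        (Bg (U @ Bt (Y @ T) k)) (Bh (U @ Bt (Y @ T) k))" for k
      using word_basis [of "U @ Bt (Y @ T) k"] by simp
    from basis_comp [OF splitting_tens_left [OF s ob_Obj [of U]] this] show ?thesis by simp
  qed
  let ?P = "\<lambda>T S k l j m. phi S ?y ?r (Bg (Y @ T) k) (Bh (Y @ T) k) (Bg (S @ R) m) (Bh (T @ R) j) *
     phi T ?u ?r (Bg (U @ S) l) (Bh (U @ S) l) (Bg (T @ R) j) (Bh (S @ R) m)"
  have "trM (U @ Y) R = (\<Sum>T\<in>I. \<Sum>p\<in>(SIGMA k:BJ (Y @ T). B (U @ Bt (Y @ T) k) T). \<Sum>j\<in>B (T @ R) T.
      phi T (ob (U @ Y)) ?r (case p of (k, l) \<Rightarrow> (\<i> ?u \<otimes>\<^sub>c Bg (Y @ T) k) \<star> Bg (U @ Bt (Y @ T) k) l)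
        (case p of (k, l) \<Rightarrow> Bh (U @ Bt (Y @ T) k) l \<star> (\<i> ?u \<otimes>\<^sub>c Bh (Y @ T) k)) (Bg (T @ R) j) (Bh (T @ R) j))"
    unfolding trM_basis [OF bb] by (intro sum.cong HOL.refl) (auto simp: B_def)
  also have "\<dots> = (\<Sum>T\<in>I. \<Sum>k\<in>BJ (Y @ T). \<Sum>l\<in>B (U @ Bt (Y @ T) k) T. \<Sum>j\<in>B (T @ R) T.
      phi T (ob (U @ Y)) ?r ((\<i> ?u \<otimes>\<^sub>c Bg (Y @ T) k) \<star> Bg (U @ Bt (Y @ T) k) l)
        (Bh (U @ Bt (Y @ T) k) l \<star> (\<i> ?u \<otimes>\<^sub>c Bh (Y @ T) k)) (Bg (T @ R) j) (Bh (T @ R) j))"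
    by (intro sum.cong HOL.refl, subst sum_Sigma_pair) (use basis_finite [OF word_basis] finite_B in simp_all)
  also have "\<dots> = (\<Sum>T\<in>I. \<Sum>k\<in>BJ (Y @ T). \<Sum>l\<in>B (U @ Bt (Y @ T) k) T. \<Sum>j\<in>B (T @ R) T.
      \<Sum>m\<in>B (Bt (Y @ T) k @ R) (Bt (Y @ T) k). ?P T (Bt (Y @ T) k) k l j m)"
  proof (intro sum.cong HOL.refl)
    fix T k l j
    assume T: "T \<in> I" and k: "k \<in> BJ (Y @ T)" and l: "l \<in> B (U @ Bt (Y @ T) k) T" and j: "j \<in> B (T @ R) T"
    let ?S = "Bt (Y @ T) k"
    have S: "?S \<in> I" using tI [OF k] .
    note [simp] = basis_mor [OF word_basis k, simplified] B_mor [OF l, simplified] B_mor [OF j, simplified]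
    let ?k = "Bg (Y @ T) k" and ?k' = "Bh (Y @ T) k" and ?l = "Bg (U @ ?S) l" and ?l' = "Bh (U @ ?S) l"
      and ?g = "Bg (T @ R) j" and ?g' = "Bh (T @ R) j"
    let ?W = "?k' \<star> (\<i> ?y \<otimes>\<^sub>c ?g') \<star> (?k \<otimes>\<^sub>c \<i> ?r)"
    have W [simp]: "?W \<in> Mor C" "Dom C ?W = ob ?S \<boxtimes> ?r" "Cod C ?W = ob ?S" by simp_all
    define \<Lambda> where "\<Lambda> w = sc (ob T) (?l' \<star> (\<i> ?u \<otimes>\<^sub>c w) \<star> (?l \<otimes>\<^sub>c \<i> ?r) \<star> ?g)" for w
    have L: "lin (ob (?S @ R)) (ob ?S) \<Lambda>"
      unfolding \<Lambda>_def by (rule lin_compose [OF lin_sc [OF I_Obj [OF T]]])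
        (auto simp: Hom_def tens_add_right comp_add_left comp_add_right)
    have "phi T (ob (U @ Y)) ?r ((\<i> ?u \<otimes>\<^sub>c ?k) \<star> ?l) (?l' \<star> (\<i> ?u \<otimes>\<^sub>c ?k')) ?g ?g' = \<Lambda> ?W"
      by (simp add: phi_def \<Lambda>_def tens_comp_left tens_comp_right assoc)
    also have "\<dots> = (\<Sum>m\<in>B (?S @ R) ?S. sc (ob ?S) (?W \<star> Bg (?S @ R) m) * \<Lambda> (Bh (?S @ R) m))"
      by (rule B_expand_left [OF S L]) (simp add: HomI)
    also have "\<dots> = (\<Sum>m\<in>B (?S @ R) ?S. ?P T ?S k l j m)"
    proof (rule sum.cong [OF HOL.refl])
      fix m assume m: "m \<in> B (?S @ R) ?S"
      note [simp] = B_mor [OF m, simplified]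
      show "sc (ob ?S) (?W \<star> Bg (?S @ R) m) * \<Lambda> (Bh (?S @ R) m) = ?P T ?S k l j m"
        by (simp add: phi_def \<Lambda>_def assoc)
    qed
    finally show "phi T (ob (U @ Y)) ?r ((\<i> ?u \<otimes>\<^sub>c ?k) \<star> ?l) (?l' \<star> (\<i> ?u \<otimes>\<^sub>c ?k')) ?g ?g' =
      (\<Sum>m\<in>B (?S @ R) ?S. ?P T ?S k l j m)" .
  qed
  also have "\<dots> = (\<Sum>T\<in>I. \<Sum>S\<in>I. \<Sum>k\<in>B (Y @ T) S. \<Sum>l\<in>B (U @ S) T. \<Sum>j\<in>B (T @ R) T. \<Sum>m\<in>B (S @ R) S. ?P T S k l j m)"
  proof (rule sum.cong [OF HOL.refl])
    fix T
    have "(\<Sum>S\<in>I. \<Sum>k\<in>B (Y @ T) S. \<Sum>l\<in>B (U @ S) T. \<Sum>j\<in>B (T @ R) T. \<Sum>m\<in>B (S @ R) S. ?P T S k l j m) =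
      (\<Sum>S\<in>I. \<Sum>k\<in>{k \<in> BJ (Y @ T). Bt (Y @ T) k = S}. \<Sum>l\<in>B (U @ Bt (Y @ T) k) T. \<Sum>j\<in>B (T @ R) T.
        \<Sum>m\<in>B (Bt (Y @ T) k @ R) (Bt (Y @ T) k). ?P T (Bt (Y @ T) k) k l j m)"
      unfolding B_def [of "Y @ T"] by (intro sum.cong HOL.refl) auto
    also have "\<dots> = (\<Sum>k\<in>BJ (Y @ T). \<Sum>l\<in>B (U @ Bt (Y @ T) k) T. \<Sum>j\<in>B (T @ R) T.
        \<Sum>m\<in>B (Bt (Y @ T) k @ R) (Bt (Y @ T) k). ?P T (Bt (Y @ T) k) k l j m)"
      by (rule sum.group) (use basis_finite [OF word_basis] finite_I tI in auto)
    finally show "(\<Sum>k\<in>BJ (Y @ T). \<Sum>l\<in>B (U @ Bt (Y @ T) k) T. \<Sum>j\<in>B (T @ R) T.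
        \<Sum>m\<in>B (Bt (Y @ T) k @ R) (Bt (Y @ T) k). ?P T (Bt (Y @ T) k) k l j m) =
      (\<Sum>S\<in>I. \<Sum>k\<in>B (Y @ T) S. \<Sum>l\<in>B (U @ S) T. \<Sum>j\<in>B (T @ R) T. \<Sum>m\<in>B (S @ R) S. ?P T S k l j m)" by simp
  qed
  finally show ?thesis .
qed

text \<open>The expression in \<open>trM_append\<close> is symmetric under the simultaneous exchange
  of \<open>U\<close> with \<open>Y\<close> and of \<open>T\<close> with \<open>S\<close>; only the
  order of summation changes.\<close>

theorem trM_cyclic: "trM (U @ Y) R = trM (Y @ U) R"
proof -
  let ?r = "ob R"
  let ?Q = "\<lambda>T S k l j m. phi S (ob Y) ?r (Bg (Y @ T) k) (Bh (Y @ T) k) (Bg (S @ R) m) (Bh (T @ R) j) *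
     phi T (ob U) ?r (Bg (U @ S) l) (Bh (U @ S) l) (Bg (T @ R) j) (Bh (S @ R) m)"
  have "trM (Y @ U) R = (\<Sum>S\<in>I. \<Sum>T\<in>I. \<Sum>l\<in>B (U @ S) T. \<Sum>k\<in>B (Y @ T) S. \<Sum>m\<in>B (S @ R) S. \<Sum>j\<in>B (T @ R) T. ?Q T S k l j m)"
    unfolding trM_append [of Y U R] by (intro sum.cong HOL.refl) (rule mult.commute)
  also have "\<dots> = (\<Sum>T\<in>I. \<Sum>S\<in>I. \<Sum>l\<in>B (U @ S) T. \<Sum>k\<in>B (Y @ T) S. \<Sum>m\<in>B (S @ R) S. \<Sum>j\<in>B (T @ R) T. ?Q T S k l j m)"
    by (rule sum.swap)
  also have "\<dots> = (\<Sum>T\<in>I. \<Sum>S\<in>I. \<Sum>k\<in>B (Y @ T) S. \<Sum>l\<in>B (U @ S) T. \<Sum>m\<in>B (S @ R) S. \<Sum>j\<in>B (T @ R) T. ?Q T S k l j m)"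
    by (intro sum.cong HOL.refl sum.swap)
  also have "\<dots> = (\<Sum>T\<in>I. \<Sum>S\<in>I. \<Sum>k\<in>B (Y @ T) S. \<Sum>l\<in>B (U @ S) T. \<Sum>j\<in>B (T @ R) T. \<Sum>m\<in>B (S @ R) S. ?Q T S k l j m)"
    by (intro sum.cong HOL.refl sum.swap)
  also have "\<dots> = trM (U @ Y) R"
    unfolding trM_append [of U Y R] ..
  finally show ?thesis by simp
qed

text \<open>As for \<open>Mx_split\<close>, now with the injections on the left strand: they slide
  past \<open>g'\<close> and cancel.\<close>

theorem trM_split:
  assumes s: "splitting (ob Y) L (\<lambda>k. ob (y k)) u u'"
  shows "trM Y R = (\<Sum>k\<in>L. trM (y k) R)"
proof -
  let ?r = "ob R"
  have bb: "basis I ob (ob Y \<boxtimes> ob T) (SIGMA k:L. BJ (y k @ T)) (\<lambda>(k, i). Bt (y k @ T) i)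
      (\<lambda>(k, i). (u k \<otimes>\<^sub>c \<i> (ob T)) \<star> Bg (y k @ T) i) (\<lambda>(k, i). Bh (y k @ T) i \<star> (u' k \<otimes>\<^sub>c \<i> (ob T)))" for T
  proof -
    have "basis I ob (ob (y k) \<boxtimes> ob T) (BJ (y k @ T)) (Bt (y k @ T)) (Bg (y k @ T)) (Bh (y k @ T))" for k
      using word_basis [of "y k @ T"] by simp
    from basis_comp [OF splitting_tens_right [OF s ob_Obj [of T]] this] show ?thesis .
  qed
  have "trM Y R = (\<Sum>T\<in>I. \<Sum>p\<in>(SIGMA k:L. B (y k @ T) T). \<Sum>j\<in>B (T @ R) T.
      phi T (ob Y) ?r (case p of (k, i) \<Rightarrow> (u k \<otimes>\<^sub>c \<i> (ob T)) \<star> Bg (y k @ T) i)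
        (case p of (k, i) \<Rightarrow> Bh (y k @ T) i \<star> (u' k \<otimes>\<^sub>c \<i> (ob T))) (Bg (T @ R) j) (Bh (T @ R) j))"
    unfolding trM_basis [OF bb] by (intro sum.cong HOL.refl) (auto simp: B_def)
  also have "\<dots> = (\<Sum>T\<in>I. \<Sum>k\<in>L. \<Sum>i\<in>B (y k @ T) T. \<Sum>j\<in>B (T @ R) T.
      phi T (ob Y) ?r ((u k \<otimes>\<^sub>c \<i> (ob T)) \<star> Bg (y k @ T) i)
        (Bh (y k @ T) i \<star> (u' k \<otimes>\<^sub>c \<i> (ob T))) (Bg (T @ R) j) (Bh (T @ R) j))"
    by (intro sum.cong HOL.refl, subst sum_Sigma_pair) (use splittingD(1) [OF s] finite_B in simp_all)
  also have "\<dots> = (\<Sum>T\<in>I. \<Sum>k\<in>L. \<Sum>i\<in>B (y k @ T) T. \<Sum>j\<in>B (T @ R) T.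
      phi T (ob (y k)) ?r (Bg (y k @ T) i) (Bh (y k @ T) i) (Bg (T @ R) j) (Bh (T @ R) j))"
  proof (intro sum.cong HOL.refl)
    fix T k i j assume T: "T \<in> I" and k: "k \<in> L" and i: "i \<in> B (y k @ T) T" and j: "j \<in> B (T @ R) T"
    note [simp] = splitting_mor [OF s k] B_mor [OF i, simplified] B_mor [OF j, simplified]
    let ?f = "Bg (y k @ T) i" and ?f' = "Bh (y k @ T) i" and ?g = "Bg (T @ R) j" and ?g' = "Bh (T @ R) j"
    have uu: "u' k \<star> u k = \<i> (ob (y k))" using splittingD(6) [OF s k k] by simp
    have "(u' k \<otimes>\<^sub>c \<i> (ob T)) \<star> (\<i> (ob Y) \<otimes>\<^sub>c ?g') \<star> (u k \<otimes>\<^sub>c \<i> (ob T \<boxtimes> ?r)) = \<i> (ob (y k)) \<otimes>\<^sub>c ?g'"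
    proof -
      have "(\<i> (ob Y) \<otimes>\<^sub>c ?g') \<star> (u k \<otimes>\<^sub>c \<i> (ob T \<boxtimes> ?r)) = (u k \<otimes>\<^sub>c \<i> (ob T)) \<star> (\<i> (ob (y k)) \<otimes>\<^sub>c ?g')"
        using slide [of "u k" ?g'] by simp
      moreover have "(u' k \<otimes>\<^sub>c \<i> (ob T)) \<star> (u k \<otimes>\<^sub>c \<i> (ob T)) \<star> (\<i> (ob (y k)) \<otimes>\<^sub>c ?g') =
          ((u' k \<star> u k) \<otimes>\<^sub>c \<i> (ob T)) \<star> (\<i> (ob (y k)) \<otimes>\<^sub>c ?g')"
        by (simp add: tens_comp_left assoc)
      ultimately show ?thesis by (simp add: uu)
    qed
    then have "?f' \<star> ((u' k \<otimes>\<^sub>c \<i> (ob T)) \<star> (\<i> (ob Y) \<otimes>\<^sub>c ?g') \<star> (u k \<otimes>\<^sub>c \<i> (ob T \<boxtimes> ?r))) \<star> (?f \<otimes>\<^sub>c \<i> ?r) \<star> ?g =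
      ?f' \<star> (\<i> (ob (y k)) \<otimes>\<^sub>c ?g') \<star> (?f \<otimes>\<^sub>c \<i> ?r) \<star> ?g"
      by simp
    then show "phi T (ob Y) ?r ((u k \<otimes>\<^sub>c \<i> (ob T)) \<star> ?f) (?f' \<star> (u' k \<otimes>\<^sub>c \<i> (ob T))) ?g ?g' =
      phi T (ob (y k)) ?r ?f ?f' ?g ?g'"
      by (simp add: phi_def tens_comp_left assoc)
  qed
  also have "\<dots> = (\<Sum>k\<in>L. trM (y k) R)"
    unfolding trM_eq by (rule sum.swap)
  finally show ?thesis .
qed

lemma trM_fuse: "trM (Y @ [l, l]) R = trM Y R + trM (Y @ [l]) R"
proof -
  have "splitting (ob Y \<boxtimes> ob [l, l]) UNIV (\<lambda>k. ob (Y @ (if k then [l] else []))) (\<lambda>k. \<i> (ob Y) \<otimes>\<^sub>c (if k then co l else cu l))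
      (\<lambda>k. \<i> (ob Y) \<otimes>\<^sub>c (if k then mu l else (1 / of_real tau) \<odot>\<^sub>c ca l))"
    using splitting_tens_left [OF splitting_fib_object [OF fibs [of l]] ob_Obj [of Y]]
    by (simp add: if_distrib cong: if_cong)
  then have "splitting (ob (Y @ [l, l])) UNIV (\<lambda>k. ob (Y @ (if k then [l] else []))) (\<lambda>k. \<i> (ob Y) \<otimes>\<^sub>c (if k then co l else cu l))
      (\<lambda>k. \<i> (ob Y) \<otimes>\<^sub>c (if k then mu l else (1 / of_real tau) \<odot>\<^sub>c ca l))"
    by simp
  from trM_split [OF this] show ?thesis by (simp add: UNIV_bool)
qed

lemma trM_alt_n: "trM (alt l n) R = trM (alt (\<not> l) n) R"
proof -
  obtain f g where "f \<in> Hom C (ob (alt (\<not> l) n)) (ob (alt l n))" "g \<in> Hom C (ob (alt l n)) (ob (alt (\<not> l) n))"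
    "g \<star> f = \<i> (ob (alt (\<not> l) n))" "f \<star> g = \<i> (ob (alt l n))"
    using isomorphic_sym [OF iso_n [of l]] unfolding isomorphic_def Defs.is_iso_def by blast
  from trM_split [OF splitting_iso [OF this, of "()"]] show ?thesis by simp
qed

end

section \<open>Spectra of complex matrices and the braid relation\<close>

definition mat_trace :: "'a :: comm_ring_1 mat \<Rightarrow> 'a" where
  "mat_trace A = (\<Sum>i<dim_row A. A $$ (i, i))"

lemma mat_trace_comm:
  assumes "A \<in> carrier_mat d d" "B \<in> carrier_mat d d"
  shows "mat_trace (A * B) = mat_trace (B * A)"
proof -
  have "mat_trace (A * B) = (\<Sum>i<d. \<Sum>j<d. A $$ (i, j) * B $$ (j, i))"
    using assms by (auto simp: mat_trace_def scalar_prod_def lessThan_atLeast0 intro!: sum.cong)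
  also have "\<dots> = (\<Sum>j<d. \<Sum>i<d. B $$ (j, i) * A $$ (i, j))"
    by (subst sum.swap) (simp add: mult.commute)
  also have "\<dots> = mat_trace (B * A)"
    using assms by (auto simp: mat_trace_def scalar_prod_def lessThan_atLeast0 intro!: sum.cong)
  finally show ?thesis .
qed

lemma mat_trace_similar:
  assumes "A \<in> carrier_mat d d" "P \<in> carrier_mat d d" "Q \<in> carrier_mat d d" "Q * P = 1\<^sub>m d"
  shows "mat_trace (P * A * Q) = mat_trace A"
proof -
  have "mat_trace (P * A * Q) = mat_trace (Q * (P * A))"
    using assms by (intro mat_trace_comm) auto
  also have "Q * (P * A) = A" using assms by (simp flip: assoc_mult_mat)
  finally show ?thesis .
qed

lemma upper_triangular_pow:
  fixes U :: "'a :: comm_ring_1 mat"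
  assumes U: "U \<in> carrier_mat d d" and ut: "upper_triangular U"
  shows "i < d \<Longrightarrow> j \<le> i \<Longrightarrow> (U ^\<^sub>m k) $$ (i, j) = (if i = j then (U $$ (i, i)) ^ k else 0)"
proof (induction k arbitrary: i j)
  case 0
  then show ?case using U by auto
next
  case (Suc k)
  have "(U ^\<^sub>m Suc k) $$ (i, j) = (\<Sum>l<d. (U ^\<^sub>m k) $$ (i, l) * U $$ (l, j))"
    using Suc U by (auto simp: scalar_prod_def lessThan_atLeast0 pow_carrier_mat intro!: sum.cong)
  also have "\<dots> = (\<Sum>l<d. if l = i then (U ^\<^sub>m k) $$ (i, i) * U $$ (i, j) else 0)"
  proof (intro sum.cong HOL.refl)
    fix l assume l: "l \<in> {..<d}"
    show "(U ^\<^sub>m k) $$ (i, l) * U $$ (l, j) = (if l = i then (U ^\<^sub>m k) $$ (i, i) * U $$ (i, j) else 0)"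
    proof (cases "l < i")
      case True
      then show ?thesis using Suc by simp
    next
      case False
      then show ?thesis using Suc(3) upper_triangularD [OF ut, of j l] l U by (cases "l = i") auto
    qed
  qed
  also have "\<dots> = (U ^\<^sub>m k) $$ (i, i) * U $$ (i, j)" using Suc by simp
  also have "\<dots> = (if i = j then (U $$ (i, i)) ^ Suc k else 0)"
    using Suc upper_triangularD [OF ut, of j i] U by auto
  finally show ?case .
qed

text \<open>Induction proceeds upward from the last row: in row \<open>i\<close> of the product,
  entries left of the diagonal vanish for \<open>U\<close> and those below row \<open>i\<close> are
  known for \<open>V\<close>.\<close>

lemma upper_triangular_inverse:
  fixes U :: "'a :: field mat"
  assumes U: "U \<in> carrier_mat d d" "upper_triangular U" and V: "V \<in> carrier_mat d d" "U * V = 1\<^sub>m d"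
    and nz: "\<And>i. i < d \<Longrightarrow> U $$ (i, i) \<noteq> 0"
  shows "i < d \<Longrightarrow> j \<le> i \<Longrightarrow> V $$ (i, j) = (if i = j then 1 / U $$ (i, i) else 0)"
proof (induction "d - i" arbitrary: i rule: less_induct)
  case less
  have "(\<Sum>l<d. U $$ (i, l) * V $$ (l, j)) = (U * V) $$ (i, j)"
    using less.prems U(1) V(1) by (simp add: scalar_prod_def lessThan_atLeast0)
  moreover have "(\<Sum>l<d. U $$ (i, l) * V $$ (l, j)) = (\<Sum>l<d. if l = i then U $$ (i, i) * V $$ (i, j) else 0)"
  proof (intro sum.cong HOL.refl)
    fix l assume l: "l \<in> {..<d}"
    show "U $$ (i, l) * V $$ (l, j) = (if l = i then U $$ (i, i) * V $$ (i, j) else 0)"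
      using less l upper_triangularD [OF U(2), of l i] U by (cases "l < i"; cases "l = i") auto
  qed
  ultimately have "U $$ (i, i) * V $$ (i, j) = (if i = j then 1 else 0)"
    using less V by simp
  then show ?case using nz [of i] less by (auto simp: field_simps)
qed

text \<open>In Schur's triangular form, powers and the inverse have the powers and reciprocals of
  the same diagonal entries on their diagonals, so one list of eigenvalues serves all
  traces.\<close>

lemma mat_trace_spectrum:
  fixes M N :: "complex mat"
  assumes M: "M \<in> carrier_mat d d" and N: "N \<in> carrier_mat d d" "M * N = 1\<^sub>m d"
  shows "\<exists>as. length as = d \<and> (\<forall>k. mat_trace (M ^\<^sub>m k) = (\<Sum>a\<leftarrow>as. a ^ k)) \<and> mat_trace N = (\<Sum>a\<leftarrow>as. 1 / a) \<and>
    (\<forall>a\<in>set as. a \<noteq> 0 \<and> eigenvalue M a)"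
proof -
  obtain as where as: "char_poly M = (\<Prod>a\<leftarrow>as. [:- a, 1:])" "length as = d"
    using char_poly_factorized [OF M] by blast
  obtain U P Q where S: "schur_decomposition M as = (U, P, Q)" by (metis prod_cases3)
  note U = schur_decomposition [OF M as(1) S]
  note PQ = similar_mat_witD2 [OF M conjunct1 [OF U]]
  have ev: "eigenvalue M a" if "a \<in> set as" for a
    unfolding eigenvalue_root_char_poly [OF M] as(1) using that by (auto simp: poly_prod_list prod_list_zero_iff image_iff)
  have nz: "a \<noteq> 0" if a: "a \<in> set as" for a
  proof
    assume "a = 0"
    then obtain v where v: "v \<in> carrier_vec d" "v \<noteq> 0\<^sub>v d" "M *\<^sub>v v = 0 \<cdot>\<^sub>v v"
      using ev [OF a] M by (auto simp: eigenvalue_def eigenvector_def)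
    have "N * M = 1\<^sub>m d" using mat_mult_left_right_inverse [OF M N] .
    then have "v = N *\<^sub>v (M *\<^sub>v v)" using M N(1) v(1) by (simp flip: assoc_mult_mat_vec)
    also have "\<dots> = 0\<^sub>v d" unfolding v(3) using v(1) N(1) by auto
    finally show False using v by simp
  qed
  have diag: "as ! i = U $$ (i, i)" if "i < d" for i
  proof -
    have "as ! i = diag_mat U ! i" using U by simp
    then show ?thesis using that PQ(5) by (simp add: diag_mat_def)
  qed
  have nzU: "U $$ (i, i) \<noteq> 0" if "i < d" for i
    using nz [OF nth_mem, of i] diag [OF that] as(2) that by simp
  have sum_as: "(\<Sum>a\<leftarrow>as. f a) = (\<Sum>i<d. f (U $$ (i, i)))" for f :: "complex \<Rightarrow> complex"
    using diag as(2) by (simp add: sum_list_sum_nth lessThan_atLeast0)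
  have "mat_trace (M ^\<^sub>m k) = (\<Sum>a\<leftarrow>as. a ^ k)" for k
  proof -
    have "mat_trace (M ^\<^sub>m k) = mat_trace (U ^\<^sub>m k)"
      unfolding similar_mat_wit_pow_id [OF conjunct1 [OF U]]
      by (rule mat_trace_similar [of _ d]) (use PQ in \<open>auto simp: pow_carrier_mat\<close>)
    also have "\<dots> = (\<Sum>i<d. (U $$ (i, i)) ^ k)"
      using upper_triangular_pow [OF PQ(5)] U PQ(5) by (auto simp: mat_trace_def intro!: sum.cong)
    finally show ?thesis by (simp add: sum_as)
  qed
  moreover have "mat_trace N = (\<Sum>a\<leftarrow>as. 1 / a)"
  proof -
    let ?V = "Q * N * P"
    have "U = Q * M * P"
      using PQ by (simp add: PQ(3) assoc_mult_mat [of _ d d _ d _ d] flip: assoc_mult_mat [of Q d d P d _ d])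
    then have "U * ?V = Q * M * (P * Q) * N * P"
      using PQ(4-7) N(1) by (simp add: assoc_mult_mat [of _ d d _ d _ d])
    also have "\<dots> = Q * (M * N) * P"
      unfolding PQ(1) using PQ(4-7) N(1) by (simp add: assoc_mult_mat [of _ d d _ d _ d])
    also have "\<dots> = 1\<^sub>m d" unfolding N(2) using PQ(2,4-7) by simp
    finally have "U * ?V = 1\<^sub>m d" .
    then have V: "?V $$ (i, i) = 1 / U $$ (i, i)" if "i < d" for i
      using upper_triangular_inverse [OF PQ(5) _ _ _ nzU, of ?V i i] U PQ N that by auto
    have "mat_trace N = mat_trace ?V"
      using mat_trace_similar [of N d Q P] N PQ by simp
    also have "\<dots> = (\<Sum>i<d. 1 / U $$ (i, i))"
      unfolding mat_trace_def using V PQ by (intro sum.cong) auto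
    finally show ?thesis by (simp add: sum_as)
  qed
  ultimately show ?thesis using as(2) ev nz by blast
qed

text \<open>The letters acting on coordinates with respect to \<open>v\<close> and
  \<open>w = A v\<close>, where \<open>v\<close> is an eigenvector of \<open>A B\<close> for
  \<open>z\<close>, with \<open>A\<close> for \<open>True\<close> and \<open>B\<close> for
  \<open>False\<close>. Both satisfy \<open>x^2 = 1 + x\<close>, so \<open>A w = v + w\<close> and
  \<open>B v = z (w - v)\<close>; the image of \<open>w\<close> under \<open>B\<close>
  follows.\<close>

primrec fib_step :: "complex \<Rightarrow> bool \<Rightarrow> complex \<times> complex \<Rightarrow> complex \<times> complex" where
  "fib_step z True p = (snd p, fst p + snd p)"
| "fib_step z False p = (snd p / z - z * fst p - (z + 1) * snd p, z * fst p + (z + 1) * snd p)"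

lemma alt_double_Suc: "alt a (2 * Suc m) = alt a (2 * m) @ [a, \<not> a]"
proof -
  have "alt b 2 = [b, \<not> b]" for b by (simp add: numeral_2_eq_2)
  then show ?thesis using alt_append [of a "2 * m" 2] by (simp del: alt_simps)
qed

lemma alt_double_snoc: "alt a (Suc (2 * m)) = alt a (2 * m) @ [a]"
  using alt_append [of a "2 * m" 1] by simp

lemma fib_step_even: "z \<noteq> 0 \<Longrightarrow> fold (fib_step z) (alt False (2 * m)) (1, 0) = (z ^ m, 0)"
  by (induction m) (simp, simp only: alt_double_Suc, simp add: field_simps)

text \<open>A double step in this order multiplies the sum of the coordinates by \<open>1/z\<close>,
  which fixes the first coordinate. \<open>s\<close> is a geometric sum; its value at
  \<open>z = 1\<close> is recorded to exclude that eigenvalue.\<close>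

lemma fib_step_odd:
  assumes z: "z \<noteq> 0"
  shows "\<exists>s. (z = 1 \<longrightarrow> s = of_nat m) \<and>
    fold (fib_step z) (alt True (2 * m)) (1, 0) = ((1 / z) ^ m - (z + 1) * s, (z + 1) * s)"
proof (induction m)
  case 0
  then show ?case by auto
next
  case (Suc m)
  then obtain s where s: "z = 1 \<longrightarrow> s = of_nat m"
    "fold (fib_step z) (alt True (2 * m)) (1, 0) = ((1 / z) ^ m - (z + 1) * s, (z + 1) * s)" by blast
  have "fold (fib_step z) (alt True (2 * Suc m)) (1, 0) =
    ((1 / z) ^ Suc m - (z + 1) * ((1 / z) ^ m + z * s), (z + 1) * ((1 / z) ^ m + z * s))"
    unfolding alt_double_Suc fold_append comp_apply s(2) using z by (simp add: field_simps)
  moreover have "z = 1 \<longrightarrow> (1 / z) ^ m + z * s = of_nat (Suc m)" using s(1) by simp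
  ultimately show ?case by blast
qed

text \<open>Comparing coordinates equates a power of \<open>z\<close> with one of
  \<open>1/z\<close>, with exponents adding up to \<open>n\<close>. For \<open>z = 1\<close> the
  other coordinate would give 2m = 0 or 2m = -1.\<close>

lemma fib_step_braid:
  assumes z: "z \<noteq> 0" and n: "0 < n"
    and braid: "fold (fib_step z) (alt False n) (1, 0) = fold (fib_step z) (alt True n) (1, 0)"
  shows "z ^ n = 1 \<and> z \<noteq> 1"
proof (cases "even n")
  case True
  then obtain m where m: "n = 2 * m" by blast
  obtain s where s: "z = 1 \<longrightarrow> s = of_nat m"
    "fold (fib_step z) (alt True (2 * m)) (1, 0) = ((1 / z) ^ m - (z + 1) * s, (z + 1) * s)"
    using fib_step_odd [OF z] by blast
  from braid have *: "(z + 1) * s = 0" "z ^ m = (1 / z) ^ m"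
    unfolding m s(2) fib_step_even [OF z] by auto
  have "z ^ n = z ^ m * z ^ m" by (simp add: m power_add mult_2)
  also have "\<dots> = 1" by (subst *(2)) (use z in \<open>simp add: power_one_over\<close>)
  finally show ?thesis using * s(1) n m by auto
next
  case False
  then obtain m where m: "n = Suc (2 * m)" by (auto elim: oddE)
  obtain s where s: "z = 1 \<longrightarrow> s = of_nat m"
    "fold (fib_step z) (alt True (2 * m)) (1, 0) = ((1 / z) ^ m - (z + 1) * s, (z + 1) * s)"
    using fib_step_odd [OF z] by blast
  from braid have *: "- (z * z ^ m) = (z + 1) * s" "z * z ^ m = (1 / z) ^ m"
    unfolding m alt_double_snoc by (auto simp: s(2) fib_step_even [OF z] simp del: alt_simps)
  have "z ^ n = z * z ^ m * z ^ m" by (simp add: m power_add mult_2)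
  also have "\<dots> = 1" unfolding *(2) using z by (simp add: power_one_over)
  finally have "z ^ n = 1" .
  moreover have "z \<noteq> 1"
  proof
    assume "z = 1"
    then have "- 1 = 2 * (of_nat m :: complex)" using *(1) s(1) by simp
    then have "of_nat (2 * m + 1) = (0 :: complex)" by (simp only: of_nat_add of_nat_mult of_nat_numeral of_nat_1) (metis add.left_inverse)
    then show False by (simp only: of_nat_eq_0_iff)
  qed
  ultimately show ?thesis by blast
qed

locale fib_rep =
  fixes V :: "bool list \<Rightarrow> complex mat" and d n :: nat
  assumes car [simp]: "V R \<in> carrier_mat d d"
    and V_Nil: "V [] = 1\<^sub>m d"
    and V_append: "V (R @ R') = V R' * V R"
    and V_fuse: "V [l, l] = 1\<^sub>m d + V [l]"
    and braid: "V (alt False n) = V (alt True n)"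
    and n: "0 < n"
begin

lemma V_Cons: "V (l # R) = V R * V [l]"
  using V_append [of "[l]" R] by simp

lemma square: "v \<in> carrier_vec d \<Longrightarrow> V [l] *\<^sub>v (V [l] *\<^sub>v v) = v + V [l] *\<^sub>v v"
  using V_fuse [of l] V_Cons [of l "[l]"]
  by (metis add_mult_distrib_mat_vec assoc_mult_mat_vec car one_carrier_mat one_mult_mat_vec)

lemma carrier_V [simp]: "v \<in> carrier_vec d \<Longrightarrow> V R *\<^sub>v v \<in> carrier_vec d"
  by (rule mult_mat_vec_carrier [OF car])

lemma V_lin: "\<lbrakk>u \<in> carrier_vec d; v \<in> carrier_vec d\<rbrakk> \<Longrightarrow> V R *\<^sub>v (x \<cdot>\<^sub>v u + y \<cdot>\<^sub>v v) = x \<cdot>\<^sub>v (V R *\<^sub>v u) + y \<cdot>\<^sub>v (V R *\<^sub>v v)"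
  by (simp add: mult_add_distrib_mat_vec [OF car] mult_mat_vec [OF car])

text \<open>If \<open>v\<close> and \<open>w\<close> are independent, coordinates can be compared
  and \<open>fib_step_braid\<close> applies. Otherwise \<open>v\<close> is a common eigenvector of
  both letters, with eigenvalues among the roots of \<open>x^2 = 1 + x\<close>.\<close>

lemma eigenvalue_cases:
  assumes ev: "eigenvalue (V [False, True]) z"
  shows "z ^ 2 - 3 * z + 1 = 0 \<or> z ^ n = 1 \<and> z \<noteq> 1"
proof -
  obtain v where v [simp]: "v \<in> carrier_vec d" and v0: "v \<noteq> 0\<^sub>v d" and "V [False, True] *\<^sub>v v = z \<cdot>\<^sub>v v"
    using ev carrier_matD(1) [OF car] by (auto simp: eigenvalue_def eigenvector_def)
  then have ABv: "V [True] *\<^sub>v (V [False] *\<^sub>v v) = z \<cdot>\<^sub>v v"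
    using V_Cons [of False "[True]"] assoc_mult_mat_vec [OF car car v] by simp
  define w where "w = V [True] *\<^sub>v v"
  have w [simp]: "w \<in> carrier_vec d" by (simp add: w_def)
  have Aw: "V [True] *\<^sub>v w = v + w" unfolding w_def by (rule square [OF v])
  \<comment> \<open>The inverse of the \<open>True\<close> matrix is itself minus 1, so this solves
    the eigenvector equation for the \<open>False\<close> matrix.\<close>
  have Bv: "V [False] *\<^sub>v v = z \<cdot>\<^sub>v (w - v)"
  proof -
    have "z \<cdot>\<^sub>v w = V [True] *\<^sub>v (V [True] *\<^sub>v (V [False] *\<^sub>v v))"
      by (simp add: ABv w_def mult_mat_vec [OF car v])
    also have "\<dots> = V [False] *\<^sub>v v + z \<cdot>\<^sub>v v"
      unfolding square [OF carrier_V [OF v], of True "[False]"] by (simp only: ABv)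
    finally have "z \<cdot>\<^sub>v w = V [False] *\<^sub>v v + z \<cdot>\<^sub>v v" .
    then have *: "z * w $ i = (V [False] *\<^sub>v v) $ i + z * v $ i" if "i < d" for i
      using arg_cong [of _ _ "\<lambda>u. u $ i"] that carrier_vecD [OF w] carrier_vecD [OF v]
      by (metis index_add_vec(1) index_smult_vec(1,2))
    show ?thesis
    proof (intro eq_vecI)
      fix i assume "i < dim_vec (z \<cdot>\<^sub>v (w - v))"
      then have "i < d" using v by simp
      then show "(V [False] *\<^sub>v v) $ i = (z \<cdot>\<^sub>v (w - v)) $ i"
        using * [of i] by (simp add: carrier_vecD [OF w] carrier_vecD [OF v] algebra_simps del: index_mult_mat_vec)
    qed (simp add: carrier_matD(1) [OF car] carrier_vecD [OF v])
  qed
  have z: "z \<noteq> 0"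
  proof
    assume "z = 0"
    then have "V [False] *\<^sub>v v = 0\<^sub>v d" using Bv w v by (auto simp: vec_eq_iff)
    moreover have "V [False] *\<^sub>v 0\<^sub>v d = 0\<^sub>v d" by (auto simp: vec_eq_iff carrier_matD(1) [OF car])
    ultimately show False using square [OF v, of False] v0 by simp
  qed
  note dims = carrier_vecD [OF v] carrier_vecD [OF w]
  have Bw: "V [False] *\<^sub>v w = (1 / z - (z + 1)) \<cdot>\<^sub>v v + (z + 1) \<cdot>\<^sub>v w"
  proof -
    have w_eq: "w = 1 \<cdot>\<^sub>v v + (1 / z) \<cdot>\<^sub>v (V [False] *\<^sub>v v)"
      unfolding Bv by (intro eq_vecI) (simp_all add: dims z)
    have "V [False] *\<^sub>v w = V [False] *\<^sub>v (1 \<cdot>\<^sub>v v + (1 / z) \<cdot>\<^sub>v (V [False] *\<^sub>v v))"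
      by (rule arg_cong [OF w_eq])
    also have "\<dots> = 1 \<cdot>\<^sub>v (V [False] *\<^sub>v v) + (1 / z) \<cdot>\<^sub>v (V [False] *\<^sub>v (V [False] *\<^sub>v v))"
      by (rule V_lin) simp_all
    also have "\<dots> = (1 / z - (z + 1)) \<cdot>\<^sub>v v + (z + 1) \<cdot>\<^sub>v w"
      unfolding square [OF v] unfolding Bv by (intro eq_vecI) (simp_all add: dims z field_simps)
    finally show ?thesis .
  qed
  define \<phi> where "\<phi> p = fst p \<cdot>\<^sub>v v + snd p \<cdot>\<^sub>v w" for p
  have \<phi>_carrier [simp]: "\<phi> p \<in> carrier_vec d" for p by (simp add: \<phi>_def)
  have step: "V [l] *\<^sub>v \<phi> p = \<phi> (fib_step z l p)" for l p
  proof (cases l)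
    case True
    then show ?thesis unfolding \<phi>_def by (simp add: V_lin Aw flip: w_def) (intro eq_vecI; simp add: dims algebra_simps)
  next
    case False
    then show ?thesis unfolding \<phi>_def by (simp add: V_lin Bv Bw) (intro eq_vecI; simp add: dims algebra_simps)
  qed
  have fold: "V R *\<^sub>v \<phi> p = \<phi> (fold (fib_step z) R p)" for R p
  proof (induction R arbitrary: p)
    case Nil
    then show ?case by (simp add: V_Nil)
  next
    case (Cons l R)
    then show ?case by (subst V_Cons) (simp add: assoc_mult_mat_vec [OF car car] step)
  qed
  have 1: "\<phi> (1, 0) = v" unfolding \<phi>_def by (intro eq_vecI) (simp_all add: dims)
  have eq: "\<phi> (fold (fib_step z) (alt False n) (1, 0)) = \<phi> (fold (fib_step z) (alt True n) (1, 0))"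
    by (simp only: braid flip: fold)
  show ?thesis
  proof (cases "\<exists>\<alpha>. w = \<alpha> \<cdot>\<^sub>v v")
    case False
    have "p = q" if pq: "\<phi> p = \<phi> q" for p q
    proof -
      have *: "fst p * v $ i + snd p * w $ i = fst q * v $ i + snd q * w $ i" if "i < d" for i
        using arg_cong [OF pq, of "\<lambda>u. u $ i"] that v w by (simp add: \<phi>_def)
      have "snd p = snd q"
      proof (rule ccontr)
        assume ne: "snd p \<noteq> snd q"
        have "w = ((fst q - fst p) / (snd p - snd q)) \<cdot>\<^sub>v v"
          using * ne by (intro eq_vecI) (auto simp: dims field_simps)
        then show False using False by blast
      qed
      moreover from this have "fst p * v $ i = fst q * v $ i" if "i < d" for i using * [OF that] by simp
      then have "fst p = fst q" using v0 v by (metis carrier_vecD eq_vecI index_zero_vec mult_right_cancel)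
      ultimately show ?thesis by (simp add: prod_eq_iff)
    qed
    then show ?thesis using fib_step_braid [OF z n] eq by blast
  next
    case True
    then obtain \<alpha> where \<alpha>: "w = \<alpha> \<cdot>\<^sub>v v" by blast
    have inj: "x = y" if "x \<cdot>\<^sub>v v = y \<cdot>\<^sub>v v" for x y
    proof -
      obtain i where "i < d" "v $ i \<noteq> 0" using v0 v by (metis carrier_vecD eq_vecI index_zero_vec)
      then show ?thesis using arg_cong [OF that, of "\<lambda>u. u $ i"] v by auto
    qed
    define \<beta> where "\<beta> = z * (\<alpha> - 1)"
    have Av': "V [True] *\<^sub>v v = \<alpha> \<cdot>\<^sub>v v" using \<alpha> w_def by simp
    have Bv': "V [False] *\<^sub>v v = \<beta> \<cdot>\<^sub>v v"
      unfolding Bv \<alpha> \<beta>_def using v by (intro eq_vecI) (auto simp: algebra_simps)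
    define c where "c l = (if l then \<alpha> else \<beta>)" for l
    have cv: "V [l] *\<^sub>v v = c l \<cdot>\<^sub>v v" for l using Av' Bv' by (simp add: c_def)
    have c2: "c l * c l = 1 + c l" for l
    proof -
      have "(c l * c l) \<cdot>\<^sub>v v = (1 + c l) \<cdot>\<^sub>v v"
        using square [OF v, of l] v unfolding cv mult_mat_vec [OF car v] smult_smult_assoc
        by (auto simp: add_smult_distrib_vec)
      then show ?thesis by (rule inj)
    qed
    have cw: "V R *\<^sub>v v = (\<Prod>l\<leftarrow>R. c l) \<cdot>\<^sub>v v" for R
    proof (induction R)
      case Nil
      then show ?case using v by (simp add: V_Nil)
    next
      case (Cons l R)
      then show ?case using v by (subst V_Cons)
        (simp add: assoc_mult_mat_vec [OF car car] cv mult_mat_vec [OF car v] smult_smult_assoc mult.commute)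
    qed
    have z_eq: "z = \<alpha> * \<beta>"
    proof (rule inj)
      show "z \<cdot>\<^sub>v v = (\<alpha> * \<beta>) \<cdot>\<^sub>v v"
        using ABv v unfolding Bv' mult_mat_vec [OF car v] Av' by (simp add: smult_smult_assoc mult.commute)
    qed
    show ?thesis
    proof (cases "\<alpha> = \<beta>")
      case True
      have "\<alpha> * \<alpha> = 1 + \<alpha>" using c2 [of True] by (simp add: c_def)
      then have "z = 1 + \<alpha>" using z_eq True by simp
      then show ?thesis using \<open>\<alpha> * \<alpha> = 1 + \<alpha>\<close> by (simp add: power2_eq_square algebra_simps)
    next
      case False
      have *: "\<alpha> * \<alpha> = 1 + \<alpha>" "\<beta> * \<beta> = 1 + \<beta>" using c2 [of True] c2 [of False] by (auto simp: c_def)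
      then have "(\<alpha> - \<beta>) * (\<alpha> + \<beta> - 1) = 0" by (simp add: algebra_simps)
      then have "\<alpha> + \<beta> - 1 = 0" using False by simp
      then have "\<beta> = 1 - \<alpha>" by (simp add: eq_diff_eq add.commute)
      then have "z = \<alpha> * (1 - \<alpha>)" unfolding z_eq by (rule arg_cong)
      then have z1: "z = - 1" using * by (simp add: right_diff_distrib)
      \<comment> \<open>Distinct eigenvalues have product -1, which is an n-th root of unity for
        even \<open>n\<close>. For odd \<open>n\<close> the two braid words differ by the last
        letter, which would force the eigenvalues to agree.\<close>
      have "even n"
      proof (rule ccontr)
        assume "odd n"
        then obtain m where m: "n = Suc (2 * m)" by (auto elim: oddE)
        have 2: "(\<Prod>l\<leftarrow>alt a (2 * k). c l) = z ^ k" for a k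
          by (induction k) (simp, simp only: alt_double_Suc, simp add: z_eq c_def mult.commute)
        have "(\<Prod>l\<leftarrow>alt False n. c l) = (\<Prod>l\<leftarrow>alt True n. c l)"
          using cw [of "alt False n"] cw [of "alt True n"] braid by (intro inj) simp
        then have "z ^ m * \<beta> = z ^ m * \<alpha>"
          unfolding m alt_double_snoc map_append prod_list.append 2 by (simp add: c_def)
        then show False using z False by simp
      qed
      then show ?thesis using z1 by simp
    qed
  qed
qed

text \<open>The inverse of the product is \<open>(B - 1) (A - 1)\<close>, whose expansion gives the
  combination of traces of words with at most two letters.\<close>

lemma spectrum:
  "\<exists>as. length as = d \<and> (\<forall>k. mat_trace (V (alt False (2 * k))) = (\<Sum>a\<leftarrow>as. a ^ k)) \<and>
    mat_trace (V [True, False]) - mat_trace (V [True]) - mat_trace (V [False]) + mat_trace (V []) = (\<Sum>a\<leftarrow>as. 1 / a) \<and>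
    (\<forall>a\<in>set as. a \<noteq> 0 \<and> (a ^ 2 - 3 * a + 1 = 0 \<or> a ^ n = 1 \<and> a \<noteq> 1))"
proof -
  let ?A = "V [True]" and ?B = "V [False]" and ?id = "1\<^sub>m d :: complex mat"
  define N where "N = (?B - ?id) * (?A - ?id)"
  have inv: "V [l] * (V [l] - ?id) = ?id" for l
  proof -
    have "V [l] * V [l] = ?id + V [l]" using V_fuse V_Cons [of l "[l]"] by simp
    then have "V [l] * (V [l] - ?id) = ?id + V [l] - V [l]"
      by (simp add: mult_minus_distrib_mat [OF car car one_carrier_mat] right_mult_one_mat [OF car])
    also have "\<dots> = ?id" using carrier_matD [OF car [of "[l]"]] by (intro eq_matI) auto
    finally show ?thesis .
  qed
  have c: "V [l] - ?id \<in> carrier_mat d d" for l by (rule minus_carrier_mat [OF one_carrier_mat])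
  have N: "N \<in> carrier_mat d d" unfolding N_def by (rule mult_carrier_mat [OF c c])
  have "V [False, True] * N = ?A * (?B * (?B - ?id)) * (?A - ?id)"
    using V_Cons [of False "[True]"] unfolding N_def
    by (simp add: assoc_mult_mat [of _ d d _ d _ d] c mult_carrier_mat [of _ d d])
  also have "\<dots> = ?id" unfolding inv right_mult_one_mat [OF car] ..
  finally have MN: "V [False, True] * N = ?id" .
  have N_eq: "N = V [True, False] - ?A - (?B - ?id)"
    unfolding N_def mult_minus_distrib_mat [OF c car one_carrier_mat] minus_mult_distrib_mat [OF car one_carrier_mat car]
      right_mult_one_mat [OF c] left_mult_one_mat [OF car] using V_Cons [of True "[False]"] by simp
  have trN: "mat_trace N = mat_trace (V [True, False]) - mat_trace ?A - mat_trace ?B + mat_trace (V [])"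
    unfolding N_eq mat_trace_def by (simp add: carrier_matD [OF car] V_Nil sum_subtractf)
  have pow: "V [False, True] ^\<^sub>m k = V (alt False (2 * k))" for k
  proof (induction k)
    case 0
    then show ?case by (simp add: V_Nil carrier_matD [OF car])
  next
    case (Suc k)
    have "alt False (2 * Suc k) = [False, True] @ alt False (2 * k)" by simp
    then have "V (alt False (2 * Suc k)) = V (alt False (2 * k)) * V [False, True]"
      by (simp only: V_append)
    then show ?case using Suc by simp
  qed
  show ?thesis
    using mat_trace_spectrum [OF car N MN] eigenvalue_cases unfolding pow trN by blast
qed

end

lemma fib_spectrum:
  fixes W :: "bool list \<Rightarrow> 'i \<Rightarrow> 'i \<Rightarrow> complex"
  assumes K: "finite K" and n: "0 < n"
    and Nil: "\<And>a b. \<lbrakk>a \<in> K; b \<in> K\<rbrakk> \<Longrightarrow> W [] a b = (if a = b then 1 else 0)"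
    and append: "\<And>R R' a b. \<lbrakk>a \<in> K; b \<in> K\<rbrakk> \<Longrightarrow> W (R @ R') a b = (\<Sum>e\<in>K. W R' a e * W R e b)"
    and fuse: "\<And>l a b. \<lbrakk>a \<in> K; b \<in> K\<rbrakk> \<Longrightarrow> W [l, l] a b = W [] a b + W [l] a b"
    and braid: "\<And>a b. \<lbrakk>a \<in> K; b \<in> K\<rbrakk> \<Longrightarrow> W (alt False n) a b = W (alt True n) a b"
  shows "\<exists>as. (\<forall>k. (\<Sum>a\<in>K. W (alt False (2 * k)) a a) = (\<Sum>a\<leftarrow>as. a ^ k)) \<and>
    (\<Sum>a\<in>K. W [True, False] a a) - (\<Sum>a\<in>K. W [True] a a) - (\<Sum>a\<in>K. W [False] a a) + (\<Sum>a\<in>K. W [] a a) = (\<Sum>a\<leftarrow>as. 1 / a) \<and>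
    (\<forall>a\<in>set as. a \<noteq> 0 \<and> (a ^ 2 - 3 * a + 1 = 0 \<or> a ^ n = 1 \<and> a \<noteq> 1))"
proof -
  define d where "d = card K"
  obtain h where h: "bij_betw h {..<d} K"
    using ex_bij_betw_nat_finite [OF K] unfolding d_def lessThan_atLeast0 by blast
  have hK [simp]: "i < d \<Longrightarrow> h i \<in> K" for i using bij_betwE [OF h] by simp
  have heq: "i < d \<Longrightarrow> j < d \<Longrightarrow> h i = h j \<longleftrightarrow> i = j" for i j
    using bij_betw_imp_inj_on [OF h] by (auto dest: inj_onD)
  define V where "V R = mat d d (\<lambda>(i, j). W R (h i) (h j))" for R
  interpret fib_rep V d n
  proof
    show "V [] = 1\<^sub>m d" by (rule eq_matI) (auto simp: V_def Nil heq)
    show "V (R @ R') = V R' * V R" for R R'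
      by (rule eq_matI) (auto simp: V_def append scalar_prod_def sum.reindex_bij_betw [OF h, symmetric] simp flip: lessThan_atLeast0)
    show "V [l, l] = 1\<^sub>m d + V [l]" for l
      by (rule eq_matI) (auto simp: V_def fuse Nil heq)
    show "V (alt False n) = V (alt True n)"
      by (rule eq_matI) (auto simp: V_def braid)
  qed (auto simp: V_def n)
  have "mat_trace (V R) = (\<Sum>a\<in>K. W R a a)" for R
    by (simp add: mat_trace_def V_def sum.reindex_bij_betw [OF h, symmetric])
  then show ?thesis using spectrum by auto
qed

section \<open>Arithmetic in the ring generated by the golden ratio\<close>

text \<open>Infinite descent: the equation has only the zero solution modulo 2, so both numbers can
  be halved.\<close>

lemma int_golden_zero:
  fixes a b :: int
  assumes "a * a + a * b = b * b"
  shows "b = 0"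
  using assms
proof (induction "nat \<bar>b\<bar>" arbitrary: a b rule: less_induct)
  case less
  show ?case
  proof (rule ccontr)
    assume b: "b \<noteq> 0"
    have "even (a * a + a * b) = even (b * b)" using less.prems by simp
    then have "even a" "even b" by auto
    then obtain a' b' where ab: "a = 2 * a'" "b = 2 * b'" by blast
    then have "a' * a' + a' * b' = b' * b'" using less.prems by simp
    moreover have "nat \<bar>b'\<bar> < nat \<bar>b\<bar>" using ab b by arith
    ultimately have "b' = 0" using less.hyps by blast
    then show False using ab b by simp
  qed
qed

lemma tau_indep:
  fixes a b :: int
  assumes "of_int a + of_int b * tau = 0"
  shows "a = 0 \<and> b = 0"
proof -
  have a: "of_int a = - of_int b * tau" using assms by simp
  have "of_int (a * a + a * b) = (of_int b * of_int b * (tau * tau - tau) :: real)"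
    by (simp add: a algebra_simps)
  also have "\<dots> = of_int (b * b)" by (simp add: tau_golden)
  finally have "b = 0" using int_golden_zero by (metis of_int_eq_iff)
  then show ?thesis using assms by simp
qed

lemma tau_tau: "tau * (tau * x) = x + tau * x"
  by (simp add: tau_golden distrib_right flip: mult.assoc)

lemma tau_pow:
  "tau ^ 2 = 1 + tau" "tau ^ 3 = 1 + 2 * tau" "tau ^ 4 = 2 + 3 * tau" "tau ^ 5 = 3 + 5 * tau"
  "tau ^ 6 = 5 + 8 * tau" "tau ^ 8 = 13 + 21 * tau" "tau ^ 10 = 34 + 55 * tau" "tau ^ 12 = 89 + 144 * tau"
  "tau ^ 14 = 233 + 377 * tau" "tau ^ 16 = 610 + 987 * tau" "tau ^ 18 = 1597 + 2584 * tau" "tau ^ 20 = 4181 + 6765 * tau"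
proof -
  have S: "tau ^ (k + 2) = tau ^ k * (1 + tau)" for k
    by (simp add: power_add power2_eq_square tau_golden)
  show 2: "tau ^ 2 = 1 + tau" using S [of 0] by (simp add: power2_eq_square)
  have *: "tau ^ (k + 2) = of_int (a + b) + of_int (a + 2 * b) * tau" if "tau ^ k = of_int a + of_int b * tau" for k a b
    unfolding S that by (simp add: algebra_simps tau_golden tau_tau)
  show 3: "tau ^ 3 = 1 + 2 * tau" using * [of 1 0 1] by (simp add: power3_eq_cube mult.assoc)
  show 4: "tau ^ 4 = 2 + 3 * tau" using * [of 2 1 1] 2 by simp
  show "tau ^ 5 = 3 + 5 * tau" using * [of 3 1 2] 3 by simp
  show 6: "tau ^ 6 = 5 + 8 * tau" using * [of 4 2 3] 4 by simp
  show 8: "tau ^ 8 = 13 + 21 * tau" using * [of 6 5 8] 6 by simp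
  show 10: "tau ^ 10 = 34 + 55 * tau" using * [of 8 13 21] 8 by simp
  show 12: "tau ^ 12 = 89 + 144 * tau" using * [of 10 34 55] 10 by simp
  show 14: "tau ^ 14 = 233 + 377 * tau" using * [of 12 89 144] 12 by simp
  show 16: "tau ^ 16 = 610 + 987 * tau" using * [of 14 233 377] 14 by simp
  show 18: "tau ^ 18 = 1597 + 2584 * tau" using * [of 16 610 987] 16 by simp
  show "tau ^ 20 = 4181 + 6765 * tau" using * [of 18 1597 2584] 18 by simp
qed

lemma tau_pow_nat: "\<exists>p q :: nat. tau ^ k = of_nat p + of_nat q * tau"
proof (induction k)
  case 0
  show ?case by (rule exI [of _ 1], rule exI [of _ 0]) simp
next
  case (Suc k)
  then obtain p q :: nat where "tau ^ k = of_nat p + of_nat q * tau" by blast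
  then have "tau ^ Suc k = of_nat q + of_nat (p + q) * tau"
    by (simp add: algebra_simps tau_golden tau_tau)
  then show ?case by blast
qed

text \<open>Provides the integrality on which every exclusion of a value of \<open>n\<close>
  rests.\<close>

lemma tau_sum_nat:
  assumes "finite A"
  shows "\<exists>p q :: nat. (\<Sum>x\<in>A. tau ^ f x * of_nat (m x)) = of_nat p + of_nat q * tau"
  using assms
proof (induction A)
  case empty
  show ?case by (rule exI [of _ 0], rule exI [of _ 0]) simp
next
  case (insert x A)
  then obtain p q :: nat where 1: "(\<Sum>x\<in>A. tau ^ f x * of_nat (m x)) = of_nat p + of_nat q * tau" by blast
  obtain p' q' :: nat where 2: "tau ^ f x = of_nat p' + of_nat q' * tau" using tau_pow_nat by blast
  have "(\<Sum>x\<in>insert x A. tau ^ f x * of_nat (m x)) = of_nat (p + p' * m x) + of_nat (q + q' * m x) * tau"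
    unfolding sum.insert [OF insert(1,2)] 1 2 by (simp add: algebra_simps)
  then show ?case by blast
qed

lemma tau_mult:
  "(of_int a + of_int b * tau) * (of_int c + of_int e * tau) =
    of_int (a * c + b * e) + of_int (a * e + b * c + b * e) * tau"
  by (simp add: algebra_simps tau_golden tau_tau)

text \<open>The homogenised minimal polynomial of \<open>2 cos (2 pi / 7)\<close>. Modulo 2 the
  coefficients lie in the field with four elements, and \<open>t^3 + t^2 + 1\<close> has no root
  there because it is an irreducible cubic over the field with two elements.\<close>

lemma cubic_no_root:
  fixes x1 x2 y1 y2 :: int
  assumes X: "X = of_int x1 + of_int x2 * tau" and Y: "Y = of_int y1 + of_int y2 * tau"
    and eq: "Y * Y * Y + Y * Y * X - 2 * (Y * (X * X)) - X * X * X = 0"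
  shows "even x1 \<and> even x2 \<and> even y1 \<and> even y2"
proof -
  define a1 a2 b1 b2 where ab: "a1 = y1 * y1 + y2 * y2" "a2 = y1 * y2 + y2 * y1 + y2 * y2"
    "b1 = x1 * x1 + x2 * x2" "b2 = x1 * x2 + x2 * x1 + x2 * x2"
  have YY: "Y * Y = of_int a1 + of_int a2 * tau" and XX: "X * X = of_int b1 + of_int b2 * tau"
    unfolding X Y tau_mult ab by simp_all
  define c1 c2 d1 d2 e1 e2 f1 f2 where A:
    "c1 = a1 * y1 + a2 * y2" "c2 = a1 * y2 + a2 * y1 + a2 * y2" "d1 = a1 * x1 + a2 * x2" "d2 = a1 * x2 + a2 * x1 + a2 * x2"
    "e1 = y1 * b1 + y2 * b2" "e2 = y1 * b2 + y2 * b1 + y2 * b2" "f1 = b1 * x1 + b2 * x2" "f2 = b1 * x2 + b2 * x1 + b2 * x2"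
  have "Y * Y * Y = of_int c1 + of_int c2 * tau" "Y * Y * X = of_int d1 + of_int d2 * tau"
    "Y * (X * X) = of_int e1 + of_int e2 * tau" "X * X * X = of_int f1 + of_int f2 * tau"
    unfolding YY XX unfolding X Y tau_mult A by (rule HOL.refl)+
  then have "of_int (c1 + d1 - 2 * e1 - f1) + of_int (c2 + d2 - 2 * e2 - f2) * tau = 0"
    using eq by (simp add: left_diff_distrib distrib_right distrib_left)
  then have "even (c1 + d1 - 2 * e1 - f1)" "even (c2 + d2 - 2 * e2 - f2)" using tau_indep [of "c1 + d1 - 2 * e1 - f1" "c2 + d2 - 2 * e2 - f2"] by simp_all
  \<comment> \<open>The term with coefficient 2 drops out modulo 2, and minus becomes plus; what is
    left is a finite check of parities.\<close>
  then have "even (c1 + d1 + f1)" "even (c2 + d2 + f2)" by simp_all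
  then show ?thesis unfolding A ab even_add even_mult_iff by argo
qed

section \<open>Multiplicities of roots of unity\<close>

context fib_words
begin

lemma spectrum_exists: "\<exists>as. (\<forall>k. trM Y (alt False (2 * k)) = (\<Sum>a\<leftarrow>as. a ^ k)) \<and>
    trM Y [True, False] - trM Y [True] - trM Y [False] + trM Y [] = (\<Sum>a\<leftarrow>as. 1 / a) \<and>
    (\<forall>a\<in>set as. a \<noteq> 0 \<and> (a ^ 2 - 3 * a + 1 = 0 \<or> a ^ n = 1 \<and> a \<noteq> 1))"
proof -
  have "Mx Y (alt False n) a b = Mx Y (alt True n) a b" if "a \<in> K Y" "b \<in> K Y" for a b
    using Mx_alt_n [OF that, of False] by simp
  moreover have "0 < n" using n3 by simp
  ultimately show ?thesis unfolding trM_def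
    by (intro fib_spectrum [where W = "Mx Y"] finite_K Mx_Nil Mx_append Mx_fuse)
qed

definition spec where "spec Y = (SOME as. (\<forall>k. trM Y (alt False (2 * k)) = (\<Sum>a\<leftarrow>as. a ^ k)) \<and>
    trM Y [True, False] - trM Y [True] - trM Y [False] + trM Y [] = (\<Sum>a\<leftarrow>as. 1 / a) \<and>
    (\<forall>a\<in>set as. a \<noteq> 0 \<and> (a ^ 2 - 3 * a + 1 = 0 \<or> a ^ n = 1 \<and> a \<noteq> 1)))"

lemma spec:
  "trM Y (alt False (2 * k)) = (\<Sum>a\<leftarrow>spec Y. a ^ k)"
  "trM Y [True, False] - trM Y [True] - trM Y [False] + trM Y [] = (\<Sum>a\<leftarrow>spec Y. 1 / a)"
  "a \<in> set (spec Y) \<Longrightarrow> a \<noteq> 0 \<and> (a ^ 2 - 3 * a + 1 = 0 \<or> a ^ n = 1 \<and> a \<noteq> 1)"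
  using someI_ex [OF spectrum_exists [of Y]] unfolding spec_def [symmetric] by blast+

definition mult where "mult z Y = count_list (spec Y) z"

text \<open>Orthogonality of roots of unity: the geometric sum selects \<open>a = z\<close> among
  n-th roots of unity, and \<open>g\<close> removes the other possible eigenvalues.\<close>

lemma roots_filter:
  assumes z: "z ^ n = 1" and a: "a \<in> set (spec Y)" and g: "a ^ 2 - 3 * a + 1 = 0 \<Longrightarrow> g a = 0"
  shows "g a * (\<Sum>k<n. (a / z) ^ k) = (if a = z then of_nat n * g z else (0 :: complex))"
proof (cases "a = z")
  case True
  have "z \<noteq> 0" using z n3 by (auto simp: power_0_left)
  then show ?thesis using True by simp
next
  case False
  have z0: "z \<noteq> 0" using z n3 by (auto simp: power_0_left)
  show ?thesis
  proof (cases "a ^ n = 1")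
    case True
    have "(\<Sum>k<n. (a / z) ^ k) = 0"
      using False z0 by (subst geometric_sum) (auto simp: power_divide True z)
    then show ?thesis using False by simp
  next
    case 2: False
    then show ?thesis using spec(3) [OF a] g False by auto
  qed
qed

lemma spec_filter:
  assumes z: "z ^ n = 1" and g: "\<And>a. \<lbrakk>a \<noteq> 0; a ^ 2 - 3 * a + 1 = 0\<rbrakk> \<Longrightarrow> g a = 0"
  shows "(\<Sum>a\<leftarrow>spec Y. g a * (\<Sum>k<n. (a / z) ^ k)) = of_nat n * g z * of_nat (mult z Y)"
proof -
  have "(\<Sum>a\<leftarrow>spec Y. g a * (\<Sum>k<n. (a / z) ^ k)) = (\<Sum>a\<leftarrow>spec Y. if a = z then of_nat n * g z else 0)"
    using roots_filter [OF z, of _ Y g] g spec(3) by (intro arg_cong [of _ _ sum_list] map_cong HOL.refl) auto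
  also have "\<dots> = of_nat n * g z * of_nat (count_list as z)" if "as = spec Y" for as
    unfolding that [symmetric] by (induction as) (auto simp: algebra_simps)
  finally show ?thesis by (simp add: mult_def)
qed

lemma mult_1: "mult 1 Y = 0"
  using spec(3) [of 1 Y] by (auto simp: mult_def count_list_0_iff)

text \<open>Multiplicities of n-th roots of unity are determined by traces, so they inherit
  additivity and cyclic invariance in \<open>Y\<close>, up to the factor
  \<open>z^2 - 3 z + 1\<close>, which must not vanish.\<close>

lemma mult_trM:
  assumes z: "z ^ n = 1"
  shows "of_nat n * (z ^ 2 - 3 * z + 1) * of_nat (mult z Y) =
    (\<Sum>k<n. (1 / z) ^ k * (trM Y (alt False (2 * (k + 2))) - 3 * trM Y (alt False (2 * (k + 1))) + trM Y (alt False (2 * k))))"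
proof -
  have l: "(\<Sum>a\<leftarrow>as. \<Sum>k<n. h k a) = (\<Sum>k<n. \<Sum>a\<leftarrow>as. h k a)" for as and h :: "nat \<Rightarrow> complex \<Rightarrow> complex"
    by (induction as) (auto simp: sum.distrib)
  have "of_nat n * (z ^ 2 - 3 * z + 1) * of_nat (mult z Y) = (\<Sum>a\<leftarrow>spec Y. (a ^ 2 - 3 * a + 1) * (\<Sum>k<n. (a / z) ^ k))"
    using spec_filter [OF z, of "\<lambda>a. a ^ 2 - 3 * a + 1"] by simp
  also have "\<dots> = (\<Sum>a\<leftarrow>spec Y. \<Sum>k<n. (1 / z) ^ k * (a ^ (k + 2) - 3 * a ^ (k + 1) + a ^ k))"
    unfolding sum_distrib_left
    by (intro arg_cong [of _ _ sum_list] map_cong sum.cong HOL.refl)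
      (simp add: power_divide power_one_over algebra_simps power_add power2_eq_square add_divide_distrib diff_divide_distrib)
  also have "\<dots> = (\<Sum>k<n. (1 / z) ^ k * (\<Sum>a\<leftarrow>spec Y. a ^ (k + 2) - 3 * a ^ (k + 1) + a ^ k))"
    unfolding l by (simp add: sum_list_const_mult)
  also have "\<dots> = (\<Sum>k<n. (1 / z) ^ k * (trM Y (alt False (2 * (k + 2))) - 3 * trM Y (alt False (2 * (k + 1))) + trM Y (alt False (2 * k))))"
    unfolding spec(1) sum_list_addf sum_list_subtractf sum_list_const_mult ..
  finally show ?thesis .
qed

lemma mult_lin:
  assumes z: "z ^ n = 1" and r: "z ^ 2 - 3 * z + 1 \<noteq> 0" and t: "\<And>R. trM Y R = trM Y1 R + trM Y2 R"
  shows "mult z Y = mult z Y1 + mult z Y2"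
proof -
  let ?c = "of_nat n * (z ^ 2 - 3 * z + 1)"
  have "?c * of_nat (mult z Y) = ?c * of_nat (mult z Y1) + ?c * of_nat (mult z Y2)"
    unfolding mult_trM [OF z] t sum.distrib [symmetric]
    by (intro sum.cong HOL.refl) (simp only: algebra_simps)
  also have "\<dots> = ?c * of_nat (mult z Y1 + mult z Y2)" by (simp add: distrib_left)
  finally show ?thesis using r n3 unfolding mult_cancel_left of_nat_eq_iff by simp
qed

lemma mult_eq:
  assumes z: "z ^ n = 1" and r: "z ^ 2 - 3 * z + 1 \<noteq> 0" and t: "\<And>R. trM Y R = trM Y1 R"
  shows "mult z Y = mult z Y1"
proof -
  have "of_nat n * (z ^ 2 - 3 * z + 1) * of_nat (mult z Y) = of_nat n * (z ^ 2 - 3 * z + 1) * (of_nat (mult z Y1) :: complex)"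
    unfolding mult_trM [OF z] t ..
  then show ?thesis using r n3 unfolding mult_cancel_left of_nat_eq_iff by simp
qed

lemma sum_I: "(\<Sum>T\<in>I. f T) = f [] + (\<Sum>k=1..<n. f (alt True k) + f (alt False k)) + f (alt False n)"
  for f :: "bool list \<Rightarrow> 'b :: comm_monoid_add"
proof -
  let ?h = "\<lambda>(k, a). alt a k"
  have I: "I = insert [] (insert (alt False n) (?h ` ({1..<n} \<times> UNIV)))" (is "_ = ?I")
  proof
    show "I \<subseteq> ?I"
    proof
      fix T assume "T \<in> I"
      then consider a k where "T = alt a k" "k < n" | "T = alt False n" by (auto simp: I_def)
      then show "T \<in> ?I"
      proof cases
        case (1 a k)
        then show ?thesis by (cases "k = 0") force+
      qed simp
    qed
    show "?I \<subseteq> I" using alt_I nil_I by auto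
  qed
  have inj: "inj_on ?h ({1..<n} \<times> UNIV)" by (auto simp: inj_on_def alt_neq)
  have 1: "alt False n \<notin> ?h ` ({1..<n} \<times> UNIV)"
    using n3 by (auto dest: arg_cong [of _ _ length])
  have 2: "[] \<notin> insert (alt False n) (?h ` ({1..<n} \<times> UNIV))"
    using n3 by (auto dest: arg_cong [of _ _ length])
  have "(\<Sum>T\<in>I. f T) = f [] + (f (alt False n) + (\<Sum>T\<in>?h ` ({1..<n} \<times> UNIV). f T))"
    unfolding I using 1 2 by simp
  also have "(\<Sum>T\<in>?h ` ({1..<n} \<times> UNIV). f T) = (\<Sum>k=1..<n. \<Sum>a\<in>UNIV. f (alt a k))"
    unfolding sum.reindex [OF inj] by (simp add: sum.cartesian_product case_prod_unfold comp_def)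
  finally show ?thesis by (simp add: UNIV_bool add.commute add.left_commute)
qed

text \<open>Integration over the eigenvalues of all \<open>spec S\<close>, weighted by dimension;
  the values at powers of the variable are the moments. \<open>DD\<close> below is the global
  dimension.\<close>

definition L :: "(complex \<Rightarrow> complex) \<Rightarrow> complex" where
  "L \<phi> = (\<Sum>S\<in>I. dm (ob S) * (\<Sum>a\<leftarrow>spec S. \<phi> a))"

definition DD :: real where "DD = (\<Sum>T\<in>I. tau ^ (2 * length T))"

lemma L_cong: "(\<And>a. a \<noteq> 0 \<Longrightarrow> \<phi> a = \<psi> a) \<Longrightarrow> L \<phi> = L \<psi>"
  unfolding L_def using spec(3)
  by (intro sum.cong HOL.refl arg_cong2 [of _ _ _ _ "(*)"] arg_cong [of _ _ sum_list] map_cong) blast+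

lemma L_add: "L (\<lambda>a. \<phi> a + \<psi> a) = L \<phi> + L \<psi>"
  by (simp add: L_def sum_list_addf distrib_left sum.distrib)

lemma L_cmult: "L (\<lambda>a. c * \<phi> a) = c * L \<phi>"
  by (simp add: L_def sum_list_const_mult sum_distrib_left mult.left_commute)

lemma L_sum: "L (\<lambda>a. \<Sum>k<m. \<phi> k a) = (\<Sum>k<m. L (\<phi> k))" for m :: nat
  by (induction m) (simp_all add: L_add, simp add: L_def)

lemma L_trM: "L (\<lambda>a. a ^ k) = (\<Sum>S\<in>I. dm (ob S) * trM S (alt False (2 * k)))"
  by (simp add: L_def spec(1))

lemma L_0: "L (\<lambda>a. a ^ 0) = of_real DD"
  unfolding L_trM using weighted_trM_Nil by (simp add: DD_def)

lemma L_pos: "\<lbrakk>1 \<le> k; k < n\<rbrakk> \<Longrightarrow> L (\<lambda>a. a ^ k) = 0"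
  unfolding L_trM by (rule weighted_trM_zero [OF dec_alt_pos]) auto

lemma L_inv: "L (\<lambda>a. 1 / a) = of_real DD"
proof -
  have *: "(\<Sum>S\<in>I. dm (ob S) * trM S (alt b k)) = 0" if "1 \<le> k" "k < 2 * n" for b k
    by (rule weighted_trM_zero [OF dec_alt_pos [OF that]])
  have "L (\<lambda>a. 1 / a) = (\<Sum>S\<in>I. dm (ob S) * trM S [True, False]) - (\<Sum>S\<in>I. dm (ob S) * trM S [True])
      - (\<Sum>S\<in>I. dm (ob S) * trM S [False]) + (\<Sum>S\<in>I. dm (ob S) * trM S [])"
    unfolding L_def spec(2) [symmetric] by (simp add: algebra_simps sum.distrib sum_subtractf)
  then show ?thesis
    using * [of 2 True] * [of 1 True] * [of 1 False] weighted_trM_Nil n3 by (simp add: DD_def numeral_2_eq_2)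
qed

text \<open>The filter is \<open>1/a - 3 + a\<close>, so that the moments range from -1 to n and
  only moment n stays undetermined.\<close>

lemma L_filter:
  assumes z: "z ^ n = 1"
  shows "of_nat n * (1 / z - 3 + z) * (\<Sum>S\<in>I. dm (ob S) * of_nat (mult z S)) =
    of_real DD * (1 / z - 2) + z * L (\<lambda>a. a ^ n)"
proof -
  have z0: "z \<noteq> 0" using z n3 by (auto simp: power_0_left)
  let ?c = "\<lambda>k. L (\<lambda>a. a ^ k)"
  let ?e = "\<lambda>k. L (\<lambda>a. a ^ k / a)"
  have g: "1 / a - 3 + a = 0" if "a \<noteq> 0" "a ^ 2 - 3 * a + 1 = 0" for a :: complex
    using that by (simp add: field_simps power2_eq_square)
  have f: "(\<Sum>a\<leftarrow>spec S. (1 / a - 3 + a) * (\<Sum>k<n. (a / z) ^ k)) = of_nat n * (1 / z - 3 + z) * of_nat (mult z S)" for S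
    by (rule spec_filter [OF z]) (rule g)
  have "of_nat n * (1 / z - 3 + z) * (\<Sum>S\<in>I. dm (ob S) * of_nat (mult z S)) =
      L (\<lambda>a. (1 / a - 3 + a) * (\<Sum>k<n. (a / z) ^ k))"
    unfolding L_def f by (simp add: sum_distrib_left mult_ac)
  also have "\<dots> = L (\<lambda>a. \<Sum>k<n. (1 / z) ^ k * (a ^ k / a + ((- 3) * a ^ k + a ^ Suc k)))"
    unfolding sum_distrib_left by (intro arg_cong [of _ _ L] ext sum.cong HOL.refl)
      (simp add: power_divide power_one_over algebra_simps add_divide_distrib diff_divide_distrib)
  also have "\<dots> = (\<Sum>k<n. (1 / z) ^ k * (?e k + ((- 3) * ?c k + ?c (Suc k))))"
    by (simp only: L_sum L_cmult L_add)
  also have "\<dots> = of_real DD * (1 / z - 2) + z * ?c n"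
  proof -
    obtain m where "n = 3 + m" using le_Suc_ex [OF n3] by blast
    then have m: "n = Suc (Suc (Suc m))" by simp
    have e: "?e (Suc k) = ?c k" for k by (rule L_cong) simp
    have e0: "?e 0 = of_real DD" using L_inv by simp
    have zm: "(1 / z) ^ Suc (Suc m) = z"
    proof -
      have "z * z ^ Suc (Suc m) = 1" using z m by simp
      then show ?thesis using z0 by (simp add: power_one_over field_simps)
    qed
    \<comment> \<open>Since moments 1 to n - 1 vanish, only \<open>k = 0\<close>,
      \<open>k = 1\<close> and \<open>k = n - 1\<close> contribute; in the last,
      \<open>(1/z)^(n-1)\<close> equals \<open>z\<close>.\<close>
    define h where "h k = (1 / z) ^ k * (?e k + ((- 3) * ?c k + ?c (Suc k)))" for k
    have c: "?c (Suc k) = 0" if "k \<le> Suc m" for k by (rule L_pos) (use that m in simp_all)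
    have "h 0 = - 2 * of_real DD" unfolding h_def e0 L_0 c [OF le0] by simp
    moreover have "h (Suc 0) = of_real DD / z" unfolding h_def e L_0 using c [of 0] c [of 1] by simp
    moreover have "h (Suc (Suc k)) = 0" if "k < m" for k
      unfolding h_def e using c [of k] c [of "Suc k"] c [of "Suc (Suc k)"] that by (simp del: power_Suc)
    moreover have "h (Suc (Suc m)) = z * ?c n"
      unfolding h_def zm e m [symmetric] using c [of m] c [of "Suc m"] by (simp del: power_Suc)
    moreover have "(\<Sum>k<Suc (Suc (Suc m)). h k) = h 0 + h (Suc 0) + (\<Sum>k<m. h (Suc (Suc k))) + h (Suc (Suc m))"
      by (induction m) simp_all
    ultimately have "(\<Sum>k<n. h k) = - 2 * of_real DD + of_real DD / z + z * ?c n"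
      by (simp flip: m)
    then show ?thesis unfolding h_def by (simp add: algebra_simps)
  qed
  finally show ?thesis .
qed

text \<open>At \<open>z = 1\<close> the multiplicity is zero, so \<open>L_filter\<close> turns into
  an equation for moment n.\<close>

lemma L_n: "L (\<lambda>a. a ^ n) = of_real DD"
  using L_filter [of 1] by (simp add: mult_1)

lemma multiplicity_formula:
  assumes z: "z ^ n = 1"
  shows "of_nat n * (z + 1 / z - 3) * of_real (\<Sum>S\<in>I. tau ^ length S * of_nat (mult z S)) = of_real DD * (z + 1 / z - 2)"
  using L_filter [OF z] unfolding L_n dm_ob by (simp add: algebra_simps)

end

section \<open>Exclusion of the values of n from 4 to 10\<close>

text \<open>Specifying a root of unity by \<open>z + 1/z\<close> keeps the computation algebraic:
  powers reduce by the quadratic relation, and the multiplicity formula depends on this trace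
  only.\<close>

lemma root_with_trace:
  fixes r :: complex
  shows "\<exists>z. z \<noteq> 0 \<and> z + 1 / z = r \<and> z * z = r * z - 1"
proof -
  obtain s where s: "s * s = r * r - 4" using power2_csqrt [of "r * r - 4"] by (auto simp: power2_eq_square)
  have "(r + s) / 2 * ((r - s) / 2) = 1" using s by (simp add: algebra_simps)
  moreover have "(r + s) / 2 + (r - s) / 2 = r" by (simp add: field_simps)
  ultimately obtain z w where zw: "z * w = 1" "z + w = r" by blast
  then have "z \<noteq> 0" by auto
  moreover from this have "1 / z = w" using zw(1) by (metis nonzero_mult_div_cancel_left)
  then have "z + 1 / z = r" using zw(2) by simp
  moreover have "z * z = r * z - 1"
  proof -
    have "z * z = (z + w) * z - z * w" by (simp add: algebra_simps)
    then show ?thesis unfolding zw .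
  qed
  ultimately show ?thesis by blast
qed

lemma fourth_power:
  fixes z r :: complex
  assumes z: "z * z = r * z - 1"
  shows "z * z * (z * z) = (r * r * r - 2 * r) * z - (r * r - 1)"
proof -
  have "z * z * (z * z) = (r * z - 1) * (r * z - 1)" by (simp only: z)
  also have "\<dots> = r * r * (z * z) - 2 * (r * z) + 1" by (simp add: algebra_simps)
  also have "\<dots> = r * r * (r * z - 1) - 2 * (r * z) + 1" by (simp only: z)
  also have "\<dots> = (r * r * r - 2 * r) * z - (r * r - 1)" by (simp add: algebra_simps)
  finally show ?thesis .
qed

context fib_words
begin

definition NN :: "complex \<Rightarrow> real" where "NN z = (\<Sum>S\<in>I. tau ^ length S * of_nat (mult z S))"

lemma NN_nat: "\<exists>p q :: int. NN z = of_int p + of_int q * tau"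
  using tau_sum_nat [OF finite_I, of length "mult z"] unfolding NN_def by (metis of_int_of_nat_eq)

lemma trace_eq:
  assumes z: "z ^ n = 1" and r: "z + 1 / z = of_real r"
  shows "real n * (r - 3) * NN z = DD * (r - 2)"
proof -
  have "complex_of_real (real n * (r - 3) * NN z) = complex_of_real (DD * (r - 2))"
    using multiplicity_formula [OF z] unfolding r NN_def by simp
  then show ?thesis unfolding of_real_eq_iff .
qed

lemma DD_eq: "DD = 1 + 2 * (\<Sum>k=1..<n. tau ^ (2 * k)) + tau ^ (2 * n)"
  unfolding DD_def sum_I by (simp add: sum_distrib_left)

text \<open>A primitive fourth root of unity has \<open>r = 0\<close> and would give
  \<open>NN z = DD / 6\<close>, but the coefficient 45 is not divisible by 6.\<close>

lemma n_neq_4: "n \<noteq> 4"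
proof
  assume n: "n = 4"
  obtain z :: complex where z: "z + 1 / z = of_real 0" "z * z = - 1" using root_with_trace [of 0] by auto
  have "z ^ n = (z * z) * (z * z)" by (simp add: n eval_nat_numeral)
  then have "z ^ n = 1" using z by simp
  from trace_eq [OF this z(1)] have "12 * NN z = 2 * DD" by (simp add: n)
  moreover have "DD = 30 + 45 * tau" unfolding DD_eq by (simp add: n atLeastLessThan_nat_numeral tau_pow)
  moreover obtain p q :: int where "NN z = of_int p + of_int q * tau" using NN_nat by blast
  ultimately have "of_int (12 * p - 60) + of_int (12 * q - 90) * tau = 0" by (simp add: algebra_simps)
  then have "12 * q = 90" using tau_indep [of "12 * p - 60" "12 * q - 90"] by simp
  then show False by presburger
qed

text \<open>A primitive sixth root of unity has \<open>r = 1\<close>, so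
  \<open>NN z = DD / 12\<close>; 12 does not divide 200.\<close>

lemma n_neq_6: "n \<noteq> 6"
proof
  assume n: "n = 6"
  obtain z :: complex where z: "z + 1 / z = of_real 1" "z * z = z - 1" using root_with_trace [of 1] by auto
  have z3: "z * (z * z) = - 1" unfolding z(2) by (simp add: right_diff_distrib z(2))
  have "z ^ n = (z * (z * z)) * (z * (z * z))" by (simp add: n eval_nat_numeral)
  then have "z ^ n = 1" unfolding z3 by simp
  from trace_eq [OF this z(1)] have "12 * NN z = DD" by (simp add: n)
  moreover have "DD = 200 + 320 * tau" unfolding DD_eq by (simp add: n atLeastLessThan_nat_numeral tau_pow)
  moreover obtain p q :: int where "NN z = of_int p + of_int q * tau" using NN_nat by blast
  ultimately have "of_int (12 * p - 200) + of_int (12 * q - 320) * tau = 0" by (simp add: algebra_simps)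
  then have "12 * p = 200" using tau_indep [of "12 * p - 200" "12 * q - 320"] by simp
  then show False by presburger
qed

text \<open>The cube roots of unity among the ninth ones have the rational trace -1, which leads to
  \<open>DD / 12\<close>; 12 does not divide 3572.\<close>

lemma n_neq_9: "n \<noteq> 9"
proof
  assume n: "n = 9"
  obtain z :: complex where z: "z + 1 / z = of_real (- 1)" "z * z = - z - 1" using root_with_trace [of "- 1"] by auto
  have z3: "z * (z * z) = 1" unfolding z(2) by (simp add: right_diff_distrib z(2))
  have "z ^ n = (z * (z * z)) * (z * (z * z)) * (z * (z * z))" by (simp add: n eval_nat_numeral)
  then have "z ^ n = 1" unfolding z3 by simp
  from trace_eq [OF this z(1)] have "12 * NN z = DD" by (simp add: n)
  moreover have "DD = 3572 + 5776 * tau" unfolding DD_eq by (simp add: n atLeastLessThan_nat_numeral tau_pow)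
  moreover obtain p q :: int where "NN z = of_int p + of_int q * tau" using NN_nat by blast
  ultimately have "of_int (12 * p - 3572) + of_int (12 * q - 5776) * tau = 0" by (simp add: algebra_simps)
  then have "12 * p = 3572" using tau_indep [of "12 * p - 3572" "12 * q - 5776"] by simp
  then show False by presburger
qed

text \<open>A primitive tenth root of unity has trace \<tau>, so all quantities stay in the golden
  field, and divisibility by 10 fails.\<close>

lemma n_neq_10: "n \<noteq> 10"
proof
  assume n: "n = 10"
  let ?t = "complex_of_real tau"
  obtain z where z: "z + 1 / z = ?t" "z * z = ?t * z - 1" using root_with_trace by blast
  have t: "?t * ?t = ?t + 1" using tau_golden by (metis of_real_1 of_real_add of_real_mult)
  have c: "(?t + 1) * ?t - 2 * ?t = 1" unfolding distrib_right t by simp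
  have "z * z * (z * z) = z - ?t" unfolding fourth_power [OF z(2)] t c by simp
  then have "z * z * (z * z) * z = - 1" by (simp only: left_diff_distrib z(2)) simp
  moreover have "z ^ n = (z * z * (z * z) * z) * (z * z * (z * z) * z)" by (simp add: n eval_nat_numeral)
  ultimately have "z ^ n = 1" by simp
  from trace_eq [OF this z(1)] have "10 * (tau - 3) * NN z = DD * (tau - 2)" by (simp add: n)
  moreover have "DD = 9350 + 15125 * tau" unfolding DD_eq by (simp add: n atLeastLessThan_nat_numeral tau_pow)
  moreover obtain p q :: int where "NN z = of_int p + of_int q * tau" using NN_nat by blast
  ultimately have "of_int (10 * (q - 3 * p) + 3575) + of_int (10 * (p - 2 * q) + 5775) * tau = 0"
    by (simp add: algebra_simps tau_golden tau_tau)
  then have "10 * (q - 3 * p) + 3575 = 0" using tau_indep by blast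
  then show False by presburger
qed

text \<open>Here \<open>r\<close> is the square root of 2, which is not in the golden field.
  Squaring gives \<open>X^2 = 2 Y^2\<close>; its \<tau>-coefficient makes \<open>x2\<close> even,
  whereas 2205 is odd.\<close>

lemma n_neq_8: "n \<noteq> 8"
proof
  assume n: "n = 8"
  let ?r = "complex_of_real (sqrt 2)"
  obtain z where z: "z + 1 / z = ?r" "z * z = ?r * z - 1" using root_with_trace by blast
  have r: "?r * ?r = 2" by (simp flip: of_real_mult)
  have "z * z * (z * z) = - 1" unfolding fourth_power [OF z(2)] r by simp
  moreover have "z ^ n = (z * z * (z * z)) * (z * z * (z * z))" by (simp add: n eval_nat_numeral)
  ultimately have "z ^ n = 1" by simp
  from trace_eq [OF this z(1)] have 1: "sqrt 2 * (8 * NN z - DD) = 2 * (12 * NN z - DD)" by (simp add: n algebra_simps)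
  have D: "DD = 1365 + 2205 * tau" unfolding DD_eq by (simp add: n atLeastLessThan_nat_numeral tau_pow)
  obtain p q :: int where N: "NN z = of_int p + of_int q * tau" using NN_nat by blast
  define x1 x2 y1 y2 where xy: "x1 = 8 * p - 1365" "x2 = 8 * q - 2205" "y1 = 12 * p - 1365" "y2 = 12 * q - 2205"
  let ?X = "of_int x1 + of_int x2 * tau" and ?Y = "of_int y1 + of_int y2 * tau"
  have "sqrt 2 * ?X = 2 * ?Y" using 1 unfolding N D xy by (simp add: algebra_simps)
  then have "(sqrt 2 * ?X) * (sqrt 2 * ?X) = (2 * ?Y) * (2 * ?Y)" by (simp only:)
  moreover have "(sqrt 2 * x) * (sqrt 2 * x) = 2 * (x * x)" "(2 * y) * (2 * y) = 4 * (y * y)" for x y :: real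
    by (simp_all add: mult.left_commute mult.assoc)
  ultimately have "2 * (?X * ?X) = 4 * (?Y * ?Y)" by (simp only:)
  then have "?X * ?X = 2 * (?Y * ?Y)" by simp
  then have "of_int (x1 * x1 + x2 * x2 - 2 * (y1 * y1 + y2 * y2)) +
      of_int (x1 * x2 + x2 * x1 + x2 * x2 - 2 * (y1 * y2 + y2 * y1 + y2 * y2)) * tau = 0"
    unfolding tau_mult by (simp add: algebra_simps)
  then have "x1 * x2 + x2 * x1 + x2 * x2 - 2 * (y1 * y2 + y2 * y1 + y2 * y2) = 0" using tau_indep by blast
  then have "x2 * x2 = 2 * (y1 * y2 + y2 * y1 + y2 * y2 - x1 * x2)" by (simp add: algebra_simps)
  then have "even (x2 * x2)" by (rule dvdI)
  then have "even x2" by simp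
  then show False unfolding xy by presburger
qed

text \<open>Here \<open>r\<close> is a root of an irreducible cubic. The trace formula reads
  \<open>r X = Y\<close>, so \<open>X\<close> and \<open>Y\<close> satisfy the homogenised cubic;
  \<open>cubic_no_root\<close> makes all their coefficients even, but 841 is odd while 1682 is
  even.\<close>

lemma n_neq_7: "n \<noteq> 7"
proof
  assume n: "n = 7"
  define z where "z = cis (2 * pi / 7)"
  define r where "r = 2 * cos (2 * pi / 7)"
  have zn: "z ^ n = 1" by (simp add: z_def n DeMoivre)
  have "cos (2 * pi / 7) < 1"
    using cos_monotone_0_pi [of 0 "2 * pi / 7"] by simp
  then have z1: "z \<noteq> 1" by (auto simp: z_def cis.code complex_eq_iff)
  have z0: "z \<noteq> 0" by (simp add: z_def)
  have zr: "z + 1 / z = of_real r"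
  proof -
    have "1 / z = cis (- (2 * pi / 7))" by (simp only: z_def cis_inverse [symmetric] inverse_eq_divide)
    then show ?thesis by (simp add: z_def r_def complex_eq_iff)
  qed
  have "(\<Sum>k<7. z ^ k) = 0" using geometric_sum [OF z1, of 7] zn n by simp
  then have s: "1 + z + z ^ 2 + z ^ 3 + z ^ 4 + z ^ 5 + z ^ 6 = 0"
    by (simp add: lessThan_nat_numeral algebra_simps)
  \<comment> \<open>The cubic in \<open>z + 1/z\<close> is the sum of all seventh roots of unity
    divided by \<open>z^3\<close>.\<close>
  have "z ^ 3 * (of_real r ^ 3 + of_real r ^ 2 - 2 * of_real r - 1) = 1 + z + z ^ 2 + z ^ 3 + z ^ 4 + z ^ 5 + z ^ 6"
  proof -
    let ?R = "complex_of_real r"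
    have zR: "z * ?R = z * z + 1" unfolding zr [symmetric] distrib_left using z0 by simp
    have "z ^ 3 * (R ^ 3 + R ^ 2 - 2 * R - 1) = (z * R) ^ 3 + z * (z * R) ^ 2 - 2 * (z * z) * (z * R) - z ^ 3" for R
      by (simp add: algebra_simps power2_eq_square power3_eq_cube)
    from this [of ?R] show ?thesis unfolding zR by (simp add: algebra_simps eval_nat_numeral)
  qed
  then have "complex_of_real (r ^ 3 + r ^ 2 - 2 * r - 1) = 0" unfolding s using z0 by simp
  then have r: "r ^ 3 + r ^ 2 - 2 * r - 1 = 0" unfolding of_real_eq_0_iff .
  have 1: "r * (7 * NN z - DD) = 21 * NN z - 2 * DD" using trace_eq [OF zn zr] by (simp add: n algebra_simps)
  have D: "DD = 522 + 841 * tau" unfolding DD_eq by (simp add: n atLeastLessThan_nat_numeral tau_pow)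
  obtain p q :: int where N: "NN z = of_int p + of_int q * tau" using NN_nat by blast
  let ?X = "7 * NN z - DD" and ?Y = "21 * NN z - 2 * DD"
  have X: "?X = of_int (7 * p - 522) + of_int (7 * q - 841) * tau" unfolding N D by (simp add: algebra_simps)
  have Y: "?Y = of_int (21 * p - 1044) + of_int (21 * q - 1682) * tau" unfolding N D by (simp add: algebra_simps)
  have eq: "?Y * ?Y * ?Y + ?Y * ?Y * ?X - 2 * (?Y * (?X * ?X)) - ?X * ?X * ?X = 0"
  proof -
    have "?Y * ?Y * ?Y + ?Y * ?Y * ?X - 2 * (?Y * (?X * ?X)) - ?X * ?X * ?X =
        ?X * ?X * ?X * (r ^ 3 + r ^ 2 - 2 * r - 1)"
      unfolding 1 [symmetric] by (simp add: algebra_simps power2_eq_square power3_eq_cube)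
    then show ?thesis unfolding r by simp
  qed
  have "even (7 * q - 841) \<and> even (21 * q - 1682)" using cubic_no_root [OF X Y eq] by blast
  then show False by presburger
qed

text \<open>The trace formula alone has the integral solution 9 + 14 \<tau>. Relations between
  multiplicities of different words, obtained by rotating and fusing equal neighbours, show that 11
  divides the \<tau>-coefficient.\<close>

lemma n_neq_5: "n \<noteq> 5"
proof
  assume n: "n = 5"
  let ?r = "complex_of_real (tau - 1)"
  obtain z where z0: "z \<noteq> 0" and z: "z + 1 / z = ?r" "z * z = ?r * z - 1" using root_with_trace by blast
  have r: "?r * ?r = 1 - ?r"
  proof -
    have "(tau - 1) * (tau - 1) = 1 - (tau - 1)" by (simp add: algebra_simps tau_golden)
    then show ?thesis by (metis of_real_1 of_real_diff of_real_mult)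
  qed
  have c: "(1 - ?r) * ?r - 2 * ?r = - 1" unfolding left_diff_distrib r by simp
  have "z * z * (z * z) = ?r - z" unfolding fourth_power [OF z(2)] r c by (simp add: algebra_simps)
  then have "z * z * (z * z) * z = ?r * z - z * z" by (simp only: left_diff_distrib)
  then have "z * z * (z * z) * z = 1" unfolding z(2) by simp
  then have zn: "z ^ n = 1" by (simp add: n eval_nat_numeral mult.assoc)
  have "z ^ 2 - 3 * z + 1 = z * (?r - 3)" using z(2) by (simp add: power2_eq_square algebra_simps)
  moreover have "?r - 3 = complex_of_real (tau - 4)" by simp
  ultimately have z3: "z ^ 2 - 3 * z + 1 \<noteq> 0" using z0 tau_less_2 by (simp only: mult_eq_0_iff of_real_eq_0_iff) simp
  have cyc: "mult z (U @ Y) = mult z (Y @ U)" for U Y by (rule mult_eq [OF zn z3 trM_cyclic])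
  have fuse: "mult z (Y @ [l, l]) = mult z Y + mult z (Y @ [l])" for Y l by (rule mult_lin [OF zn z3 trM_fuse])
  have alt5: "mult z [True, False, True, False, True] = mult z [False, True, False, True, False]"
    using mult_eq [OF zn z3 trM_alt_n [of True]] by (simp add: n eval_nat_numeral)
  define a b c where "a = mult z [True]" "b = mult z [True, False]" "c = mult z [True, False, True, False]"
  have b': "mult z [False, True] = b" using cyc [of "[False]" "[True]"] by (simp add: a_b_c_def)
  have c': "mult z [False, True, False, True] = c" using cyc [of "[False]" "[True, False, True]"] by (simp add: a_b_c_def)
  \<comment> \<open>Rotation brings the equal outer letters of an odd alternating word together,
    where they fuse.\<close>
  have FTF: "mult z [False, True, False] = a + b" using cyc [of "[False]" "[True, False]"] fuse [of "[True]" False] by (simp add: a_b_c_def)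
  have TFT: "mult z [True, False, True] = mult z [False] + b" using cyc [of "[True]" "[False, True]"] fuse [of "[False]" True] b' by simp
  have X1: "mult z [False, True, False, True, False] = mult z [True, False, True] + c"
    using cyc [of "[False]" "[True, False, True, False]"] fuse [of "[True, False, True]" False] by (simp add: a_b_c_def)
  have X2: "mult z [True, False, True, False, True] = a + b + c"
    using cyc [of "[True]" "[False, True, False, True]"] fuse [of "[False, True, False]" True] FTF c' by simp
  \<comment> \<open>The two words of length 5 have equal multiplicities; reducing each by rotation
    and fusion leaves the comparison of the two letters.\<close>
  have a': "mult z [False] = a" using X1 X2 alt5 TFT by simp
  define s where "s = a + b + c"
  define p where "p = int (mult z [] + 2 * b + 2 * (a + b) + 4 * c + 3 * s)"
  have alts: "alt True 1 = [True]" "alt False 1 = [False]" "alt True 2 = [True, False]" "alt False 2 = [False, True]"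
    "alt True 3 = [True, False, True]" "alt False 3 = [False, True, False]"
    "alt True 4 = [True, False, True, False]" "alt False 4 = [False, True, False, True]"
    "alt False n = [False, True, False, True, False]"
    by (simp_all add: n eval_nat_numeral)
  have ivl: "{1..<n} = {1..<5}" by (simp only: n)
  have sum4: "(\<Sum>k=1..<5. f k) = f 1 + f 2 + f 3 + f (4 :: nat)" for f :: "nat \<Rightarrow> real"
    by (simp add: atLeastLessThan_nat_numeral)
  have "NN z = real (mult z []) + 2 * (tau * a) + 2 * (tau ^ 2 * b) + 2 * (tau ^ 3 * (a + b)) + 2 * (tau ^ 4 * c) + tau ^ 5 * (a + b + c)"
    unfolding NN_def sum_I ivl sum4 alts X1 TFT a' FTF b' c' a_b_c_def [symmetric]
    by (simp add: algebra_simps eval_nat_numeral)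
  \<comment> \<open>The \<tau>-coefficient is \<open>2a + 2b + 4(a + b) + 6c + 5s\<close>, which is
    \<open>11 s\<close>.\<close>
  then have N: "NN z = of_int p + of_int (11 * int s) * tau"
    unfolding tau_pow p_def s_def by (simp add: algebra_simps)
  have "5 * (tau - 4) * NN z = DD * (tau - 3)" using trace_eq [OF zn z(1)] by (simp add: n algebra_simps)
  moreover have "DD = 77 + 121 * tau" unfolding DD_eq by (simp add: n atLeastLessThan_nat_numeral tau_pow)
  ultimately have "of_int (5 * (11 * int s - 4 * p) + 110) + of_int (5 * (p - 33 * int s) + 165) * tau = 0"
    unfolding N by (simp add: algebra_simps tau_golden tau_tau)
  then have "5 * (11 * int s - 4 * p) + 110 = 0" "5 * (p - 33 * int s) + 165 = 0" using tau_indep by blast+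
  \<comment> \<open>Eliminating \<open>p\<close> leaves \<open>121 s = 154\<close>.\<close>
  then show False by presburger
qed

lemma n_large: "4 \<le> n \<Longrightarrow> 10 < n"
proof (rule ccontr)
  assume "4 \<le> n" "\<not> 10 < n"
  then have "n \<in> {4, 5, 6, 7, 8, 9, 10}" by auto
  then show False using n_neq_4 n_neq_5 n_neq_6 n_neq_7 n_neq_8 n_neq_9 n_neq_10 by blast
qed

end

theorem theorem5p3:
  fixes n :: nat and \<omega> :: complex
  assumes "4 \<le> n" and "n \<le> 10" and "\<omega> ^ n = 1"
  shows "\<not> (\<exists>(D :: ('p, 'k) pcat) F U. is_TT n \<omega> D F U)"
proof (rule notI, elim exE)
  fix D :: "('p, 'k) pcat" and F U
  assume tt: "is_TT n \<omega> D F U"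
  then have uc: "unitary_category D" and TF: "tensor_functor T2_T2 D F"
    and iso: "isomorphic D (FObj F (Pw n)) (FObj F (Qw n))"
    and not_iso: "\<lbrakk>2 \<le> k; k < n\<rbrakk> \<Longrightarrow> \<not> isomorphic D (FObj F (Pw k)) (FObj F (Qw k))" for k
    by (auto simp: is_TT_def unitary_quotient_def)
  interpret D: unitary_category D by (rule uc)
  \<comment> \<open>With \<open>False\<close> for \<open>rho\<close>, the words \<open>Pw k\<close>
    and \<open>Qw k\<close> are the images of \<open>alt False k\<close> and
    \<open>alt True k\<close>.\<close>
  define h where "h a = (if a then mu else rho)" for a
  define X where "X a = FObj F [h a]" for a
  have "\<exists>c c' v v'. fib_object D (X a) c c' v v'" for a
  proof -
    obtain i where i: "h a = (i, fib)" by (cases a) (auto simp: h_def)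
    obtain c c' v v' where "fib_object T2_T2 [(i, fib)] c c' v v'" using T2_T2_fib_object by blast
    from tensor_functor.fib_object_image [OF TF FP.monoidal_category_axioms D.monoidal_category_axioms this]
    show ?thesis unfolding X_def i .
  qed
  then have "\<forall>a. \<exists>q. fib_object D (X a) (fst q) (fst (snd q)) (fst (snd (snd q))) (snd (snd (snd q)))" by simp
  then obtain q where "\<forall>a. fib_object D (X a) (fst (q a)) (fst (snd (q a))) (fst (snd (snd (q a)))) (snd (snd (snd (q a))))"
    unfolding choice_iff by blast
  then obtain cu ca mu' co where fo: "\<And>a. fib_object D (X a) (cu a) (ca a) (mu' a) (co a)"
    by (intro that [of "\<lambda>a. fst (q a)" "\<lambda>a. fst (snd (q a))" "\<lambda>a. fst (snd (snd (q a)))" "\<lambda>a. snd (snd (snd (q a)))"]) blast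
  have word: "isomorphic D (word_obj D X w) (FObj F (map h w))" for w
  proof -
    have "[h a] \<in> Obj T2_T2" for a by (cases a) (simp_all add: h_def T2_T2_objects)
    then have "[b] \<in> Obj T2_T2" if "b \<in> set (map h w)" for b using that by auto
    from tensor_functor_word_image [OF TF D.monoidal_category_axioms T2_T2_objects(2,1) FP.monoidal_category_axioms this]
    have "isomorphic D (foldr (\<lambda>a. TensO D (FObj F [a])) (map h w) (Unit D)) (FObj F (map h w))" by blast
    then show ?thesis by (simp add: word_obj_def foldr_map comp_def X_def)
  qed
  have "map h (alt a k) = alternating (h a) (h (\<not> a)) k" for a k
    by (induction k arbitrary: a) auto
  then have Pw: "map h (alt False k) = Pw k" and Qw: "map h (alt True k) = Qw k" for k
    by (simp_all add: Pw_def Qw_def h_def)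
  have PQ: "isomorphic D (word_obj D X (alt False k)) (word_obj D X (alt True k)) \<longleftrightarrow>
      isomorphic D (FObj F (Pw k)) (FObj F (Qw k))" for k
    using D.isomorphic_trans [OF D.isomorphic_trans [OF D.isomorphic_sym [OF word] _] word, of "alt False k" "alt True k"]
      D.isomorphic_trans [OF D.isomorphic_trans [OF word _] D.isomorphic_sym [OF word], of "alt False k" "alt True k"]
    unfolding Pw Qw by blast
  \<comment> \<open>The two choices of first letter are the two directions of one isomorphism, as
    the letter-symmetric locale \<open>fib_words\<close> requires.\<close>
  have sym: "isomorphic D (word_obj D X (alt a k)) (word_obj D X (alt (\<not> a) k)) \<longleftrightarrow>
      isomorphic D (FObj F (Pw k)) (FObj F (Qw k))" for a k
    using PQ D.isomorphic_sym by (cases a) auto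
  interpret fib_words D X cu ca mu' co n
    using assms(1) by unfold_locales (simp_all add: fo sym iso not_iso)
  show False using n_large assms by simp
qed

end
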